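(* Let $k\ge1$, $T>0$, $\sigma_k:=\min\{2k+1,k+3\}$, and let $u$ be the exact (periodic) solution of $\partial_t u+\partial_x u=0$ on $\Omega$ with $u\in C^1([0,T];H^{\sigma_k+1}(\Omega))$. Let $\boldsymbol u_h=(u_h^C,u_h^D)$ be the semidiscrete CDG solution on a uniform one-dimensional overlapping mesh of size $h$ with initialization $\boldsymbol u_h(\cdot,0)=\boldsymbol P^*u(\cdot,0)-\boldsymbol R^1u(\cdot,0)$. Then, at time $T$, $$e_{\rm avg}:=\Big(h\sum_i\Big(\frac1h\int_{I_i}(u-u_h^C)\,dx\Big)^2\Big)^{1/2}\lesssim h^{\sigma_k}.$$
   Context: Convention: $A\lesssim B$ means $A\le MB$ with a constant $M>0$ independent of the mesh size $h$. Mesh and spaces. $\Omega\subset\mathbb R$ is a bounded interval with periodic boundary conditions (all functions and Sobolev spaces are periodic). The primal mesh consists of the cells $I_i=[x_{i-1/2},x_{i+1/2}]$, all of length $h$, with centres $x_i$; the dual mesh consists of the cells $I_{i+1/2}=[x_i,x_{i+1}]$ (indices taken periodically). $V_h$ (resp. $W_h$) is the space of $L^2$ functions whose restriction to each $I_i$ (resp. each $I_{i+1/2}$) is a polynomial of degree $\le k$. $(\cdot,\cdot)_i$, $(\cdot,\cdot)_{i+1/2}$ are the $L^2$ inner products on $I_i$, $I_{i+1/2}$. $V_x^0\subset V_h$ and $W_x^0\subset W_h$ are the subspaces of functions with zero mean on every primal, resp. dual, cell. $\tau_{\max}=C_{\rm CFL}h$ with a fixed constant $C_{\rm CFL}>0$.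 Superscripts $\pm$ denote right/left limits. Semidiscrete CDG method. $\boldsymbol u_h(t)\in V_h\times W_h$ satisfies, for all $i$ and all $(\phi_1,\phi_2)\in V_h\times W_h$, $(\partial_t u_h^C,\phi_1)_i=\hat B_i(\boldsymbol u_h,\phi_1)$ and $(\partial_t u_h^D,\phi_2)_{i+1/2}=\tilde B_{i+1/2}(\boldsymbol u_h,\phi_2)$, where for $\boldsymbol w=(w_C,w_D)$ $$\hat B_i(\boldsymbol w,\phi_1)=\tfrac1{\tau_{\max}}\int_{I_i}(w_D-w_C)\phi_1dx+\int_{I_i}w_D\partial_x\phi_1dx-w_D(x_{i+1/2})\phi_1(x_{i+1/2}^-)+w_D(x_{i-1/2})\phi_1(x_{i-1/2}^+),$$ $$\tilde B_{i+1/2}(\boldsymbol w,\phi_2)=\tfrac1{\tau_{\max}}\int_{I_{i+1/2}}(w_C-w_D)\phi_2dx+\int_{I_{i+1/2}}w_C\partial_x\phi_2dx-w_C(x_{i+1})\phi_2(x_{i+1}^-)+w_C(x_i)\phi_2(x_i^+).$$ Projection. Define $$\widehat P_i(\omega;\phi)=\tfrac1{\tau_{\max}}\Big[\int_{x_{i-1/2}}^{x_i}(\omega(x+\tfrac h2)-\omega(x))\phi\,dx+\int_{x_i}^{x_{i+1/2}}(\omega(x-\tfrac h2)-\omega(x))\phi\,dx\Big]+\int_{x_{i-1/2}}^{x_i}\omega(x+\tfrac h2)\partial_x\phi\,dx+\int_{x_i}^{x_{i+1/2}}\omega(x-\tfrac h2)\partial_x\phi\,dx-\omega(x_i)\big(\phi(x_{i+1/2}^-)-\phi(x_{i-1/2}^+)\big),$$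 and $\widetilde P_{i+1/2}$ by the same formula with every index shifted by $1/2$ (dual cell $I_{i+1/2}$, centre $x_{i+1/2}$). For $\omega\in W^{1,\infty}(\Omega)$, $P_C^*\omega\in V_h$ is the (uniquely determined) function with $\int_{I_i}P_C^*\omega=\int_{I_i}\omega$ and $\widehat P_i(P_C^*\omega;\phi)=\widehat P_i(\omega;\phi)$ for all $\phi\in\mathbb P^k(I_i)$ and all $i$; $P_D^*\omega\in W_h$ is defined analogously on dual cells with $\widetilde P_{i+1/2}$. Set $\boldsymbol P^*\omega=(P_C^*\omega,P_D^*\omega)$. Correction function. $\boldsymbol R^0u=(R_C^0u,R_D^0u):=(u-P_C^*u,\,u-P_D^*u)$, and $\boldsymbol R^1u=(R_C^1u,R_D^1u)\in V_x^0\times W_x^0$ is defined by requiring for all $(\phi_1,\phi_2)\in V_x^0\times W_x^0$ and all $i$ $$\widehat P_i(R_C^1u,\phi_1)=-(R_C^{0}\partial_xu,\phi_1)_i-\hat B_i(\boldsymbol R^{0}u,\phi_1)+\widehat P_i(R_C^{0}u,\phi_1),$$ $$\widetilde P_{i+1/2}(R_D^1u,\phi_2)=-(R_D^{0}\partial_xu,\phi_2)_{i+1/2}-\tilde B_{i+1/2}(\boldsymbol R^{0}u,\phi_2)+\widetilde P_{i+1/2}(R_D^{0}u,\phi_2).$$ *)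

theory Defs
  imports
    "HOL-Analysis.Analysis"
    "HOL-Library.Periodic_Fun"
    "HOL-Computational_Algebra.Polynomial"
begin

section \<open>Periodic Sobolev spaces\<close>

text \<open>
  The domain is the interval \<open>[a, b]\<close> with its end points identified. A function on it is a function
  on \<open>\<real>\<close> with period \<open>b - a\<close>.
\<close>

definition L2_fun :: "real \<Rightarrow> real \<Rightarrow> (real \<Rightarrow> real) \<Rightarrow> bool" where
  "L2_fun a b f \<longleftrightarrow>
     f \<in> borel_measurable (lebesgue_on {a..b}) \<and> integrable (lebesgue_on {a..b}) (\<lambda>x. (f x)\<^sup>2)"

definition L2_norm :: "real \<Rightarrow> real \<Rightarrow> (real \<Rightarrow> real) \<Rightarrow> real" where
  "L2_norm a b f = sqrt (integral {a..b} (\<lambda>x. (f x)\<^sup>2))"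

definition periodic_test_fun :: "real \<Rightarrow> real \<Rightarrow> (real \<Rightarrow> real) \<Rightarrow> bool" where
  "periodic_test_fun a b \<phi> \<longleftrightarrow>
     periodic_fun_simple \<phi> (b - a) \<and> (\<forall>n. (deriv ^^ n) \<phi> differentiable_on UNIV)"

definition weak_deriv :: "real \<Rightarrow> real \<Rightarrow> nat \<Rightarrow> (real \<Rightarrow> real) \<Rightarrow> (real \<Rightarrow> real) \<Rightarrow> bool" where
  "weak_deriv a b j f g \<longleftrightarrow>
     (\<forall>\<phi>. periodic_test_fun a b \<phi> \<longrightarrow>
        integral {a..b} (\<lambda>x. f x * (deriv ^^ j) \<phi> x) =
        (- 1) ^ j * integral {a..b} (\<lambda>x. g x * \<phi> x))"

definition Sobolev_fun :: "real \<Rightarrow> real \<Rightarrow> nat \<Rightarrow> (real \<Rightarrow> real) \<Rightarrow> bool" where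
  "Sobolev_fun a b m f \<longleftrightarrow>
     periodic_fun_simple f (b - a) \<and> L2_fun a b f \<and>
     (\<forall>j\<le>m. \<exists>g. L2_fun a b g \<and> weak_deriv a b j f g)"

text \<open>Weak derivatives are determined up to null sets, so the choice does not affect the norm.\<close>

definition Sobolev_norm :: "real \<Rightarrow> real \<Rightarrow> nat \<Rightarrow> (real \<Rightarrow> real) \<Rightarrow> real" where
  "Sobolev_norm a b m f =
     sqrt (\<Sum>j\<le>m. (L2_norm a b (SOME g. L2_fun a b g \<and> weak_deriv a b j f g))\<^sup>2)"

text \<open>\<open>C\<^sup>1([0, T]; H\<^sup>m)\<close>; here \<open>v\<close> is the time derivative of \<open>u\<close>, one-sided at \<open>0\<close> and \<open>T\<close>.\<close>

definition C1_Sobolev :: "real \<Rightarrow> real \<Rightarrow> nat \<Rightarrow> real \<Rightarrow> (real \<Rightarrow> real \<Rightarrow> real) \<Rightarrow> bool" where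
  "C1_Sobolev a b m T u \<longleftrightarrow>
     (\<forall>t\<in>{0..T}. Sobolev_fun a b m (u t)) \<and>
     (\<exists>v. \<forall>t\<in>{0..T}. Sobolev_fun a b m (v t) \<and>
        ((\<lambda>s. Sobolev_norm a b m (\<lambda>x. (u s x - u t x) / (s - t) - v t x)) \<longlongrightarrow> 0)
          (at t within {0..T}) \<and>
        ((\<lambda>s. Sobolev_norm a b m (\<lambda>x. v s x - v t x)) \<longlongrightarrow> 0) (at t within {0..T}))"

text \<open>
  The equation is required pointwise, so that \<open>u t\<close> is the continuous representative of its class;
  point values of \<open>u\<close> enter the projection below.
\<close>

definition advection_solution :: "real \<Rightarrow> (real \<Rightarrow> real \<Rightarrow> real) \<Rightarrow> bool" where
  "advection_solution T u \<longleftrightarrow>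
     (\<forall>t\<in>{0..T}. \<forall>x.
        u t differentiable (at x) \<and>
        ((\<lambda>s. u s x) has_real_derivative - deriv (u t) x) (at t within {0..T}))"


section \<open>Overlapping meshes and broken polynomial spaces\<close>

text \<open>
  The cells are indexed by all integers, which is periodic indexing since \<open>N\<close> cells of length
  \<open>mesh_size a b N\<close> make up one period. \<open>primal_centre a b N i\<close> is \<open>x\<^sub>i\<close>, with
  \<open>I\<^sub>1, \<dots>, I\<^sub>N\<close> covering \<open>[a, b]\<close>, and \<open>dual_centre a b N i\<close> is \<open>x\<^bsub>i+1/2\<^esub>\<close>.
\<close>

definition mesh_size :: "real \<Rightarrow> real \<Rightarrow> nat \<Rightarrow> real" where
  "mesh_size a b N = (b - a) / real N"

definition primal_centre :: "real \<Rightarrow> real \<Rightarrow> nat \<Rightarrow> int \<Rightarrow> real" where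
  "primal_centre a b N i = a + (of_int i - 1 / 2) * mesh_size a b N"

definition dual_centre :: "real \<Rightarrow> real \<Rightarrow> nat \<Rightarrow> int \<Rightarrow> real" where
  "dual_centre a b N i = a + of_int i * mesh_size a b N"

abbreviation cell :: "real \<Rightarrow> real \<Rightarrow> real set" where
  "cell h c \<equiv> {c - h / 2..c + h / 2}"

text \<open>
  \<open>L\<close> is the period and \<open>c\<close> enumerates the cell centres; \<open>V\<^sub>h\<close> and \<open>W\<^sub>h\<close> arise from the primal
  and the dual centres. Each \<open>L\<^sup>2\<close> class in the space is represented by its right-continuous
  member, so that equality of classes is equality of functions.
\<close>

definition DG_space :: "nat \<Rightarrow> real \<Rightarrow> real \<Rightarrow> (int \<Rightarrow> real) \<Rightarrow> (real \<Rightarrow> real) set" where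
  "DG_space k L h c =
     {w. periodic_fun_simple w L \<and>
         (\<forall>i. \<exists>p. degree p \<le> k \<and> (\<forall>x\<in>{c i - h / 2..<c i + h / 2}. w x = poly p x))}"

definition DG_space0 :: "nat \<Rightarrow> real \<Rightarrow> real \<Rightarrow> (int \<Rightarrow> real) \<Rightarrow> (real \<Rightarrow> real) set" where
  "DG_space0 k L h c = {w \<in> DG_space k L h c. \<forall>i. integral (cell h (c i)) w = 0}"

abbreviation left_limit :: "(real \<Rightarrow> real) \<Rightarrow> real \<Rightarrow> real" where
  "left_limit f x \<equiv> Lim (at_left x) f"

abbreviation right_limit :: "(real \<Rightarrow> real) \<Rightarrow> real \<Rightarrow> real" where
  "right_limit f x \<equiv> Lim (at_right x) f"


section \<open>The semidiscrete central discontinuous Galerkin method\<close>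

text \<open>
  The forms on primal and dual cells differ only in the centre \<open>c\<close> of the cell and in the roles of
  the two components: \<open>w\<close> is the component on the mesh containing the cell and \<open>w'\<close> the one on the
  other mesh. The primal form at \<open>(w\<^sub>C, w\<^sub>D)\<close> is \<open>cdg_form \<tau> h x\<^sub>i w\<^sub>C w\<^sub>D\<close>, the dual one is
  \<open>cdg_form \<tau> h x\<^bsub>i+1/2\<^esub> w\<^sub>D w\<^sub>C\<close>.
\<close>

definition cdg_form ::
    "real \<Rightarrow> real \<Rightarrow> real \<Rightarrow> (real \<Rightarrow> real) \<Rightarrow> (real \<Rightarrow> real) \<Rightarrow> (real \<Rightarrow> real) \<Rightarrow> real" where
  "cdg_form \<tau> h c w w' \<phi> =
     1 / \<tau> * integral (cell h c) (\<lambda>x. (w' x - w x) * \<phi> x)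
     + integral (cell h c) (\<lambda>x. w' x * deriv \<phi> x)
     - w' (c + h / 2) * left_limit \<phi> (c + h / 2)
     + w' (c - h / 2) * right_limit \<phi> (c - h / 2)"

definition cdg_solution ::
    "real \<Rightarrow> real \<Rightarrow> nat \<Rightarrow> real \<Rightarrow> nat \<Rightarrow> real \<Rightarrow>
     (real \<Rightarrow> real \<Rightarrow> real) \<Rightarrow> (real \<Rightarrow> real \<Rightarrow> real) \<Rightarrow> bool" where
  "cdg_solution a b k C\<^sub>C\<^sub>F\<^sub>L N T uC uD \<longleftrightarrow>
     (let h = mesh_size a b N; \<tau> = C\<^sub>C\<^sub>F\<^sub>L * h;
          x\<^sub>C = primal_centre a b N; x\<^sub>D = dual_centre a b N;
          V = DG_space k (b - a) h x\<^sub>C; W = DG_space k (b - a) h x\<^sub>D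
      in (\<forall>t\<in>{0..T}. uC t \<in> V \<and> uD t \<in> W) \<and>
         (\<exists>vC vD. \<forall>t\<in>{0..T}.
            (\<forall>x. ((\<lambda>s. uC s x) has_real_derivative vC t x) (at t within {0..T}) \<and>
                 ((\<lambda>s. uD s x) has_real_derivative vD t x) (at t within {0..T})) \<and>
            (\<forall>i. \<forall>\<phi>\<in>V. integral (cell h (x\<^sub>C i)) (\<lambda>x. vC t x * \<phi> x) =
                          cdg_form \<tau> h (x\<^sub>C i) (uC t) (uD t) \<phi>) \<and>
            (\<forall>i. \<forall>\<phi>\<in>W. integral (cell h (x\<^sub>D i)) (\<lambda>x. vD t x * \<phi> x) =
                          cdg_form \<tau> h (x\<^sub>D i) (uD t) (uC t) \<phi>)))"


section \<open>Projection and correction function\<close>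

definition proj_form ::
    "real \<Rightarrow> real \<Rightarrow> real \<Rightarrow> (real \<Rightarrow> real) \<Rightarrow> (real \<Rightarrow> real) \<Rightarrow> real" where
  "proj_form \<tau> h c \<omega> \<phi> =
     1 / \<tau> * (integral {c - h / 2..c} (\<lambda>x. (\<omega> (x + h / 2) - \<omega> x) * \<phi> x)
              + integral {c..c + h / 2} (\<lambda>x. (\<omega> (x - h / 2) - \<omega> x) * \<phi> x))
     + integral {c - h / 2..c} (\<lambda>x. \<omega> (x + h / 2) * deriv \<phi> x)
     + integral {c..c + h / 2} (\<lambda>x. \<omega> (x - h / 2) * deriv \<phi> x)
     - \<omega> c * (left_limit \<phi> (c + h / 2) - right_limit \<phi> (c - h / 2))"

definition proj ::
    "nat \<Rightarrow> real \<Rightarrow> real \<Rightarrow> real \<Rightarrow> (int \<Rightarrow> real) \<Rightarrow> (real \<Rightarrow> real) \<Rightarrow> real \<Rightarrow> real" where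
  "proj k L \<tau> h c \<omega> =
     (THE p. p \<in> DG_space k L h c \<and>
        (\<forall>i. integral (cell h (c i)) p = integral (cell h (c i)) \<omega> \<and>
             (\<forall>q. degree q \<le> k \<longrightarrow>
                proj_form \<tau> h (c i) p (poly q) = proj_form \<tau> h (c i) \<omega> (poly q))))"

definition corr0 ::
    "nat \<Rightarrow> real \<Rightarrow> real \<Rightarrow> real \<Rightarrow> (int \<Rightarrow> real) \<Rightarrow> (real \<Rightarrow> real) \<Rightarrow> real \<Rightarrow> real" where
  "corr0 k L \<tau> h c \<omega> = (\<lambda>x. \<omega> x - proj k L \<tau> h c \<omega> x)"

text \<open>
  The component of the first correction on the mesh with centres \<open>c\<close>; the centres of the other
  mesh are \<open>c'\<close>.
\<close>

definition corr1 ::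
    "nat \<Rightarrow> real \<Rightarrow> real \<Rightarrow> real \<Rightarrow> (int \<Rightarrow> real) \<Rightarrow> (int \<Rightarrow> real) \<Rightarrow>
     (real \<Rightarrow> real) \<Rightarrow> real \<Rightarrow> real" where
  "corr1 k L \<tau> h c c' \<omega> =
     (THE r. r \<in> DG_space0 k L h c \<and>
        (\<forall>i. \<forall>\<phi>\<in>DG_space0 k L h c.
           proj_form \<tau> h (c i) r \<phi> =
             - integral (cell h (c i)) (\<lambda>x. corr0 k L \<tau> h c (deriv \<omega>) x * \<phi> x)
             - cdg_form \<tau> h (c i) (corr0 k L \<tau> h c \<omega>) (corr0 k L \<tau> h c' \<omega>) \<phi>
             + proj_form \<tau> h (c i) (corr0 k L \<tau> h c \<omega>) \<phi>))"

definition corrected_initialization ::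
    "real \<Rightarrow> real \<Rightarrow> nat \<Rightarrow> real \<Rightarrow> nat \<Rightarrow> (real \<Rightarrow> real) \<Rightarrow>
     (real \<Rightarrow> real) \<Rightarrow> (real \<Rightarrow> real) \<Rightarrow> bool" where
  "corrected_initialization a b k C\<^sub>C\<^sub>F\<^sub>L N u0 wC wD \<longleftrightarrow>
     (let L = b - a; h = mesh_size a b N; \<tau> = C\<^sub>C\<^sub>F\<^sub>L * h;
          x\<^sub>C = primal_centre a b N; x\<^sub>D = dual_centre a b N
      in wC = (\<lambda>x. proj k L \<tau> h x\<^sub>C u0 x - corr1 k L \<tau> h x\<^sub>C x\<^sub>D u0 x) \<and>
         wD = (\<lambda>x. proj k L \<tau> h x\<^sub>D u0 x - corr1 k L \<tau> h x\<^sub>D x\<^sub>C u0 x))"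

definition avg_error ::
    "real \<Rightarrow> real \<Rightarrow> nat \<Rightarrow> (real \<Rightarrow> real) \<Rightarrow> (real \<Rightarrow> real) \<Rightarrow> real" where
  "avg_error a b N u w =
     (let h = mesh_size a b N
      in sqrt (h * (\<Sum>i = 1..int N.
           (1 / h * integral (cell h (primal_centre a b N i)) (\<lambda>x. u x - w x))\<^sup>2)))"

end

theory Submission
  imports Defs
begin

text \<open>
  The primal and dual cells together form one family in which a cell only interacts with its two
  neighbours, by the same form on every cell. On each cell replace the exact solution by its Taylor
  polynomial of degree \<open>\<sigma>\<close> at the centre. There are fixed polynomials \<open>ea\<close>, \<open>eb\<close>, \<open>ed\<close> of mean
  zero such that subtracting \<open>h\<^bsup>j\<^esup> u\<^bsup>(j)\<^esup>\<close> times one of them for \<open>j = k + 1, k + 2, k + 3\<close> gives a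
  polynomial \<open>Q\<close> of degree at most \<open>k\<close> that satisfies the scheme up to \<open>h\<^bsup>\<sigma>\<^esup>\<close> times the oscillation of
  \<open>u\<^bsup>(\<sigma>)\<^esup>\<close> near the cell. The squares of these oscillations are bounded by \<open>h\<close> times local integrals
  of \<open>|u\<^bsup>(\<sigma>+1)\<^esup>|\<^sup>2\<close>, so they add up over the mesh and supply the missing power of \<open>h\<close>. The corrected
  initial data agree with \<open>Q\<close> up to \<open>O(h\<^bsup>\<sigma>\<^esup>)\<close>, and the scheme is dissipative; hence the discrete
  solution stays \<open>O(h\<^bsup>\<sigma>\<^esup>)\<close> close to \<open>Q\<close>, and the cell averages of \<open>Q\<close> are those of the Taylor
  polynomial.
\<close>

section \<open>Bilinear forms on polynomials\<close>

text \<open>The exponent comes from solvability. The problems defining \<open>ea\<close>,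
  \<open>eb\<close>, \<open>ed\<close> have left sides blind to constants, so their data must vanish
  at \<phi> = 1. For \<open>eb\<close> this follows from the equation of \<open>ea\<close> tested
  with x; \<open>ed\<close> requires also the test with x^2, available only for k \<ge> 2. Hence two
  polynomials and order 3 for k = 1, three polynomials and order k + 3 otherwise. The obstacle is
  the stability estimate, which divides the residual by h. Bounding the oscillation uniformly by a
  multiple of the square root of h would yield order \<sigma> - 1/2 only. Square-summing the local
  energies and the weight h in the averaged error supply half a power each. Q follows the
  characteristics: for a cell with centre y its coefficients are taken at y - t, so only derivatives
  of the initial datum occur. They are recovered from weak derivatives, classically up to order
  \<sigma>. The identity u(t, x) = u(0, x - t) comes from a maximum principle, for which the
  regularity in time supplies joint continuity.\<close>

definition bilinear_poly :: "(real poly \<Rightarrow> real poly \<Rightarrow> real) \<Rightarrow> bool" where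
  "bilinear_poly \<beta> \<longleftrightarrow>
     (\<forall>s t p q r. \<beta> (smult s p + smult t q) r = s * \<beta> p r + t * \<beta> q r \<and>
                  \<beta> r (smult s p + smult t q) = s * \<beta> r p + t * \<beta> r q)"

definition linear_poly :: "(real poly \<Rightarrow> real) \<Rightarrow> bool" where
  "linear_poly l \<longleftrightarrow> (\<forall>s t p q. l (smult s p + smult t q) = s * l p + t * l q)"

lemma bilinear_polyD:
  assumes "bilinear_poly \<beta>"
  shows "linear_poly (\<lambda>p. \<beta> p r)" "linear_poly (\<lambda>p. \<beta> r p)"
  using assms unfolding bilinear_poly_def linear_poly_def by auto

lemma linear_poly_simps:
  assumes "linear_poly l"
  shows "l 0 = 0" "l (smult s p) = s * l p" "l (p + q) = l p + l q" "l (p - q) = l p - l q"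
    "l (- p) = - l p"
proof -
  have *: "l (smult s p + smult t q) = s * l p + t * l q" for s t p q
    using assms unfolding linear_poly_def by blast
  show 0: "l 0 = 0" using *[of 0 0 0 0] by simp
  show "l (smult s p) = s * l p" using *[of s p 0 0] by simp
  show "l (p + q) = l p + l q" using *[of 1 p 1 q] by simp
  show "l (p - q) = l p - l q" using *[of 1 p "-1" q] by simp
  show "l (- p) = - l p" using *[of "-1" p 0 0] by simp
qed

lemma linear_poly_sum:
  assumes "linear_poly l"
  shows "l (\<Sum>i\<in>A. f i) = (\<Sum>i\<in>A. l (f i))"
  by (induction A rule: infinite_finite_induct) (auto simp: linear_poly_simps[OF assms])

lemma poly_as_sum_monom:
  fixes p :: "real poly"
  assumes "\<And>m. m \<ge> n \<Longrightarrow> coeff p m = 0"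
  shows "p = (\<Sum>j<n. smult (coeff p j) (monom 1 j))"
proof (rule poly_eqI)
  fix m
  have "coeff (\<Sum>j<n. smult (coeff p j) (monom 1 j)) m = (\<Sum>j<n. if j = m then coeff p j else 0)"
    unfolding coeff_sum by (intro sum.cong) (auto simp: coeff_monom)
  also have "\<dots> = coeff p m" using assms[of m] by (auto simp: sum.delta)
  finally show "coeff p m = coeff (\<Sum>j<n. smult (coeff p j) (monom 1 j)) m" by simp
qed

lemma linear_poly_eq_sum_coeff:
  assumes "linear_poly l" and "\<And>m. m \<ge> n \<Longrightarrow> coeff p m = 0"
  shows "l p = (\<Sum>j<n. coeff p j * l (monom 1 j))"
proof -
  have "l p = l (\<Sum>j<n. smult (coeff p j) (monom 1 j))" using poly_as_sum_monom[OF assms(2)] by simp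
  then show ?thesis by (simp add: linear_poly_sum[OF assms(1)] linear_poly_simps[OF assms(1)])
qed

text \<open>Gram-Schmidt; definiteness replaces symmetry in keeping the pivots nonzero.\<close>

lemma dual_basis_exists:
  assumes \<beta>: "bilinear_poly \<beta>" and def: "\<And>p. \<beta> p p = 0 \<Longrightarrow> p = 0"
  shows "\<exists>q. \<forall>i<n. (\<forall>m\<ge>n. coeff (q i) m = 0) \<and>
              (\<forall>j<n. \<beta> (q i) (monom 1 j) = (if i = j then 1 else 0))"
proof (induction n)
  case 0
  show ?case by simp
next
  case (Suc n)
  note lin1 = linear_poly_simps[OF bilinear_polyD(1)[OF \<beta>]]
    and lin2 = linear_poly_simps[OF bilinear_polyD(2)[OF \<beta>]]
  from Suc obtain q where q0: "\<And>i m. i < n \<Longrightarrow> m \<ge> n \<Longrightarrow> coeff (q i) m = 0"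
    and q1: "\<And>i j. i < n \<Longrightarrow> j < n \<Longrightarrow> \<beta> (q i) (monom 1 j) = (if i = j then 1 else 0)"
    by blast
  define e :: "real poly" where "e = monom 1 n"
  define e' where "e' = e - (\<Sum>i<n. smult (\<beta> e (monom 1 i)) (q i))"
  have orth: "\<beta> e' (monom 1 j) = 0" if "j < n" for j
  proof -
    have "\<beta> e' (monom 1 j) = \<beta> e (monom 1 j) - (\<Sum>i<n. \<beta> e (monom 1 i) * \<beta> (q i) (monom 1 j))"
      unfolding e'_def by (simp add: lin1 linear_poly_sum[OF bilinear_polyD(1)[OF \<beta>]])
    also have "(\<Sum>i<n. \<beta> e (monom 1 i) * \<beta> (q i) (monom 1 j)) =
        (\<Sum>i<n. if i = j then \<beta> e (monom 1 i) else 0)"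
      by (rule sum.cong) (auto simp: q1 that)
    finally show ?thesis using that by (auto simp: sum.delta)
  qed
  have ce': "coeff e' m = (if m = n then 1 else 0)" if "m \<ge> n" for m
    using that q0 unfolding e'_def e_def by (auto simp: coeff_sum)
  then have "e' \<noteq> 0" by (metis coeff_0 order_refl zero_neq_one)
  \<comment> \<open>In the second argument only the monomial of degree n survives, so the pivot
    equals \<beta> e' e'.\<close>
  have "\<beta> e' e' = (\<Sum>j<Suc n. coeff e' j * \<beta> e' (monom 1 j))"
    by (rule linear_poly_eq_sum_coeff[OF bilinear_polyD(2)[OF \<beta>]]) (simp add: ce')
  also have "\<dots> = \<beta> e' e" using orth ce' by (simp add: e_def)
  finally have ne: "\<beta> e' e \<noteq> 0" using def \<open>e' \<noteq> 0\<close> by metis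
  define qn where "qn = smult (1 / \<beta> e' e) e'"
  define q' where "q' i = (if i < n then q i - smult (\<beta> (q i) e) qn else qn)" for i
  have qn: "\<beta> qn (monom 1 j) = (if j = n then 1 else 0)" if "j < Suc n" for j
    using that orth ne unfolding qn_def by (cases "j = n") (auto simp: lin1 e_def)
  have "\<beta> (q' i) (monom 1 j) = (if i = j then 1 else 0)" if "i < Suc n" "j < Suc n" for i j
    using that qn q1 by (cases "i < n"; cases "j = n") (auto simp: q'_def lin1 e_def less_Suc_eq)
  moreover have "coeff (q' i) m = 0" if "i < Suc n" "m \<ge> Suc n" for i m
    using that q0 ce'[of m] by (auto simp: q'_def qn_def)
  ultimately show ?case by (intro exI[of _ q']) auto
qed

text \<open>Riesz representation on degree at most k. The representer is an explicit combination
  with the values of l at the monomials as coefficients; linear dependence on the data and the bound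
  of the solution operator are both read off from this formula.\<close>

lemma dual_basis_degree:
  assumes \<beta>: "bilinear_poly \<beta>" and def: "\<And>p. \<beta> p p = 0 \<Longrightarrow> p = 0"
  obtains q where "\<And>i. i \<le> k \<Longrightarrow> degree (q i) \<le> k"
    "\<And>l p. linear_poly l \<Longrightarrow> degree p \<le> k \<Longrightarrow> \<beta> (\<Sum>j\<le>k. smult (l (monom 1 j)) (q j)) p = l p"
proof -
  obtain q where q0: "\<And>i m. i < Suc k \<Longrightarrow> m \<ge> Suc k \<Longrightarrow> coeff (q i) m = 0"
    and q1: "\<And>i j. i < Suc k \<Longrightarrow> j < Suc k \<Longrightarrow> \<beta> (q i) (monom 1 j) = (if i = j then 1 else 0)"
    using dual_basis_exists[OF \<beta> def, of "Suc k"] by blast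
  show ?thesis
  proof (rule that[of q])
    show "degree (q i) \<le> k" if "i \<le> k" for i
      using q0[of i] that by (intro degree_le) auto
  next
    fix l :: "real poly \<Rightarrow> real" and p :: "real poly"
    assume l: "linear_poly l" and p: "degree p \<le> k"
    have "\<beta> (\<Sum>j\<le>k. smult (l (monom 1 j)) (q j)) p = (\<Sum>j\<le>k. l (monom 1 j) * \<beta> (q j) p)"
      by (simp add: linear_poly_sum[OF bilinear_polyD(1)[OF \<beta>]]
          linear_poly_simps[OF bilinear_polyD(1)[OF \<beta>]])
    also have "\<dots> = (\<Sum>j\<le>k. l (monom 1 j) * coeff p j)"
    proof (rule sum.cong[OF refl])
      fix j assume j: "j \<in> {..k}"
      have "\<beta> (q j) p = (\<Sum>i<Suc k. coeff p i * \<beta> (q j) (monom 1 i))"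
        by (rule linear_poly_eq_sum_coeff[OF bilinear_polyD(2)[OF \<beta>]])
          (use p in \<open>auto intro!: coeff_eq_0\<close>)
      also have "\<dots> = (\<Sum>i<Suc k. if i = j then coeff p i else 0)"
        using j by (intro sum.cong) (auto simp: q1)
      also have "\<dots> = coeff p j" using j by (auto simp: sum.delta)
      finally show "l (monom 1 j) * \<beta> (q j) p = l (monom 1 j) * coeff p j" by simp
    qed
    also have "\<dots> = l p"
      using linear_poly_eq_sum_coeff[OF l, of "Suc k" p] p
      by (auto simp: coeff_eq_0 lessThan_Suc_atMost mult.commute)
    finally show "\<beta> (\<Sum>j\<le>k. smult (l (monom 1 j)) (q j)) p = l p" .
  qed
qed

text \<open>This norm dominates the values and, on bounded degree, the derivatives on [-1, 1]. It
  refers to no fixed degree bound, so polynomials of different degrees can be compared.\<close>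

definition coeff_norm :: "real poly \<Rightarrow> real" where
  "coeff_norm p = (\<Sum>j\<le>degree p. \<bar>coeff p j\<bar>)"

lemma coeff_norm_nonneg: "coeff_norm p \<ge> 0"
  by (simp add: coeff_norm_def sum_nonneg)

lemma coeff_norm_eq:
  assumes "degree p \<le> k"
  shows "coeff_norm p = (\<Sum>j\<le>k. \<bar>coeff p j\<bar>)"
  unfolding coeff_norm_def
  by (rule sum.mono_neutral_left) (use assms in \<open>auto simp: coeff_eq_0\<close>)

lemma abs_poly_le_coeff_norm:
  fixes p :: "real poly"
  assumes "\<bar>x\<bar> \<le> 1"
  shows "\<bar>poly p x\<bar> \<le> coeff_norm p"
proof -
  have "\<bar>poly p x\<bar> \<le> (\<Sum>j\<le>degree p. \<bar>coeff p j * x ^ j\<bar>)"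
    unfolding poly_altdef by (rule sum_abs)
  also have "\<dots> \<le> coeff_norm p"
    unfolding coeff_norm_def
  proof (rule sum_mono)
    fix j
    have "\<bar>x\<bar> ^ j \<le> 1" using assms by (simp add: power_le_one)
    then show "\<bar>coeff p j * x ^ j\<bar> \<le> \<bar>coeff p j\<bar>"
      by (simp add: abs_mult power_abs mult_left_le)
  qed
  finally show ?thesis .
qed

lemma coeff_norm_pderiv_le:
  assumes "degree p \<le> k"
  shows "coeff_norm (pderiv p) \<le> k * coeff_norm p"
proof -
  have "coeff_norm (pderiv p) = (\<Sum>j\<le>k. \<bar>coeff (pderiv p) j\<bar>)"
    using assms by (intro coeff_norm_eq) (simp add: degree_pderiv)
  also have "\<dots> = (\<Sum>j\<le>k. real (Suc j) * \<bar>coeff p (Suc j)\<bar>)"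
    by (intro sum.cong) (auto simp: coeff_pderiv abs_mult)
  also have "\<dots> = (\<Sum>j\<in>{1..Suc k}. real j * \<bar>coeff p j\<bar>)"
    by (rule sum.reindex_bij_witness[of _ "\<lambda>j. j - 1" Suc]) auto
  also have "\<dots> \<le> (\<Sum>j\<in>{1..Suc k}. real k * \<bar>coeff p j\<bar>)"
  proof (rule sum_mono)
    fix j assume "j \<in> {1..Suc k}"
    then show "real j * \<bar>coeff p j\<bar> \<le> real k * \<bar>coeff p j\<bar>"
      using assms by (cases "j \<le> k") (auto simp: coeff_eq_0 mult_right_mono)
  qed
  also have "\<dots> \<le> (\<Sum>j\<in>{..Suc k}. real k * \<bar>coeff p j\<bar>)"
    by (rule sum_mono2) auto
  also have "\<dots> = k * coeff_norm p"
    using assms by (subst coeff_norm_eq[of p "Suc k"]) (simp_all add: sum_distrib_left distrib_left del: sum.atMost_Suc)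
  finally show ?thesis .
qed

lemma coeff_norm_smult_sum_le:
  assumes "\<And>j. j \<le> k \<Longrightarrow> degree (q j) \<le> k"
  shows "coeff_norm (\<Sum>j\<le>k. smult (c j) (q j)) \<le> (\<Sum>j\<le>k. \<bar>c j\<bar> * coeff_norm (q j))"
proof -
  have "degree (\<Sum>j\<le>k. smult (c j) (q j)) \<le> k"
    by (rule degree_sum_le) (use assms order_trans[OF degree_smult_le] in auto)
  then have "coeff_norm (\<Sum>j\<le>k. smult (c j) (q j)) = (\<Sum>i\<le>k. \<bar>\<Sum>j\<le>k. c j * coeff (q j) i\<bar>)"
    by (subst coeff_norm_eq[of _ k]) (auto simp: coeff_sum)
  also have "\<dots> \<le> (\<Sum>i\<le>k. \<Sum>j\<le>k. \<bar>c j\<bar> * \<bar>coeff (q j) i\<bar>)"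
    by (intro sum_mono order_trans[OF sum_abs]) (auto simp: abs_mult)
  also have "\<dots> = (\<Sum>j\<le>k. \<Sum>i\<le>k. \<bar>c j\<bar> * \<bar>coeff (q j) i\<bar>)" by (rule sum.swap)
  also have "\<dots> = (\<Sum>j\<le>k. \<bar>c j\<bar> * coeff_norm (q j))"
    using assms by (intro sum.cong) (auto simp: coeff_norm_eq[of _ k] sum_distrib_left)
  finally show ?thesis .
qed

section \<open>The scheme on the reference cell\<close>

abbreviation ref_cell :: "real set" where
  "ref_cell \<equiv> {- (1/2)..1/2}"

definition ref_mean :: "(real \<Rightarrow> real) \<Rightarrow> real" where
  "ref_mean f = integral ref_cell f"

definition ref_inner :: "(real \<Rightarrow> real) \<Rightarrow> real poly \<Rightarrow> real" where
  "ref_inner f \<phi> = integral ref_cell (\<lambda>x. f x * poly \<phi> x)"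

text \<open>The left neighbour is centred at the left end of the cell: its right half overlaps the
  left half of the cell, and \<open>f 0\<close> is the flux value there. All powers of h have
  cancelled because \<tau> = C h, so the form is independent of the mesh.\<close>

definition left_form :: "real \<Rightarrow> (real \<Rightarrow> real) \<Rightarrow> real poly \<Rightarrow> real" where
  "left_form C f \<phi> =
     integral {0..1/2} (\<lambda>y. f y * (poly \<phi> (y - 1/2) / C + poly (pderiv \<phi>) (y - 1/2)))
     + f 0 * poly \<phi> (- (1/2))"

definition right_form :: "real \<Rightarrow> (real \<Rightarrow> real) \<Rightarrow> real poly \<Rightarrow> real" where
  "right_form C f \<phi> =
     integral {- (1/2)..0} (\<lambda>y. f y * (poly \<phi> (y + 1/2) / C + poly (pderiv \<phi>) (y + 1/2)))
     - f 0 * poly \<phi> (1/2)"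

text \<open>
  The scheme on one cell in the coordinate \<open>(x - c) / h\<close>; \<open>fl\<close>, \<open>f\<close>, \<open>fr\<close> live on the left
  neighbour, the cell itself and the right neighbour in the combined mesh of primal and dual cells,
  each in its own local coordinate.
\<close>

definition cell_form ::
    "real \<Rightarrow> (real \<Rightarrow> real) \<Rightarrow> (real \<Rightarrow> real) \<Rightarrow> (real \<Rightarrow> real) \<Rightarrow> real poly \<Rightarrow> real" where
  "cell_form C fl f fr \<phi> = left_form C fl \<phi> + right_form C fr \<phi> - ref_inner f \<phi> / C"

section \<open>Linearity of the reference forms in trial and test function\<close>

lemma ref_mean_lin:
  assumes "continuous_on ref_cell f" "continuous_on ref_cell g"
  shows "ref_mean (\<lambda>x. s * f x + t * g x) = s * ref_mean f + t * ref_mean g"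
  unfolding ref_mean_def
  by (subst integral_add) (auto intro!: integrable_continuous_real continuous_intros assms)

lemma ref_inner_lin:
  assumes "continuous_on ref_cell f" "continuous_on ref_cell g"
  shows "ref_inner (\<lambda>x. s * f x + t * g x) \<phi> = s * ref_inner f \<phi> + t * ref_inner g \<phi>"
proof -
  have "ref_inner (\<lambda>x. s * f x + t * g x) \<phi> =
    integral ref_cell (\<lambda>x. s * (f x * poly \<phi> x) + t * (g x * poly \<phi> x))"
    unfolding ref_inner_def by (simp add: algebra_simps)
  also have "\<dots> = s * ref_inner f \<phi> + t * ref_inner g \<phi>"
    unfolding ref_inner_def
    by (subst integral_add) (auto intro!: integrable_continuous_real continuous_intros assms)
  finally show ?thesis .
qed

lemma left_form_lin:
  assumes "continuous_on ref_cell f" "continuous_on ref_cell g"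
  shows "left_form C (\<lambda>x. s * f x + t * g x) \<phi> = s * left_form C f \<phi> + t * left_form C g \<phi>"
proof -
  define w where "w y = poly \<phi> (y - 1/2) / C + poly (pderiv \<phi>) (y - 1/2)" for y
  have w: "continuous_on {0..1/2} w" unfolding w_def divide_inverse by (intro continuous_intros)
  have c: "continuous_on {0..1/2} f" "continuous_on {0..1/2} g"
    by (auto intro: continuous_on_subset[OF assms(1)] continuous_on_subset[OF assms(2)])
  have "integral {0..1/2} (\<lambda>y. (s * f y + t * g y) * w y) =
    integral {0..1/2} (\<lambda>y. s * (f y * w y) + t * (g y * w y))"
    by (simp add: algebra_simps)
  also have "\<dots> = s * integral {0..1/2} (\<lambda>y. f y * w y) + t * integral {0..1/2} (\<lambda>y. g y * w y)"
    by (subst integral_add) (auto intro!: integrable_continuous_real continuous_intros c w)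
  finally show ?thesis unfolding left_form_def w_def by (simp add: algebra_simps)
qed

lemma right_form_lin:
  assumes "continuous_on ref_cell f" "continuous_on ref_cell g"
  shows "right_form C (\<lambda>x. s * f x + t * g x) \<phi> = s * right_form C f \<phi> + t * right_form C g \<phi>"
proof -
  define w where "w y = poly \<phi> (y + 1/2) / C + poly (pderiv \<phi>) (y + 1/2)" for y
  have w: "continuous_on {- (1/2)..0} w" unfolding w_def divide_inverse by (intro continuous_intros)
  have c: "continuous_on {- (1/2)..0} f" "continuous_on {- (1/2)..0} g"
    by (auto intro: continuous_on_subset[OF assms(1)] continuous_on_subset[OF assms(2)])
  have "integral {- (1/2)..0} (\<lambda>y. (s * f y + t * g y) * w y) =
    integral {- (1/2)..0} (\<lambda>y. s * (f y * w y) + t * (g y * w y))"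
    by (simp add: algebra_simps)
  also have "\<dots> = s * integral {- (1/2)..0} (\<lambda>y. f y * w y) + t * integral {- (1/2)..0} (\<lambda>y. g y * w y)"
    by (subst integral_add) (auto intro!: integrable_continuous_real continuous_intros c w)
  finally show ?thesis unfolding right_form_def w_def by (simp add: algebra_simps)
qed

lemma linear_poly_ref_mean: "linear_poly (\<lambda>p. ref_mean (poly p))"
  unfolding linear_poly_def
proof (intro allI)
  fix s t :: real and p q :: "real poly"
  have "poly (smult s p + smult t q) = (\<lambda>x. s * poly p x + t * poly q x)" by auto
  then show "ref_mean (poly (smult s p + smult t q)) = s * ref_mean (poly p) + t * ref_mean (poly q)"
    by (simp add: ref_mean_lin continuous_intros)
qed

lemma linear_poly_ref_inner:
  assumes "continuous_on ref_cell f"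
  shows "linear_poly (ref_inner f)"
  unfolding linear_poly_def
proof (intro allI)
  fix s t :: real and p q :: "real poly"
  have "ref_inner f (smult s p + smult t q) =
    integral ref_cell (\<lambda>x. s * (f x * poly p x) + t * (f x * poly q x))"
    unfolding ref_inner_def by (simp add: algebra_simps)
  also have "\<dots> = s * ref_inner f p + t * ref_inner f q"
    unfolding ref_inner_def
    by (subst integral_add) (auto intro!: integrable_continuous_real continuous_intros assms)
  finally show "ref_inner f (smult s p + smult t q) = s * ref_inner f p + t * ref_inner f q" .
qed

lemma linear_poly_left_form:
  assumes "continuous_on ref_cell f"
  shows "linear_poly (left_form C f)"
  unfolding linear_poly_def
proof (intro allI)
  fix s t :: real and p q :: "real poly"
  define w where "w \<phi> y = poly \<phi> (y - 1/2) / C + poly (pderiv \<phi>) (y - 1/2)" for \<phi> y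
  have w: "continuous_on {0..1/2} (w \<phi>)" for \<phi>
    unfolding w_def divide_inverse by (intro continuous_intros)
  have c: "continuous_on {0..1/2} f" by (rule continuous_on_subset[OF assms(1)]) auto
  have lin: "w (smult s p + smult t q) y = s * w p y + t * w q y" for y
    unfolding w_def
    by (simp add: pderiv_add pderiv_smult add_divide_distrib distrib_left)
  have "integral {0..1/2} (\<lambda>y. f y * w (smult s p + smult t q) y) =
    integral {0..1/2} (\<lambda>y. s * (f y * w p y) + t * (f y * w q y))"
    unfolding lin by (simp add: algebra_simps)
  also have "\<dots> = s * integral {0..1/2} (\<lambda>y. f y * w p y) + t * integral {0..1/2} (\<lambda>y. f y * w q y)"
    by (subst integral_add) (auto intro!: integrable_continuous_real continuous_intros c w)
  finally show "left_form C f (smult s p + smult t q) = s * left_form C f p + t * left_form C f q"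
    unfolding left_form_def w_def by (simp add: algebra_simps)
qed

lemma linear_poly_right_form:
  assumes "continuous_on ref_cell f"
  shows "linear_poly (right_form C f)"
  unfolding linear_poly_def
proof (intro allI)
  fix s t :: real and p q :: "real poly"
  define w where "w \<phi> y = poly \<phi> (y + 1/2) / C + poly (pderiv \<phi>) (y + 1/2)" for \<phi> y
  have w: "continuous_on {- (1/2)..0} (w \<phi>)" for \<phi>
    unfolding w_def divide_inverse by (intro continuous_intros)
  have c: "continuous_on {- (1/2)..0} f" by (rule continuous_on_subset[OF assms(1)]) auto
  have lin: "w (smult s p + smult t q) y = s * w p y + t * w q y" for y
    unfolding w_def
    by (simp add: pderiv_add pderiv_smult add_divide_distrib distrib_left)
  have "integral {- (1/2)..0} (\<lambda>y. f y * w (smult s p + smult t q) y) =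
    integral {- (1/2)..0} (\<lambda>y. s * (f y * w p y) + t * (f y * w q y))"
    unfolding lin by (simp add: algebra_simps)
  also have "\<dots> = s * integral {- (1/2)..0} (\<lambda>y. f y * w p y) + t * integral {- (1/2)..0} (\<lambda>y. f y * w q y)"
    by (subst integral_add) (auto intro!: integrable_continuous_real continuous_intros c w)
  finally show "right_form C f (smult s p + smult t q) = s * right_form C f p + t * right_form C f q"
    unfolding right_form_def w_def by (simp add: algebra_simps)
qed

lemma linear_poly_cell_form:
  assumes "continuous_on ref_cell fl" "continuous_on ref_cell f" "continuous_on ref_cell fr"
  shows "linear_poly (cell_form C fl f fr)"
  using linear_poly_left_form[OF assms(1), of C] linear_poly_right_form[OF assms(3), of C]
    linear_poly_ref_inner[OF assms(2)]
  unfolding linear_poly_def cell_form_def by (simp add: algebra_simps add_divide_distrib)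

lemma cell_form_lin:
  assumes "continuous_on ref_cell fl" "continuous_on ref_cell f" "continuous_on ref_cell fr"
    "continuous_on ref_cell gl" "continuous_on ref_cell g" "continuous_on ref_cell gr"
  shows "cell_form C (\<lambda>x. s * fl x + t * gl x) (\<lambda>x. s * f x + t * g x) (\<lambda>x. s * fr x + t * gr x) \<phi> =
    s * cell_form C fl f fr \<phi> + t * cell_form C gl g gr \<phi>"
  unfolding cell_form_def
  by (simp add: assms left_form_lin right_form_lin ref_inner_lin add_divide_distrib algebra_simps)

section \<open>Bounds of the reference forms by sup norm and coefficient norm\<close>

lemma integral_abs_le:
  fixes f :: "real \<Rightarrow> real"
  assumes "continuous_on {u..v} f" "\<And>x. x \<in> {u..v} \<Longrightarrow> \<bar>f x\<bar> \<le> B" "u \<le> v"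
  shows "\<bar>integral {u..v} f\<bar> \<le> B * (v - u)"
  using integral_bound[OF assms(3,1), of B] assms(2) by simp

lemma ref_mean_bound:
  assumes "continuous_on ref_cell f" "\<And>x. x \<in> ref_cell \<Longrightarrow> \<bar>f x\<bar> \<le> M"
  shows "\<bar>ref_mean f\<bar> \<le> M"
  unfolding ref_mean_def using integral_abs_le[OF assms] by simp

lemma ref_inner_bound:
  assumes "continuous_on ref_cell f" "\<And>x. x \<in> ref_cell \<Longrightarrow> \<bar>f x\<bar> \<le> M"
  shows "\<bar>ref_inner f \<phi>\<bar> \<le> M * coeff_norm \<phi>"
proof -
  have "M \<ge> 0" using assms(2)[of 0] by auto
  have "\<bar>integral ref_cell (\<lambda>x. f x * poly \<phi> x)\<bar> \<le> M * coeff_norm \<phi> * (1/2 - (- (1/2)))"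
    by (rule integral_abs_le)
      (auto intro!: continuous_intros assms mult_mono abs_poly_le_coeff_norm
        simp: abs_mult \<open>M \<ge> 0\<close>)
  then show ?thesis unfolding ref_inner_def by simp
qed

lemma test_weight_bound:
  fixes \<phi> :: "real poly"
  assumes "C > 0" "degree \<phi> \<le> k" "\<bar>z\<bar> \<le> 1"
  shows "\<bar>poly \<phi> z / C + poly (pderiv \<phi>) z\<bar> \<le> (1 / C + k) * coeff_norm \<phi>"
proof -
  have "\<bar>poly (pderiv \<phi>) z\<bar> \<le> k * coeff_norm \<phi>"
    using abs_poly_le_coeff_norm[OF assms(3)] coeff_norm_pderiv_le[OF assms(2)] order_trans by blast
  moreover have "\<bar>poly \<phi> z / C\<bar> \<le> coeff_norm \<phi> / C"
    using abs_poly_le_coeff_norm[OF assms(3)] assms(1) by (simp add: divide_right_mono)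
  ultimately have "\<bar>poly \<phi> z / C + poly (pderiv \<phi>) z\<bar> \<le> coeff_norm \<phi> / C + k * coeff_norm \<phi>"
    by linarith
  then show ?thesis by (simp add: algebra_simps)
qed

lemma left_form_bound:
  assumes "continuous_on ref_cell f" "\<And>x. x \<in> ref_cell \<Longrightarrow> \<bar>f x\<bar> \<le> M"
    and "C > 0" "degree \<phi> \<le> k"
  shows "\<bar>left_form C f \<phi>\<bar> \<le> (1 / C + k + 1) * (M * coeff_norm \<phi>)"
proof -
  have M: "M \<ge> 0" using assms(2)[of 0] by auto
  have c: "continuous_on {0..1/2} f" by (rule continuous_on_subset[OF assms(1)]) auto
  define J where "J = integral {0..1/2} (\<lambda>y. f y * (poly \<phi> (y - 1/2) / C + poly (pderiv \<phi>) (y - 1/2)))"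
  have "\<bar>J\<bar> \<le> M * ((1 / C + k) * coeff_norm \<phi>) * (1/2 - 0)"
    unfolding J_def
  proof (rule integral_abs_le)
    show "continuous_on {0..1/2} (\<lambda>y. f y * (poly \<phi> (y - 1/2) / C + poly (pderiv \<phi>) (y - 1/2)))"
      unfolding divide_inverse[of _ C] by (intro continuous_intros c)
    fix x :: real assume "x \<in> {0..1/2}"
    then show "\<bar>f x * (poly \<phi> (x - 1/2) / C + poly (pderiv \<phi>) (x - 1/2))\<bar>
      \<le> M * ((1 / C + k) * coeff_norm \<phi>)"
      unfolding abs_mult
      by (intro mult_mono assms(2) test_weight_bound assms(3,4)) (auto simp: M)
  qed simp
  also have "\<dots> \<le> M * ((1 / C + k) * coeff_norm \<phi>)"
    using M assms(3) coeff_norm_nonneg[of \<phi>] by simp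
  finally have 1: "\<bar>J\<bar> \<le> M * ((1 / C + k) * coeff_norm \<phi>)" .
  have 2: "\<bar>f 0 * poly \<phi> (- (1/2))\<bar> \<le> M * coeff_norm \<phi>"
    unfolding abs_mult by (intro mult_mono assms(2) abs_poly_le_coeff_norm) (auto simp: M)
  have "\<bar>left_form C f \<phi>\<bar> \<le> \<bar>J\<bar> + \<bar>f 0 * poly \<phi> (- (1/2))\<bar>"
    unfolding left_form_def J_def by (rule abs_triangle_ineq)
  then show ?thesis using 1 2 by (simp add: algebra_simps)
qed

lemma right_form_bound:
  assumes "continuous_on ref_cell f" "\<And>x. x \<in> ref_cell \<Longrightarrow> \<bar>f x\<bar> \<le> M"
    and "C > 0" "degree \<phi> \<le> k"
  shows "\<bar>right_form C f \<phi>\<bar> \<le> (1 / C + k + 1) * (M * coeff_norm \<phi>)"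
proof -
  have M: "M \<ge> 0" using assms(2)[of 0] by auto
  have c: "continuous_on {- (1/2)..0} f" by (rule continuous_on_subset[OF assms(1)]) auto
  define J where "J = integral {- (1/2)..0} (\<lambda>y. f y * (poly \<phi> (y + 1/2) / C + poly (pderiv \<phi>) (y + 1/2)))"
  have "\<bar>J\<bar> \<le> M * ((1 / C + k) * coeff_norm \<phi>) * (0 - (- (1/2)))"
    unfolding J_def
  proof (rule integral_abs_le)
    show "continuous_on {- (1/2)..0} (\<lambda>y. f y * (poly \<phi> (y + 1/2) / C + poly (pderiv \<phi>) (y + 1/2)))"
      unfolding divide_inverse[of _ C] by (intro continuous_intros c)
    fix x :: real assume "x \<in> {- (1/2)..0}"
    then show "\<bar>f x * (poly \<phi> (x + 1/2) / C + poly (pderiv \<phi>) (x + 1/2))\<bar>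
      \<le> M * ((1 / C + k) * coeff_norm \<phi>)"
      unfolding abs_mult
      by (intro mult_mono assms(2) test_weight_bound assms(3,4)) (auto simp: M)
  qed simp
  also have "\<dots> \<le> M * ((1 / C + k) * coeff_norm \<phi>)"
    using M assms(3) coeff_norm_nonneg[of \<phi>] by simp
  finally have 1: "\<bar>J\<bar> \<le> M * ((1 / C + k) * coeff_norm \<phi>)" .
  have 2: "\<bar>f 0 * poly \<phi> (1/2)\<bar> \<le> M * coeff_norm \<phi>"
    unfolding abs_mult by (intro mult_mono assms(2) abs_poly_le_coeff_norm) (auto simp: M)
  have "\<bar>right_form C f \<phi>\<bar> \<le> \<bar>J\<bar> + \<bar>f 0 * poly \<phi> (1/2)\<bar>"
    unfolding right_form_def J_def by (rule abs_triangle_ineq4)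
  then show ?thesis using 1 2 by (simp add: algebra_simps)
qed

lemma cell_form_bound:
  assumes "continuous_on ref_cell fl" "continuous_on ref_cell f" "continuous_on ref_cell fr"
    and "\<And>x. x \<in> ref_cell \<Longrightarrow> \<bar>fl x\<bar> \<le> M" "\<And>x. x \<in> ref_cell \<Longrightarrow> \<bar>f x\<bar> \<le> M"
      "\<And>x. x \<in> ref_cell \<Longrightarrow> \<bar>fr x\<bar> \<le> M"
    and "C > 0" "degree \<phi> \<le> k"
  shows "\<bar>cell_form C fl f fr \<phi>\<bar> \<le> 3 * (1 / C + k + 1) * (M * coeff_norm \<phi>)"
proof -
  have M: "M \<ge> 0" using assms(4)[of 0] by auto
  have "\<bar>ref_inner f \<phi> / C\<bar> \<le> (M * coeff_norm \<phi>) / C"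
    using ref_inner_bound[OF assms(2,5), of \<phi>] assms(7) by (simp add: divide_right_mono)
  also have "\<dots> \<le> (1 / C + k + 1) * (M * coeff_norm \<phi>)"
    using M coeff_norm_nonneg[of \<phi>] by (simp add: algebra_simps)
  finally show ?thesis
    using left_form_bound[OF assms(1,4,7,8)] right_form_bound[OF assms(3,6,7,8)]
    unfolding cell_form_def by linarith
qed

section \<open>Energy identity and definiteness\<close>

lemma poly_form_energy:
  "left_form C (poly p) q + right_form C (poly q) p =
     2 / C * integral {0..1/2} (\<lambda>x. poly p x * poly q (x - 1/2))"
proof -
  define F where "F x = poly q (x - 1/2) * (poly p x / C + poly (pderiv p) x)" for x
  have 1: "integral {- (1/2)..0} (\<lambda>y. poly q y * (poly p (y + 1/2) / C + poly (pderiv p) (y + 1/2)))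
      = integral {0..1/2} F"
    using integral_shift_real_ivl[of 0 "1/2" "1/2" F] by (simp add: F_def)
  have ci: "(\<lambda>x. poly p x * poly (pderiv q) (x - 1/2) + poly (pderiv p) x * poly q (x - 1/2))
      integrable_on {0..1/2}"
    "(\<lambda>x. poly p x * poly q (x - 1/2)) integrable_on {0..1/2}"
    by (intro integrable_continuous_real continuous_intros)+
  \<comment> \<open>On the overlap the convective volume terms form the derivative of a product, so
    they cancel against the two point values; only the relaxation term with 1/C is left.\<close>
  have "((\<lambda>x. poly p x * poly (pderiv q) (x - 1/2) + poly (pderiv p) x * poly q (x - 1/2))
      has_integral poly p (1/2) * poly q (1/2 - 1/2) - poly p 0 * poly q (0 - 1/2)) {0..1/2}"
    by (rule fundamental_theorem_of_calculus)
      (auto intro!: derivative_eq_intros simp flip: has_real_derivative_iff_has_vector_derivative)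
  then have 2: "integral {0..1/2}
      (\<lambda>x. poly p x * poly (pderiv q) (x - 1/2) + poly (pderiv p) x * poly q (x - 1/2))
      = poly p (1/2) * poly q 0 - poly p 0 * poly q (- (1/2))"
    by (simp add: has_integral_iff)
  define G where "G y = poly p y * (poly q (y - 1/2) / C + poly (pderiv q) (y - 1/2))" for y
  have "continuous_on {0..1/2} F" "continuous_on {0..1/2} G"
    unfolding F_def G_def divide_inverse[of _ C] by (intro continuous_intros)+
  then have "integral {0..1/2} G + integral {0..1/2} F = integral {0..1/2} (\<lambda>x. G x + F x)"
    by (intro integral_add[symmetric] integrable_continuous_real)
  also have "\<dots> = integral {0..1/2} (\<lambda>x. 2 / C * (poly p x * poly q (x - 1/2)) +
      (poly p x * poly (pderiv q) (x - 1/2) + poly (pderiv p) x * poly q (x - 1/2)))"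
    by (intro integral_cong) (simp add: F_def G_def algebra_simps)
  also have "\<dots> = integral {0..1/2} (\<lambda>x. 2 / C * (poly p x * poly q (x - 1/2))) +
      (poly p (1/2) * poly q 0 - poly p 0 * poly q (- (1/2)))"
    unfolding 2[symmetric]
    by (rule integral_add) (intro integrable_continuous_real continuous_intros)+
  also have "integral {0..1/2} (\<lambda>x. 2 / C * (poly p x * poly q (x - 1/2))) =
      2 / C * integral {0..1/2} (\<lambda>x. poly p x * poly q (x - 1/2))"
    by (rule integral_mult_right)
  finally show ?thesis
    unfolding left_form_def right_form_def 1 G_def[abs_def, symmetric]
    using mult.commute[of "poly q 0" "poly p (1/2)"] by linarith
qed

lemma ref_inner_split:
  "ref_inner (poly p) q = integral {- (1/2)..0} (\<lambda>x. poly p x * poly q x)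
     + integral {0..1/2} (\<lambda>x. poly p x * poly q x)"
  unfolding ref_inner_def
  by (rule Henstock_Kurzweil_Integration.integral_combine[symmetric])
    (auto intro!: integrable_continuous_real continuous_intros)

lemma ref_inner_nonneg: "ref_inner (poly p) p \<ge> 0"
  unfolding ref_inner_def
  by (rule integral_nonneg) (auto intro!: integrable_continuous_real continuous_intros)

text \<open>Every overlap belongs to exactly two cells. Giving each of them the part of its mass
  term over that overlap completes the square, so the dissipation is the squared difference of the
  two overlapping functions.\<close>

lemma poly_form_dissipation:
  "left_form C (poly p) q + right_form C (poly q) p
     - integral {0..1/2} (\<lambda>x. poly p x * poly p x) / C - integral {- (1/2)..0} (\<lambda>x. poly q x * poly q x) / C
   = - integral {0..1/2} (\<lambda>x. (poly p x - poly q (x - 1/2))\<^sup>2) / C"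
proof -
  have s: "integral {- (1/2)..0} (\<lambda>x. poly q x * poly q x) =
      integral {0..1/2} (\<lambda>x. poly q (x - 1/2) * poly q (x - 1/2))"
    using integral_shift_real_ivl[of 0 "1/2" "1/2" "\<lambda>x. poly q (x - 1/2) * poly q (x - 1/2)"] by simp
  have "integral {0..1/2} (\<lambda>x. (poly p x - poly q (x - 1/2))\<^sup>2) =
    integral {0..1/2} (\<lambda>x. (poly p x * poly p x + poly q (x - 1/2) * poly q (x - 1/2))
       - 2 * (poly p x * poly q (x - 1/2)))"
    by (intro integral_cong) (simp add: power2_eq_square algebra_simps)
  also have "\<dots> = integral {0..1/2} (\<lambda>x. poly p x * poly p x)
      + integral {0..1/2} (\<lambda>x. poly q (x - 1/2) * poly q (x - 1/2))
      - 2 * integral {0..1/2} (\<lambda>x. poly p x * poly q (x - 1/2))"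
    by (subst integral_diff, (intro integrable_continuous_real continuous_intros)+,
        subst integral_add, (intro integrable_continuous_real continuous_intros)+) simp
  finally show ?thesis
    unfolding poly_form_energy s by (simp add: add_divide_distrib diff_divide_distrib)
qed

text \<open>The identity extends from an interval to all arguments, and then p takes the value p(0)
  at infinitely many points.\<close>

lemma periodic_poly_const:
  fixes p :: "real poly"
  assumes "c > 0" "\<And>x. x \<in> {0..c} \<Longrightarrow> poly p x = poly p (x - c)"
  shows "p = [:poly p 0:]"
proof -
  have "poly (p - pcompose p [:- c, 1:]) x = 0" if "x \<in> {0..c}" for x
    using assms(2)[OF that] by (simp add: poly_pcompose)
  then have "{0..c} \<subseteq> {x. poly (p - pcompose p [:- c, 1:]) x = 0}" by auto
  moreover have "infinite {0..c}" using assms(1) by (simp add: infinite_Icc_iff)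
  ultimately have "p - pcompose p [:- c, 1:] = 0"
    using finite_subset poly_roots_finite by blast
  then have "poly p x = poly (pcompose p [:- c, 1:]) x" for x by simp
  then have per: "poly p x = poly p (x - c)" for x by (simp add: poly_pcompose)
  have "poly p (- c * real n) = poly p 0" for n
  proof (induction n)
    case (Suc n)
    have "- c * real (Suc n) = - c * real n - c" by (simp add: algebra_simps)
    then show ?case using per[of "- c * real n"] Suc by simp
  qed simp
  then have "range (\<lambda>n::nat. - c * real n) \<subseteq> {x. poly (p - [:poly p 0:]) x = 0}" by auto
  moreover have "infinite (range (\<lambda>n::nat. - c * real n))"
    using assms(1) by (intro range_inj_infinite) (auto simp: inj_on_def)
  ultimately have "p - [:poly p 0:] = 0"
    using finite_subset poly_roots_finite by blast
  then show ?thesis by simp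
qed

text \<open>With the same polynomial on all three cells the form is a negative multiple of the
  squared distance between p and its shift by half a cell, which vanishes for constants only.
  Subtracting the squared mean removes this kernel, and both terms have the same sign.\<close>

lemma cell_form_definite:
  assumes "C > 0" "cell_form C (poly p) (poly p) (poly p) p - (ref_mean (poly p))\<^sup>2 = 0"
  shows "p = 0"
proof -
  define J where "J = integral {0..1/2} (\<lambda>x. (poly p x - poly p (x - 1/2))\<^sup>2)"
  have "cell_form C (poly p) (poly p) (poly p) p = - J / C"
    using poly_form_dissipation[of C p p]
    unfolding cell_form_def J_def ref_inner_split by (simp add: add_divide_distrib algebra_simps)
  moreover have "J \<ge> 0" unfolding J_def
    by (rule integral_nonneg) (auto intro!: integrable_continuous_real continuous_intros)
  moreover have "J / C \<ge> 0" using \<open>J \<ge> 0\<close> assms(1) by simp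
  moreover have "(ref_mean (poly p))\<^sup>2 \<ge> 0" by simp
  ultimately have J: "J / C = 0" and m: "(ref_mean (poly p))\<^sup>2 = 0"
    using assms(2) by linarith+
  from J have "J = 0" using assms(1) by simp
  have "(poly p x - poly p (x - 1/2))\<^sup>2 = 0" if "x \<in> {0..1/2}" for x
    using integral_eq_0_iff[of 0 "1/2" "\<lambda>x. (poly p x - poly p (x - 1/2))\<^sup>2"] \<open>J = 0\<close> that
    by (auto simp: J_def continuous_intros)
  then have p: "p = [:poly p 0:]" by (intro periodic_poly_const[of "1/2"]) auto
  have "poly [:poly p 0:] = (\<lambda>x. poly p 0)" by auto
  then have "ref_mean (poly [:poly p 0:]) = poly p 0" by (simp add: ref_mean_def)
  then have "poly p 0 = 0" using m p by simp
  then show ?thesis using p by simp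
qed

lemma ref_inner_definite:
  assumes "ref_inner (poly p) p = 0"
  shows "p = 0"
proof -
  have "poly p x * poly p x = 0" if "x \<in> ref_cell" for x
    using integral_eq_0_iff[of "- (1/2)" "1/2" "\<lambda>x. poly p x * poly p x"] assms that
    by (auto simp: ref_inner_def continuous_intros)
  then have "ref_cell \<subseteq> {x. poly p x = 0}" by auto
  moreover have "infinite ref_cell" by (simp add: infinite_Icc_iff)
  ultimately show ?thesis using finite_subset poly_roots_finite by blast
qed

section \<open>Solution operator of the cell problem\<close>

definition cell_dual :: "real \<Rightarrow> nat \<Rightarrow> nat \<Rightarrow> real poly" where
  "cell_dual C k = (SOME q. (\<forall>i\<le>k. degree (q i) \<le> k) \<and>
     (\<forall>l p. linear_poly l \<longrightarrow> degree p \<le> k \<longrightarrow>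
        (let r = \<Sum>j\<le>k. smult (l (monom 1 j)) (q j)
         in cell_form C (poly r) (poly r) (poly r) p - ref_mean (poly r) * ref_mean (poly p)) = l p))"

lemma cell_form_poly_lin:
  "cell_form C (poly (smult s p + smult t q)) (poly (smult s p + smult t q))
     (poly (smult s p + smult t q)) \<phi> =
   s * cell_form C (poly p) (poly p) (poly p) \<phi> + t * cell_form C (poly q) (poly q) (poly q) \<phi>"
proof -
  have "poly (smult s p + smult t q) = (\<lambda>x. s * poly p x + t * poly q x)" by auto
  then show ?thesis by (simp add: cell_form_lin continuous_intros)
qed

lemma bilinear_cell_form:
  "bilinear_poly (\<lambda>p \<phi>. cell_form C (poly p) (poly p) (poly p) \<phi>
     - ref_mean (poly p) * ref_mean (poly \<phi>))"
proof -
  have "linear_poly (cell_form C (poly r) (poly r) (poly r))" for r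
    by (intro linear_poly_cell_form continuous_intros)
  then show ?thesis
    using linear_poly_ref_mean
    unfolding bilinear_poly_def cell_form_poly_lin linear_poly_def by (simp add: algebra_simps)
qed

text \<open>Fixing one dual basis by choice makes all later constants depend on C and k only, hence
  independent of h.\<close>

lemma cell_dual:
  assumes "C > 0"
  shows "i \<le> k \<Longrightarrow> degree (cell_dual C k i) \<le> k"
    and "linear_poly l \<Longrightarrow> degree p \<le> k \<Longrightarrow>
      (let r = \<Sum>j\<le>k. smult (l (monom 1 j)) (cell_dual C k j)
         in cell_form C (poly r) (poly r) (poly r) p - ref_mean (poly r) * ref_mean (poly p)) = l p"
proof -
  have "\<exists>q. (\<forall>i\<le>k. degree (q i) \<le> k) \<and>
     (\<forall>l p. linear_poly l \<longrightarrow> degree p \<le> k \<longrightarrow>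
        (let r = \<Sum>j\<le>k. smult (l (monom 1 j)) (q j)
         in cell_form C (poly r) (poly r) (poly r) p - ref_mean (poly r) * ref_mean (poly p)) = l p)"
  proof -
    have def: "p = 0"
      if "cell_form C (poly p) (poly p) (poly p) p - ref_mean (poly p) * ref_mean (poly p) = 0" for p
      by (rule cell_form_definite[OF assms]) (simp add: power2_eq_square that)
    obtain q where "\<And>i. i \<le> k \<Longrightarrow> degree (q i) \<le> k"
      "\<And>l p. linear_poly l \<Longrightarrow> degree p \<le> k \<Longrightarrow>
        cell_form C (poly (\<Sum>j\<le>k. smult (l (monom 1 j)) (q j))) (poly (\<Sum>j\<le>k. smult (l (monom 1 j)) (q j)))
          (poly (\<Sum>j\<le>k. smult (l (monom 1 j)) (q j))) p
        - ref_mean (poly (\<Sum>j\<le>k. smult (l (monom 1 j)) (q j))) * ref_mean (poly p) = l p"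
      using dual_basis_degree[OF bilinear_cell_form def, where k = k] by blast
    then show ?thesis unfolding Let_def by blast
  qed
  from someI_ex[OF this] show "i \<le> k \<Longrightarrow> degree (cell_dual C k i) \<le> k"
    and "linear_poly l \<Longrightarrow> degree p \<le> k \<Longrightarrow>
      (let r = \<Sum>j\<le>k. smult (l (monom 1 j)) (cell_dual C k j)
         in cell_form C (poly r) (poly r) (poly r) p - ref_mean (poly r) * ref_mean (poly p)) = l p"
    unfolding cell_dual_def[symmetric] by blast+
qed

definition cell_solve :: "real \<Rightarrow> nat \<Rightarrow> (real poly \<Rightarrow> real) \<Rightarrow> real poly" where
  "cell_solve C k l = (\<Sum>j\<le>k. smult (l (monom 1 j)) (cell_dual C k j))"

lemma degree_cell_solve: "C > 0 \<Longrightarrow> degree (cell_solve C k l) \<le> k"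
  unfolding cell_solve_def
  by (rule degree_sum_le) (auto intro: order_trans[OF degree_smult_le] cell_dual)

lemma cell_solve:
  assumes "C > 0" "linear_poly l" "degree \<phi> \<le> k"
  shows "cell_form C (poly (cell_solve C k l)) (poly (cell_solve C k l)) (poly (cell_solve C k l)) \<phi>
     - ref_mean (poly (cell_solve C k l)) * ref_mean (poly \<phi>) = l \<phi>"
  using cell_dual(2)[OF assms] unfolding cell_solve_def Let_def .

lemma cell_solve_unique:
  assumes "C > 0" "linear_poly l" "degree p \<le> k"
    and "\<And>\<phi>. degree \<phi> \<le> k \<Longrightarrow>
      cell_form C (poly p) (poly p) (poly p) \<phi> - ref_mean (poly p) * ref_mean (poly \<phi>) = l \<phi>"
  shows "p = cell_solve C k l"
proof -
  define \<beta> where "\<beta> p \<phi> = cell_form C (poly p) (poly p) (poly p) \<phi> - ref_mean (poly p) * ref_mean (poly \<phi>)"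
    for p \<phi>
  define r where "r = p - cell_solve C k l"
  have r: "degree r \<le> k"
    unfolding r_def by (intro degree_diff_le assms degree_cell_solve)
  have "\<beta> r r = \<beta> p r - \<beta> (cell_solve C k l) r"
    using linear_poly_simps(4)[OF bilinear_polyD(1)[OF bilinear_cell_form[of C]]]
    unfolding r_def \<beta>_def by metis
  also have "\<dots> = 0"
    using assms(4)[OF r] cell_solve[OF assms(1,2) r] unfolding \<beta>_def by simp
  finally have "r = 0" using cell_form_definite[OF assms(1), of r]
    unfolding \<beta>_def power2_eq_square by simp
  then show ?thesis by (simp add: r_def)
qed

text \<open>The data enter through their values at the monomials, so bounding these finitely many
  numbers gives stability of the cell problem.\<close>

lemma coeff_norm_cell_solve_le:
  assumes "C > 0" "\<And>j. j \<le> k \<Longrightarrow> \<bar>l (monom 1 j)\<bar> \<le> B"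
  shows "coeff_norm (cell_solve C k l) \<le> (\<Sum>j\<le>k. coeff_norm (cell_dual C k j)) * B"
proof -
  have "coeff_norm (cell_solve C k l) \<le> (\<Sum>j\<le>k. \<bar>l (monom 1 j)\<bar> * coeff_norm (cell_dual C k j))"
    unfolding cell_solve_def by (rule coeff_norm_smult_sum_le) (auto intro: cell_dual assms)
  also have "\<dots> \<le> (\<Sum>j\<le>k. B * coeff_norm (cell_dual C k j))"
    using assms(2) by (intro sum_mono mult_right_mono) (auto simp: coeff_norm_nonneg)
  finally show ?thesis by (simp add: sum_distrib_left mult.commute)
qed

lemma coeff_norm_monom [simp]: "coeff_norm (monom 1 j) = 1"
proof -
  have "coeff_norm (monom 1 j) = (\<Sum>i\<le>j. if i = j then 1 else 0)"
    unfolding coeff_norm_eq[OF degree_monom_le] by (intro sum.cong) auto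
  then show ?thesis by simp
qed

lemma ref_mean_const [simp]: "ref_mean (\<lambda>x. c) = c"
  by (simp add: ref_mean_def)

lemma poly_const_fun: "poly [:c:] = (\<lambda>x. c)" "poly 1 = (\<lambda>x. 1)"
  by auto

lemma ref_mean_shift: "ref_mean (poly (\<phi> - [:ref_mean (poly \<phi>):])) = 0"
  using linear_poly_simps(4)[OF linear_poly_ref_mean, of \<phi> "[:ref_mean (poly \<phi>):]"]
  by (simp add: poly_const_fun)

text \<open>Tests of degree at most 2 see only the half-cell moments of f and its centre value. This
  turns the solvability conditions of the error polynomials into identities between finitely many
  real numbers.\<close>

lemma form_moments:
  fixes f :: "real \<Rightarrow> real"
  assumes "continuous_on ref_cell f"
  defines "X \<equiv> \<lambda>i. integral {0..1/2} (\<lambda>y. y ^ i * f y)"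
    and "Y \<equiv> \<lambda>i. integral {- (1/2)..0} (\<lambda>y. y ^ i * f y)"
  shows "left_form C f [:c0, c1, c2:] =
      ((c0 - c1 / 2 + c2 / 4) / C + c1 - c2) * X 0 + ((c1 - c2) / C + 2 * c2) * X 1 + c2 / C * X 2
      + f 0 * (c0 - c1 / 2 + c2 / 4)" (is ?l)
    and "right_form C f [:c0, c1, c2:] =
      ((c0 + c1 / 2 + c2 / 4) / C + c1 + c2) * Y 0 + ((c1 + c2) / C + 2 * c2) * Y 1 + c2 / C * Y 2
      - f 0 * (c0 + c1 / 2 + c2 / 4)" (is ?r)
    and "ref_inner f [:c0, c1, c2:] = c0 * (X 0 + Y 0) + c1 * (X 1 + Y 1) + c2 * (X 2 + Y 2)" (is ?i)
    and "ref_mean f = X 0 + Y 0" (is ?m)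
proof -
  have c: "continuous_on {0..1/2} f" "continuous_on {- (1/2)..0} f"
    by (auto intro: continuous_on_subset[OF assms(1)])
  have lin: "integral S (\<lambda>y. \<alpha> * f y + \<beta> * (y * f y) + \<gamma> * (y\<^sup>2 * f y)) =
    \<alpha> * integral S (\<lambda>y. y ^ 0 * f y) + \<beta> * integral S (\<lambda>y. y ^ 1 * f y)
      + \<gamma> * integral S (\<lambda>y. y ^ 2 * f y)"
    if "S = {u..v}" "continuous_on S f" for \<alpha> \<beta> \<gamma> u v S
  proof -
    have "(\<lambda>y. \<alpha> * f y) integrable_on S" "(\<lambda>y. \<beta> * (y * f y)) integrable_on S"
      "(\<lambda>y. \<gamma> * (y\<^sup>2 * f y)) integrable_on S"
      unfolding that(1)
      by (intro integrable_continuous_real continuous_intros that(2)[unfolded that(1)])+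
    then show ?thesis by (subst integral_add, auto intro!: integrable_add)
        (subst integral_add, auto)
  qed
  have "integral {0..1/2} (\<lambda>y. f y * (poly [:c0, c1, c2:] (y - 1/2) / C
      + poly (pderiv [:c0, c1, c2:]) (y - 1/2))) =
    integral {0..1/2} (\<lambda>y. ((c0 - c1 / 2 + c2 / 4) / C + c1 - c2) * f y
      + ((c1 - c2) / C + 2 * c2) * (y * f y) + c2 / C * (y\<^sup>2 * f y))"
    by (intro integral_cong)
      (simp add: pderiv_pCons power2_eq_square algebra_simps add_divide_distrib diff_divide_distrib)
  also note lin[OF refl c(1)]
  finally show ?l
    unfolding left_form_def X_def by (simp add: algebra_simps)
  have "integral {- (1/2)..0} (\<lambda>y. f y * (poly [:c0, c1, c2:] (y + 1/2) / C
      + poly (pderiv [:c0, c1, c2:]) (y + 1/2))) =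
    integral {- (1/2)..0} (\<lambda>y. ((c0 + c1 / 2 + c2 / 4) / C + c1 + c2) * f y
      + ((c1 + c2) / C + 2 * c2) * (y * f y) + c2 / C * (y\<^sup>2 * f y))"
    by (intro integral_cong)
      (simp add: pderiv_pCons power2_eq_square algebra_simps add_divide_distrib diff_divide_distrib)
  also note lin[OF refl c(2)]
  finally show ?r
    unfolding right_form_def Y_def by (simp add: algebra_simps)
  have split: "integral ref_cell g = integral {0..1/2} g + integral {- (1/2)..0} g"
    if "continuous_on ref_cell g" for g :: "real \<Rightarrow> real"
    using Henstock_Kurzweil_Integration.integral_combine[of "- (1/2)" 0 "1/2" g]
      integrable_continuous_real[OF that] by simp
  have "ref_inner f [:c0, c1, c2:] = integral ref_cell
    (\<lambda>y. c0 * f y + c1 * (y * f y) + c2 * (y\<^sup>2 * f y))"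
    unfolding ref_inner_def by (intro integral_cong) (simp add: power2_eq_square algebra_simps)
  also note lin[OF refl assms(1)]
  finally show ?i
    unfolding X_def Y_def using assms(1)
    by (simp add: split[of "\<lambda>y. y ^ i * f y" for i] continuous_intros split algebra_simps)
  show ?m unfolding X_def Y_def ref_mean_def using split[OF assms(1)] by simp
qed

text \<open>Conservation: for the constant test the halves of the two neighbours reassemble to f,
  and the fluxes at both cell ends are equal.\<close>

lemma cell_form_one:
  assumes "continuous_on ref_cell f"
  shows "cell_form C f f f 1 = 0"
proof -
  have 1: "(1 :: real poly) = [:1, 0, 0:]" by simp
  show ?thesis
    unfolding cell_form_def 1 form_moments[OF assms] by (simp add: add_divide_distrib)
qed

section \<open>Projection, correction and error polynomials\<close>

text \<open>The data l = 0 give the projection, f = 0 the correction, and f a Taylor monomial the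
  error polynomials, so one solvability argument serves all three.\<close>

definition cell_lift :: "real \<Rightarrow> nat \<Rightarrow> (real \<Rightarrow> real) \<Rightarrow> (real poly \<Rightarrow> real) \<Rightarrow> real poly" where
  "cell_lift C k f l =
     cell_solve C k (\<lambda>\<phi>. cell_form C f f f \<phi> - l \<phi> - ref_mean f * ref_mean (poly \<phi>))"

lemma linear_poly_lift:
  assumes "continuous_on ref_cell f" "linear_poly l"
  shows "linear_poly (\<lambda>\<phi>. cell_form C f f f \<phi> - l \<phi> - ref_mean f * ref_mean (poly \<phi>))"
  using linear_poly_cell_form[OF assms(1,1,1), of C] assms(2) linear_poly_ref_mean
  unfolding linear_poly_def by (simp add: algebra_simps)

text \<open>Constants are not seen by the form, so the condition at \<open>\<phi> = 1\<close> is the mean value condition.\<close>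

lemma cell_lift:
  assumes "C > 0" "continuous_on ref_cell f" "linear_poly l" "l 1 = 0"
  shows "degree (cell_lift C k f l) \<le> k"
    and "ref_mean (poly (cell_lift C k f l)) = ref_mean f"
    and "degree \<phi> \<le> k \<Longrightarrow>
      cell_form C (poly (cell_lift C k f l)) (poly (cell_lift C k f l)) (poly (cell_lift C k f l)) \<phi> =
      cell_form C f f f \<phi> - l \<phi>"
proof -
  let ?p = "cell_lift C k f l"
  note eq = cell_solve[OF assms(1) linear_poly_lift[OF assms(2,3), of C], of _ k, folded cell_lift_def]
  show "degree ?p \<le> k" unfolding cell_lift_def by (rule degree_cell_solve[OF assms(1)])
  show m: "ref_mean (poly ?p) = ref_mean f"
    using eq[of 1] by (simp add: cell_form_one assms continuous_intros poly_const_fun)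
  show "degree \<phi> \<le> k \<Longrightarrow> cell_form C (poly ?p) (poly ?p) (poly ?p) \<phi> = cell_form C f f f \<phi> - l \<phi>"
    using eq[of \<phi>] m by simp
qed

lemma cell_lift_unique:
  assumes "C > 0" "continuous_on ref_cell f" "linear_poly l"
    and "degree p \<le> k" "ref_mean (poly p) = ref_mean f"
    and "\<And>\<phi>. degree \<phi> \<le> k \<Longrightarrow>
      cell_form C (poly p) (poly p) (poly p) \<phi> = cell_form C f f f \<phi> - l \<phi>"
  shows "p = cell_lift C k f l"
  unfolding cell_lift_def
  by (rule cell_solve_unique[OF assms(1) linear_poly_lift[OF assms(2,3)] assms(4)])
    (simp add: assms(5,6))

definition ref_proj :: "real \<Rightarrow> nat \<Rightarrow> (real \<Rightarrow> real) \<Rightarrow> real poly" where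
  "ref_proj C k f = cell_lift C k f (\<lambda>\<phi>. 0)"

definition ref_err :: "real \<Rightarrow> nat \<Rightarrow> (real \<Rightarrow> real) \<Rightarrow> real \<Rightarrow> real" where
  "ref_err C k f x = f x - poly (ref_proj C k f) x"

text \<open>The correction is required for mean-free tests. Replacing \<phi> by its mean-free part
  extends the condition to all tests, with data vanishing at 1 as the lift demands.\<close>

definition ref_corr ::
    "real \<Rightarrow> nat \<Rightarrow> (real \<Rightarrow> real) \<Rightarrow> (real \<Rightarrow> real) \<Rightarrow> (real \<Rightarrow> real) \<Rightarrow> (real \<Rightarrow> real) \<Rightarrow> real poly" where
  "ref_corr C k gl g gr v = cell_lift C k (\<lambda>x. 0)
     (\<lambda>\<phi>. let \<psi> = \<phi> - [:ref_mean (poly \<phi>):]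
          in ref_inner v \<psi> + cell_form C gl g gr \<psi> - cell_form C g g g \<psi>)"

lemma linear_poly_zero: "linear_poly (\<lambda>\<phi>. 0)"
  by (simp add: linear_poly_def)

lemma ref_proj:
  assumes "C > 0" "continuous_on ref_cell f"
  shows "degree (ref_proj C k f) \<le> k"
    and "ref_mean (poly (ref_proj C k f)) = ref_mean f"
    and "degree \<phi> \<le> k \<Longrightarrow>
      cell_form C (poly (ref_proj C k f)) (poly (ref_proj C k f)) (poly (ref_proj C k f)) \<phi> =
      cell_form C f f f \<phi>"
  using cell_lift[OF assms linear_poly_zero] unfolding ref_proj_def by auto

lemma ref_proj_unique:
  assumes "C > 0" "continuous_on ref_cell f"
    and "degree p \<le> k" "ref_mean (poly p) = ref_mean f"
    and "\<And>\<phi>. degree \<phi> \<le> k \<Longrightarrow>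
      cell_form C (poly p) (poly p) (poly p) \<phi> = cell_form C f f f \<phi>"
  shows "p = ref_proj C k f"
  unfolding ref_proj_def
  by (rule cell_lift_unique[OF assms(1,2) linear_poly_zero]) (simp_all add: assms)

lemma continuous_on_ref_err:
  "continuous_on ref_cell f \<Longrightarrow> continuous_on ref_cell (ref_err C k f)"
  unfolding ref_err_def[abs_def] by (intro continuous_intros)

lemma cell_form_zero: "cell_form C (\<lambda>x. 0) (\<lambda>x. 0) (\<lambda>x. 0) \<phi> = 0"
  using cell_form_lin[of "\<lambda>x. 0" "\<lambda>x. 0" "\<lambda>x. 0" "\<lambda>x. 0" "\<lambda>x. 0" "\<lambda>x. 0" C 0 0 \<phi>] by simp

lemma linear_poly_corr:
  assumes "continuous_on ref_cell gl" "continuous_on ref_cell g" "continuous_on ref_cell gr"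
    "continuous_on ref_cell v"
  shows "linear_poly (\<lambda>\<phi>. let \<psi> = \<phi> - [:ref_mean (poly \<phi>):]
          in ref_inner v \<psi> + cell_form C gl g gr \<psi> - cell_form C g g g \<psi>)"
proof -
  define l where "l \<psi> = ref_inner v \<psi> + cell_form C gl g gr \<psi> - cell_form C g g g \<psi>" for \<psi>
  have l: "linear_poly l"
    using linear_poly_ref_inner[OF assms(4)] linear_poly_cell_form[OF assms(1-3), of C]
      linear_poly_cell_form[OF assms(2,2,2), of C]
    unfolding linear_poly_def l_def by (simp add: algebra_simps)
  have "(smult s p + smult t q) - [:ref_mean (poly (smult s p + smult t q)):] =
    smult s (p - [:ref_mean (poly p):]) + smult t (q - [:ref_mean (poly q):])" for s t p q
    using linear_poly_ref_mean unfolding linear_poly_def by (simp add: algebra_simps smult_diff_right)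
  then have "l (smult s p + smult t q - [:ref_mean (poly (smult s p + smult t q)):]) =
      s * l (p - [:ref_mean (poly p):]) + t * l (q - [:ref_mean (poly q):])" for s t p q
    using l unfolding linear_poly_def by simp
  then show ?thesis unfolding linear_poly_def Let_def l_def by blast
qed

lemma ref_corr:
  assumes "C > 0" "continuous_on ref_cell gl" "continuous_on ref_cell g" "continuous_on ref_cell gr"
    "continuous_on ref_cell v"
  shows "degree (ref_corr C k gl g gr v) \<le> k"
    and "ref_mean (poly (ref_corr C k gl g gr v)) = 0"
    and "degree \<phi> \<le> k \<Longrightarrow> ref_mean (poly \<phi>) = 0 \<Longrightarrow>
      cell_form C (poly (ref_corr C k gl g gr v)) (poly (ref_corr C k gl g gr v))
        (poly (ref_corr C k gl g gr v)) \<phi> =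
      - ref_inner v \<phi> - cell_form C gl g gr \<phi> + cell_form C g g g \<phi>"
proof -
  have 0: "continuous_on ref_cell (\<lambda>x::real. 0::real)" by simp
  have l1: "(let \<psi> = 1 - [:ref_mean (poly 1):]
      in ref_inner v \<psi> + cell_form C gl g gr \<psi> - cell_form C g g g \<psi>) = 0"
    using linear_poly_simps(1)[OF linear_poly_ref_inner[OF assms(5)]]
      linear_poly_simps(1)[OF linear_poly_cell_form[OF assms(2-4)]]
      linear_poly_simps(1)[OF linear_poly_cell_form[OF assms(3,3,3)]]
    by (simp add: poly_const_fun one_pCons)
  note * = cell_lift[OF assms(1) 0 linear_poly_corr[OF assms(2-5)] l1, folded ref_corr_def]
  show "degree (ref_corr C k gl g gr v) \<le> k" by (rule *)
  show "ref_mean (poly (ref_corr C k gl g gr v)) = 0" using *(2) by simp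
  show "degree \<phi> \<le> k \<Longrightarrow> ref_mean (poly \<phi>) = 0 \<Longrightarrow>
      cell_form C (poly (ref_corr C k gl g gr v)) (poly (ref_corr C k gl g gr v))
        (poly (ref_corr C k gl g gr v)) \<phi> =
      - ref_inner v \<phi> - cell_form C gl g gr \<phi> + cell_form C g g g \<phi>"
    using *(3)[of \<phi>] by (simp add: cell_form_zero)
qed

lemma ref_corr_unique:
  assumes "C > 0" "continuous_on ref_cell gl" "continuous_on ref_cell g" "continuous_on ref_cell gr"
    "continuous_on ref_cell v"
    and p: "degree p \<le> k" "ref_mean (poly p) = 0"
    and eq: "\<And>\<phi>. degree \<phi> \<le> k \<Longrightarrow> ref_mean (poly \<phi>) = 0 \<Longrightarrow>
      cell_form C (poly p) (poly p) (poly p) \<phi> =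
      - ref_inner v \<phi> - cell_form C gl g gr \<phi> + cell_form C g g g \<phi>"
  shows "p = ref_corr C k gl g gr v"
  unfolding ref_corr_def
proof (rule cell_lift_unique[OF assms(1) _ linear_poly_corr[OF assms(2-5)] p(1)])
  show "continuous_on ref_cell (\<lambda>x::real. 0::real)" "ref_mean (poly p) = ref_mean (\<lambda>x. 0)"
    by (simp_all add: p)
  fix \<phi> :: "real poly" assume d: "degree \<phi> \<le> k"
  \<comment> \<open>The form ignores constants, so an equation for the mean-free part of \<phi> is
    an equation for \<phi>.\<close>
  define \<psi> where "\<psi> = \<phi> - [:ref_mean (poly \<phi>):]"
  have "degree \<psi> \<le> k" unfolding \<psi>_def using d by (intro degree_diff_le) auto
  have lin: "linear_poly (cell_form C (poly p) (poly p) (poly p))"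
    by (intro linear_poly_cell_form continuous_intros)
  have "cell_form C (poly p) (poly p) (poly p) [:ref_mean (poly \<phi>):] =
      ref_mean (poly \<phi>) * cell_form C (poly p) (poly p) (poly p) 1"
    using linear_poly_simps(2)[OF lin, of "ref_mean (poly \<phi>)" 1] by simp
  also have "\<dots> = 0" by (simp add: cell_form_one continuous_intros)
  finally have "cell_form C (poly p) (poly p) (poly p) \<phi> = cell_form C (poly p) (poly p) (poly p) \<psi>"
    unfolding \<psi>_def using linear_poly_simps(4)[OF lin] by simp
  also have "\<dots> = - ref_inner v \<psi> - cell_form C gl g gr \<psi> + cell_form C g g g \<psi>"
    by (rule eq) (use \<open>degree \<psi> \<le> k\<close> ref_mean_shift in \<open>auto simp: \<psi>_def\<close>)
  finally show "cell_form C (poly p) (poly p) (poly p) \<phi> =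
      cell_form C (\<lambda>x. 0) (\<lambda>x. 0) (\<lambda>x. 0) \<phi> -
      (let \<psi> = \<phi> - [:ref_mean (poly \<phi>):]
       in ref_inner v \<psi> + cell_form C gl g gr \<psi> - cell_form C g g g \<psi>)"
    by (simp add: cell_form_zero Let_def \<psi>_def)
qed

section \<open>Polynomials carrying the leading errors\<close>

definition taylor_monom :: "nat \<Rightarrow> real poly" where
  "taylor_monom j = monom (1 / fact j) j"

lemma poly_taylor_monom: "poly (taylor_monom j) x = x ^ j / fact j"
  by (simp add: taylor_monom_def poly_monom)

text \<open>\<open>X0\<close> to \<open>Y2\<close> are the half-cell moments of \<open>ea\<close>,
  \<open>U0\<close> to \<open>V2\<close> those of \<open>eb\<close>, f and g the centre values, c =
  1/C; the unsimplified shape is the one produced by inserting x and x^2 into the moment formulas.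
  With vanishing means the claim reduces to U0 c + g = 0. The test of \<open>eb\<close> with x turns
  this into half of the relation that \<open>ea\<close> satisfies under the test with x^2.\<close>

lemma moment_identity:
  fixes c X0 X1 X2 Y0 Y1 Y2 U0 U1 U2 V0 V1 V2 f g :: real
  assumes a1: "((0 - 1 / 2 + 0 / 4) * c + 1 - 0) * X0 + ((1 - 0) * c + 2 * 0) * X1 + 0 * c * X2 + f * (0 - 1 / 2 + 0 / 4)
    + (((0 + 1 / 2 + 0 / 4) * c + 1 + 0) * Y0 + ((1 + 0) * c + 2 * 0) * Y1 + 0 * c * Y2 - f * (0 + 1 / 2 + 0 / 4))
   - (0 * (X0 + Y0) + 1 * (X1 + Y1) + 0 * (X2 + Y2)) * c = 0"
  and a2: "((0 - 0 / 2 + 1 / 4) * c + 0 - 1) * X0 + ((0 - 1) * c + 2 * 1) * X1 + 1 * c * X2 + f * (0 - 0 / 2 + 1 / 4)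
    + (((0 + 0 / 2 + 1 / 4) * c + 0 + 1) * Y0 + ((0 + 1) * c + 2 * 1) * Y1 + 1 * c * Y2 - f * (0 + 0 / 2 + 1 / 4))
   - (0 * (X0 + Y0) + 0 * (X1 + Y1) + 1 * (X2 + Y2)) * c = 0"
  and b1: "((0 - 1 / 2 + 0 / 4) * c + 1 - 0) * U0 + ((1 - 0) * c + 2 * 0) * U1 + 0 * c * U2 + g * (0 - 1 / 2 + 0 / 4)
    + (((0 + 1 / 2 + 0 / 4) * c + 1 + 0) * V0 + ((1 + 0) * c + 2 * 0) * V1 + 0 * c * V2 - g * (0 + 1 / 2 + 0 / 4))
   - (0 * (U0 + V0) + 1 * (U1 + V1) + 0 * (U2 + V2)) * c =
   - (0 * (X0 + Y0) + 1 * (X1 + Y1) + 0 * (X2 + Y2)) 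
    + (((0 - 1 / 2 + 0 / 4) * c + 1 - 0) * X0 + ((1 - 0) * c + 2 * 0) * X1 + 0 * c * X2 + f * (0 - 1 / 2 + 0 / 4)) / 2
    - (((0 + 1 / 2 + 0 / 4) * c + 1 + 0) * Y0 + ((1 + 0) * c + 2 * 0) * Y1 + 0 * c * Y2 - f * (0 + 1 / 2 + 0 / 4)) / 2"
  and "X0 + Y0 = 0" "U0 + V0 = 0"
  shows "- (U0 + V0) + (U0 * c + g) / 2 - (V0 * c - g) / 2 - (X0 * c + f) / 8 - (Y0 * c - f) / 8 = 0"
proof -
  have y: "Y0 = - X0" "V0 = - U0" using assms by auto
  have "- 2 * (X0 * c) - 2 * f = 0" using a1 unfolding y by (simp add: algebra_simps)
  moreover have "c * Y1 + 2 * X1 + 2 * Y1 - 2 * X0 - c * X1 = 0" using a2 unfolding y by (simp add: algebra_simps)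
  moreover have "- (c * U0) - g = - X1 - Y1 + X0 + c * X1 / 2 - c * Y1 / 2" using b1 unfolding y by (simp add: field_simps)
  ultimately show ?thesis unfolding y by (simp add: field_simps)
qed

text \<open>
  The polynomials carry the error of the numerical solution belonging to the data \<open>x\<^bsup>k+1\<^esup>\<close>,
  \<open>x\<^bsup>k+2\<^esup>\<close>, \<open>x\<^bsup>k+3\<^esup>\<close> (up to factorials).
\<close>

definition error_polys :: "real \<Rightarrow> nat \<Rightarrow> real poly \<Rightarrow> real poly \<Rightarrow> real poly \<Rightarrow> bool" where
  "error_polys C k ea eb ed \<longleftrightarrow>
    poly ea = ref_err C k (poly (taylor_monom (k + 1))) \<and>
    degree (taylor_monom (k + 1) - ea) \<le> k \<and> degree (taylor_monom (k + 2) - eb) \<le> k \<and>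
    degree (taylor_monom (k + 3) - ed) \<le> k \<and>
    ref_mean (poly ea) = 0 \<and> ref_mean (poly eb) = 0 \<and> ref_mean (poly ed) = 0 \<and>
    (\<forall>\<phi>. degree \<phi> \<le> k \<longrightarrow>
       cell_form C (poly ea) (poly ea) (poly ea) \<phi> = 0 \<and>
       cell_form C (poly eb) (poly eb) (poly eb) \<phi> =
         - ref_inner (poly ea) \<phi> + left_form C (poly ea) \<phi> / 2 - right_form C (poly ea) \<phi> / 2 \<and>
       (k \<ge> 2 \<longrightarrow> cell_form C (poly ed) (poly ed) (poly ed) \<phi> =
         - ref_inner (poly eb) \<phi> + left_form C (poly eb) \<phi> / 2 - right_form C (poly eb) \<phi> / 2
         - left_form C (poly ea) \<phi> / 8 - right_form C (poly ea) \<phi> / 8))"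

lemma error_polysD:
  assumes "error_polys C k ea eb ed"
  shows "poly ea = ref_err C k (poly (taylor_monom (k + 1)))"
    and "degree (taylor_monom (k + 1) - ea) \<le> k" "degree (taylor_monom (k + 2) - eb) \<le> k"
      "degree (taylor_monom (k + 3) - ed) \<le> k"
    and "ref_mean (poly ea) = 0" "ref_mean (poly eb) = 0" "ref_mean (poly ed) = 0"
    and "degree \<phi> \<le> k \<Longrightarrow> cell_form C (poly ea) (poly ea) (poly ea) \<phi> = 0"
    and "degree \<phi> \<le> k \<Longrightarrow> cell_form C (poly eb) (poly eb) (poly eb) \<phi> =
      - ref_inner (poly ea) \<phi> + left_form C (poly ea) \<phi> / 2 - right_form C (poly ea) \<phi> / 2"
    and "k \<ge> 2 \<Longrightarrow> degree \<phi> \<le> k \<Longrightarrow> cell_form C (poly ed) (poly ed) (poly ed) \<phi> =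
      - ref_inner (poly eb) \<phi> + left_form C (poly eb) \<phi> / 2 - right_form C (poly eb) \<phi> / 2
      - left_form C (poly ea) \<phi> / 8 - right_form C (poly ea) \<phi> / 8"
  using assms unfolding error_polys_def by blast+

text \<open>
  Solvability at \<open>\<phi> = 1\<close> is the superconvergence of the averages: it follows from the equation for
  \<open>ea\<close> tested with \<open>x\<close> and \<open>x\<^sup>2\<close>.
\<close>

lemma error_polys_exist:
  fixes C :: real and k :: nat
  assumes C: "C > 0" and k: "k \<ge> 1"
  shows "\<exists>ea eb ed. error_polys C k ea eb ed"
proof -
  have cp: "continuous_on ref_cell (poly p)" for p :: "real poly" by (intro continuous_intros)
  have diff_mean: "ref_mean (poly (p - q)) = ref_mean (poly p) - ref_mean (poly q)" for p q
    by (rule linear_poly_simps(4)[OF linear_poly_ref_mean])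
  have diff_form: "cell_form C (poly (p - q)) (poly (p - q)) (poly (p - q)) \<phi> =
    cell_form C (poly p) (poly p) (poly p) \<phi> - cell_form C (poly q) (poly q) (poly q) \<phi>" for p q \<phi>
    using cell_form_poly_lin[of C 1 p "-1" q \<phi>] by simp
  have lin: "linear_poly (left_form C (poly p))" "linear_poly (right_form C (poly p))"
    "linear_poly (ref_inner (poly p))" for p
    by (intro linear_poly_left_form linear_poly_right_form linear_poly_ref_inner cp)+
  have solve: "\<exists>e. degree (m - e) \<le> k \<and> ref_mean (poly e) = 0 \<and> m - e = cell_lift C k (poly m) l \<and>
      (\<forall>\<phi>. degree \<phi> \<le> k \<longrightarrow> cell_form C (poly e) (poly e) (poly e) \<phi> = l \<phi>)"
    if "linear_poly l" "l 1 = 0" for m l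
    using cell_lift[OF C cp[of m] that, where k = k]
    by (intro exI[of _ "m - cell_lift C k (poly m) l"]) (simp add: diff_mean diff_form)
  obtain ea where a: "degree (taylor_monom (k + 1) - ea) \<le> k" "ref_mean (poly ea) = 0"
      "taylor_monom (k + 1) - ea = ref_proj C k (poly (taylor_monom (k + 1)))"
      "\<And>\<phi>. degree \<phi> \<le> k \<Longrightarrow> cell_form C (poly ea) (poly ea) (poly ea) \<phi> = 0"
    using solve[OF linear_poly_zero refl] unfolding ref_proj_def by blast
  have err: "poly ea = ref_err C k (poly (taylor_monom (k + 1)))"
    unfolding ref_err_def[abs_def] a(3)[symmetric] by auto
  define lb where "lb \<phi> = - ref_inner (poly ea) \<phi> + left_form C (poly ea) \<phi> / 2
      - right_form C (poly ea) \<phi> / 2" for \<phi>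
  note ma = form_moments[OF cp[of ea]]
  have one: "(1 :: real poly) = [:1, 0, 0:]" by simp
  have a1: "cell_form C (poly ea) (poly ea) (poly ea) [:0, 1, 0:] = 0"
    by (rule a(4)) (use k in auto)
  have lb: "linear_poly lb"
    using lin unfolding linear_poly_def lb_def by (simp add: algebra_simps add_divide_distrib)
  \<comment> \<open>Since \<open>ea\<close> has mean zero, the value is up to sign the expression
    that the test of \<open>ea\<close> with x annihilates.\<close>
  have lb1: "lb 1 = 0"
    using a1 a(2) unfolding lb_def one cell_form_def ma divide_inverse[of _ C] by (simp, algebra)
  obtain eb where b: "degree (taylor_monom (k + 2) - eb) \<le> k" "ref_mean (poly eb) = 0"
      "\<And>\<phi>. degree \<phi> \<le> k \<Longrightarrow> cell_form C (poly eb) (poly eb) (poly eb) \<phi> = lb \<phi>"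
    using solve[OF lb lb1] by blast
  define ld where "ld \<phi> = (if k \<ge> 2 then - ref_inner (poly eb) \<phi> + left_form C (poly eb) \<phi> / 2
      - right_form C (poly eb) \<phi> / 2 - left_form C (poly ea) \<phi> / 8 - right_form C (poly ea) \<phi> / 8
      else 0)" for \<phi>
  note mb = form_moments[OF cp[of eb]]
  have ld: "linear_poly ld"
    using lin unfolding linear_poly_def ld_def by (simp add: algebra_simps add_divide_distrib)
  have ld1: "ld 1 = 0"
  proof (cases "k \<ge> 2")
    case True
    have a2: "cell_form C (poly ea) (poly ea) (poly ea) [:0, 0, 1:] = 0"
      by (rule a(4)) (use True in auto)
    have b1: "cell_form C (poly eb) (poly eb) (poly eb) [:0, 1, 0:] = lb [:0, 1, 0:]"
      by (rule b(3)) (use k in auto)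
    have L: "left_form C (poly e) 1 = integral {0..1/2} (\<lambda>y. y ^ 0 * poly e y) * inverse C + poly e 0"
      "right_form C (poly e) 1 = integral {- (1/2)..0} (\<lambda>y. y ^ 0 * poly e y) * inverse C - poly e 0"
      "ref_inner (poly e) 1 = integral {0..1/2} (\<lambda>y. y ^ 0 * poly e y)
         + integral {- (1/2)..0} (\<lambda>y. y ^ 0 * poly e y)" for e
      unfolding one form_moments[OF cp[of e]] by (simp_all add: divide_inverse[of _ C])
    have "- ref_inner (poly eb) 1 + left_form C (poly eb) 1 / 2
      - right_form C (poly eb) 1 / 2 - left_form C (poly ea) 1 / 8 - right_form C (poly ea) 1 / 8 = 0"
      unfolding L
      by (rule moment_identity[OF a1[unfolded cell_form_def ma divide_inverse[of _ C]]
            a2[unfolded cell_form_def ma divide_inverse[of _ C]]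
            b1[unfolded cell_form_def lb_def ma mb divide_inverse[of _ C]]
            a(2)[unfolded ma] b(2)[unfolded mb]])
    then show ?thesis using True by (simp add: ld_def)
  qed (simp add: ld_def)
  obtain ed where d: "degree (taylor_monom (k + 3) - ed) \<le> k" "ref_mean (poly ed) = 0"
      "\<And>\<phi>. degree \<phi> \<le> k \<Longrightarrow> cell_form C (poly ed) (poly ed) (poly ed) \<phi> = ld \<phi>"
    using solve[OF ld ld1] by blast
  show ?thesis
    unfolding error_polys_def using err a(1,2,4) b d by (intro exI[of _ ea] exI[of _ eb] exI[of _ ed]) (auto simp: lb_def ld_def)
qed

section \<open>Stability of the projection and comparison of the initial data\<close>

lemma continuous_on_poly' [continuous_intros]: "continuous_on A (poly p)"
  for p :: "real poly"
  by (intro continuous_intros)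

lemma cell_solve_lin:
  "cell_solve C k (\<lambda>\<phi>. s * l \<phi> + t * l' \<phi>) = smult s (cell_solve C k l) + smult t (cell_solve C k l')"
  unfolding cell_solve_def
  by (rule poly_eqI) (simp add: coeff_sum sum_distrib_left sum.distrib algebra_simps)

lemma abs_poly_monom_le:
  fixes x :: real
  assumes "x \<in> ref_cell"
  shows "\<bar>poly (monom 1 j) x\<bar> \<le> 1"
  using abs_poly_le_coeff_norm[of x "monom 1 j"] assms by auto

lemma abs_ref_mean_monom_le: "\<bar>ref_mean (poly (monom 1 j))\<bar> \<le> 1"
  by (rule ref_mean_bound[OF continuous_on_poly' abs_poly_monom_le])

lemma ref_err_lin:
  assumes "continuous_on ref_cell f" "continuous_on ref_cell g"
  shows "ref_err C k (\<lambda>x. s * f x + t * g x) x = s * ref_err C k f x + t * ref_err C k g x"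
proof -
  define l where "l f \<phi> = cell_form C f f f \<phi> - 0 - ref_mean f * ref_mean (poly \<phi>)" for f \<phi>
  have "l (\<lambda>x. s * f x + t * g x) = (\<lambda>\<phi>. s * l f \<phi> + t * l g \<phi>)"
    unfolding l_def by (simp add: cell_form_lin ref_mean_lin assms algebra_simps)
  then show ?thesis
    unfolding ref_err_def ref_proj_def cell_lift_def l_def[symmetric]
    by (simp add: cell_solve_lin algebra_simps)
qed

lemma ref_err_poly_eq_0:
  assumes "C > 0" "degree p \<le> k"
  shows "ref_err C k (poly p) x = 0"
proof -
  have "p = ref_proj C k (poly p)"
    by (rule ref_proj_unique) (auto intro: assms continuous_intros)
  then show ?thesis unfolding ref_err_def by simp
qed

text \<open>The summand 1 accounts for f itself; the factor behind the norm of the solution operator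
  adds the bounds of the form and of the product of means.\<close>

definition ref_const :: "real \<Rightarrow> nat \<Rightarrow> real" where
  "ref_const C k = 1 + (\<Sum>j\<le>k. coeff_norm (cell_dual C k j)) * (3 * (1 / C + k + 1) + 1)"

lemma ref_const_nonneg: "C > 0 \<Longrightarrow> ref_const C k \<ge> 0"
  unfolding ref_const_def
  by (intro add_nonneg_nonneg mult_nonneg_nonneg sum_nonneg coeff_norm_nonneg) auto

lemma ref_err_bound:
  assumes C: "C > 0" and f: "continuous_on ref_cell f" "\<And>x. x \<in> ref_cell \<Longrightarrow> \<bar>f x\<bar> \<le> M"
    and x: "x \<in> ref_cell"
  shows "\<bar>ref_err C k f x\<bar> \<le> ref_const C k * M"
proof -
  define S where "S = (\<Sum>j\<le>k. coeff_norm (cell_dual C k j))"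
  have M: "M \<ge> 0" using f(2)[OF x] by linarith
  have "coeff_norm (ref_proj C k f) \<le> S * ((3 * (1 / C + k + 1) + 1) * M)"
    unfolding ref_proj_def cell_lift_def S_def
  proof (rule coeff_norm_cell_solve_le[OF C])
    fix j assume "j \<le> k"
    have "\<bar>cell_form C f f f (monom 1 j)\<bar> \<le> 3 * (1 / C + k + 1) * (M * coeff_norm (monom 1 j))"
      by (rule cell_form_bound) (use f C \<open>j \<le> k\<close> in \<open>auto simp: degree_monom_eq\<close>)
    moreover have "\<bar>ref_mean f * ref_mean (poly (monom 1 j))\<bar> \<le> M * 1"
      unfolding abs_mult by (intro mult_mono ref_mean_bound f abs_ref_mean_monom_le) (auto simp: M)
    ultimately show "\<bar>cell_form C f f f (monom 1 j) - 0 - ref_mean f * ref_mean (poly (monom 1 j))\<bar>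
        \<le> (3 * (1 / C + k + 1) + 1) * M"
      by (simp add: algebra_simps)
  qed
  then have "\<bar>poly (ref_proj C k f) x\<bar> \<le> S * ((3 * (1 / C + k + 1) + 1) * M)"
    using abs_poly_le_coeff_norm[of x "ref_proj C k f"] x by force
  then show ?thesis
    using f(2)[OF x] unfolding ref_err_def ref_const_def S_def[symmetric] by (simp add: algebra_simps)
qed

text \<open>The projection error is linear and kills degree at most k, so only the two leading
  monomials and the Taylor remainder survive.\<close>

lemma ref_err_expansion:
  assumes C: "C > 0" and U: "continuous_on ref_cell U" and R: "degree R \<le> k"
    and b: "\<And>x. x \<in> ref_cell \<Longrightarrow>
        \<bar>U x - poly (R + smult A (taylor_monom (k + 1)) + smult B (taylor_monom (k + 2))) x\<bar> \<le> M"
    and x: "x \<in> ref_cell"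
  shows "\<bar>ref_err C k U x - A * ref_err C k (poly (taylor_monom (k + 1))) x
          - B * ref_err C k (poly (taylor_monom (k + 2))) x\<bar> \<le> ref_const C k * M"
proof -
  define p q where "p = poly (taylor_monom (k + 1))" and "q = poly (taylor_monom (k + 2))"
  have c: "continuous_on ref_cell (poly R)" "continuous_on ref_cell p" "continuous_on ref_cell q"
    unfolding p_def q_def by (intro continuous_intros)+
  define D1 where "D1 y = A * p y + B * q y" for y
  define D2 where "D2 y = 1 * poly R y + 1 * D1 y" for y
  define D3 where "D3 y = 1 * U y + (-1) * D2 y" for y
  have c1: "continuous_on ref_cell D1" "continuous_on ref_cell D2"
    unfolding D2_def D1_def by (intro continuous_intros c)+
  have "\<bar>ref_err C k D3 x\<bar> \<le> ref_const C k * M"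
    by (rule ref_err_bound[OF C _ _ x])
      (use b c U c1 in \<open>auto simp: D3_def D2_def D1_def p_def q_def algebra_simps intro!: continuous_intros\<close>)
  moreover have "ref_err C k D3 x = ref_err C k U x - ref_err C k D2 x"
    unfolding D3_def[abs_def] by (subst ref_err_lin[OF U c1(2)]) simp
  moreover have "ref_err C k D2 x = ref_err C k D1 x"
    unfolding D2_def[abs_def] by (subst ref_err_lin[OF c(1) c1(1)]) (simp add: ref_err_poly_eq_0 C R)
  moreover have "ref_err C k D1 x = A * ref_err C k p x + B * ref_err C k q x"
    unfolding D1_def[abs_def] by (rule ref_err_lin[OF c(2,3)])
  ultimately show ?thesis
    unfolding p_def q_def by (simp add: algebra_simps)
qed

lemma cell_form_const_test:
  assumes "continuous_on ref_cell f"
  shows "cell_form C f f f (\<phi> - [:c:]) = cell_form C f f f \<phi>"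
proof -
  note lin = linear_poly_simps[OF linear_poly_cell_form[OF assms assms assms, of C]]
  have "cell_form C f f f [:c:] = 0"
    using lin(2)[of c 1] by (simp add: cell_form_one assms)
  then show ?thesis by (simp add: lin)
qed

lemma form_diff:
  assumes "continuous_on ref_cell f" "continuous_on ref_cell g"
  shows "left_form C (\<lambda>x. f x - g x) \<phi> = left_form C f \<phi> - left_form C g \<phi>"
    "right_form C (\<lambda>x. f x - g x) \<phi> = right_form C f \<phi> - right_form C g \<phi>"
    "ref_inner (\<lambda>x. f x - g x) \<phi> = ref_inner f \<phi> - ref_inner g \<phi>"
    "ref_mean (\<lambda>x. f x - g x) = ref_mean f - ref_mean g"
  using left_form_lin[OF assms, of C 1 "-1"] right_form_lin[OF assms, of C 1 "-1"]
    ref_inner_lin[OF assms, of 1 "-1"] ref_mean_lin[OF assms, of 1 "-1"] by simp_all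

lemma form_add:
  assumes "continuous_on ref_cell f" "continuous_on ref_cell g"
  shows "left_form C (\<lambda>x. f x + g x) \<phi> = left_form C f \<phi> + left_form C g \<phi>"
    "right_form C (\<lambda>x. f x + g x) \<phi> = right_form C f \<phi> + right_form C g \<phi>"
    "ref_inner (\<lambda>x. f x + g x) \<phi> = ref_inner f \<phi> + ref_inner g \<phi>"
    "ref_mean (\<lambda>x. f x + g x) = ref_mean f + ref_mean g"
  using left_form_lin[OF assms, of C 1 "1"] right_form_lin[OF assms, of C 1 "1"]
    ref_inner_lin[OF assms, of 1 "1"] ref_mean_lin[OF assms, of 1 "1"] by simp_all

lemma form_cmult:
  assumes "continuous_on ref_cell f"
  shows "left_form C (\<lambda>x. c * f x) \<phi> = c * left_form C f \<phi>"
    "right_form C (\<lambda>x. c * f x) \<phi> = c * right_form C f \<phi>"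
    "ref_inner (\<lambda>x. c * f x) \<phi> = c * ref_inner f \<phi>"
    "ref_mean (\<lambda>x. c * f x) = c * ref_mean f"
  using left_form_lin[OF assms assms, of C c 0] right_form_lin[OF assms assms, of C c 0]
    ref_inner_lin[OF assms assms, of c 0] ref_mean_lin[OF assms assms, of c 0] by simp_all

text \<open>With c = 1/C + k + 1 the Taylor remainder costs 3c in the form and 1 in the mean; the
  inner product and the two neighbours cost 2 + 2c + 2c, because their mean-free tests have
  coefficient norm at most 2.\<close>

definition defect_const :: "real \<Rightarrow> nat \<Rightarrow> real" where
  "defect_const C k = (\<Sum>j\<le>k. coeff_norm (cell_dual C k j)) * (7 * (1 / C + k + 1) + 3)"

text \<open>The projection contributes the Taylor polynomial up to its remainder, and a multiple of
  \<open>ea\<close> is invisible to the form. The correction reproduces B \<open>eb\<close>: the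
  projection error changes by about -B/2 \<open>ea\<close> to the left neighbour and B/2
  \<open>ea\<close> to the right one, so the data of the correction are B times those of
  \<open>eb\<close>.\<close>

lemma initial_defect:
  assumes C: "C > 0"
    and eb: "\<And>\<phi>. degree \<phi> \<le> k \<Longrightarrow> cell_form C (poly eb) (poly eb) (poly eb) \<phi> =
      - ref_inner (poly ea) \<phi> + left_form C (poly ea) \<phi> / 2 - right_form C (poly ea) \<phi> / 2"
    and ea: "\<And>\<phi>. degree \<phi> \<le> k \<Longrightarrow> cell_form C (poly ea) (poly ea) (poly ea) \<phi> = 0"
    and mean: "ref_mean (poly ea) = 0" "ref_mean (poly eb) = 0"
    and cont: "continuous_on ref_cell U" "continuous_on ref_cell gl"
      "continuous_on ref_cell g" "continuous_on ref_cell gr" "continuous_on ref_cell v"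
    and dQ: "degree (tp - smult A ea - smult B eb) \<le> k"
    and bU: "\<And>x. x \<in> ref_cell \<Longrightarrow> \<bar>U x - poly tp x\<bar> \<le> M"
    and bv: "\<And>x. x \<in> ref_cell \<Longrightarrow> \<bar>v x - B * poly ea x\<bar> \<le> M"
    and bl: "\<And>x. x \<in> ref_cell \<Longrightarrow> \<bar>gl x - g x + B / 2 * poly ea x\<bar> \<le> M"
    and br: "\<And>x. x \<in> ref_cell \<Longrightarrow> \<bar>gr x - g x - B / 2 * poly ea x\<bar> \<le> M"
  shows "coeff_norm (ref_proj C k U - ref_corr C k gl g gr v - (tp - smult A ea - smult B eb))
    \<le> defect_const C k * M"
proof -
  define S where "S = (\<Sum>j\<le>k. coeff_norm (cell_dual C k j))"
  define c where "c = 1 / C + k + 1"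
  have c0: "c \<ge> 1" unfolding c_def using C by simp
    define \<beta> where "\<beta> p \<phi> = cell_form C (poly p) (poly p) (poly p) \<phi> - ref_mean (poly p) * ref_mean (poly \<phi>)"
      for p \<phi>
    have M: "M \<ge> 0" using bU[of 0] by auto
    define Q where "Q = tp - smult A ea - smult B eb"
    define r where "r = ref_corr C k gl g gr v"
    define e where "e = ref_proj C k U - r - Q"
    note corr = ref_corr[OF C cont(2-5), where k = k, folded r_def]
    note bil = bilinear_polyD[OF bilinear_cell_form[of C], folded \<beta>_def]
    note lm = linear_poly_simps[OF linear_poly_ref_mean]
    have "degree e \<le> k" unfolding e_def
      by (intro degree_diff_le corr ref_proj C cont) (use dQ in \<open>simp add: Q_def\<close>)
    \<comment> \<open>A polynomial solves the cell problem with its own data, so bounding \<beta> e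
      at the monomials bounds e.\<close>
    then have "e = cell_solve C k (\<beta> e)"
      by (intro cell_solve_unique[OF C bil(2)]) (auto simp: \<beta>_def)
    moreover have "coeff_norm (cell_solve C k (\<beta> e)) \<le> S * ((7 * c + 3) * M)"
      unfolding S_def
    proof (rule coeff_norm_cell_solve_le[OF C])
      fix j assume j: "j \<le> k"
      define \<phi> :: "real poly" where "\<phi> = monom 1 j"
      define m where "m = ref_mean (poly \<phi>)"
      \<comment> \<open>The correction equation holds for mean-free tests, so its terms and those of
        \<open>eb\<close> are evaluated at \<psi>.\<close>
      define \<psi> where "\<psi> = \<phi> - [:m:]"
      have d: "degree \<phi> \<le> k" using j by (simp add: \<phi>_def degree_monom_eq)
      then have d': "degree \<psi> \<le> k" unfolding \<psi>_def by (intro degree_diff_le) auto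
      have m: "\<bar>m\<bar> \<le> 1" unfolding m_def \<phi>_def by (rule abs_ref_mean_monom_le)
      have "coeff_norm \<psi> \<le> (\<Sum>i\<le>k. \<bar>coeff \<phi> i\<bar> + \<bar>coeff [:m:] i\<bar>)"
        unfolding coeff_norm_eq[OF d'] by (intro sum_mono) (simp add: \<psi>_def)
      also have "\<dots> = coeff_norm \<phi> + coeff_norm [:m:]"
        using coeff_norm_eq[OF d] coeff_norm_eq[of "[:m:]" k] by (simp add: sum.distrib)
      also have "\<dots> \<le> 2" using m by (simp add: \<phi>_def coeff_norm_def)
      finally have n\<psi>: "coeff_norm \<psi> \<le> 2" .
      have n\<phi>: "coeff_norm \<phi> = 1" by (simp add: \<phi>_def)
      have cp: "continuous_on ref_cell (poly p)" for p :: "real poly" by (intro continuous_intros)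
      define b where "b = B / 2"
      have B: "B = 2 * b" by (simp add: b_def)
      define fU where "fU x = U x - poly tp x" for x
      define fl where "fl x = gl x - g x + b * poly ea x" for x
      define fr where "fr x = gr x - g x - b * poly ea x" for x
      define fv where "fv x = v x - B * poly ea x" for x
      have cf: "continuous_on ref_cell fU" "continuous_on ref_cell fl" "continuous_on ref_cell fr"
        "continuous_on ref_cell fv"
        unfolding fU_def fl_def fr_def fv_def by (intro continuous_intros cont)+
      have 1: "\<beta> e \<phi> = \<beta> (ref_proj C k U) \<phi> - \<beta> r \<phi> - (\<beta> tp \<phi> - A * \<beta> ea \<phi> - B * \<beta> eb \<phi>)"
        unfolding e_def Q_def by (simp add: linear_poly_simps[OF bil(1)])
      have 2: "\<beta> ea \<phi> = 0" unfolding \<beta>_def by (simp add: ea[OF d] mean)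
      have 3: "\<beta> eb \<phi> = - ref_inner (poly ea) \<psi> + left_form C (poly ea) \<psi> / 2 - right_form C (poly ea) \<psi> / 2"
        unfolding \<beta>_def using eb[OF d'] cell_form_const_test[OF cp, of C eb \<phi> m]
        by (simp add: mean \<psi>_def)
      have "cell_form C (poly r) (poly r) (poly r) \<psi> =
          - ref_inner v \<psi> - cell_form C gl g gr \<psi> + cell_form C g g g \<psi>"
        by (rule corr(3)[OF d']) (use ref_mean_shift in \<open>auto simp: \<psi>_def m_def\<close>)
      then have 4: "\<beta> r \<phi> = - ref_inner v \<psi> - cell_form C gl g gr \<psi> + cell_form C g g g \<psi>"
        unfolding \<beta>_def using cell_form_const_test[OF cp, of C r \<phi> m]
        by (simp add: corr(2) \<psi>_def)
      have 5: "\<beta> (ref_proj C k U) \<phi> - \<beta> tp \<phi> = cell_form C fU fU fU \<phi> - ref_mean fU * ref_mean (poly \<phi>)"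
        unfolding \<beta>_def ref_proj(2)[OF C cont(1)] ref_proj(3)[OF C cont(1) d]
        unfolding fU_def cell_form_def
        by (simp add: form_diff cont cp left_diff_distrib diff_divide_distrib)
      have "\<beta> e \<phi> = (cell_form C fU fU fU \<phi> - ref_mean fU * ref_mean (poly \<phi>))
          + ref_inner fv \<psi> + left_form C fl \<psi> + right_form C fr \<psi>"
        unfolding 1 2 3 4 5[symmetric]
        unfolding fl_def fr_def fv_def cell_form_def B
        by (simp add: form_diff form_add form_cmult cont cp continuous_intros algebra_simps)
      moreover have "\<bar>cell_form C fU fU fU \<phi>\<bar> \<le> 3 * (1 / C + k + 1) * (M * coeff_norm \<phi>)"
        by (rule cell_form_bound) (use bU C d cf in \<open>auto simp: fU_def\<close>)
      moreover have "\<bar>ref_mean fU * ref_mean (poly \<phi>)\<bar> \<le> M * 1"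
        unfolding abs_mult m_def[symmetric]
        by (intro mult_mono ref_mean_bound cf) (use bU m M in \<open>auto simp: fU_def\<close>)
      moreover have "\<bar>ref_inner fv \<psi>\<bar> \<le> M * coeff_norm \<psi>"
        by (rule ref_inner_bound) (use bv cf in \<open>auto simp: fv_def\<close>)
      moreover have "\<bar>left_form C fl \<psi>\<bar> \<le> (1 / C + k + 1) * (M * coeff_norm \<psi>)"
        by (rule left_form_bound) (use bl C d' cf in \<open>auto simp: fl_def b_def\<close>)
      moreover have "\<bar>right_form C fr \<psi>\<bar> \<le> (1 / C + k + 1) * (M * coeff_norm \<psi>)"
        by (rule right_form_bound) (use br C d' cf in \<open>auto simp: fr_def b_def\<close>)
      moreover have "M * coeff_norm \<psi> \<le> M * 2" using n\<psi> M by (rule mult_left_mono)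
      moreover have "c * (M * coeff_norm \<psi>) \<le> c * (M * 2)"
        using c0 n\<psi> M by (intro mult_left_mono) auto
      ultimately have "\<bar>\<beta> e \<phi>\<bar> \<le> 3 * c * M + M + M * 2 + c * (M * 2) + c * (M * 2)"
        unfolding c_def[symmetric] n\<phi> by (simp only: abs_le_iff mult_1_right) linarith
      then show "\<bar>\<beta> e (monom 1 j)\<bar> \<le> (7 * c + 3) * M"
        unfolding \<phi>_def by (simp add: algebra_simps)
    qed
    ultimately show "coeff_norm (ref_proj C k U - ref_corr C k gl g gr v - (tp - smult A ea - smult B eb))
        \<le> defect_const C k * M"
      unfolding e_def r_def Q_def defect_const_def S_def[symmetric] c_def[symmetric] by (simp add: mult.assoc)
qed

text \<open>A shift by half a cell changes the scaled coefficients A, B, D into A +- B/2 + D/8, B +-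
  D/2 and D, and a derivative raises the order by one. The three equations of the error polynomials
  then cancel everything but the deviations from these expansions; this is where the factors 1/2 and
  1/8 in \<open>error_polys\<close> come from. The equation of \<open>ed\<close> enters multiplied
  by D because it is imposed for k \<ge> 2 only, while D = 0 for k = 1.\<close>

lemma residual_identity:
  fixes c :: real
  assumes "la + ra - ja * c = 0" "lb + rb - jb * c = - ja + la / 2 - ra / 2"
    and "D * (ld + rd - jd * c) = D * (- jb + lb / 2 - rb / 2 - la / 8 - ra / 8)"
    and "uL + uR - u * c = - v"
  shows "(pl - Al * la - Bl * lb - Dl * ld) + (pr - Ar * ra - Br * rb - Dr * rd)
      - (p0 - A * ja - B * jb - D * jd) * c + (pd - A' * ja - B' * jb - D' * jd) =
    - ((uL - pl) + (uR - pr) - (u - p0) * c) - (v - pd)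
      - (Al - (A - B / 2 + D / 8)) * la - (Bl - (B - D / 2)) * lb - (Dl - D) * ld
      - (Ar - (A + B / 2 + D / 8)) * ra - (Br - (B + D / 2)) * rb - (Dr - D) * rd
      - (A' - B) * ja - (B' - D) * jb - D' * jd"
proof -
  have "A * (la + ra - ja * c) = 0" "B * (lb + rb - jb * c) = B * (- ja + la / 2 - ra / 2)"
    using assms(1,2) by simp_all
  then show ?thesis using assms(3,4) by (simp add: algebra_simps)
qed

lemma abs_sum_le:
  fixes F :: real
  assumes "\<bar>F\<bar> \<le> 3 * z" "\<bar>G\<bar> \<le> m" "m \<le> z" "\<bar>x1\<bar> \<le> y" "\<bar>x2\<bar> \<le> y" "\<bar>x3\<bar> \<le> y" "\<bar>x4\<bar> \<le> y"
    "\<bar>x5\<bar> \<le> y" "\<bar>x6\<bar> \<le> y" "\<bar>x7\<bar> \<le> y" "\<bar>x8\<bar> \<le> y" "\<bar>x9\<bar> \<le> y"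
  shows "\<bar>- F - G - x1 - x2 - x3 - x4 - x5 - x6 - x7 - x8 - x9\<bar> \<le> 4 * z + 9 * y"
  using assms(1,2,4-)[THEN abs_le_D1] assms(1,2,4-)[THEN abs_le_D2] assms(3)
  by (intro abs_leI) linarith+

text \<open>The first part bounds the Taylor remainders in the form and in the inner product, the
  second nine coefficient deviations: three polynomials seen from the left, from the right and in
  the derivative.\<close>

definition residual_const :: "real \<Rightarrow> nat \<Rightarrow> real \<Rightarrow> real" where
  "residual_const C k e = 4 * (1 / C + k + 1) + 9 * ((1 / C + k + 1) * e)"

lemma residual_const_nonneg: "C > 0 \<Longrightarrow> e \<ge> 0 \<Longrightarrow> residual_const C k e \<ge> 0"
  unfolding residual_const_def by (intro add_nonneg_nonneg mult_nonneg_nonneg) auto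

text \<open>The exact solution satisfies the cell equation exactly, so the residual consists of
  Taylor remainders and of deviations of the coefficients from their expansions.\<close>

lemma residual_bound:
  assumes C: "C > 0"
    and ep: "error_polys C k ea eb ed"
    and cont: "continuous_on ref_cell Ul" "continuous_on ref_cell U" "continuous_on ref_cell Ur"
       "continuous_on ref_cell V"
    and ex: "cell_form C Ul U Ur \<phi> = - ref_inner V \<phi>"
    and bU: "\<And>x. x \<in> ref_cell \<Longrightarrow> \<bar>Ul x - poly pl x\<bar> \<le> M"
       "\<And>x. x \<in> ref_cell \<Longrightarrow> \<bar>U x - poly p0 x\<bar> \<le> M"
       "\<And>x. x \<in> ref_cell \<Longrightarrow> \<bar>Ur x - poly pr x\<bar> \<le> M"
       "\<And>x. x \<in> ref_cell \<Longrightarrow> \<bar>V x - poly pd x\<bar> \<le> M"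
    and bA: "\<bar>Al - (A - B / 2 + D / 8)\<bar> \<le> M" "\<bar>Ar - (A + B / 2 + D / 8)\<bar> \<le> M" "\<bar>A' - B\<bar> \<le> M"
        "\<bar>Bl - (B - D / 2)\<bar> \<le> M" "\<bar>Br - (B + D / 2)\<bar> \<le> M" "\<bar>B' - D\<bar> \<le> M"
        "\<bar>Dl - D\<bar> \<le> M" "\<bar>Dr - D\<bar> \<le> M" "\<bar>D'\<bar> \<le> M"
    and D: "k < 2 \<Longrightarrow> D = 0" and d: "degree \<phi> \<le> k"
  shows "\<bar>cell_form C (poly (pl - smult Al ea - smult Bl eb - smult Dl ed))
           (poly (p0 - smult A ea - smult B eb - smult D ed))
           (poly (pr - smult Ar ea - smult Br eb - smult Dr ed)) \<phi>
         + ref_inner (poly (pd - smult A' ea - smult B' eb - smult D' ed)) \<phi>\<bar>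
    \<le> residual_const C k (coeff_norm ea + coeff_norm eb + coeff_norm ed) * (M * coeff_norm \<phi>)"
proof -
  note ea = error_polysD(8)[OF ep] and eb = error_polysD(9)[OF ep] and ed = error_polysD(10)[OF ep]
  define E where "E = coeff_norm ea + coeff_norm eb + coeff_norm ed"
  define c where "c = 1 / C + k + 1"
  have c: "c \<ge> 1" unfolding c_def using C by simp
  have E: "E \<ge> 0" unfolding E_def by (intro add_nonneg_nonneg coeff_norm_nonneg)
  have cp: "continuous_on ref_cell (poly p)" for p :: "real poly" by (intro continuous_intros)
  have le: "coeff_norm ea \<le> E" "coeff_norm eb \<le> E" "coeff_norm ed \<le> E"
    unfolding E_def using coeff_norm_nonneg[of ea] coeff_norm_nonneg[of eb] coeff_norm_nonneg[of ed] by auto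
  have pb: "\<bar>poly p x\<bar> \<le> E" if "p \<in> {ea, eb, ed}" "x \<in> ref_cell" for p x
    using abs_poly_le_coeff_norm[of x p] that le by fastforce
    define N where "N = coeff_norm \<phi>"
    have N: "N \<ge> 0" unfolding N_def by (rule coeff_norm_nonneg)
    have M: "M \<ge> 0" using bU(1)[of 0] by auto
    let ?l = "\<lambda>p. left_form C (poly p) \<phi>" and ?r = "\<lambda>p. right_form C (poly p) \<phi>"
      and ?i = "\<lambda>p. ref_inner (poly p) \<phi>"
    define F where "F = cell_form C (\<lambda>x. Ul x - poly pl x) (\<lambda>x. U x - poly p0 x) (\<lambda>x. Ur x - poly pr x) \<phi>"
    define G where "G = ref_inner (\<lambda>x. V x - poly pd x) \<phi>"
    have F: "\<bar>F\<bar> \<le> 3 * c * (M * N)"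
      unfolding F_def c_def N_def
      by (rule cell_form_bound) (use bU C d cont cp in \<open>auto intro!: continuous_intros\<close>)
    have G: "\<bar>G\<bar> \<le> M * N"
      unfolding G_def N_def
      by (rule ref_inner_bound) (use bU cont cp in \<open>auto intro!: continuous_intros\<close>)
    have lb: "\<bar>?l p\<bar> \<le> c * (E * N)" "\<bar>?r p\<bar> \<le> c * (E * N)" "\<bar>?i p\<bar> \<le> c * (E * N)"
      if "p \<in> {ea, eb, ed}" for p
    proof -
      show "\<bar>?l p\<bar> \<le> c * (E * N)" "\<bar>?r p\<bar> \<le> c * (E * N)"
        unfolding c_def N_def using pb that C d
        by (auto intro!: left_form_bound right_form_bound cp)
      have "\<bar>?i p\<bar> \<le> E * N" unfolding N_def by (rule ref_inner_bound[OF cp pb[OF that]])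
      also have "\<dots> \<le> c * (E * N)" using mult_right_mono[of 1 c "E * N"] c E N by simp
      finally show "\<bar>?i p\<bar> \<le> c * (E * N)" .
    qed
    have tb: "\<bar>x * y\<bar> \<le> c * E * (M * N)" if "\<bar>x\<bar> \<le> M" "\<bar>y\<bar> \<le> c * (E * N)" for x y
    proof -
      have "\<bar>x * y\<bar> \<le> M * (c * (E * N))" unfolding abs_mult using that M by (intro mult_mono) auto
      then show ?thesis by (simp add: algebra_simps)
    qed
    have D3: "D * (?l ed + ?r ed - ?i ed * inverse C) =
        D * (- ?i eb + ?l eb / 2 - ?r eb / 2 - ?l ea / 8 - ?r ea / 8)"
    proof (cases "k \<ge> 2")
      case True
      then show ?thesis using ed[OF True d] unfolding cell_form_def divide_inverse[of _ C] by simp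
    next
      case False
      then show ?thesis using D by simp
    qed
    have "cell_form C (poly (pl - smult Al ea - smult Bl eb - smult Dl ed))
           (poly (p0 - smult A ea - smult B eb - smult D ed))
           (poly (pr - smult Ar ea - smult Br eb - smult Dr ed)) \<phi>
         + ref_inner (poly (pd - smult A' ea - smult B' eb - smult D' ed)) \<phi> =
      (?l pl - Al * ?l ea - Bl * ?l eb - Dl * ?l ed) + (?r pr - Ar * ?r ea - Br * ?r eb - Dr * ?r ed)
      - (?i p0 - A * ?i ea - B * ?i eb - D * ?i ed) * inverse C
      + (?i pd - A' * ?i ea - B' * ?i eb - D' * ?i ed)"
    proof -
      have "poly (p - smult x ea - smult y eb - smult z ed) =
        (\<lambda>u. poly p u - x * poly ea u - y * poly eb u - z * poly ed u)" for p x y z by auto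
      then show ?thesis unfolding cell_form_def divide_inverse[of _ C]
        by (simp add: form_diff form_cmult cp continuous_intros)
    qed
    also have "\<dots> = - ((left_form C Ul \<phi> - ?l pl) + (right_form C Ur \<phi> - ?r pr) - (ref_inner U \<phi> - ?i p0) * inverse C)
      - (ref_inner V \<phi> - ?i pd)
      - (Al - (A - B / 2 + D / 8)) * ?l ea - (Bl - (B - D / 2)) * ?l eb - (Dl - D) * ?l ed
      - (Ar - (A + B / 2 + D / 8)) * ?r ea - (Br - (B + D / 2)) * ?r eb - (Dr - D) * ?r ed
      - (A' - B) * ?i ea - (B' - D) * ?i eb - D' * ?i ed"
      by (rule residual_identity)
        (use ea[OF d] eb[OF d] D3 ex in \<open>simp_all add: cell_form_def divide_inverse[of _ C]\<close>)
    also have "(left_form C Ul \<phi> - ?l pl) + (right_form C Ur \<phi> - ?r pr) - (ref_inner U \<phi> - ?i p0) * inverse C = F"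
      unfolding F_def cell_form_def divide_inverse[of _ C] by (simp add: form_diff cont cp)
    also have "ref_inner V \<phi> - ?i pd = G"
      unfolding G_def by (simp add: form_diff cont cp)
    finally have eq: "cell_form C (poly (pl - smult Al ea - smult Bl eb - smult Dl ed))
           (poly (p0 - smult A ea - smult B eb - smult D ed))
           (poly (pr - smult Ar ea - smult Br eb - smult Dr ed)) \<phi>
         + ref_inner (poly (pd - smult A' ea - smult B' eb - smult D' ed)) \<phi> =
      - F - G - (Al - (A - B / 2 + D / 8)) * ?l ea - (Bl - (B - D / 2)) * ?l eb - (Dl - D) * ?l ed
      - (Ar - (A + B / 2 + D / 8)) * ?r ea - (Br - (B + D / 2)) * ?r eb - (Dr - D) * ?r ed
      - (A' - B) * ?i ea - (B' - D) * ?i eb - D' * ?i ed" .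
    have MN: "0 \<le> M * N" using M N by simp
    then have "M * N \<le> c * (M * N)" using c by (simp add: mult_le_cancel_right1)
    then have "\<bar>- F - G - (Al - (A - B / 2 + D / 8)) * ?l ea - (Bl - (B - D / 2)) * ?l eb - (Dl - D) * ?l ed
      - (Ar - (A + B / 2 + D / 8)) * ?r ea - (Br - (B + D / 2)) * ?r eb - (Dr - D) * ?r ed
      - (A' - B) * ?i ea - (B' - D) * ?i eb - D' * ?i ed\<bar> \<le> 4 * (c * (M * N)) + 9 * (c * E * (M * N))"
      by (intro abs_sum_le[OF F[unfolded mult.assoc] G]
          tb[OF bA(1) lb(1)] tb[OF bA(4) lb(1)] tb[OF bA(7) lb(1)] tb[OF bA(2) lb(2)] tb[OF bA(5) lb(2)]
          tb[OF bA(8) lb(2)] tb[OF bA(3) lb(3)] tb[OF bA(6) lb(3)] tb[OF bA(9) lb(3)]) simp_all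
    then show "\<bar>cell_form C (poly (pl - smult Al ea - smult Bl eb - smult Dl ed))
           (poly (p0 - smult A ea - smult B eb - smult D ed))
           (poly (pr - smult Ar ea - smult Br eb - smult Dr ed)) \<phi>
         + ref_inner (poly (pd - smult A' ea - smult B' eb - smult D' ed)) \<phi>\<bar>
        \<le> residual_const C k (coeff_norm ea + coeff_norm eb + coeff_norm ed) * (M * coeff_norm \<phi>)"
      unfolding eq N_def[symmetric] residual_const_def E_def[symmetric] c_def[symmetric]
      by (simp add: algebra_simps)
qed

text \<open>Consistency: when the neighbours carry the same function, the relaxation terms with 1/C
  cancel, and partial integration leaves minus the space derivative, which is the time derivative of
  a solution.\<close>

lemma cell_form_exact:
  assumes "\<And>y. y \<in> {0..1/2} \<Longrightarrow> fl y = f (y - 1/2)" "\<And>y. y \<in> {- (1/2)..0} \<Longrightarrow> fr y = f (y + 1/2)"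
    and "\<And>x. x \<in> ref_cell \<Longrightarrow> (f has_real_derivative f' x) (at x within ref_cell)"
    and "continuous_on ref_cell f'"
  shows "cell_form C fl f fr \<phi> = - ref_inner f' \<phi>"
proof -
  have cf: "continuous_on ref_cell f" using assms(3) by (rule DERIV_continuous_on)
  define w where "w x = f x * (poly \<phi> x / C + poly (pderiv \<phi>) x)" for x
  have "continuous_on ref_cell w" unfolding w_def divide_inverse[of _ C] by (intro continuous_intros cf)
  then have split: "integral {- (1/2)..0} w + integral {0..1/2} w = integral ref_cell w"
    by (intro Henstock_Kurzweil_Integration.integral_combine integrable_continuous_real) auto
  have "integral {0..1/2} (\<lambda>y. fl y * (poly \<phi> (y - 1/2) / C + poly (pderiv \<phi>) (y - 1/2))) =
      integral {0..1/2} (\<lambda>y. w (y - 1/2))"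
    by (intro integral_cong) (simp add: assms(1) w_def)
  also have "\<dots> = integral {- (1/2)..0} w"
    using integral_shift_real_ivl[of "- (1/2)" "- (1/2)" 0 w] by simp
  finally have l: "left_form C fl \<phi> = integral {- (1/2)..0} w + f (- (1/2)) * poly \<phi> (- (1/2))"
    unfolding left_form_def using assms(1)[of 0] by simp
  have "integral {- (1/2)..0} (\<lambda>y. fr y * (poly \<phi> (y + 1/2) / C + poly (pderiv \<phi>) (y + 1/2))) =
      integral {- (1/2)..0} (\<lambda>y. w (y + 1/2))"
    by (intro integral_cong) (simp add: assms(2) w_def)
  also have "\<dots> = integral {0..1/2} w"
    using integral_shift_real_ivl[of 0 "1/2" "1/2" w] by simp
  finally have r: "right_form C fr \<phi> = integral {0..1/2} w - f (1/2) * poly \<phi> (1/2)"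
    unfolding right_form_def using assms(2)[of 0] by simp
  have "((\<lambda>x. f x * poly (pderiv \<phi>) x + f' x * poly \<phi> x) has_integral
      f (1/2) * poly \<phi> (1/2) - f (- (1/2)) * poly \<phi> (- (1/2))) ref_cell"
    by (rule fundamental_theorem_of_calculus)
      (auto intro!: derivative_eq_intros assms(3) simp flip: has_real_derivative_iff_has_vector_derivative)
  then have ftc: "integral ref_cell (\<lambda>x. f x * poly (pderiv \<phi>) x + f' x * poly \<phi> x) =
      f (1/2) * poly \<phi> (1/2) - f (- (1/2)) * poly \<phi> (- (1/2))"
    by (rule integral_unique)
  have "integral ref_cell w + ref_inner f' \<phi> = integral ref_cell (\<lambda>x. w x + f' x * poly \<phi> x)"
    unfolding ref_inner_def
    by (intro integral_add[symmetric] integrable_continuous_real continuous_intros assms(4)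
        \<open>continuous_on ref_cell w\<close>)
  also have "\<dots> = integral ref_cell (\<lambda>x. f x * poly \<phi> x * inverse C + (f x * poly (pderiv \<phi>) x + f' x * poly \<phi> x))"
    unfolding w_def by (intro integral_cong) (simp add: algebra_simps divide_inverse[of _ C])
  also have "\<dots> = integral ref_cell (\<lambda>x. f x * poly \<phi> x * inverse C) +
      integral ref_cell (\<lambda>x. f x * poly (pderiv \<phi>) x + f' x * poly \<phi> x)"
    by (intro integral_add integrable_continuous_real continuous_intros cf assms(4))
  finally show ?thesis
    unfolding cell_form_def l r ftc using split by (simp add: ref_inner_def divide_inverse[of _ C])
qed

text \<open>Norm equivalence with an explicit constant: in the basis dual to the monomials the
  coordinates of p are its inner products with monomials, which Cauchy-Schwarz bounds.\<close>

lemma coeff_norm_le_ref_inner: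
  obtains K where "K > 0" "\<And>p. degree p \<le> k \<Longrightarrow> coeff_norm p \<le> K * sqrt (ref_inner (poly p) p)"
proof -
  have bil: "bilinear_poly (\<lambda>p q. ref_inner (poly p) q)"
  proof -
    have *: "poly (smult s p + smult t q) = (\<lambda>x. s * poly p x + t * poly q x)" for s t and p q :: "real poly"
      by auto
    have "ref_inner (poly (smult s p + smult t q)) r = s * ref_inner (poly p) r + t * ref_inner (poly q) r"
      for s t p q r
      unfolding * by (intro ref_inner_lin continuous_intros)
    moreover have "linear_poly (ref_inner (poly r))" for r
      by (intro linear_poly_ref_inner continuous_intros)
    ultimately show ?thesis unfolding bilinear_poly_def linear_poly_def by blast
  qed
  obtain q where q: "\<And>i. i \<le> k \<Longrightarrow> degree (q i) \<le> k"
    "\<And>l p. linear_poly l \<Longrightarrow> degree p \<le> k \<Longrightarrow>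
      ref_inner (poly (\<Sum>j\<le>k. smult (l (monom 1 j)) (q j))) p = l p"
    using dual_basis_degree[OF bil ref_inner_definite, where k = k] by blast
  show ?thesis
  \<comment> \<open>The summand 1 only makes the constant positive.\<close>
  proof (rule that[of "1 + (\<Sum>j\<le>k. coeff_norm (q j))"])
    show "0 < 1 + (\<Sum>j\<le>k. coeff_norm (q j))"
      by (intro add_pos_nonneg sum_nonneg coeff_norm_nonneg) simp
    fix p :: "real poly" assume p: "degree p \<le> k"
    define s where "s = sqrt (ref_inner (poly p) p)"
    have s: "s \<ge> 0" unfolding s_def using ref_inner_nonneg by simp
    define l where "l = ref_inner (poly p)"
    have l: "linear_poly l" unfolding l_def using bilinear_polyD(2)[OF bil] .
    define r where "r = (\<Sum>j\<le>k. smult (l (monom 1 j)) (q j))"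
    have dr: "degree r \<le> k" unfolding r_def
      by (rule degree_sum_le) (auto intro: order_trans[OF degree_smult_le] q)
    have "ref_inner (poly (r - p)) (r - p) = ref_inner (poly r) (r - p) - ref_inner (poly p) (r - p)"
      by (rule linear_poly_simps(4)[OF bilinear_polyD(1)[OF bil]])
    also have "\<dots> = 0"
      using q(2)[OF l degree_diff_le[OF dr p], folded r_def] by (simp add: l_def)
    finally have "r = p" using ref_inner_definite[of "r - p"] by simp
    have lj: "\<bar>l (monom 1 j)\<bar> \<le> s" if "j \<le> k" for j
    proof -
      have ii: "(\<lambda>x. (poly p x)\<^sup>2) integrable_on ref_cell" "(\<lambda>x. (poly (monom 1 j) x :: real)\<^sup>2) integrable_on ref_cell"
        "(\<lambda>x. poly p x * poly (monom 1 j) x) integrable_on ref_cell"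
        by (intro integrable_continuous_real continuous_intros)+
      define a b where "a = ref_inner (poly p) p" and "b = l (monom 1 j)"
      \<comment> \<open>Cauchy-Schwarz by a parabola in t; the monomial has norm at most 1, and t =
        b gives the claim.\<close>
      have quad: "a - 2 * t * b + t\<^sup>2 \<ge> 0" for t
      proof -
        have n: "ref_inner (poly (monom 1 j)) (monom 1 j) \<le> 1"
        proof -
          have "\<bar>ref_inner (poly (monom 1 j)) (monom 1 j)\<bar> \<le> 1 * coeff_norm (monom 1 j)"
            by (rule ref_inner_bound[OF continuous_on_poly' abs_poly_monom_le])
          then show ?thesis by simp
        qed
        have sym: "ref_inner (poly (monom 1 j)) p = b"
          unfolding b_def l_def ref_inner_def by (simp add: mult.commute)
        note L1 = linear_poly_simps[OF bilinear_polyD(1)[OF bil]]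
          and L2 = linear_poly_simps[OF bilinear_polyD(2)[OF bil]]
        have "0 \<le> ref_inner (poly (p - smult t (monom 1 j))) (p - smult t (monom 1 j))"
          by (rule ref_inner_nonneg)
        also have "\<dots> = a - t * b - t * (b - t * ref_inner (poly (monom 1 j)) (monom 1 j))"
          unfolding a_def by (simp only: L1 L2) (simp add: sym b_def l_def algebra_simps)
        also have "\<dots> = a - 2 * t * b + t\<^sup>2 * ref_inner (poly (monom 1 j)) (monom 1 j)"
          by (simp add: power2_eq_square algebra_simps)
        also have "\<dots> \<le> a - 2 * t * b + t\<^sup>2"
          using n by (simp add: mult_left_le)
        finally show ?thesis .
      qed
      have "b\<^sup>2 \<le> a" using quad[of b] by (simp add: power2_eq_square)
      then have "\<bar>b\<bar> \<le> sqrt a" by (metis real_sqrt_abs real_sqrt_le_mono)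
      then show ?thesis unfolding a_def b_def s_def .
    qed
    have "coeff_norm p \<le> (\<Sum>j\<le>k. \<bar>l (monom 1 j)\<bar> * coeff_norm (q j))"
      using coeff_norm_smult_sum_le[of k q "\<lambda>j. l (monom 1 j)"] q(1) \<open>r = p\<close> unfolding r_def by simp
    also have "\<dots> \<le> (\<Sum>j\<le>k. s * coeff_norm (q j))"
      by (intro sum_mono mult_right_mono lj coeff_norm_nonneg) auto
    also have "\<dots> \<le> (1 + (\<Sum>j\<le>k. coeff_norm (q j))) * s"
      using s by (simp add: sum_distrib_left algebra_simps)
    finally show "coeff_norm p \<le> (1 + (\<Sum>j\<le>k. coeff_norm (q j))) * sqrt (ref_inner (poly p) p)"
      unfolding s_def .
  qed
qed

section \<open>Stability\<close>

lemma sum_periodic_shift: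
  fixes f :: "int \<Rightarrow> real"
  assumes "\<And>n. f (n + int P) = f n" "P > 0"
  shows "(\<Sum>n\<in>{0..<int P}. f (n + 1)) = (\<Sum>n\<in>{0..<int P}. f n)"
proof -
  have "(\<Sum>n\<in>{0..<int P}. f (n + 1)) = (\<Sum>n\<in>{1..<int P + 1}. f n)"
    by (rule sum.reindex_bij_witness[of _ "\<lambda>n. n - 1" "\<lambda>n. n + 1"]) auto
  also have "{1..<int P + 1} = insert (int P) {1..<int P}" using assms(2) by auto
  also have "(\<Sum>n\<in>\<dots>. f n) = f (int P) + (\<Sum>n\<in>{1..<int P}. f n)" by simp
  also have "f (int P) = f 0" using assms(1)[of 0] by simp
  also have "f 0 + (\<Sum>n\<in>{1..<int P}. f n) = (\<Sum>n\<in>insert 0 {1..<int P}. f n)" by simp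
  also have "insert 0 {1..<int P} = {0..<int P}" using assms(2) by auto
  finally show ?thesis .
qed

text \<open>Regrouping the periodic sum by overlaps instead of cells brings the cross terms and mass
  terms of the neighbours n and n + 1 together, and each group is a negative multiple of a
  square.\<close>

lemma scheme_dissipative:
  assumes "C > 0" "\<And>n. e (n + int P) = e n" "P > 0"
  shows "(\<Sum>n\<in>{0..<int P}. cell_form C (poly (e (n - 1))) (poly (e n)) (poly (e (n + 1))) (e n)) \<le> 0"
proof -
  define l r x y where "l n = left_form C (poly (e n)) (e (n + 1))"
    and "r n = right_form C (poly (e (n + 1))) (e n)"
    and "x n = integral {0..1/2} (\<lambda>z. poly (e n) z * poly (e n) z) / C"
    and "y n = integral {- (1/2)..0} (\<lambda>z. poly (e n) z * poly (e n) z) / C" for n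
  have per: "e (n + int P + m) = e (n + m)" for n m
    using assms(2)[of "n + m"] by (simp add: algebra_simps)
  have "cell_form C (poly (e (n - 1))) (poly (e n)) (poly (e (n + 1))) (e n) = l (n - 1) + r n - x n - y n" for n
    unfolding cell_form_def ref_inner_split l_def r_def x_def y_def by (simp add: add_divide_distrib)
  then have "(\<Sum>n\<in>{0..<int P}. cell_form C (poly (e (n - 1))) (poly (e n)) (poly (e (n + 1))) (e n)) =
      (\<Sum>n\<in>{0..<int P}. l (n - 1)) + (\<Sum>n\<in>{0..<int P}. r n) - (\<Sum>n\<in>{0..<int P}. x n) - (\<Sum>n\<in>{0..<int P}. y n)"
    by (simp add: sum.distrib sum_subtractf)
  also have "(\<Sum>n\<in>{0..<int P}. l (n - 1)) = (\<Sum>n\<in>{0..<int P}. l n)"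
    using sum_periodic_shift[of "\<lambda>n. l (n - 1)" P] assms(2,3) per[of _ "-1"]
    by (simp add: l_def)
  also have "(\<Sum>n\<in>{0..<int P}. y n) = (\<Sum>n\<in>{0..<int P}. y (n + 1))"
    using sum_periodic_shift[of y P] assms(2,3) by (simp add: y_def)
  also have "(\<Sum>n\<in>{0..<int P}. l n) + (\<Sum>n\<in>{0..<int P}. r n) - (\<Sum>n\<in>{0..<int P}. x n)
      - (\<Sum>n\<in>{0..<int P}. y (n + 1)) = (\<Sum>n\<in>{0..<int P}. l n + r n - x n - y (n + 1))"
    by (simp add: sum.distrib sum_subtractf)
  also have "\<dots> \<le> 0"
  proof (rule sum_nonpos)
    fix n
    have "integral {0..1/2} (\<lambda>z. (poly (e n) z - poly (e (n + 1)) (z - 1/2))\<^sup>2) \<ge> 0"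
      by (rule integral_nonneg) (auto intro!: integrable_continuous_real continuous_intros)
    then show "l n + r n - x n - y (n + 1) \<le> 0"
      unfolding l_def r_def x_def y_def poly_form_dissipation using assms(1) by simp
  qed
  finally show ?thesis .
qed

text \<open>The square root is not differentiable at 0, so \<eta>^2 is added before the mean value
  theorem is applied. The bound is linear in T.\<close>

lemma sqrt_gronwall:
  assumes "T > 0" "c \<ge> 0" "\<And>t. t \<in> {0..T} \<Longrightarrow> Y t \<ge> 0"
    and der: "\<And>t. t \<in> {0..T} \<Longrightarrow> (Y has_real_derivative Y' t) (at t within {0..T})"
    and le: "\<And>t. t \<in> {0..T} \<Longrightarrow> Y' t \<le> 2 * c * sqrt (Y t)"
  shows "sqrt (Y T) \<le> sqrt (Y 0) + c * T"
proof (rule field_le_epsilon)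
  fix \<eta> :: real assume \<eta>: "\<eta> > 0"
  define Z where "Z t = sqrt (Y t + \<eta>\<^sup>2)" for t
  have pos: "Y t + \<eta>\<^sup>2 > 0" if "t \<in> {0..T}" for t
    using assms(3)[OF that] \<eta> by (simp add: add_nonneg_pos)
  have dZ: "(Z has_real_derivative Y' t / (2 * Z t)) (at t within {0..T})" if "t \<in> {0..T}" for t
    unfolding Z_def using pos[OF that]
    by (auto intro!: derivative_eq_intros der that simp: field_simps)
  then have "\<exists>t\<in>{0<..<T}. Z T - Z 0 = (\<lambda>x. Y' t / (2 * Z t) * x) (T - 0)"
    by (intro mvt_simple[OF assms(1)]) (rule dZ[unfolded has_field_derivative_def], auto)
  then obtain t where t: "t \<in> {0<..<T}" and eq: "Z T - Z 0 = Y' t / (2 * Z t) * T" by auto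
  then have t': "t \<in> {0..T}" by auto
  have Z: "Z t > 0" unfolding Z_def using pos[OF t'] by simp
  have "Y' t \<le> 2 * c * Z t"
    by (rule order_trans[OF le[OF t']]) (use assms(2) in \<open>auto intro!: mult_left_mono simp: Z_def\<close>)
  then have "Y' t / (2 * Z t) \<le> c" using Z by (simp add: field_simps)
  then have "Z T - Z 0 \<le> c * T" unfolding eq by (rule mult_right_mono) (use assms(1) in simp)
  moreover have "sqrt (Y T) \<le> Z T" unfolding Z_def by simp
  moreover have "Z 0 \<le> sqrt (Y 0) + \<eta>"
    using sqrt_add_le_add_sqrt[of "Y 0" "\<eta>\<^sup>2"] assms(1,3) \<eta> unfolding Z_def by simp
  ultimately show "sqrt (Y T) \<le> sqrt (Y 0) + c * T + \<eta>" by simp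
qed

text \<open>The error is tested with itself; dissipativity leaves the residual, and Cauchy-Schwarz
  over the cells produces a right-hand side linear in the root of the energy. Coefficients in a
  fixed basis reduce time derivatives to those of real functions and make the energy a quadratic
  form. The division by h stems from the factor h in front of the time derivative.\<close>

lemma scheme_stability:
  fixes c c' :: "real \<Rightarrow> int \<Rightarrow> nat \<Rightarrow> real" and l :: "nat \<Rightarrow> real poly" and k P :: nat
  defines "e \<equiv> \<lambda>t n. \<Sum>i\<le>k. smult (c t n i) (l i)"
    and "e' \<equiv> \<lambda>t n. \<Sum>i\<le>k. smult (c' t n i) (l i)"
  assumes C: "C > 0" and h: "h > 0" and P: "P > 0" and T: "T > 0" and Kn: "Kn > 0"
    and norm: "\<And>p. degree p \<le> k \<Longrightarrow> coeff_norm p \<le> Kn * sqrt (ref_inner (poly p) p)"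
    and l: "\<And>i. i \<le> k \<Longrightarrow> degree (l i) \<le> k"
    and der: "\<And>t n i. t \<in> {0..T} \<Longrightarrow> i \<le> k \<Longrightarrow>
      ((\<lambda>s. c s n i) has_real_derivative c' t n i) (at t within {0..T})"
    and per: "\<And>t n. t \<in> {0..T} \<Longrightarrow> e t (n + int P) = e t n"
    and res: "\<And>t n \<phi>. t \<in> {0..T} \<Longrightarrow> degree \<phi> \<le> k \<Longrightarrow>
      \<bar>h * ref_inner (poly (e' t n)) \<phi>
        - cell_form C (poly (e t (n - 1))) (poly (e t n)) (poly (e t (n + 1))) \<phi>\<bar> \<le> \<delta> t n * coeff_norm \<phi>"
    and \<delta>: "\<And>t n. t \<in> {0..T} \<Longrightarrow> \<delta> t n \<ge> 0"
    and \<Delta>: "\<And>t. t \<in> {0..T} \<Longrightarrow> sqrt (\<Sum>n\<in>{0..<int P}. (\<delta> t n)\<^sup>2) \<le> \<Delta>"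
  shows "sqrt (\<Sum>n\<in>{0..<int P}. ref_inner (poly (e T n)) (e T n)) \<le>
    sqrt (\<Sum>n\<in>{0..<int P}. ref_inner (poly (e 0 n)) (e 0 n)) + Kn * \<Delta> / h * T"
proof -
  define Y where "Y t = (\<Sum>n\<in>{0..<int P}. ref_inner (poly (e t n)) (e t n))" for t
  define Y' where "Y' t = (\<Sum>n\<in>{0..<int P}. 2 * ref_inner (poly (e' t n)) (e t n))" for t
  have bil: "ref_inner (poly (\<Sum>i\<le>k. smult (a i) (l i))) (\<Sum>i\<le>k. smult (b i) (l i)) =
    (\<Sum>i\<le>k. \<Sum>j\<le>k. a i * b j * ref_inner (poly (l i)) (l j))" for a b
  proof -
    have lin2: "linear_poly (ref_inner (poly r))" for r
      by (intro linear_poly_ref_inner continuous_intros)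
    have sym: "ref_inner (poly p) q = ref_inner (poly q) p" for p q
      unfolding ref_inner_def by (simp add: mult.commute)
    have lin1: "linear_poly (\<lambda>p. ref_inner (poly p) r)" for r
      using lin2[of r] unfolding sym[of r] .
    show ?thesis
      by (simp add: linear_poly_sum[OF lin1] linear_poly_sum[OF lin2] linear_poly_simps[OF lin1]
          linear_poly_simps[OF lin2] sum_distrib_left)
        (subst sum.swap, intro sum.cong refl, simp add: mult_ac)
  qed
  have sym: "ref_inner (poly (l i)) (l j) = ref_inner (poly (l j)) (l i)" for i j
    unfolding ref_inner_def by (simp add: mult.commute)
  have dY: "(Y has_real_derivative Y' t) (at t within {0..T})" if t: "t \<in> {0..T}" for t
    unfolding Y_def Y'_def
  proof (rule DERIV_sum)
    fix n
    have "((\<lambda>s. \<Sum>i\<le>k. \<Sum>j\<le>k. c s n i * c s n j * ref_inner (poly (l i)) (l j)) has_real_derivative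
        (\<Sum>i\<le>k. \<Sum>j\<le>k. (c' t n i * c t n j + c t n i * c' t n j) * ref_inner (poly (l i)) (l j)))
        (at t within {0..T})"
      by (intro DERIV_sum) (auto intro!: derivative_eq_intros der t)
    also have "(\<Sum>i\<le>k. \<Sum>j\<le>k. (c' t n i * c t n j + c t n i * c' t n j) * ref_inner (poly (l i)) (l j)) =
      (\<Sum>i\<le>k. \<Sum>j\<le>k. c' t n i * c t n j * ref_inner (poly (l i)) (l j))
      + (\<Sum>i\<le>k. \<Sum>j\<le>k. c t n i * c' t n j * ref_inner (poly (l i)) (l j))"
      by (simp add: distrib_right sum.distrib)
    also have "(\<Sum>i\<le>k. \<Sum>j\<le>k. c t n i * c' t n j * ref_inner (poly (l i)) (l j)) =
      (\<Sum>i\<le>k. \<Sum>j\<le>k. c' t n i * c t n j * ref_inner (poly (l i)) (l j))"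
      by (subst sum.swap) (intro sum.cong refl, subst sym, simp)
    finally show "((\<lambda>t. ref_inner (poly (e t n)) (e t n)) has_real_derivative
        2 * ref_inner (poly (e' t n)) (e t n)) (at t within {0..T})"
      unfolding e_def e'_def bil by simp
  qed
  have de: "degree (e t n) \<le> k" for t n
    unfolding e_def by (rule degree_sum_le) (auto intro: order_trans[OF degree_smult_le] l)
  have Yle: "Y' t \<le> 2 * (Kn * \<Delta> / h) * sqrt (Y t)" if t: "t \<in> {0..T}" for t
  proof -
    define q where "q n = sqrt (ref_inner (poly (e t n)) (e t n))" for n
    have q: "(q n)\<^sup>2 = ref_inner (poly (e t n)) (e t n)" for n
      unfolding q_def using ref_inner_nonneg by simp
    have "h * Y' t = 2 * (\<Sum>n\<in>{0..<int P}. h * ref_inner (poly (e' t n)) (e t n))"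
      unfolding Y'_def by (simp add: sum_distrib_left mult.left_commute)
    also have "(\<Sum>n\<in>{0..<int P}. h * ref_inner (poly (e' t n)) (e t n)) \<le>
       (\<Sum>n\<in>{0..<int P}. cell_form C (poly (e t (n - 1))) (poly (e t n)) (poly (e t (n + 1))) (e t n)
          + \<delta> t n * (Kn * q n))"
    proof (rule sum_mono)
      fix n
      have "\<delta> t n * coeff_norm (e t n) \<le> \<delta> t n * (Kn * q n)"
        unfolding q_def by (intro mult_left_mono norm de \<delta> t)
      then show "h * ref_inner (poly (e' t n)) (e t n) \<le>
        cell_form C (poly (e t (n - 1))) (poly (e t n)) (poly (e t (n + 1))) (e t n) + \<delta> t n * (Kn * q n)"
        using res[OF t de[of t n], of n] by linarith
    qed
    also have "\<dots> \<le> 0 + (\<Sum>n\<in>{0..<int P}. \<delta> t n * (Kn * q n))"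
      unfolding sum.distrib
      using scheme_dissipative[of C "e t" P, OF C per[OF t] P] by (rule add_right_mono)
    also have "\<dots> = Kn * (\<Sum>n\<in>{0..<int P}. \<delta> t n * q n)"
      by (simp add: sum_distrib_left mult.left_commute)
    also have "(\<Sum>n\<in>{0..<int P}. \<delta> t n * q n) \<le>
        sqrt (\<Sum>n\<in>{0..<int P}. (\<delta> t n)\<^sup>2) * sqrt (\<Sum>n\<in>{0..<int P}. (q n)\<^sup>2)"
      using Cauchy_Schwarz_ineq_sum[of "\<delta> t" q "{0..<int P}"]
      by (simp add: real_le_rsqrt flip: real_sqrt_mult)
    also have "\<dots> \<le> \<Delta> * sqrt (Y t)"
      unfolding q Y_def by (intro mult_right_mono \<Delta> t real_sqrt_ge_zero sum_nonneg ref_inner_nonneg)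
    finally have "h * Y' t \<le> 2 * (Kn * (\<Delta> * sqrt (Y t)))" using Kn by simp
    then show ?thesis using h by (simp add: field_simps)
  qed
  have "0 \<in> {0..T}" using T by simp
  have "\<Delta> \<ge> 0" using order_trans[OF real_sqrt_ge_zero[OF sum_nonneg] \<Delta>[OF \<open>0 \<in> {0..T}\<close>]] by simp
  then have c0: "Kn * \<Delta> / h \<ge> 0" using Kn h by simp
  have "sqrt (Y T) \<le> sqrt (Y 0) + (Kn * \<Delta> / h) * T"
    by (rule sqrt_gronwall[OF T c0 _ dY Yle]) (auto simp: Y_def intro: sum_nonneg ref_inner_nonneg)
  then show ?thesis unfolding Y_def .
qed

section \<open>Piecewise polynomials on a uniform mesh\<close>

text \<open>The finite exceptional set absorbs the ends of an interval, where a right-continuous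
  piecewise function already takes the value of the next piece and its derivative is not
  controlled.\<close>

lemma has_integral_ref:
  fixes F G :: "real \<Rightarrow> real"
  assumes h: "h > 0" and G: "(G has_integral I) {u..v}" and S: "finite S"
    and eq: "\<And>\<xi>. \<xi> \<in> {u..v} - S \<Longrightarrow> F (z + h * \<xi>) = G \<xi>"
  shows "(F has_integral h * I) {z + h * u..z + h * v}"
proof -
  have "((\<lambda>\<xi>. F (h * \<xi> + z)) has_integral I) {u..v}"
    by (rule has_integral_spike_finite[OF S _ G]) (use eq in \<open>auto simp: add.commute\<close>)
  then have "((\<lambda>\<xi>. F (h *\<^sub>R \<xi> + z)) has_integral ((h * I) /\<^sub>R h ^ DIM(real)))
      (cbox ((z + h * u - z) /\<^sub>R h) ((z + h * v - z) /\<^sub>R h))"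
    using h by (simp add: field_simps)
  then have "(F has_integral h * I) (cbox (z + h * u) (z + h * v))"
    by (rule has_integral_affinity_iff[OF h, THEN iffD1])
  then show ?thesis by simp
qed

lemma integral_ref:
  fixes F G :: "real \<Rightarrow> real"
  assumes "h > 0" "continuous_on {u..v} G" "finite S"
    "\<And>\<xi>. \<xi> \<in> {u..v} - S \<Longrightarrow> F (z + h * \<xi>) = G \<xi>"
  shows "integral {z + h * u..z + h * v} F = h * integral {u..v} G"
  using has_integral_ref[OF assms(1) integrable_integral[OF integrable_continuous_real[OF assms(2)]] assms(3,4)]
  by (rule integral_unique)

text \<open>The neighbour's contribution in the coordinate of the cell, with the two integrals kept
  apart as in the form of the scheme.\<close>

lemma left_form_alt:
  assumes "continuous_on ref_cell f"
  shows "left_form C f \<phi> = integral {- (1/2)..0} (\<lambda>\<xi>. f (\<xi> + 1/2) * poly \<phi> \<xi>) / C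
    + integral {- (1/2)..0} (\<lambda>\<xi>. f (\<xi> + 1/2) * poly (pderiv \<phi>) \<xi>) + f 0 * poly \<phi> (- (1/2))"
proof -
  define w where "w y = f y * (poly \<phi> (y - 1/2) / C + poly (pderiv \<phi>) (y - 1/2))" for y
  have c: "continuous_on {- (1/2)..0} (\<lambda>\<xi>. f (\<xi> + 1/2))"
    by (rule continuous_on_compose2[OF assms]) (auto intro!: continuous_intros)
  have "integral {0..1/2} w = integral {- (1/2)..0} (\<lambda>\<xi>. w (\<xi> + 1/2))"
    using integral_shift_real_ivl[of 0 "1/2" "1/2" w] by simp
  also have "\<dots> = integral {- (1/2)..0} (\<lambda>\<xi>. f (\<xi> + 1/2) * poly \<phi> \<xi> * inverse C
      + f (\<xi> + 1/2) * poly (pderiv \<phi>) \<xi>)"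
    by (intro integral_cong) (simp add: w_def algebra_simps divide_inverse[of _ C])
  also have "\<dots> = integral {- (1/2)..0} (\<lambda>\<xi>. f (\<xi> + 1/2) * poly \<phi> \<xi> * inverse C)
      + integral {- (1/2)..0} (\<lambda>\<xi>. f (\<xi> + 1/2) * poly (pderiv \<phi>) \<xi>)"
    by (intro integral_add integrable_continuous_real continuous_intros c)
  finally show ?thesis unfolding left_form_def w_def by (simp add: divide_inverse[of _ C])
qed

lemma right_form_alt:
  assumes "continuous_on ref_cell f"
  shows "right_form C f \<phi> = integral {0..1/2} (\<lambda>\<xi>. f (\<xi> - 1/2) * poly \<phi> \<xi>) / C
    + integral {0..1/2} (\<lambda>\<xi>. f (\<xi> - 1/2) * poly (pderiv \<phi>) \<xi>) - f 0 * poly \<phi> (1/2)"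
proof -
  define w where "w y = f y * (poly \<phi> (y + 1/2) / C + poly (pderiv \<phi>) (y + 1/2))" for y
  have c: "continuous_on {0..1/2} (\<lambda>\<xi>. f (\<xi> - 1/2))"
    by (rule continuous_on_compose2[OF assms]) (auto intro!: continuous_intros)
  have "integral {- (1/2)..0} w = integral {0..1/2} (\<lambda>\<xi>. w (\<xi> - 1/2))"
    using integral_shift_real_ivl[of "- (1/2)" "- (1/2)" 0 w] by simp
  also have "\<dots> = integral {0..1/2} (\<lambda>\<xi>. f (\<xi> - 1/2) * poly \<phi> \<xi> * inverse C
      + f (\<xi> - 1/2) * poly (pderiv \<phi>) \<xi>)"
    by (intro integral_cong) (simp add: w_def algebra_simps divide_inverse[of _ C])
  also have "\<dots> = integral {0..1/2} (\<lambda>\<xi>. f (\<xi> - 1/2) * poly \<phi> \<xi> * inverse C)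
      + integral {0..1/2} (\<lambda>\<xi>. f (\<xi> - 1/2) * poly (pderiv \<phi>) \<xi>)"
    by (intro integral_add integrable_continuous_real continuous_intros c)
  finally show ?thesis unfolding right_form_def w_def by (simp add: divide_inverse[of _ C])
qed

section \<open>Passage from mesh cells to the reference cell\<close>

lemma cell_coordinate_bounds:
  fixes h :: real
  assumes "h > 0"
  shows "z - h / 2 < x \<Longrightarrow> - (1/2) < (x - z) / h" "x < z + h / 2 \<Longrightarrow> (x - z) / h < 1/2"
    "z - h / 2 \<le> x \<Longrightarrow> - (1/2) \<le> (x - z) / h"
  using assms by (simp_all add: pos_less_divide_eq pos_divide_less_eq pos_le_divide_eq)

text \<open>Only the open cell is prescribed, because boundary values of test functions enter the
  forms through one-sided limits.\<close>

definition local_poly :: "real \<Rightarrow> real \<Rightarrow> (real \<Rightarrow> real) \<Rightarrow> real poly \<Rightarrow> bool" where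
  "local_poly h z \<phi> \<psi> \<longleftrightarrow> (\<forall>\<xi>\<in>{- (1/2)<..<1/2}. \<phi> (z + h * \<xi>) = poly \<psi> \<xi>)"

lemma local_polyD:
  assumes "h > 0" "local_poly h z \<phi> \<psi>" "x \<in> {z - h / 2<..<z + h / 2}"
  shows "poly \<psi> ((x - z) / h) = \<phi> x"
proof -
  have "(x - z) / h \<in> {- (1/2)<..<1/2}" using assms(1,3) by (simp add: cell_coordinate_bounds)
  then have "\<phi> (z + h * ((x - z) / h)) = poly \<psi> ((x - z) / h)"
    using assms(2) unfolding local_poly_def by blast
  then show ?thesis using assms(1) by simp
qed

lemma local_poly_deriv:
  assumes "h > 0" "local_poly h z \<phi> \<psi>" "\<xi> \<in> {- (1/2)<..<1/2}"
  shows "deriv \<phi> (z + h * \<xi>) = poly (pderiv \<psi>) \<xi> / h"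
proof -
  define x0 where "x0 = z + h * \<xi>"
  have "h * \<xi> < h * (1/2)" "h * (- (1/2)) < h * \<xi>"
    by (rule mult_strict_left_mono[OF _ assms(1)], use assms(3) in simp)+
  then have x0: "x0 \<in> {z - h / 2<..<z + h / 2}" unfolding x0_def by simp
  have "((\<lambda>x. (x - z) / h) has_field_derivative 1 / h) (at x0)"
    by (intro DERIV_cdivide) (auto intro!: derivative_eq_intros)
  from DERIV_chain2[OF poly_DERIV this, of \<psi>]
  have 1: "((\<lambda>x. poly \<psi> ((x - z) / h)) has_field_derivative poly (pderiv \<psi>) ((x0 - z) / h) * (1 / h)) (at x0)" .
  have "(\<phi> has_field_derivative poly (pderiv \<psi>) ((x0 - z) / h) * (1 / h)) (at x0)"
    by (rule has_field_derivative_transform_within_open[OF 1 _ x0])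
      (simp_all add: local_polyD[OF assms(1,2)])
  from DERIV_imp_deriv[OF this] show ?thesis using assms(1) by (simp add: x0_def)
qed

lemma local_poly_limits:
  assumes h: "h > 0" and lp: "local_poly h z \<phi> \<psi>"
  shows "left_limit \<phi> (z + h / 2) = poly \<psi> (1/2)"
    and "right_limit \<phi> (z - h / 2) = poly \<psi> (- (1/2))"
proof -
  note eq = local_polyD[OF h lp]
  have "isCont (\<lambda>x. poly \<psi> ((x - z) * (1 / h))) x" for x by (intro continuous_intros)
  then have lim: "((\<lambda>x. poly \<psi> ((x - z) / h)) \<longlongrightarrow> poly \<psi> ((y - z) / h)) (at y within S)" for y S
    using continuous_at_imp_continuous_within[of y _ S] unfolding continuous_within by fastforce
  have "\<forall>\<^sub>F x in at_left (z + h / 2). x \<in> {z - h / 2<..<z + h / 2}"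
    by (rule eventually_at_left_real) (use h in simp)
  then have "\<forall>\<^sub>F x in at_left (z + h / 2). poly \<psi> ((x - z) / h) = \<phi> x"
    by (rule eventually_mono) (rule eq; simp)
  from Lim_transform_eventually[OF lim this]
  have "(\<phi> \<longlongrightarrow> poly \<psi> (1/2)) (at_left (z + h / 2))" using h by simp
  then show "left_limit \<phi> (z + h / 2) = poly \<psi> (1/2)" by (intro tendsto_Lim) simp
  have "\<forall>\<^sub>F x in at_right (z - h / 2). x \<in> {z - h / 2<..<z + h / 2}"
    by (rule eventually_at_right_real) (use h in simp)
  then have "\<forall>\<^sub>F x in at_right (z - h / 2). poly \<psi> ((x - z) / h) = \<phi> x"
    by (rule eventually_mono) (rule eq; simp)
  from Lim_transform_eventually[OF lim this]
  have "(\<phi> \<longlongrightarrow> poly \<psi> (- (1/2))) (at_right (z - h / 2))" using h by simp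
  then show "right_limit \<phi> (z - h / 2) = poly \<psi> (- (1/2))" by (intro tendsto_Lim) simp
qed

lemma left_pieces:
  assumes h: "h > 0" and lp: "local_poly h z \<phi> \<psi>"
    and c: "continuous_on ref_cell f" "continuous_on ref_cell fl"
    and w: "\<And>\<xi>. \<xi> \<in> {- (1/2)<..<1/2} \<Longrightarrow> w (z + h * \<xi>) = f \<xi>"
    and w': "\<And>\<xi>. \<xi> \<in> {- (1/2)<..<0} \<Longrightarrow> w' (z + h * \<xi>) = fl (\<xi> + 1/2)"
  shows "((\<lambda>x. (w' x - w x) * \<phi> x) has_integral
      h * (integral {- (1/2)..0} (\<lambda>\<xi>. fl (\<xi> + 1/2) * poly \<psi> \<xi>) - integral {- (1/2)..0} (\<lambda>\<xi>. f \<xi> * poly \<psi> \<xi>)))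
      {z - h / 2..z}"
    and "((\<lambda>x. w' x * deriv \<phi> x) has_integral
      integral {- (1/2)..0} (\<lambda>\<xi>. fl (\<xi> + 1/2) * poly (pderiv \<psi>) \<xi>)) {z - h / 2..z}"
proof -
  have cl: "continuous_on {- (1/2)..0} (\<lambda>\<xi>. fl (\<xi> + 1/2))"
    by (rule continuous_on_compose2[OF c(2)]) (auto intro!: continuous_intros)
  have cf: "continuous_on {- (1/2)..0} f" by (rule continuous_on_subset[OF c(1)]) auto
  have cancel: "h * (x * inverse h) = x" for x using h by simp
  have S: "finite {- (1/2), 0 :: real}" by simp
  have e: "{z + h * - (1/2)..z + h * 0} = {z - h / 2..z}" by simp
  have "((\<lambda>\<xi>. fl (\<xi> + 1/2) * poly \<psi> \<xi> - f \<xi> * poly \<psi> \<xi>) has_integral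
      integral {- (1/2)..0} (\<lambda>\<xi>. fl (\<xi> + 1/2) * poly \<psi> \<xi>) - integral {- (1/2)..0} (\<lambda>\<xi>. f \<xi> * poly \<psi> \<xi>))
      {- (1/2)..0}"
    by (intro has_integral_diff integrable_integral integrable_continuous_real continuous_intros cl cf)
  from has_integral_ref[OF h this S, of "\<lambda>x. (w' x - w x) * \<phi> x" z]
  show "((\<lambda>x. (w' x - w x) * \<phi> x) has_integral
      h * (integral {- (1/2)..0} (\<lambda>\<xi>. fl (\<xi> + 1/2) * poly \<psi> \<xi>) - integral {- (1/2)..0} (\<lambda>\<xi>. f \<xi> * poly \<psi> \<xi>)))
      {z - h / 2..z}"
    unfolding e using w w' lp by (auto simp: local_poly_def algebra_simps)
  have "((\<lambda>\<xi>. fl (\<xi> + 1/2) * poly (pderiv \<psi>) \<xi> * inverse h) has_integral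
      integral {- (1/2)..0} (\<lambda>\<xi>. fl (\<xi> + 1/2) * poly (pderiv \<psi>) \<xi>) * inverse h) {- (1/2)..0}"
    by (intro has_integral_mult_left integrable_integral integrable_continuous_real continuous_intros cl)
  from has_integral_ref[OF h this S, of "\<lambda>x. w' x * deriv \<phi> x" z]
  show "((\<lambda>x. w' x * deriv \<phi> x) has_integral
      integral {- (1/2)..0} (\<lambda>\<xi>. fl (\<xi> + 1/2) * poly (pderiv \<psi>) \<xi>)) {z - h / 2..z}"
    unfolding e cancel using w' local_poly_deriv[OF h lp] by (auto simp: divide_inverse[of _ h])
qed

lemma right_pieces:
  assumes h: "h > 0" and lp: "local_poly h z \<phi> \<psi>"
    and c: "continuous_on ref_cell f" "continuous_on ref_cell fr"
    and w: "\<And>\<xi>. \<xi> \<in> {- (1/2)<..<1/2} \<Longrightarrow> w (z + h * \<xi>) = f \<xi>"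
    and w': "\<And>\<xi>. \<xi> \<in> {0<..<1/2} \<Longrightarrow> w' (z + h * \<xi>) = fr (\<xi> - 1/2)"
  shows "((\<lambda>x. (w' x - w x) * \<phi> x) has_integral
      h * (integral {0..1/2} (\<lambda>\<xi>. fr (\<xi> - 1/2) * poly \<psi> \<xi>) - integral {0..1/2} (\<lambda>\<xi>. f \<xi> * poly \<psi> \<xi>)))
      {z..z + h / 2}"
    and "((\<lambda>x. w' x * deriv \<phi> x) has_integral
      integral {0..1/2} (\<lambda>\<xi>. fr (\<xi> - 1/2) * poly (pderiv \<psi>) \<xi>)) {z..z + h / 2}"
proof -
  have cl: "continuous_on {0..1/2} (\<lambda>\<xi>. fr (\<xi> - 1/2))"
    by (rule continuous_on_compose2[OF c(2)]) (auto intro!: continuous_intros)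
  have cf: "continuous_on {0..1/2} f" by (rule continuous_on_subset[OF c(1)]) auto
  have cancel: "h * (x * inverse h) = x" for x using h by simp
  have S: "finite {0, 1/2 :: real}" by simp
  have e: "{z + h * 0..z + h * (1/2)} = {z..z + h / 2}" by simp
  have "((\<lambda>\<xi>. fr (\<xi> - 1/2) * poly \<psi> \<xi> - f \<xi> * poly \<psi> \<xi>) has_integral
      integral {0..1/2} (\<lambda>\<xi>. fr (\<xi> - 1/2) * poly \<psi> \<xi>) - integral {0..1/2} (\<lambda>\<xi>. f \<xi> * poly \<psi> \<xi>))
      {0..1/2}"
    by (intro has_integral_diff integrable_integral integrable_continuous_real continuous_intros cl cf)
  from has_integral_ref[OF h this S, of "\<lambda>x. (w' x - w x) * \<phi> x" z]
  show "((\<lambda>x. (w' x - w x) * \<phi> x) has_integral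
      h * (integral {0..1/2} (\<lambda>\<xi>. fr (\<xi> - 1/2) * poly \<psi> \<xi>) - integral {0..1/2} (\<lambda>\<xi>. f \<xi> * poly \<psi> \<xi>)))
      {z..z + h / 2}"
    unfolding e using w w' lp by (auto simp: local_poly_def algebra_simps)
  have "((\<lambda>\<xi>. fr (\<xi> - 1/2) * poly (pderiv \<psi>) \<xi> * inverse h) has_integral
      integral {0..1/2} (\<lambda>\<xi>. fr (\<xi> - 1/2) * poly (pderiv \<psi>) \<xi>) * inverse h) {0..1/2}"
    by (intro has_integral_mult_left integrable_integral integrable_continuous_real continuous_intros cl)
  from has_integral_ref[OF h this S, of "\<lambda>x. w' x * deriv \<phi> x" z]
  show "((\<lambda>x. w' x * deriv \<phi> x) has_integral
      integral {0..1/2} (\<lambda>\<xi>. fr (\<xi> - 1/2) * poly (pderiv \<psi>) \<xi>)) {z..z + h / 2}"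
    unfolding e cancel using w' local_poly_deriv[OF h lp] by (auto simp: divide_inverse[of _ h])
qed

lemma ref_inner_split':
  assumes "continuous_on ref_cell f"
  shows "ref_inner f q = integral {- (1/2)..0} (\<lambda>x. f x * poly q x) + integral {0..1/2} (\<lambda>x. f x * poly q x)"
  unfolding ref_inner_def
  by (rule Henstock_Kurzweil_Integration.integral_combine[symmetric])
    (auto intro!: integrable_continuous_real continuous_intros assms)

text \<open>At the cell ends \<open>w'\<close> is evaluated at the centres of neighbouring cells,
  hence the closed ends in the assumptions on \<open>w'\<close>. All powers of h cancel by the
  scaling of \<tau>.\<close>

lemma cdg_form_eq_cell_form:
  assumes h: "h > 0" and C: "C > 0" and lp: "local_poly h z \<phi> \<psi>"
    and c: "continuous_on ref_cell fl" "continuous_on ref_cell f" "continuous_on ref_cell fr"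
    and w: "\<And>\<xi>. \<xi> \<in> {- (1/2)<..<1/2} \<Longrightarrow> w (z + h * \<xi>) = f \<xi>"
    and wl: "\<And>\<xi>. \<xi> \<in> {- (1/2)..<0} \<Longrightarrow> w' (z + h * \<xi>) = fl (\<xi> + 1/2)"
    and wr: "\<And>\<xi>. \<xi> \<in> {0<..1/2} \<Longrightarrow> w' (z + h * \<xi>) = fr (\<xi> - 1/2)"
  shows "cdg_form (C * h) h z w w' \<phi> = cell_form C fl f fr \<psi>"
proof -
  note L = left_pieces[OF h lp c(2,1) w wl, simplified] and R = right_pieces[OF h lp c(2,3) w wr, simplified]
  have le: "z - h / 2 \<le> z" "z \<le> z + h / 2" using h by auto
  have "w' (z + h / 2) = fr 0" "w' (z - h / 2) = fl 0"
    using wr[of "1/2"] wl[of "- (1/2)"] by simp_all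
  then show ?thesis
    unfolding cdg_form_def local_poly_limits[OF h lp] cell_form_def left_form_alt[OF c(1)]
      right_form_alt[OF c(3)] ref_inner_split'[OF c(2)]
      integral_unique[OF has_integral_combine[OF le L(1) R(1)]]
      integral_unique[OF has_integral_combine[OF le L(2) R(2)]]
    using h C by (simp add: field_simps)
qed

text \<open>The projection form is the scheme with both neighbours replaced by the cell's own
  function, carried over by half a cell.\<close>

lemma proj_form_eq_cell_form:
  assumes h: "h > 0" and C: "C > 0" and lp: "local_poly h z \<phi> \<psi>"
    and c: "continuous_on ref_cell f"
    and w: "\<And>\<xi>. \<xi> \<in> {- (1/2)<..<1/2} \<Longrightarrow> w (z + h * \<xi>) = f \<xi>"
  shows "proj_form (C * h) h z w \<phi> = cell_form C f f f \<psi>"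
proof -
  define w1 w2 where "w1 x = w (x + h / 2)" and "w2 x = w (x - h / 2)" for x
  have w1: "w1 (z + h * \<xi>) = f (\<xi> + 1/2)" if "\<xi> \<in> {- (1/2)<..<0}" for \<xi>
    using w[of "\<xi> + 1/2"] that by (simp add: w1_def algebra_simps)
  have w2: "w2 (z + h * \<xi>) = f (\<xi> - 1/2)" if "\<xi> \<in> {0<..<1/2}" for \<xi>
    using w[of "\<xi> - 1/2"] that by (simp add: w2_def algebra_simps)
  note L = left_pieces[OF h lp c c w w1, simplified] and R = right_pieces[OF h lp c c w w2, simplified]
  have "w z = f 0" using w[of 0] by simp
  then show ?thesis
    unfolding proj_form_def w1_def[symmetric] w2_def[symmetric] local_poly_limits[OF h lp]
      cell_form_def left_form_alt[OF c] right_form_alt[OF c] ref_inner_split'[OF c]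
      L(1)[THEN integral_unique] R(1)[THEN integral_unique] L(2)[THEN integral_unique] R(2)[THEN integral_unique]
    using h C by (simp add: field_simps)
qed

section \<open>Piecewise polynomials as families of local polynomials\<close>

locale uniform_mesh =
  fixes h :: real and c :: "int \<Rightarrow> real"
  assumes h_pos: "h > 0" and centre: "c i = c 0 + of_int i * h"
begin

text \<open>The floor selects the half-open cell, matching the right-continuous representatives of
  the discrete spaces.\<close>

definition cell_no :: "real \<Rightarrow> int" where
  "cell_no x = \<lfloor>(x - c 0) / h + 1/2\<rfloor>"

definition pw_poly :: "(int \<Rightarrow> real poly) \<Rightarrow> real \<Rightarrow> real" where
  "pw_poly p x = poly (p (cell_no x)) ((x - c (cell_no x)) / h)"

lemma cell_no_eq:
  assumes "\<xi> \<in> {- (1/2)..<1/2}"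
  shows "cell_no (c i + h * \<xi>) = i"
proof -
  have "(c i + h * \<xi> - c 0) / h + 1/2 = of_int i + (\<xi> + 1/2)"
    using centre[of i] h_pos by (simp add: field_simps)
  then show ?thesis unfolding cell_no_def using assms by (intro floor_unique) auto
qed

lemma cell_coordinate:
  obtains \<xi> where "\<xi> \<in> {- (1/2)..<1/2}" "x = c (cell_no x) + h * \<xi>"
proof
  have *: "of_int (cell_no x) \<le> (x - c 0) / h + 1/2" "(x - c 0) / h + 1/2 < of_int (cell_no x) + 1"
    unfolding cell_no_def by linarith+
  have "(x - c (cell_no x)) / h = (x - c 0) / h - of_int (cell_no x)"
    using centre[of "cell_no x"] h_pos by (simp add: field_simps)
  then show "(x - c (cell_no x)) / h \<in> {- (1/2)..<1/2}"
    using * unfolding atLeastLessThan_iff by linarith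
  show "x = c (cell_no x) + h * ((x - c (cell_no x)) / h)" using h_pos by simp
qed

lemma pw_poly_eq:
  assumes "\<xi> \<in> {- (1/2)..<1/2}"
  shows "pw_poly p (c i + h * \<xi>) = poly (p i) \<xi>"
  unfolding pw_poly_def cell_no_eq[OF assms] using h_pos by simp

lemma local_poly_pw_poly: "local_poly h (c i) (pw_poly p) (p i)"
  unfolding local_poly_def by (auto intro!: pw_poly_eq)

lemma pw_poly_eqI:
  assumes "\<And>i \<xi>. \<xi> \<in> {- (1/2)..<1/2} \<Longrightarrow> w (c i + h * \<xi>) = poly (p i) \<xi>"
  shows "w = pw_poly p"
proof
  fix x
  obtain \<xi> where \<xi>: "\<xi> \<in> {- (1/2)..<1/2}" "x = c (cell_no x) + h * \<xi>" by (rule cell_coordinate)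
  show "w x = pw_poly p x" using assms[OF \<xi>(1), of "cell_no x"] pw_poly_eq[OF \<xi>(1), of p "cell_no x"] \<xi>(2)
    by simp
qed

lemma centre_shift: "c (i + j) = c i + of_int j * h"
  using centre[of i] centre[of "i + j"] by (simp add: algebra_simps)

lemma pw_poly_inj:
  assumes "pw_poly p = pw_poly q"
  shows "p = q"
proof
  fix i
  have "poly (p i - q i) \<xi> = 0" if "\<xi> \<in> {- (1/2)..<1/2}" for \<xi>
    using pw_poly_eq[OF that, of p i] pw_poly_eq[OF that, of q i] assms by simp
  then have "{- (1/2)..<1/2} \<subseteq> {\<xi>. poly (p i - q i) \<xi> = 0}" by auto
  moreover have "infinite {- (1/2)..<1/2 :: real}" by (simp add: infinite_Ico_iff)
  ultimately have "p i - q i = 0" using finite_subset poly_roots_finite by blast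
  then show "p i = q i" by simp
qed

text \<open>Local coordinates move each piece to the reference cell. Periodicity of the function
  becomes periodicity of the family because a polynomial is determined by its values on one
  cell.\<close>

lemma DG_space_iff:
  "w \<in> DG_space k (real N * h) h c \<longleftrightarrow>
     (\<exists>p. w = pw_poly p \<and> (\<forall>i. degree (p i) \<le> k \<and> p (i + int N) = p i))"
proof
  assume "w \<in> DG_space k (real N * h) h c"
  then have per: "\<And>x. w (x + real N * h) = w x"
    and ex: "\<forall>i. \<exists>p. degree p \<le> k \<and> (\<forall>x\<in>{c i - h / 2..<c i + h / 2}. w x = poly p x)"
    unfolding DG_space_def periodic_fun_simple_def by auto
  from choice[OF ex] obtain p where p: "\<And>i. degree (p i) \<le> k"
    "\<And>i x. x \<in> {c i - h / 2..<c i + h / 2} \<Longrightarrow> w x = poly (p i) x"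
    by blast
  define q where "q i = pcompose (p i) [:c i, h:]" for i
  have wq: "w = pw_poly q"
  proof (rule pw_poly_eqI)
    fix i \<xi> assume \<xi>: "\<xi> \<in> {- (1/2)..<1/2 :: real}"
    have "c i + h * \<xi> \<in> {c i - h / 2..<c i + h / 2}"
      using \<xi> h_pos mult_strict_left_mono[of \<xi> "1/2" h] mult_left_mono[of "- (1/2)" \<xi> h] by simp
    then show "w (c i + h * \<xi>) = poly (q i) \<xi>" using p(2) by (simp add: q_def poly_pcompose mult.commute)
  qed
  have dq: "degree (q i) \<le> k" for i using p(1)[of i] by (simp add: q_def degree_pcompose)
  have "w = pw_poly (\<lambda>i. q (i + int N))"
  proof (rule pw_poly_eqI)
    fix i \<xi> assume \<xi>: "\<xi> \<in> {- (1/2)..<1/2 :: real}"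
    have "w (c i + h * \<xi>) = w (c (i + int N) + h * \<xi>)"
      using per[of "c i + h * \<xi>"] centre_shift[of i "int N"] by (simp add: algebra_simps)
    then show "w (c i + h * \<xi>) = poly (q (i + int N)) \<xi>" unfolding wq pw_poly_eq[OF \<xi>] by simp
  qed
  then have "q = (\<lambda>i. q (i + int N))" using wq by (intro pw_poly_inj) (rule trans[OF sym])
  from fun_cong[OF this] have "q (i + int N) = q i" for i by (rule sym)
  then show "\<exists>p. w = pw_poly p \<and> (\<forall>i. degree (p i) \<le> k \<and> p (i + int N) = p i)" using wq dq by blast
next
  assume "\<exists>p. w = pw_poly p \<and> (\<forall>i. degree (p i) \<le> k \<and> p (i + int N) = p i)"
  then obtain p where w: "w = pw_poly p" and p: "\<And>i. degree (p i) \<le> k" "\<And>i. p (i + int N) = p i" by blast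
  have "w (x + real N * h) = w x" for x
  proof -
    obtain \<xi> where \<xi>: "\<xi> \<in> {- (1/2)..<1/2}" "x = c (cell_no x) + h * \<xi>" by (rule cell_coordinate)
    have "x + real N * h = c (cell_no x + int N) + h * \<xi>"
      using \<xi>(2) centre_shift[of "cell_no x" "int N"] by simp
    then show ?thesis
      unfolding w using pw_poly_eq[OF \<xi>(1), of p "cell_no x + int N"] pw_poly_eq[OF \<xi>(1), of p "cell_no x"] \<xi>(2) p(2)
      by simp
  qed
  moreover have "\<exists>q. degree q \<le> k \<and> (\<forall>x\<in>{c i - h / 2..<c i + h / 2}. w x = poly q x)" for i
  proof (intro exI[of _ "pcompose (p i) [:- c i / h, 1 / h:]"] conjI ballI)
    show "degree (pcompose (p i) [:- c i / h, 1 / h:]) \<le> k"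
      using p(1)[of i] h_pos by (simp add: degree_pcompose)
    fix x assume x: "x \<in> {c i - h / 2..<c i + h / 2}"
    define \<xi> where "\<xi> = (x - c i) / h"
    have "\<xi> \<in> {- (1/2)..<1/2}" "x = c i + h * \<xi>"
      using x h_pos by (simp_all add: \<xi>_def cell_coordinate_bounds)
    then have "w x = poly (p i) \<xi>" unfolding w by (simp only: pw_poly_eq)
    also have "\<xi> = poly [:- c i / h, 1 / h:] x" by (simp add: \<xi>_def diff_divide_distrib)
    finally show "w x = poly (pcompose (p i) [:- c i / h, 1 / h:]) x" by (simp add: poly_pcompose)
  qed
  ultimately show "w \<in> DG_space k (real N * h) h c"
    unfolding DG_space_def periodic_fun_simple_def by auto
qed

lemma integral_cell_pw_poly:
  "integral (cell h (c i)) (\<lambda>x. pw_poly p x * pw_poly q x) = h * ref_inner (poly (p i)) (q i)"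
  using integral_ref[OF h_pos, of "- (1/2)" "1/2" "\<lambda>\<xi>. poly (p i) \<xi> * poly (q i) \<xi>" "{1/2}"
      "\<lambda>x. pw_poly p x * pw_poly q x" "c i"]
  unfolding ref_inner_def by (auto simp: pw_poly_eq continuous_intros)

lemma integral_cell_pw_poly_mean: "integral (cell h (c i)) (pw_poly p) = h * ref_mean (poly (p i))"
  using integral_ref[OF h_pos, of "- (1/2)" "1/2" "poly (p i)" "{1/2}" "pw_poly p" "c i"]
  unfolding ref_mean_def by (auto simp: pw_poly_eq continuous_intros)

lemma integral_cell_mean:
  assumes "continuous_on ref_cell (\<lambda>\<xi>. w (c i + h * \<xi>))"
  shows "integral (cell h (c i)) w = h * ref_mean (\<lambda>\<xi>. w (c i + h * \<xi>))"
  using integral_ref[OF h_pos assms, of "{}" w "c i"] unfolding ref_mean_def by auto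

lemma local_poly_const: "pw_poly (\<lambda>_. \<psi>) \<in> DG_space k (real N * h) h c" if "degree \<psi> \<le> k"
  unfolding DG_space_iff using that by auto

lemma DG_space0_iff:
  "w \<in> DG_space0 k (real N * h) h c \<longleftrightarrow>
     (\<exists>p. w = pw_poly p \<and> (\<forall>i. degree (p i) \<le> k \<and> p (i + int N) = p i \<and> ref_mean (poly (p i)) = 0))"
  unfolding DG_space0_def DG_space_iff using h_pos by (auto simp: integral_cell_pw_poly_mean)

text \<open>The definite description is legitimate because the conditions decouple into one uniquely
  solvable problem per cell; the solution inherits the periodicity of \<omega>.\<close>

lemma proj_eq:
  assumes C: "C > 0" and cont: "\<And>x. isCont \<omega> x" and per: "\<And>x. \<omega> (x + real N * h) = \<omega> x"
  shows "proj k (real N * h) (C * h) h c \<omega> = pw_poly (\<lambda>i. ref_proj C k (\<lambda>\<xi>. \<omega> (c i + h * \<xi>)))"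
  unfolding proj_def
proof (rule the_equality)
  define p where "p i = ref_proj C k (\<lambda>\<xi>. \<omega> (c i + h * \<xi>))" for i
  have cw: "continuous_on ref_cell (\<lambda>\<xi>. \<omega> (z + h * \<xi>))" for z
    by (intro continuous_at_imp_continuous_on ballI isCont_o2[OF _ cont] continuous_intros)
  have lp: "local_poly h z (poly q) (pcompose q [:z, h:])" for z q
    by (simp add: local_poly_def poly_pcompose mult.commute)
  have dq: "degree (pcompose q [:z, h:]) = degree q" for q :: "real poly" and z
    using h_pos by (simp add: degree_pcompose)
  have fw: "proj_form (C * h) h (c i) \<omega> (poly q) =
      cell_form C (\<lambda>\<xi>. \<omega> (c i + h * \<xi>)) (\<lambda>\<xi>. \<omega> (c i + h * \<xi>)) (\<lambda>\<xi>. \<omega> (c i + h * \<xi>)) (pcompose q [:c i, h:])"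
    for i q
    by (rule proj_form_eq_cell_form[OF h_pos C lp cw]) simp
  have fp: "proj_form (C * h) h (c i) (pw_poly r) (poly q) =
      cell_form C (poly (r i)) (poly (r i)) (poly (r i)) (pcompose q [:c i, h:])" for i q r
    by (rule proj_form_eq_cell_form[OF h_pos C lp]) (auto intro: continuous_intros pw_poly_eq)
  have "\<omega> (c (i + int N) + h * \<xi>) = \<omega> (c i + h * \<xi>)" for i \<xi>
    using per[of "c i + h * \<xi>"] centre_shift[of i "int N"] by (simp add: algebra_simps)
  then have pp: "p (i + int N) = p i" for i unfolding p_def by simp
  have pr: "degree (p i) \<le> k" "ref_mean (poly (p i)) = ref_mean (\<lambda>\<xi>. \<omega> (c i + h * \<xi>))"
    "degree \<phi> \<le> k \<Longrightarrow> cell_form C (poly (p i)) (poly (p i)) (poly (p i)) \<phi> =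
      cell_form C (\<lambda>\<xi>. \<omega> (c i + h * \<xi>)) (\<lambda>\<xi>. \<omega> (c i + h * \<xi>)) (\<lambda>\<xi>. \<omega> (c i + h * \<xi>)) \<phi>"
    for i \<phi> unfolding p_def by (intro ref_proj C cw; assumption)+
  show "pw_poly p \<in> DG_space k (real N * h) h c \<and>
    (\<forall>i. integral (cell h (c i)) (pw_poly p) = integral (cell h (c i)) \<omega> \<and>
      (\<forall>q. degree q \<le> k \<longrightarrow> proj_form (C * h) h (c i) (pw_poly p) (poly q) =
         proj_form (C * h) h (c i) \<omega> (poly q)))"
  proof (intro conjI allI impI)
    show "pw_poly p \<in> DG_space k (real N * h) h c" unfolding DG_space_iff using pp pr(1) by blast
    show "integral (cell h (c i)) (pw_poly p) = integral (cell h (c i)) \<omega>" for i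
      unfolding integral_cell_pw_poly_mean integral_cell_mean[OF cw] pr(2) ..
    show "proj_form (C * h) h (c i) (pw_poly p) (poly q) = proj_form (C * h) h (c i) \<omega> (poly q)"
      if "degree q \<le> k" for i q
      unfolding fw fp using that by (intro pr(3)) (simp add: dq)
  qed
  fix w assume w: "w \<in> DG_space k (real N * h) h c \<and>
    (\<forall>i. integral (cell h (c i)) w = integral (cell h (c i)) \<omega> \<and>
      (\<forall>q. degree q \<le> k \<longrightarrow> proj_form (C * h) h (c i) w (poly q) =
         proj_form (C * h) h (c i) \<omega> (poly q)))"
  then obtain r where r: "w = pw_poly r" "\<And>i. degree (r i) \<le> k" unfolding DG_space_iff by blast
  have "r i = p i" for i
    unfolding p_def
  proof (rule ref_proj_unique[OF C cw r(2)])
    show "ref_mean (poly (r i)) = ref_mean (\<lambda>\<xi>. \<omega> (c i + h * \<xi>))"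
      using w h_pos unfolding r(1) by (simp add: integral_cell_pw_poly_mean integral_cell_mean[OF cw])
    fix \<phi> :: "real poly" assume d: "degree \<phi> \<le> k"
    \<comment> \<open>The global polynomial whose local representation on this cell is
      \<phi>.\<close>
    define q where "q = pcompose \<phi> [:- c i / h, 1 / h:]"
    have "pcompose q [:c i, h:] = pcompose \<phi> (pcompose [:- c i / h, 1 / h:] [:c i, h:])"
      unfolding q_def by (simp only: pcompose_assoc)
    also have "pcompose [:- c i / h, 1 / h:] [:c i, h:] = [:0, 1:]"
      using h_pos by (simp add: pcompose_pCons)
    finally have "pcompose q [:c i, h:] = \<phi>" by (simp add: pcompose_idR)
    moreover have "degree q \<le> k" using d h_pos by (simp add: q_def degree_pcompose)
    ultimately show "cell_form C (poly (r i)) (poly (r i)) (poly (r i)) \<phi> =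
        cell_form C (\<lambda>\<xi>. \<omega> (c i + h * \<xi>)) (\<lambda>\<xi>. \<omega> (c i + h * \<xi>)) (\<lambda>\<xi>. \<omega> (c i + h * \<xi>)) \<phi>"
      using w fw[of i q] fp[of i r q] unfolding r(1) by simp
  qed
  then have "r = p" by (rule ext)
  then show "w = pw_poly p" unfolding r(1) by (rule arg_cong)
qed

end

context uniform_mesh
begin

lemma corr0_eq:
  assumes "C > 0" "\<And>x. isCont \<omega> x" "\<And>x. \<omega> (x + real N * h) = \<omega> x" "\<xi> \<in> {- (1/2)..<1/2}"
  shows "corr0 k (real N * h) (C * h) h c \<omega> (c i + h * \<xi>) = ref_err C k (\<lambda>\<xi>. \<omega> (c i + h * \<xi>)) \<xi>"
  unfolding corr0_def proj_eq[OF assms(1-3)] pw_poly_eq[OF assms(4)] ref_err_def ..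

text \<open>The offset s relates the numberings of the two meshes, 0 from primal to dual and 1 from
  dual to primal, so one proof covers both components. The factor h in front of the projection error
  of the derivative is the Jacobian of the cell coordinate, which cancels in the other
  terms.\<close>

lemma corr1_eq:
  fixes C :: real and k N :: nat and \<omega> :: "real \<Rightarrow> real" and s :: int and c' :: "int \<Rightarrow> real"
  assumes other: "uniform_mesh h c'" and off: "\<And>i. c' (i + s) = c i + h / 2"
    and C: "C > 0" and cont: "\<And>x. isCont \<omega> x" "\<And>x. isCont (deriv \<omega>) x"
    and per: "\<And>x. \<omega> (x + real N * h) = \<omega> x" "\<And>x. deriv \<omega> (x + real N * h) = deriv \<omega> x"
  defines "E \<equiv> \<lambda>z. ref_err C k (\<lambda>\<xi>. \<omega> (z + h * \<xi>))"
  shows "corr1 k (real N * h) (C * h) h c c' \<omega> = pw_poly (\<lambda>i. ref_corr C k (E (c i - h / 2)) (E (c i))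
    (E (c i + h / 2)) (\<lambda>\<xi>. h * ref_err C k (\<lambda>\<xi>. deriv \<omega> (c i + h * \<xi>)) \<xi>))"
  unfolding corr1_def
proof (rule the_equality)
  interpret o: uniform_mesh h c' by (rule other)
  define v where "v z = (\<lambda>\<xi>. h * ref_err C k (\<lambda>\<xi>. deriv \<omega> (z + h * \<xi>)) \<xi>)" for z
  define p where "p i = ref_corr C k (E (c i - h / 2)) (E (c i)) (E (c i + h / 2)) (v (c i))" for i
  define rhs where "rhs i \<phi> = - integral (cell h (c i)) (\<lambda>x. corr0 k (real N * h) (C * h) h c (deriv \<omega>) x * \<phi> x)
    - cdg_form (C * h) h (c i) (corr0 k (real N * h) (C * h) h c \<omega>) (corr0 k (real N * h) (C * h) h c' \<omega>) \<phi>
    + proj_form (C * h) h (c i) (corr0 k (real N * h) (C * h) h c \<omega>) \<phi>" for i \<phi>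
  have cw: "continuous_on ref_cell (\<lambda>\<xi>. f (z + h * \<xi>))" if "\<And>x. isCont f x" for f :: "real \<Rightarrow> real" and z
    by (intro continuous_at_imp_continuous_on ballI isCont_o2[OF _ that] continuous_intros)
  have cE: "continuous_on ref_cell (E z)" for z
    unfolding E_def by (intro continuous_on_ref_err cw cont)
  have cr: "continuous_on ref_cell (ref_err C k (\<lambda>\<xi>. deriv \<omega> (z + h * \<xi>)))" for z
    by (intro continuous_on_ref_err cw cont)
  have cv: "continuous_on ref_cell (v z)" for z
    unfolding v_def by (intro continuous_intros cr)
  have rhs: "rhs i (pw_poly q) = - ref_inner (v (c i)) (q i)
      - cell_form C (E (c i - h / 2)) (E (c i)) (E (c i + h / 2)) (q i)
      + cell_form C (E (c i)) (E (c i)) (E (c i)) (q i)" for i q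
  proof -
    have e0: "corr0 k (real N * h) (C * h) h c \<omega> (c i + h * \<xi>) = E (c i) \<xi>" if "\<xi> \<in> {- (1/2)<..<1/2}" for \<xi>
      unfolding E_def using that by (intro corr0_eq C cont per) auto
    have offm: "c' (i + s - 1) = c i - h / 2"
      using o.centre_shift[of "i + s" "-1"] off[of i] by simp
    have el: "corr0 k (real N * h) (C * h) h c' \<omega> (c i + h * \<xi>) = E (c i - h / 2) (\<xi> + 1/2)"
      if "\<xi> \<in> {- (1/2)..<0}" for \<xi>
    proof -
      have "corr0 k (real N * h) (C * h) h c' \<omega> (c' (i + s - 1) + h * (\<xi> + 1/2)) = E (c' (i + s - 1)) (\<xi> + 1/2)"
        unfolding E_def using that by (intro o.corr0_eq C cont per) auto
      then show ?thesis unfolding offm by (simp add: algebra_simps)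
    qed
    have er: "corr0 k (real N * h) (C * h) h c' \<omega> (c i + h * \<xi>) = E (c i + h / 2) (\<xi> - 1/2)"
      if "\<xi> \<in> {0<..1/2}" for \<xi>
    proof -
      have "corr0 k (real N * h) (C * h) h c' \<omega> (c' (i + s) + h * (\<xi> - 1/2)) = E (c' (i + s)) (\<xi> - 1/2)"
        unfolding E_def using that by (intro o.corr0_eq C cont per) auto
      then show ?thesis unfolding off by (simp add: algebra_simps)
    qed
    have "integral {c i + h * - (1/2)..c i + h * (1/2)}
        (\<lambda>x. corr0 k (real N * h) (C * h) h c (deriv \<omega>) x * pw_poly q x) =
      h * integral ref_cell (\<lambda>\<xi>. ref_err C k (\<lambda>\<xi>. deriv \<omega> (c i + h * \<xi>)) \<xi> * poly (q i) \<xi>)"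
    proof (rule integral_ref[OF h_pos, where S = "{1/2}"])
      fix \<xi> :: real assume "\<xi> \<in> ref_cell - {1/2}"
      then have \<xi>: "\<xi> \<in> {- (1/2)..<1/2}" by auto
      show "corr0 k (real N * h) (C * h) h c (deriv \<omega>) (c i + h * \<xi>) * pw_poly q (c i + h * \<xi>) =
        ref_err C k (\<lambda>\<xi>. deriv \<omega> (c i + h * \<xi>)) \<xi> * poly (q i) \<xi>"
        by (simp only: corr0_eq[OF C cont(2) per(2) \<xi>] pw_poly_eq[OF \<xi>])
    qed (auto intro!: continuous_intros cr)
    then have i1: "integral (cell h (c i)) (\<lambda>x. corr0 k (real N * h) (C * h) h c (deriv \<omega>) x * pw_poly q x) =
        ref_inner (v (c i)) (q i)"
      unfolding ref_inner_def v_def by (simp add: mult.assoc)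
    have i2: "cdg_form (C * h) h (c i) (corr0 k (real N * h) (C * h) h c \<omega>)
        (corr0 k (real N * h) (C * h) h c' \<omega>) (pw_poly q) =
        cell_form C (E (c i - h / 2)) (E (c i)) (E (c i + h / 2)) (q i)"
      by (rule cdg_form_eq_cell_form[OF h_pos C local_poly_pw_poly cE cE cE e0 el er])
    have i3: "proj_form (C * h) h (c i) (corr0 k (real N * h) (C * h) h c \<omega>) (pw_poly q) =
        cell_form C (E (c i)) (E (c i)) (E (c i)) (q i)"
      by (rule proj_form_eq_cell_form[OF h_pos C local_poly_pw_poly cE e0])
    show ?thesis unfolding rhs_def i1 i2 i3 ..
  qed
  have lhs: "proj_form (C * h) h (c i) (pw_poly r) (pw_poly q) =
      cell_form C (poly (r i)) (poly (r i)) (poly (r i)) (q i)" for i r q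
    by (rule proj_form_eq_cell_form[OF h_pos C local_poly_pw_poly continuous_on_poly']) (auto intro: pw_poly_eq)
  have shift: "\<omega> (c (i + int N) + x) = \<omega> (c i + x)" "deriv \<omega> (c (i + int N) + x) = deriv \<omega> (c i + x)" for i x
    using per(1)[of "c i + x"] per(2)[of "c i + x"] centre_shift[of i "int N"] by (simp_all add: algebra_simps)
  have pp: "p (i + int N) = p i" for i
    using shift[of i "h / 2 + h * _"] shift[of i "- (h / 2) + h * _"] shift[of i "h * _"]
    unfolding p_def E_def v_def by (simp add: algebra_simps)
  note pr = ref_corr[OF C cE cE cE cv, where k = k]
  show "pw_poly p \<in> DG_space0 k (real N * h) h c \<and>
    (\<forall>i. \<forall>\<phi>\<in>DG_space0 k (real N * h) h c. proj_form (C * h) h (c i) (pw_poly p) \<phi> = rhs i \<phi>)"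
  proof (intro conjI allI ballI)
    show "pw_poly p \<in> DG_space0 k (real N * h) h c"
      unfolding DG_space0_iff using pp pr(1,2) by (intro exI[of _ p]) (simp add: p_def)
    fix i \<phi> assume "\<phi> \<in> DG_space0 k (real N * h) h c"
    then obtain q where q: "\<phi> = pw_poly q" "degree (q i) \<le> k" "ref_mean (poly (q i)) = 0"
      unfolding DG_space0_iff by blast
    show "proj_form (C * h) h (c i) (pw_poly p) \<phi> = rhs i \<phi>"
      unfolding q(1) rhs lhs p_def by (rule pr(3)[OF q(2,3)])
  qed
  fix w assume w: "w \<in> DG_space0 k (real N * h) h c \<and>
    (\<forall>i. \<forall>\<phi>\<in>DG_space0 k (real N * h) h c. proj_form (C * h) h (c i) w \<phi> = rhs i \<phi>)"
  then obtain r where r: "w = pw_poly r" "\<And>i. degree (r i) \<le> k" "\<And>i. ref_mean (poly (r i)) = 0"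
    unfolding DG_space0_iff by blast
  have "r i = p i" for i
    unfolding p_def
  proof (rule ref_corr_unique[OF C cE cE cE cv r(2,3)])
    fix \<phi> :: "real poly" assume d: "degree \<phi> \<le> k" "ref_mean (poly \<phi>) = 0"
    \<comment> \<open>The forms are local, so repeating \<phi> on every cell gives a periodic
      mean-free test function that serves for cell i.\<close>
    have "pw_poly (\<lambda>_. \<phi>) \<in> DG_space0 k (real N * h) h c" unfolding DG_space0_iff using d by blast
    then have "proj_form (C * h) h (c i) w (pw_poly (\<lambda>_. \<phi>)) = rhs i (pw_poly (\<lambda>_. \<phi>))" using w by blast
    then show "cell_form C (poly (r i)) (poly (r i)) (poly (r i)) \<phi> =
      - ref_inner (v (c i)) \<phi> - cell_form C (E (c i - h / 2)) (E (c i)) (E (c i + h / 2)) \<phi>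
      + cell_form C (E (c i)) (E (c i)) (E (c i)) \<phi>"
      unfolding r(1) rhs lhs .
  qed
  then have "r = p" by (rule ext)
  then show "w = pw_poly p" unfolding r(1) by (rule arg_cong)
qed

lemma cdg_form_pw_poly:
  assumes other: "uniform_mesh h c'" and off: "\<And>i. c' (i + s) = c i + h / 2" and C: "C > 0"
  shows "cdg_form (C * h) h (c i) (pw_poly p) (uniform_mesh.pw_poly h c' q) (pw_poly r) =
    cell_form C (poly (q (i + s - 1))) (poly (p i)) (poly (q (i + s))) (r i)"
proof -
  interpret o: uniform_mesh h c' by (rule other)
  have offm: "c' (i + s - 1) = c i - h / 2"
    using o.centre_shift[of "i + s" "-1"] off[of i] by simp
  show ?thesis
  proof (rule cdg_form_eq_cell_form[OF h_pos C local_poly_pw_poly])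
    fix \<xi> :: real assume "\<xi> \<in> {- (1/2)..<0}"
    then have "o.pw_poly q (c' (i + s - 1) + h * (\<xi> + 1/2)) = poly (q (i + s - 1)) (\<xi> + 1/2)"
      by (intro o.pw_poly_eq) auto
    then show "o.pw_poly q (c i + h * \<xi>) = poly (q (i + s - 1)) (\<xi> + 1/2)"
      unfolding offm by (simp add: algebra_simps)
  next
    fix \<xi> :: real assume "\<xi> \<in> {0<..1/2}"
    then have "o.pw_poly q (c' (i + s) + h * (\<xi> - 1/2)) = poly (q (i + s)) (\<xi> - 1/2)"
      by (intro o.pw_poly_eq) auto
    then show "o.pw_poly q (c i + h * \<xi>) = poly (q (i + s)) (\<xi> - 1/2)"
      unfolding off by (simp add: algebra_simps)
  qed (auto intro: pw_poly_eq continuous_on_poly')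
qed

end

text \<open>Nodes inside the half-open cell express the coefficients by point values; in time it is
  the point values of the numerical solution that are known to be differentiable.\<close>

lemma lagrange_basis:
  fixes k :: nat
  obtains x :: "nat \<Rightarrow> real" and l :: "nat \<Rightarrow> real poly" where
    "\<And>j. j \<le> k \<Longrightarrow> x j \<in> {- (1/2)..<1/2}" "\<And>j. j \<le> k \<Longrightarrow> degree (l j) \<le> k"
    "\<And>p. degree p \<le> k \<Longrightarrow> p = (\<Sum>j\<le>k. smult (poly p (x j)) (l j))"
proof -
  define x where "x j = real j / (2 * (real k + 1))" for j
  have inj: "x i = x j \<longleftrightarrow> i = j" for i j by (auto simp: x_def)
  define l where "l j = (\<Prod>i\<in>{..k} - {j}. smult (1 / (x j - x i)) [:- x i, 1:])" for j
  have range: "x j \<in> {- (1/2)..<1/2}" if "j \<le> k" for j using that by (auto simp: x_def field_simps)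
  have deg: "degree (l j) \<le> k" if "j \<le> k" for j
  proof -
    have "degree (l j) \<le> sum (degree \<circ> (\<lambda>i. smult (1 / (x j - x i)) [:- x i, 1:])) ({..k} - {j})"
      unfolding l_def by (rule degree_prod_sum_le) simp
    also have "\<dots> \<le> (\<Sum>i\<in>{..k} - {j}. 1)"
      by (intro sum_mono order_trans[OF degree_smult_le]) simp
    also have "\<dots> = k" using that by simp
    finally show ?thesis .
  qed
  have val: "poly (l j) (x i) = (if i = j then 1 else 0)" if "j \<le> k" "i \<le> k" for i j
  proof (cases "i = j")
    case True
    show ?thesis unfolding l_def poly_prod True
      by (auto intro!: prod.neutral simp: inj simp flip: diff_divide_distrib)
  next
    case False
    then show ?thesis unfolding l_def poly_prod using that by (auto intro!: prod_zero)
  qed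
  have rep: "p = (\<Sum>j\<le>k. smult (poly p (x j)) (l j))" if "degree p \<le> k" for p
  proof (rule ccontr)
    \<comment> \<open>The difference has degree at most k and vanishes at k + 1 nodes.\<close>
    define r where "r = p - (\<Sum>j\<le>k. smult (poly p (x j)) (l j))"
    assume "p \<noteq> (\<Sum>j\<le>k. smult (poly p (x j)) (l j))"
    then have "r \<noteq> 0" by (simp add: r_def)
    have dr: "degree r \<le> k"
      unfolding r_def using that deg
      by (intro degree_diff_le degree_sum_le) (auto intro: order_trans[OF degree_smult_le])
    have "poly r (x i) = 0" if "i \<le> k" for i
    proof -
      have "(\<Sum>j\<le>k. poly p (x j) * poly (l j) (x i)) = (\<Sum>j\<le>k. if j = i then poly p (x j) else 0)"
        by (rule sum.cong) (auto simp: val that)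
      then show ?thesis using that unfolding r_def by (simp add: poly_sum)
    qed
    then have "x ` {..k} \<subseteq> {y. poly r y = 0}" by auto
    then have "card (x ` {..k}) \<le> card {y. poly r y = 0}"
      by (rule card_mono[OF poly_roots_finite[OF \<open>r \<noteq> 0\<close>]])
    also have "\<dots> \<le> degree r" by (rule card_poly_roots_bound[OF \<open>r \<noteq> 0\<close>])
    finally show False using dr card_image[of x "{..k}"] inj by (simp add: inj_on_def)
  qed
  show ?thesis by (rule that[OF range deg rep])
qed

section \<open>Weak derivatives\<close>

text \<open>Smoothness of finite order, peeled off at the innermost derivative, so that inductions
  can generalise over the function. Test functions are those of every order.\<close>

fun diff_upto :: "nat \<Rightarrow> (real \<Rightarrow> real) \<Rightarrow> bool" where
  "diff_upto 0 f \<longleftrightarrow> f differentiable_on UNIV"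
| "diff_upto (Suc n) f \<longleftrightarrow> f differentiable_on UNIV \<and> diff_upto n (deriv f)"

lemma diff_upto_differentiable: "diff_upto n f \<Longrightarrow> f differentiable_on UNIV"
  by (cases n) auto

lemma diff_upto_has_deriv: "diff_upto n f \<Longrightarrow> (f has_real_derivative deriv f x) (at x)"
  using diff_upto_differentiable[of n f]
  by (auto simp: differentiable_on_def DERIV_deriv_iff_real_differentiable)

lemma diff_uptoI:
  assumes "\<And>x. (f has_real_derivative f' x) (at x)" "diff_upto n f'"
  shows "diff_upto (Suc n) f"
proof -
  have "deriv f = f'" using assms(1) by (intro ext DERIV_imp_deriv)
  moreover have "f differentiable_on UNIV"
    using assms(1) unfolding differentiable_on_def real_differentiable_def
    by (blast intro: has_field_derivative_at_within)
  ultimately show ?thesis using assms(2) by simp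
qed

lemma diff_upto_Suc_D: "diff_upto (Suc n) f \<Longrightarrow> diff_upto n f"
  by (induction n arbitrary: f) auto

lemma diff_upto_zeroI:
  assumes "\<And>x. (f has_real_derivative f' x) (at x)"
  shows "diff_upto 0 f"
  using assms unfolding diff_upto.simps differentiable_on_def real_differentiable_def
  by (blast intro: has_field_derivative_at_within)

lemma diff_upto_const: "diff_upto n (\<lambda>x. c)"
  by (induction n arbitrary: c) simp_all

lemma diff_upto_add:
  "diff_upto n f \<Longrightarrow> diff_upto n g \<Longrightarrow> diff_upto n (\<lambda>x. f x + g x)"
proof (induction n arbitrary: f g)
  case 0
  then show ?case by (auto intro: differentiable_on_add)
next
  case (Suc n)
  show ?case
  proof (rule diff_uptoI)
    show "((\<lambda>x. f x + g x) has_real_derivative deriv f x + deriv g x) (at x)" for x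
      by (intro DERIV_add diff_upto_has_deriv[OF Suc.prems(1)] diff_upto_has_deriv[OF Suc.prems(2)])
    show "diff_upto n (\<lambda>x. deriv f x + deriv g x)" using Suc by simp
  qed
qed

lemma diff_upto_mult:
  "diff_upto n f \<Longrightarrow> diff_upto n g \<Longrightarrow> diff_upto n (\<lambda>x. f x * g x)"
proof (induction n arbitrary: f g)
  case 0
  then show ?case by (auto intro: differentiable_on_mult)
next
  case (Suc n)
  show ?case
  proof (rule diff_uptoI)
    show "((\<lambda>x. f x * g x) has_real_derivative deriv f x * g x + deriv g x * f x) (at x)" for x
      by (intro DERIV_mult diff_upto_has_deriv[OF Suc.prems(1)] diff_upto_has_deriv[OF Suc.prems(2)])
    show "diff_upto n (\<lambda>x. deriv f x * g x + deriv g x * f x)"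
      using Suc.prems diff_upto_Suc_D[OF Suc.prems(1)] diff_upto_Suc_D[OF Suc.prems(2)]
      by (intro diff_upto_add Suc.IH) simp_all
  qed
qed

lemma diff_upto_power: "diff_upto n f \<Longrightarrow> diff_upto n (\<lambda>x. f x ^ m)"
  by (induction m) (auto intro: diff_upto_const diff_upto_mult)

text \<open>Written with a phase, the family is closed under differentiation: each derivative adds
  pi/2 to the phase.\<close>

lemma diff_upto_cos: "diff_upto n (\<lambda>x. A * cos (\<theta> * x + c))"
proof (induction n arbitrary: A c)
  case 0
  have "((\<lambda>x. A * cos (\<theta> * x + c)) has_real_derivative A * (- sin (\<theta> * x + c) * \<theta>)) (at x)" for x
    by (auto intro!: derivative_eq_intros)
  then show ?case by (rule diff_upto_zeroI)
next
  case (Suc n)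
  show ?case
  proof (rule diff_uptoI)
    show "((\<lambda>x. A * cos (\<theta> * x + c)) has_real_derivative (A * \<theta>) * cos (\<theta> * x + (c + pi / 2))) (at x)" for x
      by (auto intro!: derivative_eq_intros simp: cos_add sin_add algebra_simps)
    show "diff_upto n (\<lambda>x. (A * \<theta>) * cos (\<theta> * x + (c + pi / 2)))" by (rule Suc.IH)
  qed
qed

lemma diff_upto_iff:
  "(\<forall>n. (deriv ^^ n) f differentiable_on UNIV) \<longleftrightarrow> (\<forall>n. diff_upto n f)"
proof
  have "diff_upto n f \<Longrightarrow> (deriv ^^ n) f differentiable_on UNIV" for n
    by (induction n arbitrary: f) (simp_all add: funpow_swap1)
  then show "\<forall>n. diff_upto n f \<Longrightarrow> \<forall>n. (deriv ^^ n) f differentiable_on UNIV" by blast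
  have "\<forall>m\<le>n. (deriv ^^ m) f differentiable_on UNIV \<Longrightarrow> diff_upto n f" for n
  proof (induction n arbitrary: f)
    case 0
    from spec[OF 0, of 0] show ?case by simp
  next
    case (Suc n)
    have "\<forall>m\<le>n. (deriv ^^ m) (deriv f) differentiable_on UNIV"
    proof (intro allI impI)
      fix m assume "m \<le> n"
      then have "(deriv ^^ Suc m) f differentiable_on UNIV" using Suc.prems by blast
      then show "(deriv ^^ m) (deriv f) differentiable_on UNIV" by (simp add: funpow_swap1)
    qed
    moreover have "f differentiable_on UNIV" using spec[OF Suc.prems, of 0] by simp
    ultimately show ?case using Suc.IH by simp
  qed
  then show "\<forall>n. (deriv ^^ n) f differentiable_on UNIV \<Longrightarrow> \<forall>n. diff_upto n f" by blast
qed

section \<open>Periodic test functions and the functions orthogonal to all of them\<close>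

lemma periodic_test_fun_iff:
  "periodic_test_fun a b \<phi> \<longleftrightarrow> (\<forall>x. \<phi> (x + (b - a)) = \<phi> x) \<and> (\<forall>n. diff_upto n \<phi>)"
  unfolding periodic_test_fun_def diff_upto_iff periodic_fun_simple_def by blast

lemma test_fun_deriv:
  assumes "periodic_test_fun a b \<phi>"
  shows "(\<phi> has_real_derivative deriv \<phi> x) (at x)" "periodic_test_fun a b (deriv \<phi>)"
proof -
  have d: "(\<phi> has_real_derivative deriv \<phi> x) (at x)" for x
    using assms diff_upto_has_deriv[of 0 \<phi>] unfolding periodic_test_fun_iff by blast
  then show "(\<phi> has_real_derivative deriv \<phi> x) (at x)" .
  have "deriv \<phi> (x + (b - a)) = deriv \<phi> x" for x
  proof -
    have "((\<lambda>x. \<phi> (x + (b - a))) has_real_derivative deriv \<phi> (x + (b - a))) (at x)"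
      using d[of "x + (b - a)"] by (simp add: DERIV_shift)
    moreover have "(\<lambda>x. \<phi> (x + (b - a))) = \<phi>" using assms unfolding periodic_test_fun_iff by blast
    ultimately show ?thesis using d[of x] DERIV_unique by metis
  qed
  moreover have "diff_upto n (deriv \<phi>)" for n
    using assms diff_upto.simps(2)[of n \<phi>] unfolding periodic_test_fun_iff by blast
  ultimately show "periodic_test_fun a b (deriv \<phi>)" unfolding periodic_test_fun_iff by blast
qed

lemma test_fun_cont:
  assumes "periodic_test_fun a b \<phi>"
  shows "isCont \<phi> x" "isCont ((deriv ^^ j) \<phi>) x"
proof -
  have "isCont \<psi> x" if "periodic_test_fun a b \<psi>" for \<psi> x
    using test_fun_deriv(1)[OF that] by (rule DERIV_isCont)
  moreover have "periodic_test_fun a b ((deriv ^^ j) \<phi>)"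
    by (induction j) (auto simp: assms test_fun_deriv)
  ultimately show "isCont \<phi> x" "isCont ((deriv ^^ j) \<phi>) x" using assms by blast+
qed

lemma test_fun_const: "periodic_test_fun a b (\<lambda>x. c)"
  unfolding periodic_test_fun_iff by (auto intro: diff_upto_const)

lemma test_fun_add_const:
  "periodic_test_fun a b \<phi> \<Longrightarrow> periodic_test_fun a b (\<lambda>x. \<phi> x + c)"
  unfolding periodic_test_fun_iff by (auto intro: diff_upto_const diff_upto_add)

text \<open>Trigonometric polynomials are periodic and smooth at once and take the place of
  compactly supported bumps.\<close>

lemma test_fun_bump:
  assumes "a < b"
  shows "periodic_test_fun a b (\<lambda>x. (1 + cos (2 * pi / (b - a) * (x - y)) - d) ^ n)"
  unfolding periodic_test_fun_iff
proof (intro conjI allI)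
  define \<theta> where "\<theta> = 2 * pi / (b - a)"
  have "\<theta> * (x + (b - a) - y) = \<theta> * (x - y) + 2 * pi" for x
    using assms by (simp add: \<theta>_def field_simps)
  then show "(1 + cos (2 * pi / (b - a) * (x + (b - a) - y)) - d) ^ n =
    (1 + cos (2 * pi / (b - a) * (x - y)) - d) ^ n" for x
    unfolding \<theta>_def[symmetric] by simp
  have "diff_upto m (\<lambda>x. ((1 - d) + 1 * cos (\<theta> * x + (- \<theta> * y))) ^ n)" for m
    by (intro diff_upto_power diff_upto_add diff_upto_const diff_upto_cos)
  moreover have "(\<lambda>x. ((1 - d) + 1 * cos (\<theta> * x + (- \<theta> * y))) ^ n) =
    (\<lambda>x. (1 + cos (2 * pi / (b - a) * (x - y)) - d) ^ n)"
    by (simp add: \<theta>_def algebra_simps diff_divide_distrib)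
  ultimately show "diff_upto m (\<lambda>x. (1 + cos (2 * pi / (b - a) * (x - y)) - d) ^ n)" for m by simp
qed

lemma periodic_extend_zero:
  fixes F :: "real \<Rightarrow> real"
  assumes ab: "a < b" and per: "\<And>x. F (x + (b - a)) = F x" and zero: "\<And>x. x \<in> {a..<b} \<Longrightarrow> F x = 0"
  shows "F x = 0"
proof -
  interpret periodic_fun_simple F "b - a" by standard (rule per)
  define n where "n = \<lfloor>(x - a) / (b - a)\<rfloor>"
  have "of_int n \<le> (x - a) / (b - a)" "(x - a) / (b - a) < of_int n + 1" unfolding n_def by linarith+
  then have "x - of_int n * (b - a) \<in> {a..<b}" using ab by (auto simp: field_simps)
  then show ?thesis using zero minus_of_int[of x n] by simp
qed

text \<open>The powers of \<open>1 + cos t - cos \<delta>\<close> concentrate on \<open>|t| < \<delta>\<close>.\<close>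

lemma test_fun_kernel:
  fixes F :: "real \<Rightarrow> real"
  assumes ab: "a < b" and cont: "\<And>x. isCont F x" and per: "\<And>x. F (x + (b - a)) = F x"
    and orth: "\<And>\<phi>. periodic_test_fun a b \<phi> \<Longrightarrow> integral {a..b} (\<lambda>x. F x * \<phi> x) = 0"
  shows "F x = 0"
proof -
  have no_pos: False
    if cont: "\<And>x. isCont G x"
      and orth: "\<And>\<phi>. periodic_test_fun a b \<phi> \<Longrightarrow> integral {a..b} (\<lambda>x. G x * \<phi> x) = 0"
      and y: "y \<in> {a<..<b}" "G y > 0" for G :: "real \<Rightarrow> real" and y
  proof -
    define m where "m = G y / 2"
    have m: "m > 0" using y m_def by simp
    obtain d0 where d0: "d0 > 0" "\<And>x. \<bar>x - y\<bar> < d0 \<Longrightarrow> \<bar>G x - G y\<bar> < m"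
      using cont[of y] m unfolding continuous_at_eps_delta dist_real_def by blast
    \<comment> \<open>Half the gaps to a and b keep the d-neighbourhood of y inside the interval and
      keep [a, b] at distance at least d from the other translates of y, where the cosine is large
      again.\<close>
    define d where "d = min (d0 / 2) (min ((y - a) / 2) ((b - y) / 2))"
    have d: "d > 0" "d < d0" "a < y - d" "y + d < b" using d0 y by (auto simp: d_def min_def field_simps)
    have Gm: "G x \<ge> m" if "\<bar>x - y\<bar> \<le> d" for x
      using d0(2)[of x] that d m_def by (auto simp: abs_real_def split: if_splits)
    define \<theta> where "\<theta> = 2 * pi / (b - a)"
    have \<theta>: "\<theta> > 0" "\<theta> * (b - a) = 2 * pi" using ab by (auto simp: \<theta>_def)
    define t where "t x = 1 + cos (\<theta> * (x - y)) - cos (\<theta> * d)" for x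
    have dpi: "\<theta> * d < pi"
    proof -
      have "2 * d < b - a" using d by linarith
      then have "\<theta> * (2 * d) < \<theta> * (b - a)" using \<theta> by (intro mult_strict_left_mono)
      then show ?thesis using \<theta> by simp
    qed
    have cos_abs: "cos (\<theta> * (x - y)) = cos (\<theta> * \<bar>x - y\<bar>)" for x
      by (cases "x \<ge> y") (auto simp: abs_if cos_diff right_diff_distrib)
    have t_in: "t x \<ge> 1" if "\<bar>x - y\<bar> \<le> d" for x
    proof -
      have "cos (\<theta> * d) \<le> cos (\<theta> * \<bar>x - y\<bar>)"
        using that \<theta> dpi d by (intro cos_monotone_0_pi_le) auto
      then show ?thesis unfolding t_def cos_abs by simp
    qed
    define q where "q = 1 + cos (\<theta> * (d / 2)) - cos (\<theta> * d)"
    have q: "q > 1"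
    proof -
      have "cos (\<theta> * d) < cos (\<theta> * (d / 2))" using \<theta> dpi d by (intro cos_monotone_0_pi) auto
      then show ?thesis by (simp add: q_def)
    qed
    have t_core: "t x \<ge> q" if "\<bar>x - y\<bar> \<le> d / 2" for x
    proof -
      have "cos (\<theta> * (d / 2)) \<le> cos (\<theta> * \<bar>x - y\<bar>)"
      proof (rule cos_monotone_0_pi_le)
        show "\<theta> * \<bar>x - y\<bar> \<le> \<theta> * (d / 2)" using that \<theta> by (intro mult_left_mono) auto
        have "\<theta> * (d / 2) \<le> \<theta> * d" using \<theta> d by (intro mult_left_mono) auto
        then show "\<theta> * (d / 2) \<le> pi" using dpi by linarith
      qed (use \<theta> in auto)
      then show ?thesis unfolding t_def q_def cos_abs by simp
    qed
    have t_out: "\<bar>t x\<bar> \<le> 1" if "x \<in> {a..b}" "\<bar>x - y\<bar> \<ge> d" for x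
    proof -
      have le: "cos (\<theta> * \<bar>x - y\<bar>) \<le> cos (\<theta> * d)"
      proof (cases "\<theta> * \<bar>x - y\<bar> \<le> pi")
        case True
        then show ?thesis using that \<theta> d by (intro cos_monotone_0_pi_le) auto
      next
        case False
        have "\<bar>x - y\<bar> \<le> (b - a) - d" using that(1) d by (auto simp: abs_real_def)
        then have "\<theta> * \<bar>x - y\<bar> \<le> \<theta> * ((b - a) - d)" using \<theta> by (intro mult_left_mono) auto
        then have "\<theta> * d \<le> 2 * pi - \<theta> * \<bar>x - y\<bar>" using \<theta>(2) by (simp add: right_diff_distrib)
        then have "cos (2 * pi - \<theta> * \<bar>x - y\<bar>) \<le> cos (\<theta> * d)"
          using False \<theta> d by (intro cos_monotone_0_pi_le) auto
        then show ?thesis by (simp add: cos_diff)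
      qed
      have "cos (\<theta> * d) \<le> 1" "- 1 \<le> cos (\<theta> * \<bar>x - y\<bar>)" by simp_all
      then show ?thesis unfolding t_def cos_abs abs_le_iff using le by (intro conjI; linarith)
    qed
    have cG: "continuous_on {a..b} G" using cont by (simp add: continuous_at_imp_continuous_on)
    obtain B where B: "B \<ge> 0" "\<And>x. x \<in> {a..b} \<Longrightarrow> \<bar>G x\<bar> \<le> B"
    proof -
      have "bounded (G ` {a..b})" using cG by (intro compact_imp_bounded compact_continuous_image) auto
      then obtain B where "\<forall>x\<in>G ` {a..b}. norm x \<le> B" unfolding bounded_iff by blast
      then show ?thesis using that[of "max B 0"] by force
    qed
    \<comment> \<open>The core of width d contributes at least m q^n d, the rest of the
      d-neighbourhood is nonnegative, and outside |t| is at most 1. As q > 1, the inequality fails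
      for large n.\<close>
    have bound: "m * q ^ n * d \<le> B * (b - a)" for n
    proof -
      have ct: "continuous_on {a..b} (\<lambda>x. G x * t x ^ n)"
        unfolding t_def by (intro continuous_intros cG)
      define S where "S = {y - d / 2..y + d / 2}"
      have S: "S \<subseteq> {a..b}" using d by (auto simp: S_def)
      have "((\<lambda>x. if x \<in> S then m * q ^ n else 0) has_integral m * q ^ n * d) {a..b}"
      proof -
        have "((\<lambda>x. m * q ^ n) has_integral m * q ^ n * d) S"
          using has_integral_const_real[of "m * q ^ n" "y - d / 2" "y + d / 2"] d
          by (simp add: S_def mult.commute)
        then show ?thesis by (simp only: has_integral_restrict[OF S])
      qed
      moreover have "((\<lambda>x. - B) has_integral - B * (b - a)) {a..b}"
        using has_integral_const_real[of "- B" a b] ab by (simp add: mult.commute)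
      ultimately have "((\<lambda>x. (if x \<in> S then m * q ^ n else 0) + - B) has_integral
          m * q ^ n * d + - B * (b - a)) {a..b}"
        by (rule has_integral_add)
      moreover have "((\<lambda>x. G x * t x ^ n) has_integral 0) {a..b}"
        using orth[OF test_fun_bump[OF ab, of y "cos (\<theta> * d)" n]] integrable_continuous_real[OF ct]
        unfolding t_def \<theta>_def by (simp add: has_integral_iff)
      ultimately have "m * q ^ n * d + - B * (b - a) \<le> 0"
      proof (rule has_integral_le)
        fix x assume x: "x \<in> {a..b}"
        show "(if x \<in> S then m * q ^ n else 0) + - B \<le> G x * t x ^ n"
        proof (cases "\<bar>x - y\<bar> \<le> d")
          case True
          show ?thesis
          proof (cases "x \<in> S")
            case True
            then have "\<bar>x - y\<bar> \<le> d / 2" by (auto simp: S_def abs_real_def)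
            then have "m * q ^ n \<le> G x * t x ^ n"
              using t_core[of x] Gm[of x] m q d by (intro mult_mono power_mono) auto
            then show ?thesis using True B(1) by simp
          next
            case False
            have "G x * t x ^ n \<ge> 0"
              using t_in[OF \<open>\<bar>x - y\<bar> \<le> d\<close>] Gm[OF \<open>\<bar>x - y\<bar> \<le> d\<close>] m by (intro mult_nonneg_nonneg) auto
            then show ?thesis using False B(1) by simp
          qed
        next
          case False
          then have "x \<notin> S" using d by (auto simp: S_def abs_real_def split: if_splits)
          have "\<bar>t x ^ n\<bar> \<le> 1" using t_out[OF x] False by (simp add: power_abs power_le_one)
          then have "\<bar>G x * t x ^ n\<bar> \<le> B * 1"
            unfolding abs_mult using B(2)[OF x] B(1) by (intro mult_mono) auto
          then show ?thesis using \<open>x \<notin> S\<close> by (simp add: abs_le_iff)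
        qed
      qed
      then show ?thesis by simp
    qed
    obtain n where "B * (b - a) / (m * d) < q ^ n" using real_arch_pow[OF q] by blast
    then have "B * (b - a) < m * q ^ n * d" using m d by (simp add: field_simps)
    then show False using bound[of n] by linarith
  qed
  have zero: "F y = 0" if "y \<in> {a<..<b}" for y
  proof (rule ccontr)
    assume "F y \<noteq> 0"
    then consider "F y > 0" | "- F y > 0" by linarith
    then show False
    proof cases
      case 1
      then show False using no_pos[OF cont orth that] by blast
    next
      case 2
      have "integral {a..b} (\<lambda>x. - F x * \<phi> x) = 0" if "periodic_test_fun a b \<phi>" for \<phi>
        using orth[OF that] by simp
      then show False using no_pos[of "\<lambda>x. - F x" y] cont that 2 by (simp add: continuous_minus)
    qed
  qed
  \<comment> \<open>The end point was excluded above and follows by continuity.\<close>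
  have "F a = 0"
  proof -
    have "(F \<longlongrightarrow> F a) (at_right a)" using cont[of a] by (simp add: isCont_def filterlim_at_split)
    moreover have "\<forall>\<^sub>F x in at_right a. F x = 0"
      using eventually_at_right_real[OF ab] by (rule eventually_mono) (rule zero)
    then have "(F \<longlongrightarrow> 0) (at_right a)" by (rule tendsto_eventually)
    ultimately show ?thesis using tendsto_unique trivial_limit_at_right_real by blast
  qed
  then have "F z = 0" if "z \<in> {a..<b}" for z using zero[of z] that by (cases "z = a") auto
  then show ?thesis by (rule periodic_extend_zero[where F = F, OF ab per])
qed

section \<open>Square integrable functions and their primitives\<close>

lemma L2_fun_integrable:
  assumes "L2_fun a b g"
  shows "g absolutely_integrable_on {a..b}" "(\<lambda>x. (g x)\<^sup>2) integrable_on {a..b}"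
proof -
  have m: "g \<in> borel_measurable (lebesgue_on {a..b})" using assms unfolding L2_fun_def by simp
  show sq: "(\<lambda>x. (g x)\<^sup>2) integrable_on {a..b}"
    using assms unfolding L2_fun_def by (intro integrable_on_lebesgue_on) auto
  show "g absolutely_integrable_on {a..b}"
  proof (rule measurable_bounded_by_integrable_imp_absolutely_integrable[OF m])
    show "(\<lambda>x. 1 + (g x)\<^sup>2) integrable_on {a..b}"
      by (intro integrable_add sq integrable_const_ivl)
    fix x
    \<comment> \<open>On a bounded interval square integrability implies integrability because 2 |g|
      \<le> 1 + g^2.\<close>
    have "0 \<le> (\<bar>g x\<bar> - 1)\<^sup>2" by simp
    then have "2 * \<bar>g x\<bar> \<le> 1 + (g x)\<^sup>2" by (simp add: power2_eq_square algebra_simps abs_mult_self_eq)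
    then show "norm (g x) \<le> 1 + (g x)\<^sup>2" by simp
  qed simp
qed

lemma L2_fun_lin:
  assumes "L2_fun a b f" "L2_fun a b g"
  shows "L2_fun a b (\<lambda>x. s * f x + t * g x)"
proof -
  have m: "f \<in> borel_measurable (lebesgue_on {a..b})" "g \<in> borel_measurable (lebesgue_on {a..b})"
    and i: "integrable (lebesgue_on {a..b}) (\<lambda>x. (f x)\<^sup>2)" "integrable (lebesgue_on {a..b}) (\<lambda>x. (g x)\<^sup>2)"
    using assms unfolding L2_fun_def by auto
  have "integrable (lebesgue_on {a..b}) (\<lambda>x. (s * f x + t * g x)\<^sup>2)"
  proof (rule Bochner_Integration.integrable_bound)
    show "integrable (lebesgue_on {a..b}) (\<lambda>x. 2 * s\<^sup>2 * (f x)\<^sup>2 + 2 * t\<^sup>2 * (g x)\<^sup>2)"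
      using i by simp
    show "(\<lambda>x. (s * f x + t * g x)\<^sup>2) \<in> borel_measurable (lebesgue_on {a..b})" using m by measurable
    have "(s * f x + t * g x)\<^sup>2 \<le> 2 * s\<^sup>2 * (f x)\<^sup>2 + 2 * t\<^sup>2 * (g x)\<^sup>2" for x
    proof -
      have "0 \<le> (s * f x - t * g x)\<^sup>2" by simp
      then show ?thesis by (simp add: power2_eq_square algebra_simps)
    qed
    then show "AE x in lebesgue_on {a..b}. norm ((s * f x + t * g x)\<^sup>2) \<le>
        norm (2 * s\<^sup>2 * (f x)\<^sup>2 + 2 * t\<^sup>2 * (g x)\<^sup>2)"
      by (intro AE_I2) (auto intro: order_trans[OF _ abs_ge_self])
  qed
  then show ?thesis unfolding L2_fun_def using m by (auto intro!: borel_measurable_add borel_measurable_times)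
qed

lemma integrable_mult_cont:
  fixes g \<phi> :: "real \<Rightarrow> real"
  assumes "g absolutely_integrable_on {a..b}" "continuous_on {a..b} \<phi>"
  shows "(\<lambda>x. g x * \<phi> x) absolutely_integrable_on {a..b :: real}"
    "(\<lambda>x. g x * \<phi> x) integrable_on {a..b}"
proof -
  have "(\<lambda>x. \<phi> x * g x) absolutely_integrable_on {a..b}"
  proof (rule absolutely_integrable_bounded_measurable_product_real[where f = \<phi> and g = g])
    show "\<phi> \<in> borel_measurable (lebesgue_on {a..b})"
      by (rule borel_measurable_integrable[OF continuous_imp_integrable_real[OF assms(2)]])
    show "bounded (\<phi> ` {a..b})"
      by (intro compact_imp_bounded compact_continuous_image assms(2)) simp
  qed (simp_all add: assms)
  then show "(\<lambda>x. g x * \<phi> x) absolutely_integrable_on {a..b :: real}" by (simp add: mult.commute)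
  then show "(\<lambda>x. g x * \<phi> x) integrable_on {a..b}" by (rule set_lebesgue_integral_eq_integral(1))
qed

lemma integral_square_le:
  fixes g :: "real \<Rightarrow> real"
  assumes "g integrable_on {x..y}" "(\<lambda>x. (g x)\<^sup>2) integrable_on {x..y}" "x \<le> y"
  shows "(integral {x..y} g)\<^sup>2 \<le> (y - x) * integral {x..y} (\<lambda>x. (g x)\<^sup>2)"
proof (cases "x = y")
  case False
  then have xy: "y - x > 0" using assms(3) by simp
  define I J where "I = integral {x..y} g" and "J = integral {x..y} (\<lambda>x. (g x)\<^sup>2)"
  \<comment> \<open>The mean of g; the nonnegative integral of (g - s)^2 gives
    Cauchy-Schwarz.\<close>
  define s where "s = I / (y - x)"
  have "((\<lambda>z. (g z)\<^sup>2 - 2 * s * g z + s\<^sup>2) has_integral J - 2 * s * I + s\<^sup>2 * (y - x)) {x..y}"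
    unfolding I_def J_def using has_integral_const_real[of "s\<^sup>2" x y] assms(3)
    by (intro has_integral_add has_integral_diff has_integral_mult_right integrable_integral assms)
      (simp add: mult.commute)
  moreover have "0 \<le> (g z)\<^sup>2 - 2 * s * g z + s\<^sup>2" for z
    using zero_le_power2[of "g z - s"] by (simp add: power2_eq_square algebra_simps)
  ultimately have "0 \<le> J - 2 * s * I + s\<^sup>2 * (y - x)" by (rule has_integral_nonneg)
  also have "\<dots> = J - I\<^sup>2 / (y - x)"
  proof -
    have "s * (y - x) = I" using xy by (simp add: s_def)
    then have "s\<^sup>2 * (y - x) = s * I" by (simp add: power2_eq_square mult.assoc)
    moreover have "s * I = I\<^sup>2 / (y - x)" by (simp add: s_def power2_eq_square)
    ultimately show ?thesis by simp
  qed
  finally have "I\<^sup>2 / (y - x) \<le> J" by simp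
  then show ?thesis
    unfolding I_def[symmetric] J_def[symmetric] using xy by (simp add: pos_divide_le_eq mult.commute)
qed simp

text \<open>\<open>E\<close> plays the role of a primitive of the square of the derivative of \<open>f\<close>.\<close>

definition energy_bound :: "real \<Rightarrow> real \<Rightarrow> (real \<Rightarrow> real) \<Rightarrow> (real \<Rightarrow> real) \<Rightarrow> bool" where
  "energy_bound L K E f \<longleftrightarrow> (\<forall>x. E (x + L) = E x + K) \<and>
     (\<forall>x y. y \<le> x \<longrightarrow> x \<le> y + L \<longrightarrow> (f x - f y)\<^sup>2 \<le> (x - y) * (E x - E y))"

text \<open>Cauchy-Schwarz for two terms; it glues the increment estimates on both sides of a period
  boundary.\<close>

lemma abs_le_sqrt_add:
  fixes u v p q r s :: real
  assumes "u\<^sup>2 \<le> p * q" "v\<^sup>2 \<le> r * s" "p \<ge> 0" "q \<ge> 0" "r \<ge> 0" "s \<ge> 0"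
  shows "(u + v)\<^sup>2 \<le> (p + r) * (q + s)"
proof -
  have "(u * v)\<^sup>2 \<le> (p * q) * (r * s)"
    unfolding power_mult_distrib using assms by (intro mult_mono) auto
  also have "\<dots> = (p * s) * (r * q)" by simp
  also have "\<dots> \<le> ((p * s + r * q) / 2)\<^sup>2"
    using zero_le_power2[of "p * s - r * q"] by (simp add: power2_eq_square algebra_simps)
  finally have "\<bar>u * v\<bar> \<le> (p * s + r * q) / 2"
    using assms by (intro power2_le_imp_le[of "\<bar>u * v\<bar>"]) auto
  then have "2 * (u * v) \<le> p * s + r * q" using abs_ge_self[of "u * v"] by simp
  then show ?thesis using assms(1,2) by (simp add: power2_eq_square algebra_simps)
qed

lemma L2_primitive:
  assumes ab: "a < b" and g: "L2_fun a b g" and zero: "integral {a..b} g = 0"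
  obtains G E where "energy_bound (b - a) ((L2_norm a b g)\<^sup>2) E G" "\<And>x. G (x + (b - a)) = G x"
    "\<And>x. x \<in> {a..b} \<Longrightarrow> G x = integral {a..x} g"
proof -
  define L where "L = b - a"
  have L: "L > 0" using ab by (simp add: L_def)
  note gi = L2_fun_integrable[OF g]
  have gi1: "g integrable_on {a..b}" using gi(1) set_lebesgue_integral_eq_integral(1) by blast
  define G0 E0 where "G0 x = integral {a..x} g" and "E0 x = integral {a..x} (\<lambda>x. (g x)\<^sup>2)" for x
  define K where "K = E0 b"
  have K: "K = (L2_norm a b g)\<^sup>2"
    unfolding K_def E0_def L2_norm_def
    by (simp add: Henstock_Kurzweil_Integration.integral_nonneg[OF gi(2)])
  have incr: "G0 y - G0 x = integral {x..y} g" "E0 y - E0 x = integral {x..y} (\<lambda>x. (g x)\<^sup>2)"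
    "E0 x \<le> E0 y" "(G0 y - G0 x)\<^sup>2 \<le> (y - x) * (E0 y - E0 x)" if "a \<le> x" "x \<le> y" "y \<le> b" for x y
  proof -
    have sub: "g integrable_on {a..y}" "(\<lambda>x. (g x)\<^sup>2) integrable_on {a..y}"
      "g integrable_on {x..y}" "(\<lambda>x. (g x)\<^sup>2) integrable_on {x..y}"
      using integrable_on_subinterval[OF gi1] integrable_on_subinterval[OF gi(2)] that by auto
    show 1: "G0 y - G0 x = integral {x..y} g"
      using Henstock_Kurzweil_Integration.integral_combine[OF that(1,2) sub(1)] by (simp add: G0_def)
    show 2: "E0 y - E0 x = integral {x..y} (\<lambda>x. (g x)\<^sup>2)"
      using Henstock_Kurzweil_Integration.integral_combine[OF that(1,2) sub(2)] by (simp add: E0_def)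
    then show "E0 x \<le> E0 y"
      using Henstock_Kurzweil_Integration.integral_nonneg[OF sub(4)] by simp
    show "(G0 y - G0 x)\<^sup>2 \<le> (y - x) * (E0 y - E0 x)"
      unfolding 1 2 using that by (intro integral_square_le sub)
  qed
  have G0: "G0 a = 0" "G0 b = 0" "E0 a = 0" by (simp_all add: G0_def E0_def zero)
  define n where "n x = \<lfloor>(x - a) / L\<rfloor>" for x
  define w where "w x = x - of_int (n x) * L" for x
  have w: "w x \<in> {a..<b}" for x
  proof -
    have "of_int (n x) \<le> (x - a) / L" "(x - a) / L < of_int (n x) + 1" unfolding n_def by linarith+
    then show ?thesis using L unfolding w_def L_def by (auto simp: field_simps)
  qed
  have n_unique: "n x = m" if "x - of_int m * L \<in> {a..<b}" for x m
  proof -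
    have "of_int m * L \<le> x - a" "x - a < (of_int m + 1) * L" using that by (auto simp: L_def algebra_simps)
    then have "of_int m \<le> (x - a) / L" "(x - a) / L < of_int m + 1"
      using L by (simp_all add: pos_le_divide_eq pos_divide_less_eq)
    then show ?thesis unfolding n_def by (intro floor_unique)
  qed
  \<comment> \<open>The primitive wraps around since g has mean zero, while E gains the energy K in
    every period.\<close>
  define G E where "G x = G0 (w x)" and "E x = E0 (w x) + of_int (n x) * K" for x
  have n_shift: "n (x + L) = n x + 1" for x
    by (rule n_unique) (use w[of x] in \<open>auto simp: w_def algebra_simps\<close>)
  then have w_shift: "w (x + L) = w x" for x by (simp add: w_def distrib_right)
  have "(G x - G y)\<^sup>2 \<le> (x - y) * (E x - E y)" if xy: "y \<le> x" "x \<le> y + L" for x y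
  proof -
    define x' where "x' = x - of_int (n y) * L"
    have x': "w y \<le> x'" "x' \<le> w y + L" using xy by (auto simp: x'_def w_def)
    have diff: "x - y = x' - w y" by (simp add: x'_def w_def)
    show ?thesis
    proof (cases "x' < b")
      case True
      have "n x = n y" by (rule n_unique) (use True x' w[of y] in \<open>auto simp: x'_def\<close>)
      then have "w x = x'" by (simp add: x'_def w_def)
      then show ?thesis
        using incr(4)[of "w y" x'] x' w[of y] True unfolding G_def E_def diff \<open>n x = n y\<close> by simp
    next
      \<comment> \<open>The interval contains exactly one translate of b, because x \<le> y + L; the
        increment is split there.\<close>
      case False
      have nx: "n x = n y + 1"
        by (rule n_unique) (use False x' w[of y] in \<open>auto simp: x'_def algebra_simps L_def\<close>)
      then have wx: "w x = x' - L" by (simp add: x'_def w_def algebra_simps)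
      have wxy: "w x \<in> {a..<b}" "w y \<in> {a..<b}" using w by auto
      have "((G0 (w x) - G0 a) + (G0 b - G0 (w y)))\<^sup>2 \<le>
        ((w x - a) + (b - w y)) * ((E0 (w x) - E0 a) + (E0 b - E0 (w y)))"
        using wxy incr(3,4)[of a "w x"] incr(3,4)[of "w y" b] by (intro abs_le_sqrt_add) auto
      moreover have "(w x - a) + (b - w y) = x - y" unfolding diff wx L_def by simp
      moreover have "G x - G y = (G0 (w x) - G0 a) + (G0 b - G0 (w y))"
        unfolding G_def G0 by simp
      moreover have "E x - E y = (E0 (w x) - E0 a) + (E0 b - E0 (w y))"
        unfolding E_def nx G0 K_def by (simp add: algebra_simps)
      ultimately show ?thesis by simp
    qed
  qed
  then have "energy_bound (b - a) ((L2_norm a b g)\<^sup>2) E G"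
    unfolding energy_bound_def L_def[symmetric] K[symmetric]
    by (auto simp: E_def n_shift w_shift distrib_right)
  moreover have "G (x + (b - a)) = G x" for x
    unfolding L_def[symmetric] by (simp add: G_def w_shift)
  moreover have "G x = integral {a..x} g" if "x \<in> {a..b}" for x
  proof (cases "x = b")
    case True
    have "n b = 1" by (rule n_unique) (use ab in \<open>auto simp: L_def\<close>)
    then have "G b = G0 a" by (simp add: G_def w_def L_def)
    then show ?thesis using G0 zero True by simp
  next
    case False
    have "n x = 0" by (rule n_unique) (use False that in auto)
    then show ?thesis by (simp add: G_def w_def G0_def)
  qed
  ultimately show ?thesis by (rule that)
qed

text \<open>E is monotone over distances up to one period, so its increment there is at most
  K.\<close>

lemma energy_bound_abs:
  assumes "energy_bound L K E f" "K \<ge> 0" "\<bar>x - y\<bar> \<le> L"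
  shows "(f x - f y)\<^sup>2 \<le> \<bar>x - y\<bar> * K"
proof -
  have shift: "E (z + L) = E z + K" for z using assms(1) unfolding energy_bound_def by blast
  have eb: "(f u - f v)\<^sup>2 \<le> (u - v) * (E u - E v)" if "v \<le> u" "u \<le> v + L" for u v
    using assms(1) that unfolding energy_bound_def by blast
  have mono: "E v \<le> E u" if "v \<le> u" "u \<le> v + L" for u v
  proof (cases "u = v")
    case False
    have "0 \<le> (u - v) * (E u - E v)" using eb[OF that] zero_le_power2[of "f u - f v"] by linarith
    then show ?thesis using that False by (simp add: zero_le_mult_iff)
  qed simp
  have *: "(f u - f v)\<^sup>2 \<le> (u - v) * K" if "v \<le> u" "u \<le> v + L" for u v
  proof -
    have "E u \<le> E v + K" using mono[of u "v + L"] shift[of v] that by simp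
    then have "(u - v) * (E u - E v) \<le> (u - v) * K" using that by (intro mult_left_mono) auto
    then show ?thesis using eb[OF that] by linarith
  qed
  show ?thesis
    using *[of y x] *[of x y] assms(3) by (cases "y \<le> x") (auto simp: power2_commute)
qed

lemma energy_bound_mono:
  assumes "energy_bound L K E f" "v \<le> u" "u \<le> v + L"
  shows "E v \<le> E u"
proof (cases "u = v")
  case False
  have "(f u - f v)\<^sup>2 \<le> (u - v) * (E u - E v)"
    using assms unfolding energy_bound_def by blast
  then have "0 \<le> (u - v) * (E u - E v)" using zero_le_power2[of "f u - f v"] by linarith
  then show ?thesis using assms False by (simp add: zero_le_mult_iff)
qed simp

lemma energy_bound_isCont:
  assumes "energy_bound L K E f" "K \<ge> 0" "L > 0"
  shows "isCont f x"
  unfolding continuous_at_eps_delta dist_real_def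
proof (intro allI impI)
  fix e :: real assume e: "e > 0"
  define d where "d = min L (e\<^sup>2 / (K + 1))"
  have d: "d > 0" using e assms by (simp add: d_def)
  have "\<bar>f y - f x\<bar> < e" if "\<bar>y - x\<bar> < d" for y
  proof -
    have "\<bar>y - x\<bar> < e\<^sup>2 / (K + 1)" using that by (simp add: d_def)
    then have "\<bar>y - x\<bar> * (K + 1) < e\<^sup>2" using assms(2) by (simp add: pos_less_divide_eq)
    then have "(f y - f x)\<^sup>2 < e\<^sup>2"
      using energy_bound_abs[OF assms(1,2), of y x] that by (simp add: d_def algebra_simps)
    then show ?thesis using e power2_less_imp_less[of "\<bar>f y - f x\<bar>" e] by simp
  qed
  then show "\<exists>d>0. \<forall>y. \<bar>y - x\<bar> < d \<longrightarrow> \<bar>f y - f x\<bar> < e" using d by blast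
qed

text \<open>On a partition into n equal parts the increments add up to at most a constant over n,
  because those of A telescope.\<close>

lemma constant_if_superlinear_increments:
  fixes H A :: "real \<Rightarrow> real"
  assumes ab: "a < b" and M: "M \<ge> 0"
    and H: "\<And>x y. a \<le> x \<Longrightarrow> x \<le> y \<Longrightarrow> y \<le> b \<Longrightarrow> \<bar>H y - H x\<bar> \<le> M * (y - x) * (A y - A x)"
  shows "H b = H a"
proof -
  define B where "B = M * (b - a) * (A b - A a)"
  have bound: "\<bar>H b - H a\<bar> \<le> B / real n" if n: "n > 0" for n
  proof -
    define x where "x i = a + real i * ((b - a) / real n)" for i
    have step: "x (Suc i) - x i = (b - a) / real n" for i by (simp add: x_def distrib_right add_divide_distrib)
    have ends: "x 0 = a" "x n = b" using n by (simp_all add: x_def)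
    have rng: "a \<le> x i" "x i \<le> x (Suc i)" "x (Suc i) \<le> b" if "i < n" for i
    proof -
      show "a \<le> x i" using ab by (simp add: x_def)
      show "x i \<le> x (Suc i)" using step[of i] ab by (smt (verit) divide_nonneg_nonneg of_nat_0_le_iff)
      have "real (Suc i) * ((b - a) / real n) \<le> real n * ((b - a) / real n)"
        using that ab by (intro mult_right_mono) auto
      then show "x (Suc i) \<le> b" using n by (simp add: x_def)
    qed
    have "H b - H a = (\<Sum>i<n. H (x (Suc i)) - H (x i))"
      using sum_lessThan_telescope[of "\<lambda>i. H (x i)" n] by (simp only: ends)
    then have "\<bar>H b - H a\<bar> \<le> (\<Sum>i<n. \<bar>H (x (Suc i)) - H (x i)\<bar>)" by (simp add: sum_abs)
    also have "\<dots> \<le> (\<Sum>i<n. M * ((b - a) / real n) * (A (x (Suc i)) - A (x i)))"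
    proof (rule sum_mono)
      fix i assume "i \<in> {..<n}"
      then show "\<bar>H (x (Suc i)) - H (x i)\<bar> \<le> M * ((b - a) / real n) * (A (x (Suc i)) - A (x i))"
        using H[OF rng(1-3), of i] by (simp add: step)
    qed
    also have "\<dots> = M * ((b - a) / real n) * (A b - A a)"
      using sum_lessThan_telescope[of "\<lambda>i. A (x i)" n] by (simp only: ends sum_distrib_left[symmetric])
    finally show ?thesis by (simp add: B_def)
  qed
  show ?thesis
  proof (rule ccontr)
    assume "H b \<noteq> H a"
    then have pos: "\<bar>H b - H a\<bar> > 0" by simp
    obtain n where "B / \<bar>H b - H a\<bar> < real n" using reals_Archimedean2 by blast
    then have "B < real (Suc n) * \<bar>H b - H a\<bar>" using pos by (simp add: divide_less_eq algebra_simps)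
    then show False using bound[of "Suc n"] by (simp add: pos_le_divide_eq mult.commute)
  qed
qed

text \<open>
  Partial integration for the primitive of a merely integrable function: the defect has increments
  that are small compared with the length of the interval.
\<close>

lemma integral_by_parts_primitive:
  fixes g \<psi> \<psi>' :: "real \<Rightarrow> real"
  assumes ab: "a < b" and g: "g absolutely_integrable_on {a..b}" and zero: "integral {a..b} g = 0"
    and der: "\<And>x. (\<psi> has_real_derivative \<psi>' x) (at x)" and cont: "continuous_on {a..b} \<psi>'"
  shows "integral {a..b} (\<lambda>x. integral {a..x} g * \<psi>' x) = - integral {a..b} (\<lambda>x. g x * \<psi> x)"
proof -
  define G where "G x = integral {a..x} g" for x
  define A where "A x = integral {a..x} (\<lambda>x. \<bar>g x\<bar>)" for x
  have c\<psi>: "continuous_on S \<psi>" for S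
    using der DERIV_isCont continuous_at_imp_continuous_on by blast
  have g1: "g integrable_on {a..b}" "(\<lambda>x. \<bar>g x\<bar>) integrable_on {a..b}"
    using g unfolding absolutely_integrable_on_def by auto
  have cG: "continuous_on {a..b} G"
    unfolding G_def by (rule indefinite_integral_continuous_1[OF g1(1)])
  have gp: "(\<lambda>x. g x * \<psi> x) integrable_on {a..b}" by (rule integrable_mult_cont[OF g c\<psi>])
  have Gp: "(\<lambda>x. G x * \<psi>' x) integrable_on {a..b}"
    by (intro integrable_continuous_real continuous_intros cG cont)
  \<comment> \<open>H vanishes at a, and its value at b is the defect of the claim, since G is zero
    at both ends.\<close>
  define H where "H x = integral {a..x} (\<lambda>x. g x * \<psi> x) + integral {a..x} (\<lambda>x. G x * \<psi>' x) - G x * \<psi> x" for x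
  obtain M where M: "M \<ge> 0" "\<And>x. x \<in> {a..b} \<Longrightarrow> \<bar>\<psi>' x\<bar> \<le> M"
  proof -
    have "bounded (\<psi>' ` {a..b})" using cont by (intro compact_imp_bounded compact_continuous_image) auto
    then obtain B where "\<forall>x\<in>\<psi>' ` {a..b}. norm x \<le> B" unfolding bounded_iff by blast
    then show ?thesis using that[of "max B 0"] by force
  qed
  have "\<bar>H y - H x\<bar> \<le> (2 * M) * (y - x) * (A y - A x)" if xy: "a \<le> x" "x \<le> y" "y \<le> b" for x y
  proof -
    have sub: "f integrable_on {a..y}" "f integrable_on {x..y}" if "f integrable_on {a..b}" for f :: "real \<Rightarrow> real"
      using integrable_on_subinterval[OF that] xy by auto
    have split: "integral {a..y} f - integral {a..x} f = integral {x..y} f" if "f integrable_on {a..b}"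
      for f :: "real \<Rightarrow> real"
      using Henstock_Kurzweil_Integration.integral_combine[OF xy(1,2) sub(1)[OF that]] by simp
    have osc: "\<bar>\<psi> s - \<psi> y\<bar> \<le> M * (y - x)" if "s \<in> {x..y}" for s
    proof -
      have "norm (\<psi> s - \<psi> y) \<le> M * norm (s - y)"
        by (rule field_differentiable_bound[of "{x..y}" \<psi> \<psi>'])
          (use that xy M(2) in \<open>auto intro: has_field_derivative_at_within der\<close>)
      also have "\<dots> \<le> M * (y - x)" using that M(1) by (intro mult_left_mono) auto
      finally show ?thesis by simp
    qed
    have Ay: "A y - A x = integral {x..y} (\<lambda>x. \<bar>g x\<bar>)" unfolding A_def by (rule split[OF g1(2)])
    have Gs: "\<bar>G s - G x\<bar> \<le> A y - A x" if s: "s \<in> {x..y}" for s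
    proof -
      have i: "g integrable_on {a..s}" "g integrable_on {x..s}" "(\<lambda>x. \<bar>g x\<bar>) integrable_on {x..s}"
        using integrable_on_subinterval[OF g1(1)] integrable_on_subinterval[OF g1(2)] s xy by auto
      have "G s - G x = integral {x..s} g"
        using Henstock_Kurzweil_Integration.integral_combine[OF xy(1) _ i(1)] s by (simp add: G_def)
      also have "norm \<dots> \<le> integral {x..s} (\<lambda>x. \<bar>g x\<bar>)"
        by (rule integral_norm_bound_integral[OF i(2,3)]) simp
      also have "\<dots> \<le> integral {x..y} (\<lambda>x. \<bar>g x\<bar>)"
        using s by (intro integral_subset_le i(3) sub(2)[OF g1(2)]) auto
      finally show ?thesis unfolding Ay by simp
    qed
    have c1: "continuous_on {x..y} (\<lambda>s. \<psi> s - \<psi> y)" by (intro continuous_intros c\<psi>)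
    have gs: "g absolutely_integrable_on {x..y}"
      by (rule absolutely_integrable_on_subinterval[OF g]) (use xy in auto)
    have "\<bar>integral {x..y} (\<lambda>s. g s * (\<psi> s - \<psi> y))\<bar> \<le> integral {x..y} (\<lambda>s. \<bar>g s\<bar> * (M * (y - x)))"
      unfolding real_norm_def[symmetric]
    proof (rule integral_norm_bound_integral)
      show "(\<lambda>s. g s * (\<psi> s - \<psi> y)) integrable_on {x..y}" by (rule integrable_mult_cont[OF gs c1])
      show "(\<lambda>s. norm (g s) * (M * (y - x))) integrable_on {x..y}"
        using sub(2)[OF g1(2)] by (intro integrable_on_mult_left) simp
      show "norm (g s * (\<psi> s - \<psi> y)) \<le> norm (g s) * (M * (y - x))" if "s \<in> {x..y}" for s
        using osc[OF that] by (simp add: abs_mult mult_left_mono)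
    qed
    then have I1: "\<bar>integral {x..y} (\<lambda>s. g s * (\<psi> s - \<psi> y))\<bar> \<le> M * (y - x) * (A y - A x)"
      unfolding Ay by (simp add: mult.commute)
    have cG': "continuous_on {x..y} G" "continuous_on {x..y} \<psi>'"
      using continuous_on_subset[OF cG] continuous_on_subset[OF cont] xy by auto
    have A0: "A y - A x \<ge> 0" using Gs[of x] xy by auto
    have "\<bar>integral {x..y} (\<lambda>s. (G s - G x) * \<psi>' s)\<bar> \<le> ((A y - A x) * M) * (y - x)"
      unfolding real_norm_def[symmetric]
    proof (rule integral_bound)
      show "norm ((G s - G x) * \<psi>' s) \<le> (A y - A x) * M" if "s \<in> {x..y}" for s
        unfolding real_norm_def abs_mult using that Gs[OF that] M(2)[of s] xy A0
        by (intro mult_mono) auto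
    qed (use xy in \<open>auto intro!: continuous_intros cG'\<close>)
    then have I2: "\<bar>integral {x..y} (\<lambda>s. (G s - G x) * \<psi>' s)\<bar> \<le> M * (y - x) * (A y - A x)"
      by (simp add: mult_ac)
    have ftc: "integral {x..y} \<psi>' = \<psi> y - \<psi> x"
      using fundamental_theorem_of_calculus[OF xy(2), of \<psi> \<psi>'] der
      by (intro integral_unique)
        (simp add: has_field_derivative_at_within flip: has_real_derivative_iff_has_vector_derivative)
    have "integral {x..y} (\<lambda>s. g s * (\<psi> s - \<psi> y)) = integral {x..y} (\<lambda>s. g s * \<psi> s - g s * \<psi> y)"
      by (simp add: right_diff_distrib)
    also have "\<dots> = integral {x..y} (\<lambda>s. g s * \<psi> s) - integral {x..y} (\<lambda>s. g s * \<psi> y)"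
      by (intro Henstock_Kurzweil_Integration.integral_diff sub(2)[OF gp] integrable_on_mult_left sub(2)[OF g1(1)])
    finally have e1: "integral {x..y} (\<lambda>s. g s * (\<psi> s - \<psi> y)) =
        integral {x..y} (\<lambda>s. g s * \<psi> s) - integral {x..y} g * \<psi> y"
      by simp
    have "integral {x..y} (\<lambda>s. (G s - G x) * \<psi>' s) = integral {x..y} (\<lambda>s. G s * \<psi>' s - G x * \<psi>' s)"
      by (simp add: left_diff_distrib)
    also have "\<dots> = integral {x..y} (\<lambda>s. G s * \<psi>' s) - integral {x..y} (\<lambda>s. G x * \<psi>' s)"
      by (intro Henstock_Kurzweil_Integration.integral_diff sub(2)[OF Gp] integrable_on_mult_right
          integrable_continuous_real cG')
    finally have e2: "integral {x..y} (\<lambda>s. (G s - G x) * \<psi>' s) =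
        integral {x..y} (\<lambda>s. G s * \<psi>' s) - G x * (\<psi> y - \<psi> x)"
      by (simp add: ftc)
    \<comment> \<open>Freezing \<psi> at y and G at x gives two integrals, each containing an
      oscillation over [x, y].\<close>
    have "H y - H x = integral {x..y} (\<lambda>s. g s * (\<psi> s - \<psi> y)) + integral {x..y} (\<lambda>s. (G s - G x) * \<psi>' s)"
      unfolding e1 e2 H_def split[OF gp, symmetric] split[OF Gp, symmetric] split[OF g1(1), symmetric] G_def[symmetric]
      by (simp add: algebra_simps)
    then show ?thesis using I1 I2 by (simp add: algebra_simps)
  qed
  then have "H b = H a" using M(1) by (intro constant_if_superlinear_increments[OF ab, of "2 * M" H A]) auto
  then show ?thesis unfolding H_def G_def using zero by simp
qed

section \<open>Antiderivatives and partial integration for periodic functions\<close>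

lemma periodic_antiderivative:
  fixes f :: "real \<Rightarrow> real"
  assumes ab: "a < b" and cont: "\<And>x. isCont f x" and per: "\<And>x. f (x + (b - a)) = f x"
    and zero: "integral {a..b} f = 0"
  obtains F where "\<And>x. (F has_real_derivative f x) (at x)" "\<And>x. F (x + (b - a)) = F x"
    "integral {a..b} F = 0"
proof -
  have "\<exists>F. \<forall>x :: real. -\<infinity> < ereal x \<longrightarrow> ereal x < \<infinity> \<longrightarrow> (F has_vector_derivative f x) (at x)"
    by (rule einterval_antiderivative) (auto intro: cont)
  then obtain F0 where F0: "\<And>x. (F0 has_real_derivative f x) (at x)"
    by (auto simp: has_real_derivative_iff_has_vector_derivative)
  \<comment> \<open>The increment over one period is constant, and its value at a is the integral of
    f, which is zero.\<close>
  have "((\<lambda>x. F0 (x + (b - a)) - F0 x) has_real_derivative 0) (at x)" for x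
  proof -
    have "((\<lambda>x. F0 (x + (b - a))) has_real_derivative f (x + (b - a))) (at x)"
      using F0[of "x + (b - a)"] by (simp only: DERIV_shift)
    from DERIV_diff[OF this F0[of x]] show ?thesis by (simp add: per)
  qed
  then have const: "F0 (x + (b - a)) - F0 x = F0 (y + (b - a)) - F0 y" for x y
    by (rule DERIV_isconst_all[rule_format])
  have "(f has_integral F0 b - F0 a) {a..b}"
    using ab F0 by (intro fundamental_theorem_of_calculus)
      (auto simp: has_field_derivative_at_within simp flip: has_real_derivative_iff_has_vector_derivative)
  then have "F0 b = F0 a" using zero by (simp add: integral_unique)
  then have per0: "F0 (x + (b - a)) = F0 x" for x using const[of x a] by simp
  \<comment> \<open>Normalising to mean zero allows the construction to be iterated.\<close>
  define m where "m = integral {a..b} F0 / (b - a)"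
  have cF0: "continuous_on {a..b} F0"
    using F0 DERIV_isCont continuous_at_imp_continuous_on by blast
  have "integral {a..b} (\<lambda>x. F0 x - m) = integral {a..b} F0 - m * (b - a)"
    using ab by (subst Henstock_Kurzweil_Integration.integral_diff)
      (auto intro!: integrable_continuous_real cF0 simp: mult.commute)
  also have "\<dots> = 0" using ab by (simp add: m_def)
  finally show ?thesis
    using F0 per0 by (intro that[of "\<lambda>x. F0 x - m"]) (auto intro!: derivative_eq_intros)
qed

lemma test_fun_antiderivative:
  assumes ab: "a < b" and \<psi>: "periodic_test_fun a b \<psi>" and zero: "integral {a..b} \<psi> = 0"
  obtains \<phi> where "periodic_test_fun a b \<phi>" "(deriv ^^ m) \<phi> = \<psi>"
proof -
  have "\<exists>\<phi>. periodic_test_fun a b \<phi> \<and> integral {a..b} \<phi> = 0 \<and> (deriv ^^ m) \<phi> = \<psi>"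
  proof (induction m)
    case 0
    then show ?case using \<psi> zero by auto
  next
    case (Suc m)
    then obtain \<phi> where \<phi>: "periodic_test_fun a b \<phi>" "integral {a..b} \<phi> = 0" "(deriv ^^ m) \<phi> = \<psi>" by blast
    obtain F where F: "\<And>x. (F has_real_derivative \<phi> x) (at x)" "\<And>x. F (x + (b - a)) = F x"
      "integral {a..b} F = 0"
      using periodic_antiderivative[OF ab test_fun_cont(1)[OF \<phi>(1)] _ \<phi>(2)] \<phi>(1)
      unfolding periodic_test_fun_iff by blast
    have "deriv F = \<phi>" using F(1) by (intro ext DERIV_imp_deriv)
    moreover have "diff_upto n F" for n
    proof (cases n)
      case 0
      then show ?thesis using diff_upto_zeroI[OF F(1)] by simp
    next
      case (Suc j)
      then show ?thesis using diff_uptoI[OF F(1)] \<phi>(1) unfolding periodic_test_fun_iff by blast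
    qed
    ultimately show ?case
      using F \<phi>(3) by (intro exI[of _ F]) (simp add: periodic_test_fun_iff funpow_swap1)
  qed
  then show ?thesis using that by blast
qed

lemma periodic_by_parts:
  fixes F f \<psi> :: "real \<Rightarrow> real"
  assumes ab: "a < b" and F: "\<And>x. (F has_real_derivative f x) (at x)" "\<And>x. F (x + (b - a)) = F x"
    and cf: "continuous_on {a..b} f"
    and \<psi>: "periodic_test_fun a b \<psi>"
  shows "integral {a..b} (\<lambda>x. F x * deriv \<psi> x) = - integral {a..b} (\<lambda>x. f x * \<psi> x)"
proof -
  have "((\<lambda>x. F x * deriv \<psi> x + f x * \<psi> x) has_integral F b * \<psi> b - F a * \<psi> a) {a..b}"
    by (rule fundamental_theorem_of_calculus)
      (use ab in \<open>auto intro!: derivative_eq_intros has_field_derivative_at_within[OF F(1)]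
        has_field_derivative_at_within[OF test_fun_deriv(1)[OF \<psi>]]
        simp flip: has_real_derivative_iff_has_vector_derivative\<close>)
  moreover have "F b = F a" "\<psi> b = \<psi> a"
    using F(2)[of a] \<psi> unfolding periodic_test_fun_iff by (auto dest: spec[of _ a])
  ultimately have "integral {a..b} (\<lambda>x. F x * deriv \<psi> x + f x * \<psi> x) = 0"
    by (simp add: integral_unique)
  moreover have "continuous_on {a..b} F"
    using F(1) DERIV_isCont continuous_at_imp_continuous_on by blast
  moreover have "continuous_on {a..b} \<psi>" "continuous_on {a..b} (deriv \<psi>)"
    using test_fun_cont(1)[OF \<psi>] test_fun_cont(1)[OF test_fun_deriv(2)[OF \<psi>]]
    by (auto intro: continuous_at_imp_continuous_on)
  ultimately show ?thesis
    by (subst (asm) Henstock_Kurzweil_Integration.integral_add)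
      (auto intro!: integrable_continuous_real continuous_intros cf)
qed

text \<open>
  The representation comes from iterated primitives of the weak derivative: they differ from \<open>f\<close> by
  a function orthogonal to all test functions of mean zero.
\<close>

lemma sobolev_representation:
  fixes f g :: "real \<Rightarrow> real" and i :: nat
  assumes ab: "a < b" and cont: "\<And>x. isCont f x" and per: "\<And>x. f (x + (b - a)) = f x"
    and g: "L2_fun a b g" and wd: "weak_deriv a b (Suc i) f g"
  obtains D E where "D 0 = f" "\<And>j x. j < i \<Longrightarrow> (D j has_real_derivative D (Suc j) x) (at x)"
    "\<And>j x. j \<le> i \<Longrightarrow> D j (x + (b - a)) = D j x"
    "energy_bound (b - a) ((L2_norm a b g)\<^sup>2) E (D i)"
proof -
  \<comment> \<open>Testing with a constant shows that g has mean zero, which makes its primitive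
    periodic.\<close>
  have d1: "(deriv ^^ Suc i) (\<lambda>x. 1) = (\<lambda>x::real. 0::real)"
    by (induction i) simp_all
  have zero: "integral {a..b} g = 0"
    using wd[unfolded weak_deriv_def, rule_format, OF test_fun_const[of a b 1], unfolded d1] by simp
  obtain G E where E: "energy_bound (b - a) ((L2_norm a b g)\<^sup>2) E G" "\<And>x. G (x + (b - a)) = G x"
    "\<And>x. x \<in> {a..b} \<Longrightarrow> G x = integral {a..x} g"
    by (rule L2_primitive[OF ab g zero]) (rule that)
  have cG: "isCont G x" for x by (rule energy_bound_isCont[OF E(1)]) (use ab in auto)
  have cG': "continuous_on {a..b} G" using cG continuous_at_imp_continuous_on by blast
  define m where "m = integral {a..b} G / (b - a)"
  define G0 where "G0 x = G x - m" for x
  have int_G0: "integral {a..b} G0 = 0"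
  proof -
    have "integral {a..b} G0 = integral {a..b} G - m * (b - a)"
      unfolding G0_def using ab by (subst Henstock_Kurzweil_Integration.integral_diff)
        (auto intro!: integrable_continuous_real cG' simp: mult.commute)
    then show ?thesis using ab by (simp add: m_def)
  qed
  have cG0: "isCont G0 x" for x unfolding G0_def by (intro continuous_intros cG)
  have E0: "energy_bound (b - a) ((L2_norm a b g)\<^sup>2) E G0"
    using E(1) unfolding energy_bound_def G0_def by simp
  have parts0: "integral {a..b} (\<lambda>x. G0 x * deriv \<psi> x) = - integral {a..b} (\<lambda>x. g x * \<psi> x)"
    if \<psi>: "periodic_test_fun a b \<psi>" for \<psi>
  proof -
    have c: "continuous_on {a..b} (deriv \<psi>)" "continuous_on {a..b} \<psi>"
      using test_fun_cont(1)[OF \<psi>] test_fun_cont(1)[OF test_fun_deriv(2)[OF \<psi>]]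
      by (auto intro: continuous_at_imp_continuous_on)
    have "integral {a..b} (\<lambda>x. G x * deriv \<psi> x) = integral {a..b} (\<lambda>x. integral {a..x} g * deriv \<psi> x)"
      by (intro integral_cong) (simp add: E(3))
    also have "\<dots> = - integral {a..b} (\<lambda>x. g x * \<psi> x)"
      by (rule integral_by_parts_primitive[OF ab L2_fun_integrable(1)[OF g] zero test_fun_deriv(1)[OF \<psi>] c(1)])
    finally have 1: "integral {a..b} (\<lambda>x. G x * deriv \<psi> x) = - integral {a..b} (\<lambda>x. g x * \<psi> x)" .
    have "(deriv \<psi> has_integral \<psi> b - \<psi> a) {a..b}"
      using ab by (intro fundamental_theorem_of_calculus)
        (auto intro: has_field_derivative_at_within test_fun_deriv(1)[OF \<psi>]
          simp flip: has_real_derivative_iff_has_vector_derivative)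
    moreover have "\<psi> b = \<psi> a" using \<psi> unfolding periodic_test_fun_iff by (auto dest: spec[of _ a])
    ultimately have 2: "integral {a..b} (deriv \<psi>) = 0" by (simp add: integral_unique)
    have "integral {a..b} (\<lambda>x. G0 x * deriv \<psi> x) =
        integral {a..b} (\<lambda>x. G x * deriv \<psi> x - m * deriv \<psi> x)"
      unfolding G0_def by (simp add: left_diff_distrib)
    also have "\<dots> = integral {a..b} (\<lambda>x. G x * deriv \<psi> x) - integral {a..b} (\<lambda>x. m * deriv \<psi> x)"
      by (intro Henstock_Kurzweil_Integration.integral_diff integrable_continuous_real continuous_intros cG' c)
    finally show ?thesis using 1 2 by simp
  qed
  \<comment> \<open>\<open>P i D\<close> says that \<open>D 0\<close> is an i-fold periodic
    antiderivative of \<open>G0\<close> that satisfies the same weak equation of order i + 1 as f.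
    Each induction step integrates once more and shifts the indices.\<close>
  define P where "P i D \<longleftrightarrow> D i = G0 \<and> (\<forall>j<i. \<forall>x. (D j has_real_derivative D (Suc j) x) (at x)) \<and>
      (\<forall>j\<le>i. \<forall>x. D j (x + (b - a)) = D j x) \<and> (\<forall>x. isCont (D 0) x) \<and> integral {a..b} (D 0) = 0 \<and>
      (\<forall>\<psi>. periodic_test_fun a b \<psi> \<longrightarrow>
         integral {a..b} (\<lambda>x. D 0 x * (deriv ^^ Suc i) \<psi> x) = (- 1) ^ Suc i * integral {a..b} (\<lambda>x. g x * \<psi> x))"
    for i and D :: "nat \<Rightarrow> real \<Rightarrow> real"
  have "\<exists>D. P i D"
  proof (induction i)
    case 0
    show ?case
      unfolding P_def using parts0 cG0 int_G0 E(2) by (intro exI[of _ "\<lambda>_. G0"]) (simp add: G0_def[abs_def])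
  next
    case (Suc i)
    then obtain D where "P i D" ..
    then have D: "D i = G0" "\<And>j x. j < i \<Longrightarrow> (D j has_real_derivative D (Suc j) x) (at x)"
      "\<And>j x. j \<le> i \<Longrightarrow> D j (x + (b - a)) = D j x" "\<And>x. isCont (D 0) x" "integral {a..b} (D 0) = 0"
      "\<And>\<psi>. periodic_test_fun a b \<psi> \<Longrightarrow>
         integral {a..b} (\<lambda>x. D 0 x * (deriv ^^ Suc i) \<psi> x) = (- 1) ^ Suc i * integral {a..b} (\<lambda>x. g x * \<psi> x)"
      unfolding P_def by (elim conjE, simp)+
    obtain F where F: "\<And>x. (F has_real_derivative D 0 x) (at x)" "\<And>x. F (x + (b - a)) = F x"
      "integral {a..b} F = 0"
      by (rule periodic_antiderivative[OF ab D(4) D(3)[OF le0] D(5)]) (rule that)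
    define D' where "D' j = (case j of 0 \<Rightarrow> F | Suc j \<Rightarrow> D j)" for j
    have "(D' j has_real_derivative D' (Suc j) x) (at x)" if "j < Suc i" for j x
      using that F(1) D(2) by (cases j) (auto simp: D'_def)
    moreover have "D' j (x + (b - a)) = D' j x" if "j \<le> Suc i" for j x
      using that F(2) D(3) by (cases j) (auto simp: D'_def)
    moreover have "integral {a..b} (\<lambda>x. F x * (deriv ^^ Suc (Suc i)) \<psi> x) =
        (- 1) ^ Suc (Suc i) * integral {a..b} (\<lambda>x. g x * \<psi> x)" if \<psi>: "periodic_test_fun a b \<psi>" for \<psi>
    proof -
      have t: "periodic_test_fun a b ((deriv ^^ n) \<psi>)" for n
        by (induction n) (auto simp: \<psi> test_fun_deriv)
      have c: "continuous_on {a..b} (D 0)" using D(4) by (simp add: continuous_at_imp_continuous_on)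
      have "integral {a..b} (\<lambda>x. F x * (deriv ^^ Suc (Suc i)) \<psi> x) =
          integral {a..b} (\<lambda>x. F x * deriv ((deriv ^^ Suc i) \<psi>) x)" by simp
      also have "\<dots> = - integral {a..b} (\<lambda>x. D 0 x * (deriv ^^ Suc i) \<psi> x)"
        by (rule periodic_by_parts[OF ab F(1,2) c t])
      also have "\<dots> = - ((- 1) ^ Suc i * integral {a..b} (\<lambda>x. g x * \<psi> x))"
        by (simp only: D(6)[OF \<psi>])
      finally show ?thesis by simp
    qed
    moreover have "isCont F x" for x by (rule DERIV_isCont[OF F(1)])
    moreover have "D' 0 = F" "D' (Suc i) = G0" using D(1) by (simp_all add: D'_def)
    ultimately have "P (Suc i) D'" unfolding P_def using F(3) by (simp del: funpow.simps)
    then show ?case by (rule exI[of _ D'])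
  qed
  then obtain D where "P i D" ..
  then have D: "D i = G0" "\<And>j x. j < i \<Longrightarrow> (D j has_real_derivative D (Suc j) x) (at x)"
      "\<And>j x. j \<le> i \<Longrightarrow> D j (x + (b - a)) = D j x" "\<And>x. isCont (D 0) x" "integral {a..b} (D 0) = 0"
      "\<And>\<psi>. periodic_test_fun a b \<psi> \<Longrightarrow>
         integral {a..b} (\<lambda>x. D 0 x * (deriv ^^ Suc i) \<psi> x) = (- 1) ^ Suc i * integral {a..b} (\<lambda>x. g x * \<psi> x)"
    unfolding P_def by (elim conjE, simp)+
  have cf: "continuous_on {a..b} f" "continuous_on {a..b} (D 0)"
    using cont D(4) continuous_at_imp_continuous_on by blast+
  define \<mu> where "\<mu> = integral {a..b} f / (b - a)"
  define F where "F x = f x - D 0 x - \<mu>" for x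
  have cF: "isCont F x" for x unfolding F_def by (intro continuous_intros cont D(4))
  then have cF': "continuous_on {a..b} F" using continuous_at_imp_continuous_on by blast
  have int_F: "integral {a..b} F = 0"
  proof -
    have "integral {a..b} F = integral {a..b} f - integral {a..b} (D 0) - \<mu> * (b - a)"
      unfolding F_def using ab
      by (simp add: Henstock_Kurzweil_Integration.integral_diff integrable_continuous_real cf continuous_intros mult.commute)
    then show ?thesis using ab D(5) by (simp add: \<mu>_def)
  qed
  have "F x = 0" for x
  proof (rule test_fun_kernel[OF ab cF])
    show "F (x + (b - a)) = F x" for x unfolding F_def using per D(3)[of 0] by simp
    fix \<phi> assume \<phi>: "periodic_test_fun a b \<phi>"
    \<comment> \<open>Only mean-free test functions have periodic antiderivatives; the mean part of
      \<phi> is handled by the zero mean of F.\<close>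
    define s where "s = integral {a..b} \<phi> / (b - a)"
    have c\<phi>: "continuous_on {a..b} \<phi>" using test_fun_cont(1)[OF \<phi>] continuous_at_imp_continuous_on by blast
    have t: "periodic_test_fun a b (\<lambda>x. \<phi> x + - s)" by (rule test_fun_add_const[OF \<phi>])
    have "integral {a..b} (\<lambda>x. \<phi> x + - s) = integral {a..b} \<phi> - s * (b - a)"
      using ab by (simp add: Henstock_Kurzweil_Integration.integral_diff integrable_continuous_real c\<phi> mult.commute)
    then have z: "integral {a..b} (\<lambda>x. \<phi> x + - s) = 0" using ab by (simp add: s_def)
    obtain \<psi> where \<psi>: "periodic_test_fun a b \<psi>" "(deriv ^^ Suc i) \<psi> = (\<lambda>x. \<phi> x + - s)"
      by (rule test_fun_antiderivative[OF ab t z])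
    have "integral {a..b} (\<lambda>x. f x * (\<phi> x + - s)) = integral {a..b} (\<lambda>x. D 0 x * (\<phi> x + - s))"
      using wd[unfolded weak_deriv_def, rule_format, OF \<psi>(1)] D(6)[OF \<psi>(1)] unfolding \<psi>(2) by simp
    moreover have "integral {a..b} (\<lambda>x. F x * \<phi> x) =
      integral {a..b} (\<lambda>x. f x * (\<phi> x + - s) - D 0 x * (\<phi> x + - s) - \<mu> * (\<phi> x + - s) + s * F x)"
      by (intro integral_cong) (simp add: F_def algebra_simps)
    moreover have "((\<lambda>x. f x * (\<phi> x + - s) - D 0 x * (\<phi> x + - s) - \<mu> * (\<phi> x + - s) + s * F x) has_integral
        integral {a..b} (\<lambda>x. f x * (\<phi> x + - s)) - integral {a..b} (\<lambda>x. D 0 x * (\<phi> x + - s))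
       - \<mu> * integral {a..b} (\<lambda>x. \<phi> x + - s) + s * integral {a..b} F) {a..b}"
      by (intro has_integral_add has_integral_diff has_integral_mult_right integrable_integral
          integrable_continuous_real continuous_intros cf cF' c\<phi>)
    ultimately show "integral {a..b} (\<lambda>x. F x * \<phi> x) = 0" using z int_F by (simp add: integral_unique)
  qed
  then have "f x - D 0 x - \<mu> = 0" for x unfolding F_def by blast
  then have f_eq: "f x = D 0 x + \<mu>" for x by (metis diff_diff_add right_minus_eq)
  \<comment> \<open>The constant \<mu> affects the entry of index 0 alone, so the higher derivatives
    are kept.\<close>
  define D' where "D' j = (if j = 0 then f else D j)" for j
  show ?thesis
  proof (rule that[of D' E])
    show "D' 0 = f" by (simp add: D'_def)
    show "D' j (x + (b - a)) = D' j x" if "j \<le> i" for j x using that D(3) per by (simp add: D'_def)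
    show "energy_bound (b - a) ((L2_norm a b g)\<^sup>2) E (D' i)"
      using E0 D(1) f_eq by (cases "i = 0") (auto simp: D'_def energy_bound_def)
    show "(D' j has_real_derivative D' (Suc j) x) (at x)" if "j < i" for j x
    proof (cases "j = 0")
      case True
      have "((\<lambda>x. D 0 x + \<mu>) has_real_derivative D (Suc 0) x) (at x)"
        using D(2)[of 0 x] that by (auto intro!: derivative_eq_intros)
      moreover have "(\<lambda>x. D 0 x + \<mu>) = f" using f_eq by auto
      ultimately show ?thesis using True by (simp add: D'_def)
    next
      case False
      then show ?thesis using D(2)[OF that] by (simp add: D'_def)
    qed
  qed
qed

section \<open>The advection equation\<close>

lemma L2_norm_square: "L2_fun a b g \<Longrightarrow> (L2_norm a b g)\<^sup>2 = integral {a..b} (\<lambda>x. (g x)\<^sup>2)"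
  unfolding L2_norm_def
  by (simp add: Henstock_Kurzweil_Integration.integral_nonneg[OF L2_fun_integrable(2)])

lemma L2_norm_lin:
  assumes "L2_fun a b f" "L2_fun a b g"
  shows "(L2_norm a b (\<lambda>x. s * f x + s * g x))\<^sup>2 \<le> 2 * s\<^sup>2 * ((L2_norm a b f)\<^sup>2 + (L2_norm a b g)\<^sup>2)"
proof -
  note L2 = L2_fun_lin[OF assms, of s s]
  have "integral {a..b} (\<lambda>x. (s * f x + s * g x)\<^sup>2) \<le>
      integral {a..b} (\<lambda>x. 2 * s\<^sup>2 * ((f x)\<^sup>2 + (g x)\<^sup>2))"
  proof (rule integral_le[OF L2_fun_integrable(2)[OF L2]])
    show "(\<lambda>x. 2 * s\<^sup>2 * ((f x)\<^sup>2 + (g x)\<^sup>2)) integrable_on {a..b}"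
      by (intro integrable_on_mult_right integrable_add L2_fun_integrable(2) assms)
    fix x
    have "0 \<le> (s * f x - s * g x)\<^sup>2" by simp
    then show "(s * f x + s * g x)\<^sup>2 \<le> 2 * s\<^sup>2 * ((f x)\<^sup>2 + (g x)\<^sup>2)"
      by (simp add: power2_eq_square algebra_simps)
  qed
  also have "\<dots> = 2 * s\<^sup>2 * (integral {a..b} (\<lambda>x. (f x)\<^sup>2) + integral {a..b} (\<lambda>x. (g x)\<^sup>2))"
    by (simp add: Henstock_Kurzweil_Integration.integral_add L2_fun_integrable(2) assms)
  finally show ?thesis by (simp add: L2_norm_square L2 assms)
qed

lemma weak_deriv_lin:
  assumes "weak_deriv a b j f1 g1" "weak_deriv a b j f2 g2"
    and "L2_fun a b f1" "L2_fun a b g1" "L2_fun a b f2" "L2_fun a b g2"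
  shows "weak_deriv a b j (\<lambda>x. s * f1 x + t * f2 x) (\<lambda>x. s * g1 x + t * g2 x)"
  unfolding weak_deriv_def
proof (intro allI impI)
  fix \<phi> assume \<phi>: "periodic_test_fun a b \<phi>"
  have c: "continuous_on {a..b} \<phi>" "continuous_on {a..b} ((deriv ^^ j) \<phi>)"
    using test_fun_cont[OF \<phi>] continuous_at_imp_continuous_on by blast+
  have lin: "integral {a..b} (\<lambda>x. (s * p x + t * q x) * \<psi> x) =
      s * integral {a..b} (\<lambda>x. p x * \<psi> x) + t * integral {a..b} (\<lambda>x. q x * \<psi> x)"
    if "L2_fun a b p" "L2_fun a b q" "continuous_on {a..b} \<psi>" for p q \<psi>
  proof -
    note i = integrable_mult_cont(2)[OF L2_fun_integrable(1) that(3)]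
    have "integral {a..b} (\<lambda>x. (s * p x + t * q x) * \<psi> x) =
        integral {a..b} (\<lambda>x. s * (p x * \<psi> x) + t * (q x * \<psi> x))" by (simp add: algebra_simps)
    also have "\<dots> = integral {a..b} (\<lambda>x. s * (p x * \<psi> x)) + integral {a..b} (\<lambda>x. t * (q x * \<psi> x))"
      by (intro Henstock_Kurzweil_Integration.integral_add integrable_on_mult_right i that)
    finally show ?thesis by simp
  qed
  show "integral {a..b} (\<lambda>x. (s * f1 x + t * f2 x) * (deriv ^^ j) \<phi> x) =
      (- 1) ^ j * integral {a..b} (\<lambda>x. (s * g1 x + t * g2 x) * \<phi> x)"
    unfolding lin[OF assms(3,5) c(2)] lin[OF assms(4,6) c(1)]
      assms(1)[unfolded weak_deriv_def, rule_format, OF \<phi>] assms(2)[unfolded weak_deriv_def, rule_format, OF \<phi>]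
    by (simp add: distrib_left mult_ac)
qed

text \<open>The function attains its mean value somewhere, and the oscillation around it is
  controlled by the weak derivative. The mean is estimated through a weak derivative of order zero
  because the Sobolev norm is defined with a chosen representative of it.\<close>

lemma sobolev_sup_bound:
  assumes ab: "a < b" and cont: "\<And>x. isCont f x" and per: "\<And>x. f (x + (b - a)) = f x"
    and g0: "L2_fun a b g0" "weak_deriv a b 0 f g0" and g1: "L2_fun a b g1" "weak_deriv a b 1 f g1"
  shows "(f x)\<^sup>2 \<le> 2 * (b - a) * (L2_norm a b g1)\<^sup>2 + 2 / (b - a) * (L2_norm a b g0)\<^sup>2"
proof -
  define L where "L = b - a"
  have L: "L > 0" using ab by (simp add: L_def)
  obtain D E where DE: "D 0 = f" "energy_bound (b - a) ((L2_norm a b g1)\<^sup>2) E (D 0)"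
  proof -
    have wd: "weak_deriv a b (Suc 0) f g1" using g1(2) by simp
    show thesis by (rule sobolev_representation[OF ab cont per g1(1) wd]) (rule that)
  qed
  have osc: "(f x - f y)\<^sup>2 \<le> L * (L2_norm a b g1)\<^sup>2" if "\<bar>x - y\<bar> \<le> L" for x y
  proof -
    have "(f x - f y)\<^sup>2 \<le> \<bar>x - y\<bar> * (L2_norm a b g1)\<^sup>2"
      by (rule energy_bound_abs[OF DE(2)[unfolded DE(1)]]) (use that in \<open>auto simp: L_def\<close>)
    also have "\<dots> \<le> L * (L2_norm a b g1)\<^sup>2" using that by (intro mult_right_mono) auto
    finally show ?thesis .
  qed
  have cf: "continuous_on {a..b} f" using cont continuous_at_imp_continuous_on by blast
  define \<mu> where "\<mu> = integral {a..b} f / L"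
  have "integral {a..b} f = integral {a..b} g0"
    using g0(2)[unfolded weak_deriv_def, rule_format, OF test_fun_const[of a b 1]] by simp
  then have "\<mu>\<^sup>2 = (integral {a..b} g0)\<^sup>2 / L\<^sup>2" by (simp add: \<mu>_def power_divide)
  also have "\<dots> \<le> (L * (L2_norm a b g0)\<^sup>2) / L\<^sup>2"
  proof -
    have "(integral {a..b} g0)\<^sup>2 \<le> (b - a) * integral {a..b} (\<lambda>x. (g0 x)\<^sup>2)"
      using L2_fun_integrable[OF g0(1)] ab set_lebesgue_integral_eq_integral(1)
      by (intro integral_square_le) auto
    then show ?thesis using g0(1) by (intro divide_right_mono) (simp_all add: L2_norm_square L_def)
  qed
  also have "\<dots> = (L2_norm a b g0)\<^sup>2 / L" using L by (simp add: power2_eq_square)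
  finally have \<mu>: "\<mu>\<^sup>2 \<le> (L2_norm a b g0)\<^sup>2 / L" .
  have main: "(f z)\<^sup>2 \<le> 2 * L * (L2_norm a b g1)\<^sup>2 + 2 / L * (L2_norm a b g0)\<^sup>2" if z: "z \<in> {a..<b}" for z
  proof -
    have "\<exists>y\<in>{a..b}. f y = \<mu>"
    proof -
      have "((\<lambda>x. f x - \<mu>) has_integral integral {a..b} f - \<mu> * L) {a..b}"
        using has_integral_const_real[of \<mu> a b] ab
        by (intro has_integral_diff integrable_integral integrable_continuous_real cf)
          (simp add: L_def mult.commute)
      then have zero: "((\<lambda>x. f x - \<mu>) has_integral 0) {a..b}" using L by (simp add: \<mu>_def)
      show ?thesis
      proof (rule ccontr)
        assume no: "\<not> (\<exists>y\<in>{a..b}. f y = \<mu>)"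
        have pos: False if "continuous_on {a..b} p" "(p has_integral 0) {a..b}" "\<And>x. x \<in> {a..b} \<Longrightarrow> p x > 0"
          for p :: "real \<Rightarrow> real"
        proof -
          have "p a = 0" using integral_eq_0_iff[OF that(1) ab] that(2,3) ab
            by (auto simp: integral_unique less_imp_le)
          then show False using that(3)[of a] ab by simp
        qed
        have "(\<forall>y\<in>{a..b}. f y > \<mu>) \<or> (\<forall>y\<in>{a..b}. f y < \<mu>)"
        proof (rule ccontr)
          assume n: "\<not> ?thesis"
          from n obtain p where p: "p \<in> {a..b}" "\<not> f p > \<mu>" by blast
          from n obtain q where q: "q \<in> {a..b}" "\<not> f q < \<mu>" by blast
          have "connected (f ` {a..b})" by (intro connected_continuous_image cf) simp
          moreover have "f p \<in> f ` {a..b}" "f q \<in> f ` {a..b}" using p q by blast+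
          ultimately have "{f p..f q} \<subseteq> f ` {a..b}" by (rule connected_contains_Icc)
          then have "\<mu> \<in> f ` {a..b}" using p q by (auto simp: not_less)
          then show False using no by auto
        qed
        moreover have c: "continuous_on {a..b} (\<lambda>x. f x - \<mu>)" "continuous_on {a..b} (\<lambda>x. - (f x - \<mu>))"
          by (intro continuous_intros cf)+
        moreover have "((\<lambda>x. - (f x - \<mu>)) has_integral 0) {a..b}"
          using has_integral_neg[OF zero] by simp
        ultimately show False using pos[OF c(1) zero] pos[OF c(2)] by force
      qed
    qed
    then obtain y where y: "y \<in> {a..b}" "f y = \<mu>" by blast
    have "(f z - \<mu>)\<^sup>2 \<le> L * (L2_norm a b g1)\<^sup>2" using osc[of z y] y z by (auto simp: L_def)
    moreover have "(f z)\<^sup>2 \<le> 2 * (f z - \<mu>)\<^sup>2 + 2 * \<mu>\<^sup>2"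
      using zero_le_power2[of "(f z - \<mu>) - \<mu>"] by (simp add: power2_eq_square algebra_simps)
    ultimately show ?thesis using \<mu> by (simp add: algebra_simps)
  qed
  interpret periodic_fun_simple f "b - a" by standard (rule per)
  define n where "n = \<lfloor>(x - a) / (b - a)\<rfloor>"
  have "of_int n \<le> (x - a) / (b - a)" "(x - a) / (b - a) < of_int n + 1" unfolding n_def by linarith+
  then have "x - of_int n * (b - a) \<in> {a..<b}" using ab by (auto simp: field_simps)
  from main[OF this] show ?thesis by (simp only: L_def minus_of_int)
qed

lemma Sobolev_norm_ge:
  assumes "j \<le> m" "L2_fun a b (SOME g. L2_fun a b g \<and> weak_deriv a b j f g)"
  shows "(L2_norm a b (SOME g. L2_fun a b g \<and> weak_deriv a b j f g))\<^sup>2 \<le> (Sobolev_norm a b m f)\<^sup>2"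
proof -
  let ?N = "\<lambda>j. (L2_norm a b (SOME g. L2_fun a b g \<and> weak_deriv a b j f g))\<^sup>2"
  have "?N j \<le> (\<Sum>j\<le>m. ?N j)" using assms(1) by (intro member_le_sum) auto
  also have "\<dots> = (Sobolev_norm a b m f)\<^sup>2" unfolding Sobolev_norm_def by (simp add: sum_nonneg)
  finally show ?thesis .
qed

text \<open>Near t the difference quotient minus v(t) is bounded in the Sobolev norm, so u(s) - u(t)
  is O(|s - t|) in the norms of order 0 and 1, and the sup bound makes this uniform in x.\<close>

lemma C1_Sobolev_uniformly_continuous:
  assumes ab: "a < b" and m: "m \<ge> 1" and C1: "C1_Sobolev a b m T u"
    and cont: "\<And>t x. t \<in> {0..T} \<Longrightarrow> isCont (u t) x" and t: "t \<in> {0..T}" and e: "e > 0"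
  shows "\<exists>d>0. \<forall>s\<in>{0..T}. \<bar>s - t\<bar> < d \<longrightarrow> (\<forall>x. \<bar>u s x - u t x\<bar> < e)"
proof -
  obtain v where v: "Sobolev_fun a b m (v t)"
    "((\<lambda>s. Sobolev_norm a b m (\<lambda>x. (u s x - u t x) / (s - t) - v t x)) \<longlongrightarrow> 0) (at t within {0..T})"
    using C1 t unfolding C1_Sobolev_def by blast
  have su: "Sobolev_fun a b m (u s)" if "s \<in> {0..T}" for s using C1 that unfolding C1_Sobolev_def by blast
  define W where "W s x = (u s x - u t x) / (s - t) - v t x" for s x
  have "((\<lambda>s. Sobolev_norm a b m (W s)) \<longlongrightarrow> 0) (at t within {0..T})"
    using v(2) unfolding W_def[abs_def] .
  from tendstoD[OF this zero_less_one] obtain d0 where "d0 > 0"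
    "\<forall>s\<in>{0..T}. s \<noteq> t \<and> \<bar>s - t\<bar> < d0 \<longrightarrow> \<bar>Sobolev_norm a b m (W s) - 0\<bar> < 1"
    unfolding eventually_at dist_real_def by (elim exE conjE) (rule that)
  then have d0: "d0 > 0"
    "\<And>s. s \<in> {0..T} \<Longrightarrow> s \<noteq> t \<Longrightarrow> \<bar>s - t\<bar> < d0 \<Longrightarrow> \<bar>Sobolev_norm a b m (W s)\<bar> < 1"
    by simp_all
  obtain V where V: "\<And>j. j \<le> 1 \<Longrightarrow> L2_fun a b (V j)" "\<And>j. j \<le> 1 \<Longrightarrow> weak_deriv a b j (v t) (V j)"
  proof -
    have "\<forall>j\<in>{..m}. \<exists>g. L2_fun a b g \<and> weak_deriv a b j (v t) g" using v(1) unfolding Sobolev_fun_def by auto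
    from bchoice[OF this] obtain V where "\<forall>j\<in>{..m}. L2_fun a b (V j) \<and> weak_deriv a b j (v t) (V j)" ..
    then show ?thesis using m by (intro that[of V]) auto
  qed
  \<comment> \<open>The constants of the sup bound, with the squared norms replaced by 2 (1 + the
    squared norm of the weak derivative of v(t)) and the factor (s - t)^2 taken out.\<close>
  define K where "K = 2 * (b - a) * (2 * (1 + (L2_norm a b (V 1))\<^sup>2)) + 2 / (b - a) * (2 * (1 + (L2_norm a b (V 0))\<^sup>2))"
  have p1: "1 + z\<^sup>2 > 0" for z :: real by (simp add: add_pos_nonneg)
  have K: "K > 0" unfolding K_def using ab by (intro add_pos_pos mult_pos_pos divide_pos_pos p1) auto
  have bound: "(u s x - u t x)\<^sup>2 \<le> (s - t)\<^sup>2 * K" if s: "s \<in> {0..T}" "s \<noteq> t" "\<bar>s - t\<bar> < d0" for s x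
  proof -
    define w where "w x = u s x - u t x" for x
    \<comment> \<open>The representatives used by the Sobolev norm. They are weak derivatives
      because a witness can be built from those of u(s), u(t) and v(t).\<close>
    define G where "G j = (SOME g. L2_fun a b g \<and> weak_deriv a b j (W s) g)" for j
    have l2: "L2_fun a b (u s)" "L2_fun a b (u t)" "L2_fun a b (v t)"
      using su[OF s(1)] su[OF t] v(1) unfolding Sobolev_fun_def by auto
    have W_eq: "W s = (\<lambda>x. (1 / (s - t)) * (1 * u s x + (- 1) * u t x) + (- 1) * v t x)"
      unfolding W_def by auto
    have W2: "L2_fun a b (W s)" unfolding W_eq by (rule L2_fun_lin[OF L2_fun_lin[OF l2(1,2)] l2(3)])
    have Gj: "L2_fun a b (G j)" "weak_deriv a b j (W s) (G j)" if j: "j \<le> 1" for j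
    proof -
      have jm: "j \<le> m" using j m by simp
      obtain gs gt where g: "L2_fun a b gs" "weak_deriv a b j (u s) gs" "L2_fun a b gt" "weak_deriv a b j (u t) gt"
        using su[OF s(1)] su[OF t] jm unfolding Sobolev_fun_def by blast
      note L = L2_fun_lin[OF g(1,3), of 1 "- 1"] L2_fun_lin[OF l2(1,2), of 1 "- 1"]
      have "L2_fun a b (\<lambda>x. (1 / (s - t)) * (1 * gs x + (- 1) * gt x) + (- 1) * V j x) \<and>
        weak_deriv a b j (W s) (\<lambda>x. (1 / (s - t)) * (1 * gs x + (- 1) * gt x) + (- 1) * V j x)"
        unfolding W_eq
        by (rule conjI[OF L2_fun_lin[OF L(1) V(1)[OF j]]
              weak_deriv_lin[OF weak_deriv_lin[OF g(2,4) l2(1) g(1) l2(2) g(3)] V(2)[OF j] L(2,1) l2(3) V(1)[OF j]]])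
      then have "L2_fun a b (G j) \<and> weak_deriv a b j (W s) (G j)" unfolding G_def
        by (rule someI[where P = "\<lambda>g. L2_fun a b g \<and> weak_deriv a b j (W s) g"])
      then show "L2_fun a b (G j)" "weak_deriv a b j (W s) (G j)" by auto
    qed
    have Gn: "(L2_norm a b (G j))\<^sup>2 \<le> 1" if j: "j \<le> 1" for j
    proof -
      have "(L2_norm a b (G j))\<^sup>2 \<le> (Sobolev_norm a b m (W s))\<^sup>2"
        unfolding G_def by (rule Sobolev_norm_ge) (use j m Gj(1)[OF j, unfolded G_def] in simp_all)
      also have "\<dots> \<le> 1" using d0(2)[OF s] by (simp add: abs_square_le_1)
      finally show ?thesis .
    qed
    have w_eq: "w = (\<lambda>x. (s - t) * W s x + (s - t) * v t x)"
    proof (rule ext)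
      fix x
      have "(s - t) * (q - v t x) + (s - t) * v t x = (s - t) * q" for q by (simp add: right_diff_distrib)
      then show "w x = (s - t) * W s x + (s - t) * v t x"
        unfolding w_def W_def using s(2) by simp
    qed
    define H where "H j x = (s - t) * G j x + (s - t) * V j x" for j x
    have H: "L2_fun a b (H j)" "weak_deriv a b j w (H j)" if "j \<le> 1" for j
    proof -
      show "L2_fun a b (H j)"
        unfolding H_def[abs_def] by (rule L2_fun_lin[OF Gj(1)[OF that] V(1)[OF that]])
      show "weak_deriv a b j w (H j)"
        unfolding H_def[abs_def] w_eq
        by (rule weak_deriv_lin[OF Gj(2)[OF that] V(2)[OF that] W2 Gj(1)[OF that] l2(3) V(1)[OF that]])
    qed
    have Hn: "(L2_norm a b (H j))\<^sup>2 \<le> 2 * (s - t)\<^sup>2 * (1 + (L2_norm a b (V j))\<^sup>2)" if j: "j \<le> 1" for j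
    proof -
      have "(L2_norm a b (H j))\<^sup>2 \<le> 2 * (s - t)\<^sup>2 * ((L2_norm a b (G j))\<^sup>2 + (L2_norm a b (V j))\<^sup>2)"
        unfolding H_def[abs_def] by (rule L2_norm_lin) (use j Gj V in auto)
      also have "\<dots> \<le> 2 * (s - t)\<^sup>2 * (1 + (L2_norm a b (V j))\<^sup>2)"
        using Gn[OF j] by (intro mult_left_mono add_right_mono) auto
      finally show ?thesis .
    qed
    have "(w x)\<^sup>2 \<le> 2 * (b - a) * (L2_norm a b (H 1))\<^sup>2 + 2 / (b - a) * (L2_norm a b (H 0))\<^sup>2"
    proof (rule sobolev_sup_bound[where f = w, OF ab])
      show "isCont w x" for x unfolding w_def by (intro continuous_intros cont s t)
      show "w (x + (b - a)) = w x" for x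
        using su[OF s(1)] su[OF t] unfolding w_def Sobolev_fun_def periodic_fun_simple_def by simp
    qed (use H in auto)
    also have "\<dots> \<le> 2 * (b - a) * (2 * (s - t)\<^sup>2 * (1 + (L2_norm a b (V 1))\<^sup>2))
        + 2 / (b - a) * (2 * (s - t)\<^sup>2 * (1 + (L2_norm a b (V 0))\<^sup>2))"
      using Hn[of 0] Hn[of 1] ab by (intro add_mono mult_left_mono) auto
    also have "\<dots> = (s - t)\<^sup>2 * K" unfolding K_def by (simp add: algebra_simps)
    finally show ?thesis unfolding w_def .
  qed
  define d where "d = min d0 (e / sqrt K)"
  have "\<bar>u s x - u t x\<bar> < e" if s: "s \<in> {0..T}" "\<bar>s - t\<bar> < d" for s x
  proof (cases "s = t")
    case False
    have "\<bar>s - t\<bar> < e / sqrt K" "\<bar>s - t\<bar> < d0" using s by (auto simp: d_def)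
    then have "\<bar>s - t\<bar> * sqrt K < e" using K by (simp add: pos_less_divide_eq)
    then have "(\<bar>s - t\<bar> * sqrt K)\<^sup>2 < e\<^sup>2" using e K by (intro power_strict_mono) auto
    then have "(s - t)\<^sup>2 * K < e\<^sup>2" using K by (simp add: power_mult_distrib)
    then have "\<bar>u s x - u t x\<bar>\<^sup>2 < e\<^sup>2" using bound[OF s(1) False \<open>\<bar>s - t\<bar> < d0\<close>, of x] by simp
    then show ?thesis using e power2_less_imp_less[of "\<bar>u s x - u t x\<bar>" e] by simp
  qed (use e in simp)
  moreover have "d > 0" using d0 e K by (simp add: d_def)
  ultimately show ?thesis by blast
qed

text \<open>Maximum principle: \<open>w - \<epsilon> t\<close> cannot attain its maximum at a positive time.\<close>

lemma advection_max_principle: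
  fixes w w\<^sub>x :: "real \<Rightarrow> real \<Rightarrow> real"
  assumes ab: "a < b" and T: "T \<ge> 0" and cont: "continuous_on ({0..T} \<times> {a..b}) (\<lambda>(t, x). w t x)"
    and per: "\<And>t x. t \<in> {0..T} \<Longrightarrow> w t (x + (b - a)) = w t x"
    and dx: "\<And>t x. t \<in> {0..T} \<Longrightarrow> (w t has_real_derivative w\<^sub>x t x) (at x)"
    and dt: "\<And>t x. t \<in> {0..T} \<Longrightarrow> ((\<lambda>s. w s x) has_real_derivative - w\<^sub>x t x) (at t within {0..T})"
    and init: "\<And>x. w 0 x \<le> 0" and t: "t \<in> {0..T}"
  shows "w t x \<le> 0"
proof -
  have wrap: "\<exists>y\<in>{a..b}. w s x = w s y" if "s \<in> {0..T}" for s x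
  proof -
    interpret periodic_fun_simple "w s" "b - a" by standard (rule per[OF that])
    define n where "n = \<lfloor>(x - a) / (b - a)\<rfloor>"
    have "of_int n \<le> (x - a) / (b - a)" "(x - a) / (b - a) < of_int n + 1" unfolding n_def by linarith+
    then have "x - of_int n * (b - a) \<in> {a..b}" using ab by (auto simp: field_simps)
    then show ?thesis using minus_of_int[of x n] by (intro bexI[of _ "x - of_int n * (b - a)"]) simp
  qed
  have le: "w t x \<le> \<epsilon> * t" if \<epsilon>: "\<epsilon> > 0" for \<epsilon>
  proof -
    define f where "f = (\<lambda>(t, x). w t x - \<epsilon> * t)"
    have "continuous_on ({0..T} \<times> {a..b}) f"
    proof -
      have "f = (\<lambda>p. (case p of (t, x) \<Rightarrow> w t x) - \<epsilon> * fst p)" by (auto simp: f_def)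
      then show ?thesis by (simp only:) (intro continuous_intros cont)
    qed
    moreover have "compact ({0..T} \<times> {a..b})" by (intro compact_Times) auto
    moreover have "{0..T} \<times> {a..b} \<noteq> {}" using ab T by auto
    ultimately have "\<exists>p\<in>{0..T} \<times> {a..b}. \<forall>q\<in>{0..T} \<times> {a..b}. f q \<le> f p"
      by (intro continuous_attains_sup)
    then obtain p where p: "p \<in> {0..T} \<times> {a..b}" "\<And>q. q \<in> {0..T} \<times> {a..b} \<Longrightarrow> f q \<le> f p"
      by blast
    obtain t0 x0 where p_eq: "p = (t0, x0)" by (cases p)
    have t0: "t0 \<in> {0..T}" using p(1) p_eq by simp
    have max: "w s y - \<epsilon> * s \<le> w t0 x0 - \<epsilon> * t0" if st: "s \<in> {0..T}" for s y
    proof -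
      obtain z where "z \<in> {a..b}" "w s y = w s z" using wrap[OF st] by blast
      then show ?thesis using p(2)[of "(s, z)"] st by (simp add: f_def p_eq)
    qed
    have "t0 = 0"
    proof (rule ccontr)
      assume "t0 \<noteq> 0"
      then have pos: "t0 > 0" using t0 by simp
      have "w\<^sub>x t0 x0 = 0"
        by (rule DERIV_local_max[OF dx[OF t0], of 1]) (use max[OF t0] in auto)
      then have d: "((\<lambda>s. w s x0 - \<epsilon> * s) has_real_derivative - \<epsilon>) (at t0 within {0..T})"
        using dt[OF t0, of x0] by (auto intro!: derivative_eq_intros)
      \<comment> \<open>At a maximum the space derivative vanishes, so only -\<epsilon> is left in
        time and the function is larger just before t0. The one-sided derivative suffices, also for
        t0 = T.\<close>
      have "\<exists>d>0. \<forall>h>0. t0 - h \<in> {0..T} \<longrightarrow> h < d \<longrightarrow> w t0 x0 - \<epsilon> * t0 < w (t0 - h) x0 - \<epsilon> * (t0 - h)"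
        using has_real_derivative_neg_dec_left[OF d] \<epsilon> by simp
      then obtain d where d: "d > 0" "\<And>h. h > 0 \<Longrightarrow> t0 - h \<in> {0..T} \<Longrightarrow> h < d \<Longrightarrow>
          w t0 x0 - \<epsilon> * t0 < w (t0 - h) x0 - \<epsilon> * (t0 - h)" by blast
      define h where "h = min (d / 2) t0"
      have "h > 0" "h < d" "t0 - h \<in> {0..T}" using d(1) pos t0 by (auto simp: h_def)
      then show False using d(2)[of h] max[of "t0 - h" x0] by simp
    qed
    then show ?thesis using max[OF t, of x] init[of x0] by simp
  qed
  show ?thesis
  proof (rule field_le_epsilon)
    fix e :: real assume e: "e > 0"
    have "w t x \<le> e / (t + 1) * t" by (rule le) (use e t in auto)
    also have "\<dots> \<le> e" using e t by (simp add: field_simps)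
    finally show "w t x \<le> 0 + e" by simp
  qed
qed

text \<open>The difference from the translated initial datum solves the equation with zero initial
  values, and the maximum principle applies to it and to its negative. Sup norm continuity in time
  supplies the joint continuity on the compact rectangle.\<close>

lemma advection_translation:
  assumes ab: "a < b" and T: "T > 0" and m: "m \<ge> 1" and C1: "C1_Sobolev a b m T u"
    and sol: "advection_solution T u" and t: "t \<in> {0..T}"
  shows "u t x = u 0 (x - t)"
proof -
  have per: "u t (x + (b - a)) = u t x" if "t \<in> {0..T}" for t x
    using C1 that unfolding C1_Sobolev_def Sobolev_fun_def periodic_fun_simple_def by blast
  have dx: "(u t has_real_derivative deriv (u t) x) (at x)" if "t \<in> {0..T}" for t x
    using sol that unfolding advection_solution_def by (simp add: DERIV_deriv_iff_real_differentiable)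
  have dt: "((\<lambda>s. u s x) has_real_derivative - deriv (u t) x) (at t within {0..T})" if "t \<in> {0..T}" for t x
    using sol that unfolding advection_solution_def by blast
  have cont: "isCont (u t) x" if "t \<in> {0..T}" for t x using dx[OF that] by (rule DERIV_isCont)
  have zero: "0 \<in> {0..T}" using T by simp
  define w where "w t x = u t x - u 0 (x - t)" for t x
  define wx where "wx t x = deriv (u t) x - deriv (u 0) (x - t)" for t x
  have perw: "w t (x + (b - a)) = w t x" if "t \<in> {0..T}" for t x
    using per[OF that, of x] per[OF zero, of "x - t"] by (simp add: w_def algebra_simps)
  have dxw: "(w t has_real_derivative wx t x) (at x)" if "t \<in> {0..T}" for t x
  proof -
    have "((\<lambda>x. u 0 (x - t)) has_real_derivative deriv (u 0) (x - t) * 1) (at x)"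
      by (rule DERIV_chain2[OF dx[OF zero]]) (auto intro!: derivative_eq_intros)
    then show ?thesis unfolding w_def[abs_def] wx_def by (intro DERIV_diff dx that) simp
  qed
  have dtw: "((\<lambda>s. w s x) has_real_derivative - wx t x) (at t within {0..T})" if "t \<in> {0..T}" for t x
  proof -
    have "((\<lambda>s. u 0 (x - s)) has_real_derivative deriv (u 0) (x - t) * (- 1)) (at t within {0..T})"
      by (rule DERIV_chain2[OF dx[OF zero]]) (auto intro!: derivative_eq_intros)
    from DERIV_diff[OF dt[OF that, of x] this] show ?thesis by (simp add: w_def wx_def)
  qed
  have contw: "continuous_on ({0..T} \<times> {a..b}) (\<lambda>(t, x). w t x)"
  proof -
    have "continuous_on ({0..T} \<times> {a..b}) (\<lambda>(t, x). u t x)"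
      unfolding continuous_on_iff
    proof (intro ballI allI impI)
      fix p :: "real \<times> real" and e :: real assume p: "p \<in> {0..T} \<times> {a..b}" and e: "e > 0"
      obtain t x where p_eq: "p = (t, x)" by (cases p)
      have t: "t \<in> {0..T}" using p p_eq by simp
      obtain d1 where d1: "d1 > 0" "\<And>s y. s \<in> {0..T} \<Longrightarrow> \<bar>s - t\<bar> < d1 \<Longrightarrow> \<bar>u s y - u t y\<bar> < e / 2"
        using C1_Sobolev_uniformly_continuous[OF ab m C1 cont t, of "e / 2"] e by auto
      obtain d2 where d2: "d2 > 0" "\<And>y. \<bar>y - x\<bar> < d2 \<Longrightarrow> \<bar>u t y - u t x\<bar> < e / 2"
        using cont[OF t, of x, unfolded continuous_at_eps_delta dist_real_def, rule_format, of "e / 2"] e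
        by auto
      show "\<exists>d>0. \<forall>q\<in>{0..T} \<times> {a..b}. dist q p < d \<longrightarrow>
          dist (case q of (t, x) \<Rightarrow> u t x) (case p of (t, x) \<Rightarrow> u t x) < e"
      proof (intro exI[of _ "min d1 d2"] conjI ballI impI)
        show "min d1 d2 > 0" using d1 d2 by simp
        fix q :: "real \<times> real" assume q: "q \<in> {0..T} \<times> {a..b}" "dist q p < min d1 d2"
        obtain s y where q_eq: "q = (s, y)" by (cases q)
        have "\<bar>s - t\<bar> < d1" "\<bar>y - x\<bar> < d2"
          using q(2) dist_fst_le[of q p] dist_snd_le[of q p] by (auto simp: p_eq q_eq dist_real_def)
        then have "\<bar>u s y - u t y\<bar> < e / 2" "\<bar>u t y - u t x\<bar> < e / 2"
          using q(1) d1(2)[of s y] d2(2)[of y] by (simp_all add: q_eq)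
        then have "\<bar>u s y - u t x\<bar> < e" by linarith
        then show "dist (case q of (t, x) \<Rightarrow> u t x) (case p of (t, x) \<Rightarrow> u t x) < e"
          by (simp add: p_eq q_eq dist_real_def)
      qed
    qed
    moreover have "continuous_on ({0..T} \<times> {a..b}) (\<lambda>p. u 0 (snd p - fst p))"
      by (intro continuous_at_imp_continuous_on ballI isCont_o2[OF _ cont[OF zero]] continuous_intros)
    ultimately have "continuous_on ({0..T} \<times> {a..b}) (\<lambda>p. (case p of (t, x) \<Rightarrow> u t x) - u 0 (snd p - fst p))"
      by (rule continuous_on_diff)
    moreover have "(\<lambda>(t, x). w t x) = (\<lambda>p. (case p of (t, x) \<Rightarrow> u t x) - u 0 (snd p - fst p))"
      by (auto simp: w_def)
    ultimately show ?thesis by simp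
  qed
  have T0: "T \<ge> 0" using T by simp
  have "w t x \<le> 0"
    by (rule advection_max_principle[OF ab T0 contw perw dxw dtw _ t]) (auto simp: w_def)
  moreover have "- w t x \<le> 0"
  proof (rule advection_max_principle[OF ab T0, where w = "\<lambda>t x. - w t x" and w\<^sub>x = "\<lambda>t x. - wx t x"])
    have "(\<lambda>(t, x). - w t x) = (\<lambda>p. - (case p of (t, x) \<Rightarrow> w t x))" by auto
    then show "continuous_on ({0..T} \<times> {a..b}) (\<lambda>(t, x). - w t x)"
      by (simp only:) (intro continuous_intros contw)
    show "- w t (x + (b - a)) = - w t x" if "t \<in> {0..T}" for t x by (simp only: perw[OF that])
    show "((\<lambda>x. - w t x) has_real_derivative - wx t x) (at x)" if "t \<in> {0..T}" for t x
      by (rule DERIV_minus[OF dxw[OF that]])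
    show "((\<lambda>s. - w s x) has_real_derivative - (- wx t x)) (at t within {0..T})" if "t \<in> {0..T}" for t x
      by (rule DERIV_minus[OF dtw[OF that]])
  qed (simp_all add: w_def t[simplified])
  ultimately show ?thesis by (simp add: w_def)
qed

section \<open>Taylor expansion of the exact solution\<close>

lemma abs_diff_combine:
  fixes q :: real
  assumes "\<bar>c - s\<bar> \<le> 2 * q" "c = v" "s = p + t1" "r = p' + t2 + t3" "p' = p" "\<bar>t2 - t1\<bar> \<le> q" "\<bar>t3\<bar> \<le> 2 * q"
  shows "\<bar>v - r\<bar> \<le> 5 * q"
  using assms by linarith

text \<open>Derivatives of the initial datum as the Sobolev representation delivers them: classical
  up to order \<sigma>, the last one with a square integrable derivative encoded by E and K. The
  bound h \<le> L keeps the local windows within the range of the energy estimate.\<close>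

locale taylor_data =
  fixes k \<sigma> :: nat and L K S h :: real and D :: "nat \<Rightarrow> real \<Rightarrow> real" and E :: "real \<Rightarrow> real"
  assumes k_ge: "k \<ge> 1" and \<sigma>_eq: "\<sigma> = min (2 * k + 1) (k + 3)"
    and der: "\<And>j x. j < \<sigma> \<Longrightarrow> (D j has_real_derivative D (Suc j) x) (at x)"
    and energy: "energy_bound L K E (D \<sigma>)"
    and sup: "\<And>x. \<bar>D \<sigma> x\<bar> \<le> S"
    and h_pos: "h > 0" and h_le: "h \<le> L"
begin

lemma order_cases: "k = 1 \<and> \<sigma> = 3 \<or> k \<ge> 2 \<and> \<sigma> = k + 3"
  using k_ge \<sigma>_eq by auto

lemma order_ge: "\<sigma> \<ge> 3" "k + 2 \<le> \<sigma>"
  using order_cases by auto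

text \<open>Bounds the oscillation of \<open>D \<sigma>\<close> near z. The window of radius h
  covers the cell and both overlapping neighbours, whose centres lie at distance h/2.\<close>

definition om :: "real \<Rightarrow> real" where
  "om z = sqrt (h * (E (z + h) - E (z - h)))"

text \<open>
  Scaled Taylor coefficients. The highest one is a difference quotient because \<open>D \<sigma>\<close> need not be
  differentiable.
\<close>

definition cf :: "nat \<Rightarrow> real \<Rightarrow> real" where
  "cf j z = (if j < \<sigma> then h ^ j * D j z
     else h ^ (\<sigma> - 1) * (D (\<sigma> - 1) (z + h / 2) - D (\<sigma> - 1) (z - h / 2)))"

text \<open>This is h times the derivative of \<open>cf j\<close> with respect to the centre. The
  top entry is a difference of \<open>D \<sigma>\<close> and hence as small as its
  oscillation.\<close>

definition cd :: "nat \<Rightarrow> real \<Rightarrow> real" where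
  "cd j z = (if j < \<sigma> then h ^ Suc j * D (Suc j) z else h ^ \<sigma> * (D \<sigma> (z + h / 2) - D \<sigma> (z - h / 2)))"

lemma S_nonneg: "S \<ge> 0"
  using sup[of 0] by linarith

lemma window_increments: "E (z - h) \<le> E z" "E z \<le> E (z + h)"
  using energy_bound_mono[OF energy, of "z - h" z] energy_bound_mono[OF energy, of z "z + h"] h_pos h_le
  by auto

lemma om_nonneg: "om z \<ge> 0"
  unfolding om_def using window_increments[of z] h_pos by (auto intro: mult_nonneg_nonneg)

lemma om_square: "(om z)\<^sup>2 = h * (E (z + h) - E (z - h))"
  unfolding om_def using window_increments[of z] h_pos by simp

lemma osc:
  assumes "\<bar>\<zeta> - z\<bar> \<le> h"
  shows "\<bar>D \<sigma> \<zeta> - D \<sigma> z\<bar> \<le> om z"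
proof -
  have eb: "(D \<sigma> x - D \<sigma> y)\<^sup>2 \<le> (x - y) * (E x - E y)" if "y \<le> x" "x \<le> y + L" for x y
    using energy that unfolding energy_bound_def by blast
  have "(D \<sigma> \<zeta> - D \<sigma> z)\<^sup>2 \<le> h * (E (z + h) - E (z - h))"
  proof (cases "z \<le> \<zeta>")
    case True
    have "(D \<sigma> \<zeta> - D \<sigma> z)\<^sup>2 \<le> (\<zeta> - z) * (E \<zeta> - E z)"
      using True assms h_le by (intro eb) auto
    also have "\<dots> \<le> h * (E (z + h) - E (z - h))"
    proof (rule mult_mono)
      have "E \<zeta> \<le> E (z + h)" by (rule energy_bound_mono[OF energy]) (use True assms h_le in auto)
      then show "E \<zeta> - E z \<le> E (z + h) - E (z - h)" using window_increments[of z] by simp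
      show "0 \<le> E \<zeta> - E z" using energy_bound_mono[OF energy, of z \<zeta>] True assms h_le by simp
    qed (use True assms h_pos in auto)
    finally show ?thesis .
  next
    case False
    have "(D \<sigma> z - D \<sigma> \<zeta>)\<^sup>2 \<le> (z - \<zeta>) * (E z - E \<zeta>)"
      using False assms h_le by (intro eb) auto
    also have "\<dots> \<le> h * (E (z + h) - E (z - h))"
    proof (rule mult_mono)
      have "E (z - h) \<le> E \<zeta>" by (rule energy_bound_mono[OF energy]) (use False assms h_le in auto)
      then show "E z - E \<zeta> \<le> E (z + h) - E (z - h)" using window_increments[of z] by simp
      show "0 \<le> E z - E \<zeta>" using energy_bound_mono[OF energy, of \<zeta> z] False assms h_le by simp
    qed (use False assms h_pos in auto)
    finally show ?thesis by (simp add: power2_commute)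
  qed
  then have "sqrt ((D \<sigma> \<zeta> - D \<sigma> z)\<^sup>2) \<le> om z" unfolding om_def by (rule real_sqrt_le_mono)
  then show ?thesis by simp
qed

lemma cf_top: "\<exists>\<zeta>. \<bar>\<zeta> - z\<bar> \<le> h / 2 \<and> cf \<sigma> z = h ^ \<sigma> * D \<sigma> \<zeta>"
proof -
  have s: "\<sigma> - 1 < \<sigma>" "Suc (\<sigma> - 1) = \<sigma>" using order_ge by auto
  have "\<exists>\<zeta>. z - h / 2 < \<zeta> \<and> \<zeta> < z + h / 2 \<and>
      D (\<sigma> - 1) (z + h / 2) - D (\<sigma> - 1) (z - h / 2) = (z + h / 2 - (z - h / 2)) * D \<sigma> \<zeta>"
    using h_pos der[OF s(1)] unfolding s(2) by (intro MVT2) auto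
  then obtain \<zeta> where \<zeta>: "z - h / 2 < \<zeta>" "\<zeta> < z + h / 2"
    "D (\<sigma> - 1) (z + h / 2) - D (\<sigma> - 1) (z - h / 2) = h * D \<sigma> \<zeta>" by auto
  have "h ^ \<sigma> = h ^ (\<sigma> - 1) * h" using power_Suc2[of h "\<sigma> - 1"] unfolding s(2) .
  then have "cf \<sigma> z = h ^ \<sigma> * D \<sigma> \<zeta>" unfolding cf_def \<zeta>(3) by simp
  moreover have "\<bar>\<zeta> - z\<bar> \<le> h / 2" using \<zeta>(1,2) by linarith
  ultimately show ?thesis by blast
qed

lemma cf_top_near:
  assumes "\<And>\<zeta>. \<bar>\<zeta> - z\<bar> \<le> h / 2 \<Longrightarrow> \<bar>D \<sigma> \<zeta> - d\<bar> \<le> W"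
  shows "\<bar>cf \<sigma> z - h ^ \<sigma> * d\<bar> \<le> h ^ \<sigma> * W"
proof -
  obtain \<zeta> where \<zeta>: "\<bar>\<zeta> - z\<bar> \<le> h / 2" "cf \<sigma> z = h ^ \<sigma> * D \<sigma> \<zeta>" using cf_top by blast
  have "cf \<sigma> z - h ^ \<sigma> * d = h ^ \<sigma> * (D \<sigma> \<zeta> - d)" unfolding \<zeta>(2) by (simp add: right_diff_distrib)
  then show ?thesis using assms[OF \<zeta>(1)] h_pos by (simp add: abs_mult)
qed

text \<open>The Lagrange remainder and the top coefficient are values of \<open>D \<sigma>\<close>
  at two unknown nearby points; comparing both with d costs the factor 2.\<close>

lemma taylor_expansion:
  assumes j: "j < \<sigma>" and s: "\<bar>s\<bar> \<le> 1/2"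
    and W: "\<And>\<zeta>. \<bar>\<zeta> - z\<bar> \<le> h / 2 \<Longrightarrow> \<bar>D \<sigma> \<zeta> - d\<bar> \<le> W"
  shows "\<bar>cf j (z + h * s) - (\<Sum>m\<le>\<sigma> - j. cf (j + m) z * (s ^ m / fact m))\<bar> \<le> 2 * (h ^ \<sigma> * W)"
proof -
  define n where "n = \<sigma> - j"
  have n: "n > 0" "j + n = \<sigma>" using j by (auto simp: n_def)
  have "\<exists>t. \<bar>t\<bar> \<le> \<bar>h * s\<bar> \<and> D j (z + h * s) =
      (\<Sum>m<n. D (j + m) (z + 0) / fact m * (h * s) ^ m) + D (j + n) (z + t) / fact n * (h * s) ^ n"
  proof (rule Maclaurin_bi_le[where diff = "\<lambda>m x. D (j + m) (z + x)" and f = "\<lambda>x. D j (z + x)"])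
    show "\<forall>m t. m < n \<and> \<bar>t\<bar> \<le> \<bar>h * s\<bar> \<longrightarrow>
        ((\<lambda>x. D (j + m) (z + x)) has_real_derivative D (j + Suc m) (z + t)) (at t)"
    proof (intro allI impI)
      fix m t assume "m < n \<and> \<bar>t\<bar> \<le> \<bar>h * s\<bar>"
      then have "j + m < \<sigma>" using n by simp
      from der[OF this, of "z + t"]
      show "((\<lambda>x. D (j + m) (z + x)) has_real_derivative D (j + Suc m) (z + t)) (at t)"
        using DERIV_shift[of "D (j + m)" _ t z] by (simp add: add.commute)
    qed
  qed simp
  then obtain t where t: "\<bar>t\<bar> \<le> \<bar>h * s\<bar>" "D j (z + h * s) =
      (\<Sum>m<n. D (j + m) z / fact m * (h * s) ^ m) + D \<sigma> (z + t) / fact n * (h * s) ^ n"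
    unfolding n(2) by auto
  have ht: "\<bar>(z + t) - z\<bar> \<le> h / 2"
  proof -
    have "\<bar>h * s\<bar> \<le> h * (1/2)" unfolding abs_mult using s h_pos by (intro mult_mono) auto
    then show ?thesis using t(1) by simp
  qed
  have "cf j (z + h * s) = (\<Sum>m<n. cf (j + m) z * (s ^ m / fact m)) + h ^ \<sigma> * D \<sigma> (z + t) * (s ^ n / fact n)"
  proof -
    have "cf j (z + h * s) = (\<Sum>m<n. h ^ j * (D (j + m) z / fact m * (h * s) ^ m))
        + h ^ j * (D \<sigma> (z + t) / fact n * (h * s) ^ n)"
      using j unfolding cf_def t(2) by (simp add: distrib_left sum_distrib_left)
    also have "(\<Sum>m<n. h ^ j * (D (j + m) z / fact m * (h * s) ^ m)) = (\<Sum>m<n. cf (j + m) z * (s ^ m / fact m))"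
      by (intro sum.cong refl) (use n in \<open>simp add: cf_def power_add power_mult_distrib\<close>)
    also have "h ^ j * (D \<sigma> (z + t) / fact n * (h * s) ^ n) = h ^ \<sigma> * D \<sigma> (z + t) * (s ^ n / fact n)"
      unfolding n(2)[symmetric] by (simp add: power_add power_mult_distrib)
    finally show ?thesis .
  qed
  moreover have "(\<Sum>m\<le>n. cf (j + m) z * (s ^ m / fact m)) =
      (\<Sum>m<n. cf (j + m) z * (s ^ m / fact m)) + cf \<sigma> z * (s ^ n / fact n)"
    unfolding lessThan_Suc_atMost[symmetric] using n by simp
  ultimately have "cf j (z + h * s) - (\<Sum>m\<le>n. cf (j + m) z * (s ^ m / fact m)) =
      (h ^ \<sigma> * D \<sigma> (z + t) - cf \<sigma> z) * (s ^ n / fact n)"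
    by (simp add: left_diff_distrib diff_divide_distrib)
  also have "\<bar>\<dots>\<bar> \<le> (2 * (h ^ \<sigma> * W)) * 1"
    unfolding abs_mult
  proof (rule mult_mono)
    have "\<bar>h ^ \<sigma> * D \<sigma> (z + t) - h ^ \<sigma> * d\<bar> \<le> h ^ \<sigma> * W"
      using W[OF ht] h_pos by (simp add: abs_mult flip: right_diff_distrib)
    then show "\<bar>h ^ \<sigma> * D \<sigma> (z + t) - cf \<sigma> z\<bar> \<le> 2 * (h ^ \<sigma> * W)"
      using cf_top_near[OF W, of z] by linarith
    have "\<bar>s\<bar> ^ n \<le> 1" using s by (intro power_le_one) auto
    then show "\<bar>s ^ n / fact n\<bar> \<le> 1"
      by (simp add: power_abs divide_le_eq_1 order_trans[OF _ fact_ge_1])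
    show "0 \<le> 2 * (h ^ \<sigma> * W)" using W[OF ht] h_pos by (auto intro!: mult_nonneg_nonneg)
  qed simp
  finally show ?thesis unfolding n_def by simp
qed

lemma taylor_om:
  assumes "j < \<sigma>" "\<bar>s\<bar> \<le> 1/2" "\<bar>z' - z\<bar> \<le> h / 2"
  shows "\<bar>cf j (z' + h * s) - (\<Sum>m\<le>\<sigma> - j. cf (j + m) z' * (s ^ m / fact m))\<bar> \<le> 2 * (h ^ \<sigma> * om z)"
  by (rule taylor_expansion[OF assms(1,2), where d = "D \<sigma> z"], rule osc) (use assms(3) in linarith)

lemma cf_top_om: "\<bar>z' - z\<bar> \<le> h / 2 \<Longrightarrow> \<bar>cf \<sigma> z' - h ^ \<sigma> * D \<sigma> z\<bar> \<le> h ^ \<sigma> * om z"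
  by (rule cf_top_near, rule osc) linarith

lemma cf_top_sup: "\<bar>cf \<sigma> z\<bar> \<le> h ^ \<sigma> * S"
  using cf_top_near[of z 0 S] sup by simp

lemma cf_cd: "Suc j < \<sigma> \<Longrightarrow> cd j z = cf (Suc j) z"
  by (simp add: cf_def cd_def)

lemma cd_pre: "Suc j = \<sigma> \<Longrightarrow> \<bar>cd j z - cf (Suc j) z\<bar> \<le> h ^ \<sigma> * om z"
  using cf_top_om[of z z] h_pos by (auto simp: cd_def abs_minus_commute)

lemma cd_top: "\<bar>cd \<sigma> z\<bar> \<le> 2 * (h ^ \<sigma> * om z)"
proof -
  have "\<bar>D \<sigma> (z + h / 2) - D \<sigma> (z - h / 2)\<bar> \<le> 2 * om z"
    using osc[of "z + h / 2" z] osc[of "z - h / 2" z] h_pos by auto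
  then have "h ^ \<sigma> * \<bar>D \<sigma> (z + h / 2) - D \<sigma> (z - h / 2)\<bar> \<le> h ^ \<sigma> * (2 * om z)"
    using h_pos by (intro mult_left_mono) auto
  then show ?thesis using h_pos by (simp add: cd_def abs_mult)
qed

lemma cf_deriv: "(cf j has_real_derivative cd j z / h) (at z)"
proof (cases "j < \<sigma>")
  case True
  have "((\<lambda>z. h ^ j * D j z) has_real_derivative h ^ j * D (Suc j) z) (at z)"
    by (rule DERIV_cmult[OF der[OF True]])
  then show ?thesis using True h_pos by (simp add: cf_def[abs_def] cd_def)
next
  case False
  have s: "\<sigma> - 1 < \<sigma>" "Suc (\<sigma> - 1) = \<sigma>" using order_ge by auto
  have d: "((\<lambda>z. D (\<sigma> - 1) (z + c)) has_real_derivative D \<sigma> (z + c)) (at z)" for c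
    using der[OF s(1), of "z + c"] unfolding s(2) by (simp add: DERIV_shift)
  have "((\<lambda>z. h ^ (\<sigma> - 1) * (D (\<sigma> - 1) (z + h / 2) - D (\<sigma> - 1) (z + - (h / 2)))) has_real_derivative
      h ^ (\<sigma> - 1) * (D \<sigma> (z + h / 2) - D \<sigma> (z + - (h / 2)))) (at z)"
    by (intro DERIV_cmult DERIV_diff d)
  moreover have "h ^ \<sigma> = h ^ (\<sigma> - 1) * h" using power_Suc2[of h "\<sigma> - 1"] unfolding s(2) .
  ultimately show ?thesis using False h_pos by (simp add: cf_def[abs_def] cd_def)
qed

section \<open>Taylor polynomials and the expected numerical solution\<close>

definition tpoly :: "(nat \<Rightarrow> real) \<Rightarrow> real poly" where
  "tpoly \<gamma> = (\<Sum>j\<le>\<sigma>. smult (\<gamma> j) (taylor_monom j))"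

text \<open>For k = 1 the order is \<sigma> = k + 2, so there is no coefficient of order k +
  3.\<close>

definition third :: "(nat \<Rightarrow> real) \<Rightarrow> real" where
  "third \<gamma> = (if k \<ge> 2 then \<gamma> (k + 3) else 0)"

lemma poly_tpoly: "poly (tpoly \<gamma>) x = (\<Sum>j\<le>\<sigma>. \<gamma> j * (x ^ j / fact j))"
  by (simp add: tpoly_def poly_sum poly_taylor_monom)

lemma tpoly_split:
  "tpoly \<gamma> = (\<Sum>j\<le>k. smult (\<gamma> j) (taylor_monom j)) + smult (\<gamma> (k + 1)) (taylor_monom (k + 1))
     + smult (\<gamma> (k + 2)) (taylor_monom (k + 2)) + smult (third \<gamma>) (taylor_monom (k + 3))"
proof -
  consider "\<sigma> = k + 2" "\<not> 2 \<le> k" | "\<sigma> = k + 3" "2 \<le> k" using order_cases by fastforce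
  then show ?thesis
    unfolding tpoly_def third_def by cases (simp_all add: numeral_eq_Suc)
qed

text \<open>
  The polynomial that the scheme should produce for data with Taylor coefficients \<open>\<gamma>\<close>.
\<close>

definition qpoly :: "real poly \<Rightarrow> real poly \<Rightarrow> real poly \<Rightarrow> (nat \<Rightarrow> real) \<Rightarrow> real poly" where
  "qpoly ea eb ed \<gamma> = tpoly \<gamma> - smult (\<gamma> (k + 1)) ea - smult (\<gamma> (k + 2)) eb - smult (third \<gamma>) ed"

text \<open>Each monomial of degree above k is reduced by an error polynomial that agrees with it
  above degree k.\<close>

lemma degree_qpoly:
  assumes "degree (taylor_monom (k + 1) - ea) \<le> k" "degree (taylor_monom (k + 2) - eb) \<le> k"
    "degree (taylor_monom (k + 3) - ed) \<le> k"
  shows "degree (qpoly ea eb ed \<gamma>) \<le> k"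
proof -
  have "qpoly ea eb ed \<gamma> = (\<Sum>j\<le>k. smult (\<gamma> j) (taylor_monom j))
      + smult (\<gamma> (k + 1)) (taylor_monom (k + 1) - ea) + smult (\<gamma> (k + 2)) (taylor_monom (k + 2) - eb)
      + smult (third \<gamma>) (taylor_monom (k + 3) - ed)"
    unfolding qpoly_def tpoly_split by (simp add: smult_diff_right)
  moreover have "degree (taylor_monom j) \<le> j" for j unfolding taylor_monom_def by (rule degree_monom_le)
  then have "degree (\<Sum>j\<le>k. smult (\<gamma> j) (taylor_monom j)) \<le> k"
    by (intro degree_sum_le) (auto intro: order_trans[OF degree_smult_le] order_trans)
  ultimately show ?thesis
    using assms by (auto intro!: degree_add_le order_trans[OF degree_smult_le])
qed

lemma poly_qpoly:
  "poly (qpoly ea eb ed \<gamma>) x = (\<Sum>j\<le>\<sigma>. \<gamma> j * (x ^ j / fact j)) - \<gamma> (k + 1) * poly ea x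
     - \<gamma> (k + 2) * poly eb x - third \<gamma> * poly ed x"
  by (simp add: qpoly_def poly_tpoly)

lemma qpoly_deriv:
  "((\<lambda>z. poly (qpoly ea eb ed (\<lambda>j. cf j z)) x) has_real_derivative
     poly (qpoly ea eb ed (\<lambda>j. cd j z)) x / h) (at z)"
proof -
  have t: "((\<lambda>z. third (\<lambda>j. cf j z)) has_real_derivative third (\<lambda>j. cd j z) / h) (at z)"
    unfolding third_def using cf_deriv by auto
  have "((\<lambda>z. (\<Sum>j\<le>\<sigma>. cf j z * (x ^ j / fact j)) - cf (k + 1) z * poly ea x - cf (k + 2) z * poly eb x
      - third (\<lambda>j. cf j z) * poly ed x) has_real_derivative
    (\<Sum>j\<le>\<sigma>. cd j z / h * (x ^ j / fact j)) - cd (k + 1) z / h * poly ea x - cd (k + 2) z / h * poly eb x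
      - third (\<lambda>j. cd j z) / h * poly ed x) (at z)"
    by (intro DERIV_diff DERIV_sum DERIV_cmult_right cf_deriv t)
  also have "(\<Sum>j\<le>\<sigma>. cd j z / h * (x ^ j / fact j)) - cd (k + 1) z / h * poly ea x - cd (k + 2) z / h * poly eb x
      - third (\<lambda>j. cd j z) / h * poly ed x = poly (qpoly ea eb ed (\<lambda>j. cd j z)) x / h"
    unfolding poly_qpoly by (simp add: diff_divide_distrib sum_divide_distrib mult.commute)
  finally show ?thesis unfolding poly_qpoly .
qed

text \<open>The expansion gives 2; the constant 5 is chosen to agree with that of the
  derivative.\<close>

lemma value_bound:
  assumes "\<bar>x\<bar> \<le> 1/2" "\<bar>z' - z\<bar> \<le> h / 2"
  shows "\<bar>D 0 (z' + h * x) - poly (tpoly (\<lambda>j. cf j z')) x\<bar> \<le> 5 * (h ^ \<sigma> * om z)"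
proof -
  have "0 < \<sigma>" using order_ge by simp
  from taylor_om[OF this assms] have "\<bar>D 0 (z' + h * x) - poly (tpoly (\<lambda>j. cf j z')) x\<bar> \<le> 2 * (h ^ \<sigma> * om z)"
    using \<open>0 < \<sigma>\<close> by (simp add: poly_tpoly cf_def[of 0])
  moreover have "0 \<le> h ^ \<sigma> * om z" using om_nonneg[of z] h_pos by simp
  ultimately show ?thesis by linarith
qed

text \<open>The count is 2 for the expansion, 1 for the coefficient below the top, which is a value
  of \<open>D \<sigma>\<close> instead of a difference quotient, and 2 for the top one.\<close>

lemma derivative_bound:
  assumes x: "\<bar>x\<bar> \<le> 1/2"
  shows "\<bar>h * D 1 (z + h * x) - poly (tpoly (\<lambda>j. cd j z)) x\<bar> \<le> 5 * (h ^ \<sigma> * om z)"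
proof -
  obtain n where n: "\<sigma> = Suc (Suc n)" "n \<ge> 1" using order_ge by (metis One_nat_def Suc_le_D Suc_le_mono numeral_3_eq_3)
  have xj: "\<bar>x ^ j / fact j\<bar> \<le> 1" for j
  proof -
    have "\<bar>x\<bar> ^ j \<le> 1" using x by (intro power_le_one) auto
    then show ?thesis by (simp add: power_abs divide_le_eq_1 order_trans[OF _ fact_ge_1])
  qed
  have "\<bar>cf 1 (z + h * x) - (\<Sum>m\<le>\<sigma> - 1. cf (1 + m) z * (x ^ m / fact m))\<bar> \<le> 2 * (h ^ \<sigma> * om z)"
    using order_ge h_pos by (intro taylor_om x) auto
  moreover have "cf 1 (z + h * x) = h * D 1 (z + h * x)" using order_ge by (simp add: cf_def)
  moreover have "(\<Sum>m\<le>\<sigma> - 1. cf (1 + m) z * (x ^ m / fact m)) =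
      (\<Sum>m\<le>n. cf (Suc m) z * (x ^ m / fact m)) + cf \<sigma> z * (x ^ Suc n / fact (Suc n))"
    using n by (simp del: fact_Suc)
  moreover have "poly (tpoly (\<lambda>j. cd j z)) x = (\<Sum>m\<le>n. cd m z * (x ^ m / fact m))
      + cd (Suc n) z * (x ^ Suc n / fact (Suc n)) + cd \<sigma> z * (x ^ \<sigma> / fact \<sigma>)"
    unfolding poly_tpoly using n by (simp del: fact_Suc)
  moreover have "(\<Sum>m\<le>n. cd m z * (x ^ m / fact m)) = (\<Sum>m\<le>n. cf (Suc m) z * (x ^ m / fact m))"
  proof (rule sum.cong[OF refl])
    fix m assume "m \<in> {..n}"
    then have "Suc m < \<sigma>" using n by simp
    then show "cd m z * (x ^ m / fact m) = cf (Suc m) z * (x ^ m / fact m)" by (simp only: cf_cd)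
  qed
  moreover have "\<bar>(cd (Suc n) z - cf \<sigma> z) * (x ^ Suc n / fact (Suc n))\<bar> \<le> (h ^ \<sigma> * om z) * 1"
    unfolding abs_mult using cd_pre[of "Suc n" z] n xj[of "Suc n"] om_nonneg[of z] h_pos
    by (intro mult_mono) auto
  moreover have "\<bar>cd \<sigma> z * (x ^ \<sigma> / fact \<sigma>)\<bar> \<le> (2 * (h ^ \<sigma> * om z)) * 1"
    unfolding abs_mult using cd_top[of z] xj[of \<sigma>] om_nonneg[of z] h_pos
    by (intro mult_mono) auto
  ultimately show ?thesis unfolding left_diff_distrib mult_1_right by (rule abs_diff_combine)
qed

text \<open>Taylor expansion of the coefficients under a shift by half a cell, in the form in which
  the residual cancels. The cases k = 1 and k \<ge> 2 differ in which coefficient is the top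
  one.\<close>

lemma coefficient_bounds:
  defines "M \<equiv> \<lambda>z. 5 * (h ^ \<sigma> * om z)"
  defines "A \<equiv> cf (k + 1)" and "B \<equiv> cf (k + 2)" and "C \<equiv> \<lambda>z. third (\<lambda>j. cf j z)"
  shows "\<bar>A (z - h / 2) - (A z - B z / 2 + C z / 8)\<bar> \<le> M z"
    "\<bar>A (z + h / 2) - (A z + B z / 2 + C z / 8)\<bar> \<le> M z"
    "\<bar>B (z - h / 2) - (B z - C z / 2)\<bar> \<le> M z" "\<bar>B (z + h / 2) - (B z + C z / 2)\<bar> \<le> M z"
    "\<bar>C (z - h / 2) - C z\<bar> \<le> M z" "\<bar>C (z + h / 2) - C z\<bar> \<le> M z"
    "\<bar>cd (k + 1) z - B z\<bar> \<le> M z" "\<bar>cd (k + 2) z - C z\<bar> \<le> M z" "\<bar>third (\<lambda>j. cd j z)\<bar> \<le> M z"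
proof -
  define q where "q = h ^ \<sigma> * om z"
  have q: "q \<ge> 0" "M z = 5 * q" unfolding q_def M_def using om_nonneg[of z] h_pos by simp_all
  have top: "\<bar>cf \<sigma> (z + h * s) - cf \<sigma> z\<bar> \<le> 2 * q" if "\<bar>s\<bar> = 1/2" for s
  proof -
    have "\<bar>(z + h * s) - z\<bar> \<le> h / 2" using that h_pos by (simp add: abs_mult)
    from cf_top_om[OF this] cf_top_om[of z z] h_pos show ?thesis unfolding q_def by (simp add: abs_if split: if_splits)
  qed
  have low: "\<bar>cf j (z + h * s) - (\<Sum>m\<le>\<sigma> - j. cf (j + m) z * (s ^ m / fact m))\<bar> \<le> 2 * q"
    if "\<bar>s\<bar> = 1/2" "j < \<sigma>" for j s
    unfolding q_def using that h_pos by (intro taylor_om) auto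
  have pm: "z - h / 2 = z + h * - (1/2)" "z + h / 2 = z + h * (1/2)" by simp_all
  note pre = cd_pre[of _ z, folded q_def] and tp = cd_top[of z, folded q_def]
  have A: "\<bar>A (z + h * s) - (A z + B z * s + C z * (s\<^sup>2 / 2))\<bar> \<le> 2 * q"
    and B: "\<bar>B (z + h * s) - (B z + C z * s)\<bar> \<le> 2 * q"
    and C: "\<bar>C (z + h * s) - C z\<bar> \<le> 2 * q" if s: "\<bar>s\<bar> = 1/2" for s
    using order_cases low[OF s, of "k + 1"] low[OF s, of "k + 2"] top[OF s] q(1)
    unfolding A_def B_def C_def third_def
    by (auto simp: numeral_eq_Suc power2_eq_square)
  show "\<bar>A (z - h / 2) - (A z - B z / 2 + C z / 8)\<bar> \<le> M z"
    "\<bar>A (z + h / 2) - (A z + B z / 2 + C z / 8)\<bar> \<le> M z"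
    "\<bar>B (z - h / 2) - (B z - C z / 2)\<bar> \<le> M z" "\<bar>B (z + h / 2) - (B z + C z / 2)\<bar> \<le> M z"
    "\<bar>C (z - h / 2) - C z\<bar> \<le> M z" "\<bar>C (z + h / 2) - C z\<bar> \<le> M z"
    using A[of "- (1/2)"] A[of "1/2"] B[of "- (1/2)"] B[of "1/2"] C[of "- (1/2)"] C[of "1/2"] q
    by (simp_all add: power2_eq_square)
  show "\<bar>cd (k + 1) z - B z\<bar> \<le> M z" "\<bar>cd (k + 2) z - C z\<bar> \<le> M z" "\<bar>third (\<lambda>j. cd j z)\<bar> \<le> M z"
  proof -
    consider (1) "k + 2 = \<sigma>" "\<not> 2 \<le> k" | (2) "k + 3 = \<sigma>" "2 \<le> k" using order_cases by fastforce
    then have "\<bar>cd (k + 1) z - B z\<bar> \<le> q \<and> \<bar>cd (k + 2) z - C z\<bar> \<le> 2 * q \<and> \<bar>third (\<lambda>j. cd j z)\<bar> \<le> 2 * q"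
    proof cases
      case 1
      have "C z = 0" "third (\<lambda>j. cd j z) = 0" by (simp_all add: C_def third_def 1(2))
      then show ?thesis using pre[of "k + 1"] tp 1(1) q(1) by (simp add: B_def)
    next
      case 2
      have "C z = cf \<sigma> z" "third (\<lambda>j. cd j z) = cd \<sigma> z" by (simp_all add: C_def third_def 2)
      moreover have "Suc (k + 2) = \<sigma>" "Suc (k + 1) < \<sigma>" "Suc (k + 1) = k + 2" using 2 by simp_all
      ultimately show ?thesis
        using pre[of "k + 2"] tp cf_cd[of "k + 1" z] q(1) by (simp add: B_def)
    qed
    then show "\<bar>cd (k + 1) z - B z\<bar> \<le> M z" "\<bar>cd (k + 2) z - C z\<bar> \<le> M z" "\<bar>third (\<lambda>j. cd j z)\<bar> \<le> M z"
      using q by auto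
  qed
qed

end

section \<open>Residual, initial error and summation over the mesh\<close>

lemma coeff_norm_add: "coeff_norm (p + q) \<le> coeff_norm p + coeff_norm q"
proof -
  define k where "k = max (degree p) (degree q)"
  have "degree (p + q) \<le> k" unfolding k_def by (rule degree_add_le_max)
  then show ?thesis
    using coeff_norm_eq[of "p + q" k] coeff_norm_eq[of p k] coeff_norm_eq[of q k]
    by (simp add: k_def flip: sum.distrib) (intro sum_mono abs_triangle_ineq)
qed

lemma coeff_norm_smult: "coeff_norm (smult c p) = \<bar>c\<bar> * coeff_norm p"
  using coeff_norm_eq[of "smult c p" "degree p"] coeff_norm_eq[of p "degree p"] degree_smult_le[of c p]
  by (simp add: sum_distrib_left abs_mult)

lemma sum_int_telescope: "(\<Sum>n\<in>{0..<int P}. f (n + 1) - f n) = f (int P) - (f 0 :: real)"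
proof (induction P)
  case (Suc P)
  have "{0..<int (Suc P)} = insert (int P) {0..<int P}" by auto
  then show ?case using Suc by (simp add: add.commute)
qed simp

lemma ref_mean_poly_square_le: "(ref_mean (poly p))\<^sup>2 \<le> ref_inner (poly p) p"
proof -
  have "(integral ref_cell (poly p))\<^sup>2 \<le> (1/2 - - (1/2)) * integral ref_cell (\<lambda>x. (poly p x)\<^sup>2)"
    by (intro integral_square_le integrable_continuous_real continuous_intros) auto
  then show ?thesis unfolding ref_mean_def ref_inner_def by (simp add: power2_eq_square)
qed

lemma ref_inner_poly_le: "ref_inner (poly p) p \<le> (coeff_norm p)\<^sup>2"
proof -
  have "\<bar>ref_inner (poly p) p\<bar> \<le> coeff_norm p * coeff_norm p"
    by (rule ref_inner_bound[OF continuous_on_poly']) (auto intro!: abs_poly_le_coeff_norm)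
  then show ?thesis by (simp add: power2_eq_square)
qed

context taylor_data
begin

lemma D_cont: "isCont (D 0) x" "isCont (D 1) x"
  using DERIV_isCont[OF der[of 0 x]] DERIV_isCont[OF der[of 1 x]] order_ge by auto

lemma cell_cont: "continuous_on ref_cell (\<lambda>x. D 0 (z + h * x))" "continuous_on ref_cell (\<lambda>x. D 1 (z + h * x))"
  by (intro continuous_at_imp_continuous_on ballI isCont_o2[OF _ D_cont(1)] isCont_o2[OF _ D_cont(2)]
      continuous_intros)+

lemma ref_cell_iff: "x \<in> ref_cell \<longleftrightarrow> \<bar>x\<bar> \<le> 1/2"
  by (auto simp: abs_le_iff)

lemma qpoly_residual:
  assumes C: "C > 0"
    and ep: "error_polys C k ea eb ed"
    and d: "degree \<phi> \<le> k"
  defines "Q \<equiv> \<lambda>z. qpoly ea eb ed (\<lambda>j. cf j z)"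
  shows "\<bar>cell_form C (poly (Q (z - h / 2))) (poly (Q z)) (poly (Q (z + h / 2))) \<phi>
      + ref_inner (poly (qpoly ea eb ed (\<lambda>j. cd j z))) \<phi>\<bar>
    \<le> residual_const C k (coeff_norm ea + coeff_norm eb + coeff_norm ed) * (5 * (h ^ \<sigma> * om z) * coeff_norm \<phi>)"
  unfolding Q_def qpoly_def
proof (rule residual_bound[OF C ep])
  show "cell_form C (\<lambda>x. D 0 (z - h / 2 + h * x)) (\<lambda>x. D 0 (z + h * x)) (\<lambda>x. D 0 (z + h / 2 + h * x)) \<phi> =
      - ref_inner (\<lambda>x. h * D 1 (z + h * x)) \<phi>"
  proof (rule cell_form_exact)
    fix x :: real
    have "((\<lambda>x. D 0 (z + h * x)) has_real_derivative D (Suc 0) (z + h * x) * h) (at x within ref_cell)"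
      using order_ge by (intro DERIV_chain2[OF der]) (auto intro!: derivative_eq_intros)
    then show "((\<lambda>x. D 0 (z + h * x)) has_real_derivative h * D 1 (z + h * x)) (at x within ref_cell)"
      by (simp add: mult.commute)
    show "continuous_on ref_cell (\<lambda>x. h * D 1 (z + h * x))" by (intro continuous_intros cell_cont)
  qed (auto simp: algebra_simps)
  show "continuous_on ref_cell (\<lambda>x. D 0 (z - h / 2 + h * x))" "continuous_on ref_cell (\<lambda>x. D 0 (z + h * x))"
    "continuous_on ref_cell (\<lambda>x. D 0 (z + h / 2 + h * x))" "continuous_on ref_cell (\<lambda>x. h * D 1 (z + h * x))"
    by (intro cell_cont continuous_intros)+
  show "third (\<lambda>j. cf j z) = 0" if "k < 2" using that by (simp add: third_def)
  fix x :: real assume "x \<in> ref_cell"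
  then have x: "\<bar>x\<bar> \<le> 1/2" by (simp only: ref_cell_iff)
  show "\<bar>D 0 (z - h / 2 + h * x) - poly (tpoly (\<lambda>j. cf j (z - h / 2))) x\<bar> \<le> 5 * (h ^ \<sigma> * om z)"
    "\<bar>D 0 (z + h * x) - poly (tpoly (\<lambda>j. cf j z)) x\<bar> \<le> 5 * (h ^ \<sigma> * om z)"
    "\<bar>D 0 (z + h / 2 + h * x) - poly (tpoly (\<lambda>j. cf j (z + h / 2))) x\<bar> \<le> 5 * (h ^ \<sigma> * om z)"
    using h_pos by (intro value_bound x; simp)+
  show "\<bar>h * D 1 (z + h * x) - poly (tpoly (\<lambda>j. cd j z)) x\<bar> \<le> 5 * (h ^ \<sigma> * om z)"
    by (rule derivative_bound[OF x])
qed (assumption | rule coefficient_bounds d)+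

text \<open>A crude bound uniform in h and z, used where no division by h follows: for the initial
  data and for the cell means of the Taylor remainder.\<close>

definition om_max :: real where
  "om_max = sqrt (2 * L * K)"

lemma om_le: "om z \<le> om_max"
proof -
  have shift: "E (y + L) = E y + K" for y using energy unfolding energy_bound_def by blast
  have "E (z + h) \<le> E (z + L)" by (rule energy_bound_mono[OF energy]) (use h_pos h_le in auto)
  moreover have "E (z - L) \<le> E (z - h)" by (rule energy_bound_mono[OF energy]) (use h_pos h_le in auto)
  ultimately have "E (z + h) - E (z - h) \<le> 2 * K" using shift[of z] shift[of "z - L"] by simp
  moreover have "0 \<le> E (z + h) - E (z - h)" using window_increments[of z] by simp
  ultimately have "h * (E (z + h) - E (z - h)) \<le> L * (2 * K)"
    using h_pos h_le by (intro mult_mono) auto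
  then show ?thesis unfolding om_def om_max_def by (simp add: mult_ac)
qed

lemma om_max_nonneg: "om_max \<ge> 0"
  using om_nonneg[of 0] om_le[of 0] by linarith

text \<open>The initialization contains one correction, matching the \<open>eb\<close> part of Q.
  The \<open>ed\<close> part has a coefficient of order h^\<sigma> already, so it may stay
  uncorrected. The factors 6 and 21 in the proof collect the Taylor remainder and the omitted
  coefficients for the value and for the derivative.\<close>

lemma initial_close:
  fixes C :: real and ea eb ed :: "real poly"
  assumes C: "C > 0"
    and ep: "error_polys C k ea eb ed"
  defines "G \<equiv> \<lambda>z. ref_err C k (\<lambda>x. D 0 (z + h * x))"
  shows "coeff_norm (ref_proj C k (\<lambda>x. D 0 (z + h * x))
      - ref_corr C k (G (z - h / 2)) (G z) (G (z + h / 2)) (\<lambda>\<xi>. h * ref_err C k (\<lambda>x. D 1 (z + h * x)) \<xi>)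
      - qpoly ea eb ed (\<lambda>j. cf j z))
    \<le> (defect_const C k * (21 * ref_const C k + 6 * coeff_norm ea + 6) + coeff_norm (taylor_monom (k + 3) - ed))
      * (h ^ \<sigma> * (S + om_max))"
proof -
  note err = error_polysD(1)[OF ep] and deg = error_polysD(2-4)[OF ep] and mean = error_polysD(5,6)[OF ep] and ea = error_polysD(8)[OF ep] and eb = error_polysD(9)[OF ep]
  define q where "q = h ^ \<sigma> * (S + om_max)"
  define r where "r = ref_const C k"
  define e where "e = coeff_norm ea"
  define s where "s = ref_err C k (poly (taylor_monom (k + 2)))"
  define A where "A = cf (k + 1)"
  define B where "B = cf (k + 2)"
  define Th where "Th z = third (\<lambda>j. cf j z)" for z
  define R where "R \<gamma> = (\<Sum>j\<le>k. smult (\<gamma> j) (taylor_monom j))" for \<gamma> :: "nat \<Rightarrow> real"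
  define tp where "tp = R (\<lambda>j. cf j z) + smult (A z) (taylor_monom (k + 1)) + smult (B z) (taylor_monom (k + 2))"
  have r0: "r \<ge> 0" unfolding r_def by (rule ref_const_nonneg[OF C])
  have e0: "e \<ge> 0" unfolding e_def by (rule coeff_norm_nonneg)
  have hs: "h ^ \<sigma> \<ge> 0" using h_pos by simp
  have q0: "q \<ge> 0" unfolding q_def using hs S_nonneg om_max_nonneg by simp
  have omq: "5 * (h ^ \<sigma> * om y) \<le> 5 * q" for y
    unfolding q_def using hs om_le[of y] S_nonneg by (intro mult_left_mono) auto
  have Th: "\<bar>Th y\<bar> \<le> q" for y
  proof (cases "k \<ge> 2")
    case True
    then have "Th y = cf \<sigma> y" using order_cases by (auto simp: Th_def third_def)
    moreover have "h ^ \<sigma> * S \<le> q" unfolding q_def using hs om_max_nonneg by (intro mult_left_mono) auto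
    ultimately show ?thesis using cf_top_sup[of y] by linarith
  qed (use q0 in \<open>simp add: Th_def third_def\<close>)
  have mono_le: "\<bar>poly (taylor_monom j) x\<bar> \<le> 1" if "\<bar>x\<bar> \<le> 1/2" for j x
  proof -
    have "\<bar>x\<bar> ^ j \<le> 1" using that by (intro power_le_one) auto
    then show ?thesis unfolding poly_taylor_monom
      by (simp add: power_abs divide_le_eq_1 order_trans[OF _ fact_ge_1])
  qed
  have prod_le: "\<bar>c * poly (taylor_monom j) x\<bar> \<le> m" if "\<bar>x\<bar> \<le> 1/2" "\<bar>c\<bar> \<le> m" for c j x m
    using mult_mono[OF that(2) mono_le[OF that(1), of j]] that(2) by (simp add: abs_mult)
  have dR: "degree (R \<gamma>) \<le> k" for \<gamma>
    unfolding R_def by (intro degree_sum_le)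
      (auto intro!: order_trans[OF degree_smult_le] order_trans[OF degree_monom_le] simp: taylor_monom_def)
  have tsplit: "poly (tpoly \<gamma>) x = poly (R \<gamma>) x + \<gamma> (k + 1) * poly (taylor_monom (k + 1)) x
     + \<gamma> (k + 2) * poly (taylor_monom (k + 2)) x + third \<gamma> * poly (taylor_monom (k + 3)) x" for \<gamma> x
    unfolding tpoly_split R_def by simp
  have val: "\<bar>D 0 (y + h * x) - poly (R (\<lambda>j. cf j y) + smult (A y) (taylor_monom (k + 1))
      + smult (B y) (taylor_monom (k + 2))) x\<bar> \<le> 6 * q" if "x \<in> ref_cell" for x y
  proof -
    have x: "\<bar>x\<bar> \<le> 1/2" using that by (simp only: ref_cell_iff)
    have "\<bar>D 0 (y + h * x) - poly (tpoly (\<lambda>j. cf j y)) x\<bar> \<le> 5 * q"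
      using value_bound[OF x, of y y] omq[of y] h_pos by simp
    moreover have "\<bar>Th y * poly (taylor_monom (k + 3)) x\<bar> \<le> q" by (rule prod_le[OF x Th])
    ultimately show ?thesis unfolding tsplit A_def B_def Th_def poly_add poly_smult by linarith
  qed
  have dval: "\<bar>h * D 1 (z + h * x) - poly (R (\<lambda>j. cd j z) + smult (B z) (taylor_monom (k + 1))
      + smult 0 (taylor_monom (k + 2))) x\<bar> \<le> 21 * q" if "x \<in> ref_cell" for x
  proof -
    have x: "\<bar>x\<bar> \<le> 1/2" using that by (simp only: ref_cell_iff)
    note cb = coefficient_bounds(7-9)[of z, folded B_def Th_def]
    have "\<bar>h * D 1 (z + h * x) - poly (tpoly (\<lambda>j. cd j z)) x\<bar> \<le> 5 * q"
      using derivative_bound[OF x, of z] omq[of z] by linarith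
    moreover have "\<bar>(cd (k + 1) z - B z) * poly (taylor_monom (k + 1)) x\<bar> \<le> 5 * q"
      by (rule prod_le[OF x]) (use cb(1) omq[of z] in linarith)
    moreover have "\<bar>cd (k + 2) z * poly (taylor_monom (k + 2)) x\<bar> \<le> 6 * q"
      by (rule prod_le[OF x]) (use cb(2) Th[of z] omq[of z] in linarith)
    moreover have "\<bar>third (\<lambda>j. cd j z) * poly (taylor_monom (k + 3)) x\<bar> \<le> 5 * q"
      by (rule prod_le[OF x]) (use cb(3) omq[of z] in linarith)
    ultimately show ?thesis unfolding tsplit poly_add poly_smult left_diff_distrib by linarith
  qed
  have G: "\<bar>G y x - A y * poly ea x - B y * s x\<bar> \<le> r * (6 * q)" if "x \<in> ref_cell" for y x
    unfolding G_def err s_def r_def by (rule ref_err_expansion[OF C cell_cont(1) dR val that])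
  have s: "\<bar>s x\<bar> \<le> r" if "x \<in> ref_cell" for x
  proof -
    have "\<bar>ref_err C k (poly (taylor_monom (k + 2))) x\<bar> \<le> ref_const C k * 1"
      by (rule ref_err_bound[OF C continuous_on_poly' mono_le that]) (simp only: ref_cell_iff)
    then show ?thesis unfolding s_def r_def by simp
  qed
  have eax: "\<bar>poly ea x\<bar> \<le> e" if "x \<in> ref_cell" for x
    unfolding e_def by (rule abs_poly_le_coeff_norm) (use that in auto)
  \<comment> \<open>A common majorant for the value, the derivative and the difference to a
    neighbour, as listed in \<open>Mge\<close>.\<close>
  define M where "M = (21 * r + 6 * e + 6) * q"
  have Mge: "6 * q \<le> M" "r * (21 * q) \<le> M" "r * (6 * q) + r * (6 * q) + 6 * q * e + 6 * q * r \<le> M"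
    unfolding M_def using r0 e0 q0 by (simp_all add: algebra_simps)
  have step: "\<bar>(gA) * poly ea x + (gB) * s x\<bar> \<le> 6 * q * e + 6 * q * r"
    if "\<bar>gA\<bar> \<le> 6 * q" "\<bar>gB\<bar> \<le> 6 * q" "x \<in> ref_cell" for gA gB x
    using mult_mono[OF that(1) eax[OF that(3)]] mult_mono[OF that(2) s[OF that(3)]] q0
    by (intro order_trans[OF abs_triangle_ineq]) (simp add: abs_mult)
  note cb = coefficient_bounds(1-4)[of z, folded A_def B_def Th_def]
  have main: "coeff_norm (ref_proj C k (\<lambda>x. D 0 (z + h * x))
      - ref_corr C k (G (z - h / 2)) (G z) (G (z + h / 2)) (\<lambda>\<xi>. h * ref_err C k (\<lambda>x. D 1 (z + h * x)) \<xi>)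
      - (tp - smult (A z) ea - smult (B z) eb)) \<le> defect_const C k * M"
  proof (rule initial_defect[OF C eb ea mean])
    show "continuous_on ref_cell (\<lambda>x. D 0 (z + h * x))" by (rule cell_cont)
    show "continuous_on ref_cell (G (z - h / 2))" "continuous_on ref_cell (G z)" "continuous_on ref_cell (G (z + h / 2))"
      unfolding G_def by (intro continuous_on_ref_err cell_cont)+
    show "continuous_on ref_cell (\<lambda>\<xi>. h * ref_err C k (\<lambda>x. D 1 (z + h * x)) \<xi>)"
      by (intro continuous_intros continuous_on_ref_err cell_cont)
    have "tp - smult (A z) ea - smult (B z) eb = R (\<lambda>j. cf j z) + smult (A z) (taylor_monom (k + 1) - ea)
        + smult (B z) (taylor_monom (k + 2) - eb)"
      unfolding tp_def by (simp add: smult_diff_right)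
    then show "degree (tp - smult (A z) ea - smult (B z) eb) \<le> k"
      using deg dR by (auto intro!: degree_add_le order_trans[OF degree_smult_le])
    fix x :: real assume x: "x \<in> ref_cell"
    show "\<bar>D 0 (z + h * x) - poly tp x\<bar> \<le> M" unfolding tp_def using val[OF x, of z] Mge(1) by linarith
    have "h * ref_err C k (\<lambda>x. D 1 (z + h * x)) x = ref_err C k (\<lambda>x. h * D 1 (z + h * x)) x"
      using ref_err_lin[OF cell_cont(2) cell_cont(2), of C k h z 0 z x] by simp
    moreover have "\<bar>ref_err C k (\<lambda>x. h * D 1 (z + h * x)) x - B z * poly ea x - 0 * s x\<bar> \<le> r * (21 * q)"
      unfolding err s_def r_def
      by (rule ref_err_expansion[OF C _ dR dval x]) (intro continuous_intros cell_cont)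
    ultimately show "\<bar>h * ref_err C k (\<lambda>x. D 1 (z + h * x)) x - B z * poly ea x\<bar> \<le> M"
      using Mge(2) by simp
    have "\<bar>(A (z - h / 2) - A z + B z / 2) * poly ea x + (B (z - h / 2) - B z) * s x\<bar> \<le> 6 * q * e + 6 * q * r"
      using cb(1,3) Th[of z] omq[of z] q0 by (intro step x) linarith+
    moreover have "G (z - h / 2) x - G z x + B z / 2 * poly ea x =
        (G (z - h / 2) x - A (z - h / 2) * poly ea x - B (z - h / 2) * s x) - (G z x - A z * poly ea x - B z * s x)
        + ((A (z - h / 2) - A z + B z / 2) * poly ea x + (B (z - h / 2) - B z) * s x)"
      by (simp add: algebra_simps)
    ultimately show "\<bar>G (z - h / 2) x - G z x + B z / 2 * poly ea x\<bar> \<le> M"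
      using G[OF x, of "z - h / 2"] G[OF x, of z] Mge(3) by linarith
    have "\<bar>(A (z + h / 2) - A z - B z / 2) * poly ea x + (B (z + h / 2) - B z) * s x\<bar> \<le> 6 * q * e + 6 * q * r"
      using cb(2,4) Th[of z] omq[of z] q0 by (intro step x) linarith+
    moreover have "G (z + h / 2) x - G z x - B z / 2 * poly ea x =
        (G (z + h / 2) x - A (z + h / 2) * poly ea x - B (z + h / 2) * s x) - (G z x - A z * poly ea x - B z * s x)
        + ((A (z + h / 2) - A z - B z / 2) * poly ea x + (B (z + h / 2) - B z) * s x)"
      by (simp add: algebra_simps)
    ultimately show "\<bar>G (z + h / 2) x - G z x - B z / 2 * poly ea x\<bar> \<le> M"
      using G[OF x, of "z + h / 2"] G[OF x, of z] Mge(3) by linarith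
  qed
  define W where "W = ref_proj C k (\<lambda>x. D 0 (z + h * x))
      - ref_corr C k (G (z - h / 2)) (G z) (G (z + h / 2)) (\<lambda>\<xi>. h * ref_err C k (\<lambda>x. D 1 (z + h * x)) \<xi>)"
  have "W - qpoly ea eb ed (\<lambda>j. cf j z) = (W - (tp - smult (A z) ea - smult (B z) eb))
      + smult (- Th z) (taylor_monom (k + 3) - ed)"
    unfolding qpoly_def tpoly_split tp_def R_def A_def B_def Th_def by (simp add: smult_diff_right)
  then have "coeff_norm (W - qpoly ea eb ed (\<lambda>j. cf j z)) \<le>
      coeff_norm (W - (tp - smult (A z) ea - smult (B z) eb)) + \<bar>- Th z\<bar> * coeff_norm (taylor_monom (k + 3) - ed)"
    by (simp only: coeff_norm_smult[symmetric] coeff_norm_add)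
  also have "\<dots> \<le> defect_const C k * M + \<bar>Th z\<bar> * coeff_norm (taylor_monom (k + 3) - ed)"
    using main unfolding W_def[symmetric] by simp
  also have "\<dots> \<le> defect_const C k * M + q * coeff_norm (taylor_monom (k + 3) - ed)"
    by (intro add_left_mono mult_right_mono Th coeff_norm_nonneg)
  also have "\<dots> = (defect_const C k * (21 * r + 6 * e + 6) + coeff_norm (taylor_monom (k + 3) - ed)) * q"
    unfolding M_def by (simp add: algebra_simps)
  finally show ?thesis unfolding W_def q_def r_def e_def .
qed

text \<open>At spacing h/2 each window consists of four grid steps, and P steps cover exactly one
  period, so each of the four shifted sums telescopes to K.\<close>

lemma om_square_sum:
  fixes P :: nat
  assumes P: "real P * h = 2 * L" "P > 0"
  shows "(\<Sum>n\<in>{0..<int P}. (om (z + of_int n * h / 2))\<^sup>2) = 4 * h * K"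
proof -
  define f where "f n = E (z + of_int n * h / 2)" for n :: int
  define g where "g n = f (n + 1) - f n" for n
  have Esh: "E (y + L) = E y + K" for y using energy unfolding energy_bound_def by blast
  have eq: "z + of_int (n + int P) * h / 2 = (z + of_int n * h / 2) + L" for n
    using P by (simp add: field_simps)
  have fP: "f (n + int P) = f n + K" for n unfolding f_def eq by (rule Esh)
  have gP: "g (n + j + int P) = g (n + j)" for n j
    using fP[of "n + j"] fP[of "n + j + 1"] by (simp add: g_def add_ac)
  have g0: "(\<Sum>n\<in>{0..<int P}. g n) = K"
    unfolding g_def sum_int_telescope using fP[of 0] by simp
  have shift: "(\<Sum>n\<in>{0..<int P}. g (n + (j + 1))) = (\<Sum>n\<in>{0..<int P}. g (n + j))" for j
    using sum_periodic_shift[of "\<lambda>n. g (n + j)" P] gP P(2) by (simp add: add_ac)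
  have g1: "(\<Sum>n\<in>{0..<int P}. g (n + 1)) = K" using shift[of 0] g0 by simp
  have gm1: "(\<Sum>n\<in>{0..<int P}. g (n - 1)) = K" using shift[of "-1"] g0 by simp
  have gm2: "(\<Sum>n\<in>{0..<int P}. g (n - 2)) = K" using shift[of "-2"] gm1 by simp
  have "(om (z + of_int n * h / 2))\<^sup>2 = h * (g (n + 1) + g n + g (n - 1) + g (n - 2))" for n
  proof -
    have e: "z + of_int n * h / 2 + h = z + of_int (n + 2) * h / 2"
      "z + of_int n * h / 2 - h = z + of_int (n - 2) * h / 2" by (simp_all add: field_simps)
    have "(om (z + of_int n * h / 2))\<^sup>2 = h * (f (n + 2) - f (n - 2))"
      unfolding om_square e f_def ..
    then show ?thesis unfolding g_def by (simp add: add_ac)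
  qed
  then show ?thesis
    using g0 g1 gm1 gm2 by (simp add: sum.distrib flip: sum_distrib_left)
qed

end

section \<open>The error estimate\<close>

context uniform_mesh
begin

text \<open>Differentiability is given pointwise in x. Interpolation at fixed nodes transfers it to
  the local polynomials, and uniqueness of derivatives on [0, T] identifies v.\<close>

lemma DG_time_derivative:
  fixes w v :: "real \<Rightarrow> real \<Rightarrow> real" and k N :: nat
  assumes T: "T > 0" and w: "\<And>t. t \<in> {0..T} \<Longrightarrow> w t \<in> DG_space k (real N * h) h c"
    and der: "\<And>t x. t \<in> {0..T} \<Longrightarrow> ((\<lambda>s. w s x) has_real_derivative v t x) (at t within {0..T})"
  obtains p V where "\<And>t. t \<in> {0..T} \<Longrightarrow> w t = pw_poly (p t)"
    "\<And>t i. t \<in> {0..T} \<Longrightarrow> degree (p t i) \<le> k" "\<And>t i. t \<in> {0..T} \<Longrightarrow> p t (i + int N) = p t i"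
    "\<And>t. t \<in> {0..T} \<Longrightarrow> v t = pw_poly (V t)" "\<And>t i. degree (V t i) \<le> k"
    "\<And>t i \<xi>. t \<in> {0..T} \<Longrightarrow>
       ((\<lambda>s. poly (p s i) \<xi>) has_real_derivative poly (V t i) \<xi>) (at t within {0..T})"
proof -
  obtain x :: "nat \<Rightarrow> real" and l :: "nat \<Rightarrow> real poly" where
    x: "\<And>j. j \<le> k \<Longrightarrow> x j \<in> {- (1/2)..<1/2}" and l: "\<And>j. j \<le> k \<Longrightarrow> degree (l j) \<le> k"
    and rep: "\<And>p. degree p \<le> k \<Longrightarrow> p = (\<Sum>j\<le>k. smult (poly p (x j)) (l j))"
    by (rule lagrange_basis[of k]) (rule that)
  have "\<forall>t. \<exists>q. t \<in> {0..T} \<longrightarrow> w t = pw_poly q \<and> (\<forall>i. degree (q i) \<le> k \<and> q (i + int N) = q i)"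
    using w unfolding DG_space_iff by blast
  from choice[OF this] obtain p where p: "\<And>t. t \<in> {0..T} \<Longrightarrow> w t = pw_poly (p t)"
    "\<And>t i. t \<in> {0..T} \<Longrightarrow> degree (p t i) \<le> k" "\<And>t i. t \<in> {0..T} \<Longrightarrow> p t (i + int N) = p t i"
    by blast
  define V where "V t i = (\<Sum>j\<le>k. smult (v t (c i + h * x j)) (l j))" for t i
  have dV: "degree (V t i) \<le> k" for t i
    unfolding V_def using l by (intro degree_sum_le) (auto intro: order_trans[OF degree_smult_le])
  have d: "((\<lambda>s. poly (p s i) \<xi>) has_real_derivative poly (V t i) \<xi>) (at t within {0..T})"
    if t: "t \<in> {0..T}" for t i \<xi>
  proof -
    have "((\<lambda>s. \<Sum>j\<le>k. w s (c i + h * x j) * poly (l j) \<xi>) has_real_derivative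
        (\<Sum>j\<le>k. v t (c i + h * x j) * poly (l j) \<xi>)) (at t within {0..T})"
      by (intro DERIV_sum DERIV_cmult_right der t)
    moreover have "(\<Sum>j\<le>k. w s (c i + h * x j) * poly (l j) \<xi>) = poly (p s i) \<xi>" if s: "s \<in> {0..T}" for s
    proof -
      have "(\<Sum>j\<le>k. w s (c i + h * x j) * poly (l j) \<xi>) = (\<Sum>j\<le>k. poly (p s i) (x j) * poly (l j) \<xi>)"
        by (intro sum.cong refl) (simp add: p(1)[OF s] pw_poly_eq[OF x])
      also have "\<dots> = poly (\<Sum>j\<le>k. smult (poly (p s i) (x j)) (l j)) \<xi>" by (simp add: poly_sum)
      finally show ?thesis unfolding rep[OF p(2)[OF s], symmetric] .
    qed
    ultimately have "((\<lambda>s. poly (p s i) \<xi>) has_real_derivative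
        (\<Sum>j\<le>k. v t (c i + h * x j) * poly (l j) \<xi>)) (at t within {0..T})"
      by (rule has_field_derivative_transform_within[OF _ zero_less_one t])
    then show ?thesis unfolding V_def by (simp add: poly_sum)
  qed
  have "v t = pw_poly (V t)" if t: "t \<in> {0..T}" for t
  proof (rule pw_poly_eqI)
    fix i \<xi> assume \<xi>: "\<xi> \<in> {- (1/2)..<1/2 :: real}"
    have "((\<lambda>s. poly (p s i) \<xi>) has_real_derivative v t (c i + h * \<xi>)) (at t within {0..T})"
      by (rule has_field_derivative_transform_within[OF der[OF t] zero_less_one t])
        (simp add: p(1) pw_poly_eq[OF \<xi>])
    then show "v t (c i + h * \<xi>) = poly (V t i) \<xi>"
      using vector_derivative_unique_within_closed_interval[of 0 T t] T t d[OF t, of i \<xi>]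
      by (auto simp: has_real_derivative_iff_has_vector_derivative)
  qed
  then show thesis using that p dV d by blast
qed

lemma corrected_projection_eq:
  fixes C :: real and k N :: nat and \<omega> :: "real \<Rightarrow> real" and s :: int and c' :: "int \<Rightarrow> real"
  assumes other: "uniform_mesh h c'" and off: "\<And>i. c' (i + s) = c i + h / 2"
    and C: "C > 0" and cont: "\<And>x. isCont \<omega> x" "\<And>x. isCont (deriv \<omega>) x"
    and per: "\<And>x. \<omega> (x + real N * h) = \<omega> x" "\<And>x. deriv \<omega> (x + real N * h) = deriv \<omega> x"
  defines "E \<equiv> \<lambda>z. ref_err C k (\<lambda>\<xi>. \<omega> (z + h * \<xi>))"
  shows "(\<lambda>x. proj k (real N * h) (C * h) h c \<omega> x - corr1 k (real N * h) (C * h) h c c' \<omega> x) =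
    pw_poly (\<lambda>i. ref_proj C k (\<lambda>\<xi>. \<omega> (c i + h * \<xi>)) - ref_corr C k (E (c i - h / 2)) (E (c i))
      (E (c i + h / 2)) (\<lambda>\<xi>. h * ref_err C k (\<lambda>\<xi>. deriv \<omega> (c i + h * \<xi>)) \<xi>))"
  unfolding proj_eq[OF C cont(1) per(1)] corr1_eq[OF other off C cont per] E_def by (simp add: pw_poly_def[abs_def])

end

section \<open>The two meshes as one family of cells\<close>

lemma primal_dual_meshes:
  assumes "a < b" "N \<ge> 1"
  shows "mesh_size a b N > 0" "real N * mesh_size a b N = b - a"
    "uniform_mesh (mesh_size a b N) (primal_centre a b N)"
    "uniform_mesh (mesh_size a b N) (dual_centre a b N)"
    "dual_centre a b N (i + 0) = primal_centre a b N i + mesh_size a b N / 2"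
    "primal_centre a b N (i + 1) = dual_centre a b N i + mesh_size a b N / 2"
    "primal_centre a b N i = a + of_int (2 * i - 1) * mesh_size a b N / 2"
    "dual_centre a b N i = a + of_int (2 * i) * mesh_size a b N / 2"
proof -
  show h: "mesh_size a b N > 0" "real N * mesh_size a b N = b - a"
    using assms by (simp_all add: mesh_size_def)
  show "uniform_mesh (mesh_size a b N) (primal_centre a b N)"
    "uniform_mesh (mesh_size a b N) (dual_centre a b N)"
    using h by (simp_all add: uniform_mesh_def primal_centre_def dual_centre_def algebra_simps)
qed (simp_all add: primal_centre_def dual_centre_def algebra_simps add_divide_distrib diff_divide_distrib)

lemma int_parity_cases:
  fixes n :: int
  obtains i where "n = 2 * i" | i where "n = 2 * i - 1"
proof (cases "even n")
  case False
  then obtain j where "n = 2 * j + 1" by (elim oddE)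
  then show ?thesis using that(2)[of "j + 1"] by simp
qed (use that(1) in auto)

text \<open>
  The primal and the dual cells are numbered jointly along the line, the primal cell \<open>I\<^sub>i\<close> as
  \<open>2 * i - 1\<close> and the dual cell \<open>I\<^bsub>i+1/2\<^esub>\<close> as \<open>2 * i\<close>. Both halves of the scheme then become one
  family of equations on consecutive cells.
\<close>

lemma cdg_solution_polys:
  fixes a b C T :: real and k N :: nat and uC uD :: "real \<Rightarrow> real \<Rightarrow> real"
  defines "h \<equiv> mesh_size a b N"
  assumes ab: "a < b" and N: "N \<ge> 1" and C: "C > 0" and T: "T > 0"
    and sol: "cdg_solution a b k C N T uC uD"
  obtains p V :: "real \<Rightarrow> int \<Rightarrow> real poly" where
    "\<And>t. t \<in> {0..T} \<Longrightarrow> uC t = uniform_mesh.pw_poly h (primal_centre a b N) (\<lambda>i. p t (2 * i - 1))"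
    "\<And>t. t \<in> {0..T} \<Longrightarrow> uD t = uniform_mesh.pw_poly h (dual_centre a b N) (\<lambda>i. p t (2 * i))"
    "\<And>t n. t \<in> {0..T} \<Longrightarrow> degree (p t n) \<le> k" "\<And>t n. degree (V t n) \<le> k"
    "\<And>t n. t \<in> {0..T} \<Longrightarrow> p t (n + int (2 * N)) = p t n"
    "\<And>t n \<xi>. t \<in> {0..T} \<Longrightarrow>
       ((\<lambda>s. poly (p s n) \<xi>) has_real_derivative poly (V t n) \<xi>) (at t within {0..T})"
    "\<And>t n \<phi>. t \<in> {0..T} \<Longrightarrow> degree \<phi> \<le> k \<Longrightarrow> h * ref_inner (poly (V t n)) \<phi> =
       cell_form C (poly (p t (n - 1))) (poly (p t n)) (poly (p t (n + 1))) \<phi>"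
proof -
  note mesh = primal_dual_meshes[OF ab N, folded h_def]
  interpret P: uniform_mesh h "primal_centre a b N" by (rule mesh)
  interpret D: uniform_mesh h "dual_centre a b N" by (rule mesh)
  from sol obtain vC vD where s:
    "\<And>t. t \<in> {0..T} \<Longrightarrow> uC t \<in> DG_space k (real N * h) h (primal_centre a b N)"
    "\<And>t. t \<in> {0..T} \<Longrightarrow> uD t \<in> DG_space k (real N * h) h (dual_centre a b N)"
    "\<And>t x. t \<in> {0..T} \<Longrightarrow> ((\<lambda>s. uC s x) has_real_derivative vC t x) (at t within {0..T})"
    "\<And>t x. t \<in> {0..T} \<Longrightarrow> ((\<lambda>s. uD s x) has_real_derivative vD t x) (at t within {0..T})"
    "\<And>t i \<phi>. t \<in> {0..T} \<Longrightarrow> \<phi> \<in> DG_space k (real N * h) h (primal_centre a b N) \<Longrightarrow>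
      integral (cell h (primal_centre a b N i)) (\<lambda>x. vC t x * \<phi> x) =
      cdg_form (C * h) h (primal_centre a b N i) (uC t) (uD t) \<phi>"
    "\<And>t i \<phi>. t \<in> {0..T} \<Longrightarrow> \<phi> \<in> DG_space k (real N * h) h (dual_centre a b N) \<Longrightarrow>
      integral (cell h (dual_centre a b N i)) (\<lambda>x. vD t x * \<phi> x) =
      cdg_form (C * h) h (dual_centre a b N i) (uD t) (uC t) \<phi>"
    unfolding cdg_solution_def Let_def mesh(2) h_def[symmetric] by blast
  obtain pC VC where pC: "\<And>t. t \<in> {0..T} \<Longrightarrow> uC t = P.pw_poly (pC t)"
    "\<And>t i. t \<in> {0..T} \<Longrightarrow> degree (pC t i) \<le> k" "\<And>t i. t \<in> {0..T} \<Longrightarrow> pC t (i + int N) = pC t i"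
    "\<And>t. t \<in> {0..T} \<Longrightarrow> vC t = P.pw_poly (VC t)" "\<And>t i. degree (VC t i) \<le> k"
    "\<And>t i \<xi>. t \<in> {0..T} \<Longrightarrow>
       ((\<lambda>s. poly (pC s i) \<xi>) has_real_derivative poly (VC t i) \<xi>) (at t within {0..T})"
    by (rule P.DG_time_derivative[OF T s(1,3)]) (assumption | rule that)+
  obtain pD VD where pD: "\<And>t. t \<in> {0..T} \<Longrightarrow> uD t = D.pw_poly (pD t)"
    "\<And>t i. t \<in> {0..T} \<Longrightarrow> degree (pD t i) \<le> k" "\<And>t i. t \<in> {0..T} \<Longrightarrow> pD t (i + int N) = pD t i"
    "\<And>t. t \<in> {0..T} \<Longrightarrow> vD t = D.pw_poly (VD t)" "\<And>t i. degree (VD t i) \<le> k"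
    "\<And>t i \<xi>. t \<in> {0..T} \<Longrightarrow>
       ((\<lambda>s. poly (pD s i) \<xi>) has_real_derivative poly (VD t i) \<xi>) (at t within {0..T})"
    by (rule D.DG_time_derivative[OF T s(2,4)]) (assumption | rule that)+
  define p where "p t n = (if even n then pD t (n div 2) else pC t ((n + 1) div 2))" for t n
  define V where "V t n = (if even n then VD t (n div 2) else VC t ((n + 1) div 2))" for t n
  have p: "p t (2 * i) = pD t i" "p t (2 * i - 1) = pC t i" "p t (2 * i + 1) = pC t (i + 1)"
    "p t (2 * i - 2) = pD t (i - 1)" "V t (2 * i) = VD t i" "V t (2 * i - 1) = VC t i" for t i
    unfolding p_def V_def by (simp_all add: diff_divide_distrib add.commute)
  show thesis
  proof
    fix t :: real and n :: int assume t: "t \<in> {0..T}"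
    show "uC t = P.pw_poly (\<lambda>i. p t (2 * i - 1))" "uD t = D.pw_poly (\<lambda>i. p t (2 * i))"
      using pC(1) pD(1) t by (simp_all add: p)
    show "degree (p t n) \<le> k" using pC(2) pD(2) t by (simp add: p_def)
    show "p t (n + int (2 * N)) = p t n"
    proof (cases n rule: int_parity_cases)
      case (1 i)
      have "n + int (2 * N) = 2 * (i + int N)" using 1 by simp
      then show ?thesis unfolding 1 p using pD(3)[OF t] by (simp only: p)
    next
      case (2 i)
      have "n + int (2 * N) = 2 * (i + int N) - 1" using 2 by simp
      then show ?thesis unfolding 2 p using pC(3)[OF t] by (simp only: p)
    qed
    show "((\<lambda>s. poly (p s n) \<xi>) has_real_derivative poly (V t n) \<xi>) (at t within {0..T})" for \<xi>
      using pC(6)[OF t] pD(6)[OF t] by (simp add: p_def V_def)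
    fix \<phi> :: "real poly" assume d: "degree \<phi> \<le> k"
    show "h * ref_inner (poly (V t n)) \<phi> =
      cell_form C (poly (p t (n - 1))) (poly (p t n)) (poly (p t (n + 1))) \<phi>"
    proof (cases n rule: int_parity_cases)
      case (1 i)
      have "h * ref_inner (poly (VD t i)) \<phi> =
          cell_form C (poly (pC t (i + 1 - 1))) (poly (pD t i)) (poly (pC t (i + 1))) \<phi>"
        using s(6)[OF t D.local_poly_const[OF d], of i]
        unfolding pC(1)[OF t] pD(1,4)[OF t] D.integral_cell_pw_poly
          D.cdg_form_pw_poly[OF P.uniform_mesh_axioms mesh(6) C] .
      then show ?thesis unfolding 1 p add_diff_cancel_right' .
    next
      case (2 i)
      have "h * ref_inner (poly (VC t i)) \<phi> =
          cell_form C (poly (pD t (i + 0 - 1))) (poly (pC t i)) (poly (pD t (i + 0))) \<phi>"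
        using s(5)[OF t P.local_poly_const[OF d], of i]
        unfolding pD(1)[OF t] pC(1,4)[OF t] P.integral_cell_pw_poly
          P.cdg_form_pw_poly[OF D.uniform_mesh_axioms mesh(5) C] .
      moreover have "n - 1 = 2 * i - 2" "n + 1 = 2 * i" using 2 by simp_all
      ultimately show ?thesis unfolding 2 by (simp only: p) simp
    qed
  next
    fix t n show "degree (V t n) \<le> k" using pC(5) pD(5) by (simp add: V_def)
  qed
qed

context taylor_data
begin

text \<open>Q is followed along the characteristic, with centre y n - t, so its time derivative is
  -\<open>Qd\<close>/h and the residual of Q is exactly the right-hand side of the error
  equation.\<close>

lemma scheme_error:
  fixes p V :: "real \<Rightarrow> int \<Rightarrow> real poly" and y0 C T Kn B :: real and P :: nat and ea eb ed :: "real poly"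
  defines "Q \<equiv> \<lambda>z. qpoly ea eb ed (\<lambda>j. cf j z)" and "y \<equiv> \<lambda>n. y0 + of_int n * h / 2"
  assumes C: "C > 0" and T: "T > 0" and P: "P > 0" "real P * h = 2 * L" and Kn: "Kn > 0"
    and norm: "\<And>p. degree p \<le> k \<Longrightarrow> coeff_norm p \<le> Kn * sqrt (ref_inner (poly p) p)"
    and ep: "error_polys C k ea eb ed"
    and Dper: "\<And>j x. j \<le> \<sigma> \<Longrightarrow> D j (x + L) = D j x"
    and p: "\<And>t n. t \<in> {0..T} \<Longrightarrow> degree (p t n) \<le> k" "\<And>t n. degree (V t n) \<le> k"
      "\<And>t n. t \<in> {0..T} \<Longrightarrow> p t (n + int P) = p t n"
      "\<And>t n \<xi>. t \<in> {0..T} \<Longrightarrow>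
         ((\<lambda>s. poly (p s n) \<xi>) has_real_derivative poly (V t n) \<xi>) (at t within {0..T})"
      "\<And>t n \<phi>. t \<in> {0..T} \<Longrightarrow> degree \<phi> \<le> k \<Longrightarrow> h * ref_inner (poly (V t n)) \<phi> =
         cell_form C (poly (p t (n - 1))) (poly (p t n)) (poly (p t (n + 1))) \<phi>"
    and init: "\<And>n. coeff_norm (p 0 n - Q (y n)) \<le> B" and B: "B \<ge> 0"
  shows "sqrt (\<Sum>n\<in>{0..<int P}. ref_inner (poly (p T n - Q (y n - T))) (p T n - Q (y n - T))) \<le>
    sqrt (real P) * B + Kn * (5 * residual_const C k (coeff_norm ea + coeff_norm eb + coeff_norm ed)
      * h ^ \<sigma> * sqrt (4 * h * K)) / h * T"
proof -
  define R where "R = residual_const C k (coeff_norm ea + coeff_norm eb + coeff_norm ed)"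
  define Qd where "Qd z = qpoly ea eb ed (\<lambda>j. cd j z)" for z
  define \<delta> where "\<delta> t n = 5 * R * h ^ \<sigma> * om (y n - t)" for t n
  have R: "R \<ge> 0" unfolding R_def by (intro residual_const_nonneg C add_nonneg_nonneg coeff_norm_nonneg)
  obtain x :: "nat \<Rightarrow> real" and l :: "nat \<Rightarrow> real poly" where
    x: "\<And>j. j \<le> k \<Longrightarrow> x j \<in> {- (1/2)..<1/2}" and l: "\<And>j. j \<le> k \<Longrightarrow> degree (l j) \<le> k"
    and rep: "\<And>p. degree p \<le> k \<Longrightarrow> p = (\<Sum>j\<le>k. smult (poly p (x j)) (l j))"
    by (rule lagrange_basis[of k]) (rule that)
  define e where "e t n = p t n - Q (y n - t)" for t n
  define e' where "e' t n = V t n + smult (1 / h) (Qd (y n - t))" for t n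
  define c where "c t n i = poly (e t n) (x i)" for t n i
  define c' where "c' t n i = poly (e' t n) (x i)" for t n i
  have dQ: "degree (Q z) \<le> k" "degree (Qd z) \<le> k" for z
    unfolding Q_def Qd_def by (intro degree_qpoly error_polysD[OF ep])+
  have e: "(\<Sum>i\<le>k. smult (c t n i) (l i)) = e t n" if "t \<in> {0..T}" for t n
    unfolding c_def by (rule rep[symmetric]) (use p(1)[OF that] dQ in \<open>auto simp: e_def intro!: degree_diff_le\<close>)
  have e': "(\<Sum>i\<le>k. smult (c' t n i) (l i)) = e' t n" for t n
    unfolding c'_def by (rule rep[symmetric])
      (use p(2) dQ in \<open>auto simp: e'_def intro!: degree_add_le order_trans[OF degree_smult_le]\<close>)
  have T0: "0 \<in> {0..T}" "T \<in> {0..T}" using T by auto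
  have stab: "sqrt (\<Sum>n\<in>{0..<int P}. ref_inner (poly (\<Sum>i\<le>k. smult (c T n i) (l i))) (\<Sum>i\<le>k. smult (c T n i) (l i))) \<le>
    sqrt (\<Sum>n\<in>{0..<int P}. ref_inner (poly (\<Sum>i\<le>k. smult (c 0 n i) (l i))) (\<Sum>i\<le>k. smult (c 0 n i) (l i)))
    + Kn * (5 * R * h ^ \<sigma> * sqrt (4 * h * K)) / h * T"
  proof (rule scheme_stability[where C = C and c' = c' and \<delta> = \<delta>])
    show "C > 0" "h > 0" "P > 0" "T > 0" "Kn > 0" by (fact C h_pos P(1) T Kn)+
    show "coeff_norm p \<le> Kn * sqrt (ref_inner (poly p) p)" if "degree p \<le> k" for p by (rule norm[OF that])
    show "degree (l i) \<le> k" if "i \<le> k" for i by (rule l[OF that])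
    fix t n assume t: "t \<in> {0..T}"
    show "((\<lambda>s. c s n i) has_real_derivative c' t n i) (at t within {0..T})" for i
    proof -
      have "((\<lambda>z. poly (Q z) (x i)) has_real_derivative poly (Qd (y n - t)) (x i) / h) (at (y n - t))"
        unfolding Q_def Qd_def by (rule qpoly_deriv)
      then have "((\<lambda>s. poly (Q (y n - s)) (x i)) has_real_derivative poly (Qd (y n - t)) (x i) / h * (0 - 1))
          (at t within {0..T})"
        by (rule DERIV_chain2) (intro DERIV_diff DERIV_const DERIV_ident)
      from DERIV_diff[OF p(4)[OF t, of n "x i"] this] show ?thesis
        unfolding c_def c'_def e_def e'_def by simp
    qed
    have Qper: "Q (z + L) = Q z" for z
    proof -
      have "cf j (z + L) = cf j z" for j
      proof -
        have "z + L + h / 2 = z + h / 2 + L" "z + L - h / 2 = z - h / 2 + L" by simp_all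
        then have "D (\<sigma> - 1) (z + L + h / 2) = D (\<sigma> - 1) (z + h / 2)"
          "D (\<sigma> - 1) (z + L - h / 2) = D (\<sigma> - 1) (z - h / 2)" by (simp_all only: Dper diff_le_self)
        then show ?thesis unfolding cf_def using Dper[of j z] by simp
      qed
      then show ?thesis unfolding Q_def by simp
    qed
    have yP: "y (n + int P) - t = (y n - t) + L"
      unfolding y_def using P(2) by (simp add: field_simps)
    have "e t (n + int P) = e t n" unfolding e_def p(3)[OF t] yP Qper ..
    then show "(\<Sum>i\<le>k. smult (c t (n + int P) i) (l i)) = (\<Sum>i\<le>k. smult (c t n i) (l i))"
      unfolding e[OF t] .
    show "\<delta> t n \<ge> 0" unfolding \<delta>_def using R h_pos om_nonneg by simp
    show "\<bar>h * ref_inner (poly (\<Sum>i\<le>k. smult (c' t n i) (l i))) \<phi>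
        - cell_form C (poly (\<Sum>i\<le>k. smult (c t (n - 1) i) (l i))) (poly (\<Sum>i\<le>k. smult (c t n i) (l i)))
          (poly (\<Sum>i\<le>k. smult (c t (n + 1) i) (l i))) \<phi>\<bar> \<le> \<delta> t n * coeff_norm \<phi>"
      if d: "degree \<phi> \<le> k" for \<phi>
    proof -
      define z where "z = y n - t"
      have z: "y (n - 1) - t = z - h / 2" "y (n + 1) - t = z + h / 2"
        unfolding z_def y_def by (simp_all add: field_simps)
      have cp: "continuous_on ref_cell (poly q)" for q :: "real poly" by (intro continuous_intros)
      have "cell_form C (poly (e t (n - 1))) (poly (e t n)) (poly (e t (n + 1))) \<phi> =
          1 * cell_form C (poly (p t (n - 1))) (poly (p t n)) (poly (p t (n + 1))) \<phi>
          + (- 1) * cell_form C (poly (Q (z - h / 2))) (poly (Q z)) (poly (Q (z + h / 2))) \<phi>"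
        unfolding e_def z z_def[symmetric] cell_form_lin[OF cp cp cp cp cp cp, symmetric]
        by (intro arg_cong4[where f = "cell_form C"]) auto
      moreover have "ref_inner (poly (e' t n)) \<phi> =
          1 * ref_inner (poly (V t n)) \<phi> + (1 / h) * ref_inner (poly (Qd z)) \<phi>"
        unfolding e'_def z_def[symmetric] ref_inner_lin[OF cp cp, symmetric]
        by (rule arg_cong[where f = "\<lambda>f. ref_inner f \<phi>"]) auto
      moreover have "h * (1 / h * ref_inner (poly (Qd z)) \<phi>) = ref_inner (poly (Qd z)) \<phi>" using h_pos by simp
      ultimately have "h * ref_inner (poly (e' t n)) \<phi>
          - cell_form C (poly (e t (n - 1))) (poly (e t n)) (poly (e t (n + 1))) \<phi> =
          cell_form C (poly (Q (z - h / 2))) (poly (Q z)) (poly (Q (z + h / 2))) \<phi> + ref_inner (poly (Qd z)) \<phi>"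
        using p(5)[OF t d, of n] by (simp add: distrib_left)
      moreover have "\<bar>cell_form C (poly (Q (z - h / 2))) (poly (Q z)) (poly (Q (z + h / 2))) \<phi>
          + ref_inner (poly (Qd z)) \<phi>\<bar> \<le> R * (5 * (h ^ \<sigma> * om z) * coeff_norm \<phi>)"
        unfolding Q_def Qd_def R_def by (rule qpoly_residual[OF C ep d])
      ultimately show ?thesis unfolding e[OF t] e' \<delta>_def z_def by (simp add: mult_ac)
    qed
    have "(\<Sum>n\<in>{0..<int P}. (\<delta> t n)\<^sup>2) = (5 * R * h ^ \<sigma>)\<^sup>2 * (\<Sum>n\<in>{0..<int P}. (om (y0 - t + of_int n * h / 2))\<^sup>2)"
      unfolding \<delta>_def y_def by (simp add: power_mult_distrib sum_distrib_left algebra_simps)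
    also have "\<dots> = (5 * R * h ^ \<sigma>)\<^sup>2 * (4 * h * K)" unfolding om_square_sum[OF P(2,1)] ..
    finally show "sqrt (\<Sum>n\<in>{0..<int P}. (\<delta> t n)\<^sup>2) \<le> 5 * R * h ^ \<sigma> * sqrt (4 * h * K)"
      using R h_pos by (simp add: real_sqrt_mult)
  qed
  have "ref_inner (poly (e 0 n)) (e 0 n) \<le> B\<^sup>2" for n
  proof -
    have "coeff_norm (e 0 n) \<le> B" unfolding e_def using init[of n] by simp
    then have "(coeff_norm (e 0 n))\<^sup>2 \<le> B\<^sup>2" by (intro power_mono coeff_norm_nonneg)
    then show ?thesis using ref_inner_poly_le[of "e 0 n"] by linarith
  qed
  then have "(\<Sum>n\<in>{0..<int P}. ref_inner (poly (e 0 n)) (e 0 n)) \<le> (\<Sum>n\<in>{0..<int P}. B\<^sup>2)"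
    by (intro sum_mono)
  then have "sqrt (\<Sum>n\<in>{0..<int P}. ref_inner (poly (e 0 n)) (e 0 n)) \<le> sqrt (real P * B\<^sup>2)"
    by (intro real_sqrt_le_mono) simp
  also have "\<dots> = sqrt (real P) * B" using B by (simp add: real_sqrt_mult)
  finally have "sqrt (\<Sum>n\<in>{0..<int P}. ref_inner (poly (e T n)) (e T n)) \<le>
    sqrt (real P) * B + Kn * (5 * R * h ^ \<sigma> * sqrt (4 * h * K)) / h * T"
    using stab unfolding e[OF T0(1)] e[OF T0(2)] by linarith
  then show ?thesis unfolding e_def R_def .
qed

text \<open>The error polynomials have mean zero, so Q has the cell mean of the Taylor polynomial
  although it differs from it pointwise by terms of order h^(k+1). This is how the averages
  gain.\<close>

lemma cell_mean_error:
  fixes z :: real and p ea eb ed :: "real poly"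
  assumes "ref_mean (poly ea) = 0" "ref_mean (poly eb) = 0" "ref_mean (poly ed) = 0"
  defines "Q \<equiv> qpoly ea eb ed (\<lambda>j. cf j z)"
  shows "\<bar>ref_mean (\<lambda>\<xi>. D 0 (z + h * \<xi>) - poly p \<xi>) + ref_mean (poly (p - Q))\<bar> \<le> 5 * (h ^ \<sigma> * om z)"
proof -
  define tp where "tp = tpoly (\<lambda>j. cf j z)"
  note m = linear_poly_simps[OF linear_poly_ref_mean]
  have c: "continuous_on ref_cell (\<lambda>\<xi>. D 0 (z + h * \<xi>) - poly tp \<xi>)" "continuous_on ref_cell (poly (tp - p))"
    by (intro continuous_intros cell_cont)+
  have "ref_mean (\<lambda>\<xi>. D 0 (z + h * \<xi>) - poly p \<xi>) =
      ref_mean (\<lambda>\<xi>. 1 * (D 0 (z + h * \<xi>) - poly tp \<xi>) + 1 * poly (tp - p) \<xi>)" by simp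
  also have "\<dots> = ref_mean (\<lambda>\<xi>. D 0 (z + h * \<xi>) - poly tp \<xi>) + ref_mean (poly (tp - p))"
    unfolding ref_mean_lin[OF c] by simp
  also have "ref_mean (poly (tp - p)) = - ref_mean (poly (p - Q))"
    unfolding Q_def qpoly_def tp_def by (simp add: m assms)
  finally have "ref_mean (\<lambda>\<xi>. D 0 (z + h * \<xi>) - poly p \<xi>) + ref_mean (poly (p - Q)) =
    ref_mean (\<lambda>\<xi>. D 0 (z + h * \<xi>) - poly tp \<xi>)" by simp
  also have "\<bar>\<dots>\<bar> \<le> 5 * (h ^ \<sigma> * om z)"
  proof (rule ref_mean_bound[OF c(1)])
    fix x :: real assume "x \<in> ref_cell"
    then have "\<bar>x\<bar> \<le> 1/2" by (simp only: ref_cell_iff)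
    then show "\<bar>D 0 (z + h * x) - poly tp x\<bar> \<le> 5 * (h ^ \<sigma> * om z)"
      unfolding tp_def using h_pos by (intro value_bound) auto
  qed
  finally show ?thesis .
qed

text \<open>The constant is written out because it has to be chosen before N: it involves k, C, T,
  the length of the interval and the initial datum.\<close>

lemma mesh_error:
  fixes a b C T Kn :: real and N :: nat and u uC uD :: "real \<Rightarrow> real \<Rightarrow> real" and ea eb ed :: "real poly"
  defines "B \<equiv> (defect_const C k * (21 * ref_const C k + 6 * coeff_norm ea + 6) + coeff_norm (taylor_monom (k + 3) - ed))
      * (S + om_max)"
    and "R \<equiv> residual_const C k (coeff_norm ea + coeff_norm eb + coeff_norm ed)"
  assumes ab: "a < b" and N: "N \<ge> 1" and C: "C > 0" and T: "T > 0"
    and hL: "h = mesh_size a b N" "L = b - a" and K: "K \<ge> 0"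
    and sol: "cdg_solution a b k C N T uC uD"
    and ini: "corrected_initialization a b k C N (u 0) (uC 0) (uD 0)"
    and u: "u 0 = D 0" "\<And>x. u T x = D 0 (x - T)"
    and Dper: "\<And>j x. j \<le> \<sigma> \<Longrightarrow> D j (x + L) = D j x"
    and Kn: "Kn > 0" "\<And>p. degree p \<le> k \<Longrightarrow> coeff_norm p \<le> Kn * sqrt (ref_inner (poly p) p)"
    and ep: "error_polys C k ea eb ed"
  shows "avg_error a b N (u T) (uC T) \<le>
    (sqrt (2 * L) * (5 * om_max) + sqrt 2 * (sqrt (2 * L) * B + 10 * Kn * R * sqrt K * T)) * h ^ \<sigma>"
proof -
  define Q where "Q z = qpoly ea eb ed (\<lambda>j. cf j z)" for z
  define y where "y n = a + of_int n * h / 2" for n :: int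
  note mesh = primal_dual_meshes[OF ab N, folded hL]
  interpret P: uniform_mesh h "primal_centre a b N" by (rule mesh)
  interpret Dm: uniform_mesh h "dual_centre a b N" by (rule mesh)
  have hs: "h ^ \<sigma> > 0" using h_pos by simp
  have L: "L > 0" using ab hL by simp
  have R0: "R \<ge> 0" unfolding R_def by (intro residual_const_nonneg C add_nonneg_nonneg coeff_norm_nonneg)
  obtain p V where p: "\<And>t. t \<in> {0..T} \<Longrightarrow> uC t = P.pw_poly (\<lambda>i. p t (2 * i - 1))"
    "\<And>t. t \<in> {0..T} \<Longrightarrow> uD t = Dm.pw_poly (\<lambda>i. p t (2 * i))"
    "\<And>t n. t \<in> {0..T} \<Longrightarrow> degree (p t n) \<le> k" "\<And>t n. degree (V t n) \<le> k"
    "\<And>t n. t \<in> {0..T} \<Longrightarrow> p t (n + int (2 * N)) = p t n"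
    "\<And>t n \<xi>. t \<in> {0..T} \<Longrightarrow>
       ((\<lambda>s. poly (p s n) \<xi>) has_real_derivative poly (V t n) \<xi>) (at t within {0..T})"
    "\<And>t n \<phi>. t \<in> {0..T} \<Longrightarrow> degree \<phi> \<le> k \<Longrightarrow> h * ref_inner (poly (V t n)) \<phi> =
       cell_form C (poly (p t (n - 1))) (poly (p t n)) (poly (p t (n + 1))) \<phi>"
    by (rule cdg_solution_polys[OF ab N C T sol, folded hL]) (assumption | rule that)+
  define G where "G z = ref_err C k (\<lambda>x. D 0 (z + h * x))" for z
  define I where "I z = ref_proj C k (\<lambda>x. D 0 (z + h * x))
      - ref_corr C k (G (z - h / 2)) (G z) (G (z + h / 2)) (\<lambda>\<xi>. h * ref_err C k (\<lambda>x. D 1 (z + h * x)) \<xi>)" for z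
  have T0: "0 \<in> {0..T}" "T \<in> {0..T}" using T by auto
  have D1: "deriv (D 0) = D 1"
    using DERIV_imp_deriv[OF der[of 0]] order_ge by (auto simp: fun_eq_iff)
  have per: "D 0 (x + real N * h) = D 0 x" "D 1 (x + real N * h) = D 1 x" for x
    unfolding mesh(2) using Dper[of 0 x] Dper[of 1 x] order_ge by auto
  have init: "p 0 n = I (y n)" for n
  proof (cases n rule: int_parity_cases)
    case (1 i)
    have "Dm.pw_poly (\<lambda>i. p 0 (2 * i)) = Dm.pw_poly (\<lambda>i. I (y (2 * i)))"
      using ini Dm.corrected_projection_eq[where k = k and N = N, OF P.uniform_mesh_axioms mesh(6) C D_cont[folded D1] per[folded D1]]
      unfolding corrected_initialization_def Let_def hL(1)[symmetric] hL(2)[symmetric] u(1) p(2)[OF T0(1)] D1 I_def G_def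
      mesh(2) y_def mesh(8)[symmetric] by simp
    from Dm.pw_poly_inj[OF this] show ?thesis unfolding 1 by (rule fun_cong)
  next
    case (2 i)
    have "P.pw_poly (\<lambda>i. p 0 (2 * i - 1)) = P.pw_poly (\<lambda>i. I (y (2 * i - 1)))"
      using ini P.corrected_projection_eq[where k = k and N = N, OF Dm.uniform_mesh_axioms mesh(5) C D_cont[folded D1] per[folded D1]]
      unfolding corrected_initialization_def Let_def hL(1)[symmetric] hL(2)[symmetric] u(1) p(1)[OF T0(1)] D1 I_def G_def
      mesh(2) y_def mesh(7)[symmetric] by simp
    from P.pw_poly_inj[OF this] show ?thesis unfolding 2 by (rule fun_cong)
  qed
  have B: "coeff_norm (p 0 n - Q (y n)) \<le> B * h ^ \<sigma>" for n
    using initial_close[OF C ep, of "y n"]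
    unfolding init I_def G_def Q_def B_def by (simp only: mult_ac)
  have B0: "B * h ^ \<sigma> \<ge> 0" using B[of 0] coeff_norm_nonneg order_trans by blast
  define e where "e n = p T n - Q (y n - T)" for n
  define q where "q n = ref_inner (poly (e n)) (e n)" for n
  define Y where "Y = (\<Sum>n\<in>{0..<int (2 * N)}. q n)"
  have P2: "2 * N > 0" "real (2 * N) * h = 2 * L" using N mesh(2) by auto
  have Ybound: "sqrt Y \<le> sqrt (real (2 * N)) * (B * h ^ \<sigma>) + Kn * (5 * R * h ^ \<sigma> * sqrt (4 * h * K)) / h * T"
    unfolding Y_def q_def e_def y_def R_def Q_def
    by (rule scheme_error[OF C T P2 Kn ep Dper p(3-7) B[unfolded Q_def y_def] B0])
  define W where "W = 5 * (h ^ \<sigma> * om_max)"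
  have W0: "W \<ge> 0" unfolding W_def using hs om_max_nonneg by simp
  have q0: "(ref_mean (poly (e n)))\<^sup>2 \<le> q n" for n unfolding q_def by (rule ref_mean_poly_square_le)
  then have qn: "q n \<ge> 0" for n using order_trans zero_le_power2 by blast
  have avg: "(1 / h * integral (cell h (primal_centre a b N i)) (\<lambda>x. u T x - uC T x))\<^sup>2 \<le> 2 * W\<^sup>2 + 2 * q (2 * i - 1)"
    for i
  proof -
    define z where "z = y (2 * i - 1) - T"
    define m where "m = ref_mean (\<lambda>\<xi>. D 0 (z + h * \<xi>) - poly (p T (2 * i - 1)) \<xi>)"
    have pc: "primal_centre a b N i - T = z" unfolding z_def y_def mesh(7) ..
    have "integral {primal_centre a b N i + h * - (1/2)..primal_centre a b N i + h * (1/2)} (\<lambda>x. u T x - uC T x) = h * m"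
      unfolding m_def ref_mean_def
    proof (rule integral_ref[OF h_pos, where S = "{1/2}"])
      fix \<xi> :: real assume "\<xi> \<in> ref_cell - {1/2}"
      then have \<xi>: "\<xi> \<in> {- (1/2)..<1/2}" by auto
      have eq: "primal_centre a b N i + h * \<xi> - T = z + h * \<xi>" using pc by simp
      show "u T (primal_centre a b N i + h * \<xi>) - uC T (primal_centre a b N i + h * \<xi>) =
          D 0 (z + h * \<xi>) - poly (p T (2 * i - 1)) \<xi>"
        unfolding u(2) p(1)[OF T0(2)] P.pw_poly_eq[OF \<xi>] eq ..
    qed (auto intro!: continuous_intros cell_cont)
    then have "1 / h * integral (cell h (primal_centre a b N i)) (\<lambda>x. u T x - uC T x) = m"
      using h_pos by simp
    moreover have "m\<^sup>2 \<le> 2 * W\<^sup>2 + 2 * q (2 * i - 1)"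
    proof -
      define r where "r = ref_mean (poly (e (2 * i - 1)))"
      have "\<bar>m + r\<bar> \<le> 5 * (h ^ \<sigma> * om z)"
        unfolding m_def r_def e_def z_def[symmetric] Q_def by (rule cell_mean_error[OF error_polysD(5-7)[OF ep]])
      also have "\<dots> \<le> W" unfolding W_def using om_le[of z] hs by simp
      finally have "(m + r)\<^sup>2 \<le> W\<^sup>2" using W0 by (simp add: abs_le_square_iff[symmetric])
      moreover have "m\<^sup>2 \<le> 2 * (m + r)\<^sup>2 + 2 * r\<^sup>2"
        using zero_le_power2[of "m + 2 * r"] by (simp add: power2_eq_square algebra_simps)
      moreover have "r\<^sup>2 \<le> q (2 * i - 1)" unfolding r_def by (rule q0)
      ultimately show ?thesis by linarith
    qed
    ultimately show ?thesis by simp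
  qed
  \<comment> \<open>Primal cells carry the odd numbers; the dual contributions are nonnegative and
    may be added.\<close>
  have "(\<Sum>i = 1..int N. q (2 * i - 1)) = sum q ((\<lambda>i. 2 * i - 1) ` {1..int N})"
    by (subst sum.reindex) (auto simp: inj_on_def)
  also have "\<dots> \<le> Y" unfolding Y_def by (rule sum_mono2) (auto simp: qn)
  finally have "(\<Sum>i = 1..int N. 2 * W\<^sup>2 + 2 * q (2 * i - 1)) \<le> real N * (2 * W\<^sup>2) + 2 * Y"
    by (simp add: sum.distrib flip: sum_distrib_left)
  then have "(\<Sum>i = 1..int N. (1 / h * integral (cell h (primal_centre a b N i)) (\<lambda>x. u T x - uC T x))\<^sup>2)
      \<le> real N * (2 * W\<^sup>2) + 2 * Y"
    by (rule order_trans[OF sum_mono[OF avg]])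
  then have "h * (\<Sum>i = 1..int N. (1 / h * integral (cell h (primal_centre a b N i)) (\<lambda>x. u T x - uC T x))\<^sup>2)
      \<le> h * (real N * (2 * W\<^sup>2) + 2 * Y)"
    by (rule mult_left_mono) (use h_pos in simp)
  also have "\<dots> = (real N * h) * (2 * W\<^sup>2) + 2 * (h * Y)" by (simp add: algebra_simps)
  also have "\<dots> = 2 * L * W\<^sup>2 + 2 * (h * Y)" unfolding mesh(2) by simp
  finally have "avg_error a b N (u T) (uC T) \<le> sqrt (2 * L * W\<^sup>2 + 2 * (h * Y))"
    unfolding avg_error_def Let_def hL(1)[symmetric] by (rule real_sqrt_le_mono)
  also have "\<dots> \<le> sqrt (2 * L * W\<^sup>2) + sqrt (2 * (h * Y))"
    by (rule sqrt_add_le_add_sqrt) (use L h_pos qn in \<open>auto simp: Y_def intro!: mult_nonneg_nonneg sum_nonneg\<close>)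
  also have "\<dots> = sqrt (2 * L) * W + sqrt 2 * (sqrt h * sqrt Y)"
    using W0 by (simp add: real_sqrt_mult)
  also have "sqrt h * sqrt Y \<le> sqrt h * (sqrt (real (2 * N)) * (B * h ^ \<sigma>) + Kn * (5 * R * h ^ \<sigma> * sqrt (4 * h * K)) / h * T)"
    using h_pos by (intro mult_left_mono Ybound) simp
  also have "\<dots> = (sqrt (real (2 * N)) * sqrt h) * (B * h ^ \<sigma>)
      + Kn * (5 * R * h ^ \<sigma> * (sqrt h * sqrt (4 * h * K))) / h * T"
    by (simp add: algebra_simps)
  also have "sqrt (real (2 * N)) * sqrt h = sqrt (2 * L)"
    unfolding real_sqrt_mult[symmetric] P2(2) ..
  \<comment> \<open>The two half powers of h combine here and cancel the division by h.\<close>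
  also have "sqrt h * sqrt (4 * h * K) = 2 * h * sqrt K"
    using h_pos by (simp add: real_sqrt_mult)
  finally show ?thesis
    unfolding W_def using h_pos by (simp add: algebra_simps)
qed

end

theorem corollary3p2:
  fixes a b T C\<^sub>C\<^sub>F\<^sub>L :: real and k :: nat and u :: "real \<Rightarrow> real \<Rightarrow> real"
  defines "\<sigma> \<equiv> min (2 * k + 1) (k + 3)"
  assumes "a < b" and "C\<^sub>C\<^sub>F\<^sub>L > 0" and "k \<ge> 1" and "T > 0"
    and "C1_Sobolev a b (\<sigma> + 1) T u"
    and "advection_solution T u"
  shows "\<exists>M>0. \<forall>N\<ge>1. \<forall>uC uD.
           cdg_solution a b k C\<^sub>C\<^sub>F\<^sub>L N T uC uD \<longrightarrow>
           corrected_initialization a b k C\<^sub>C\<^sub>F\<^sub>L N (u 0) (uC 0) (uD 0) \<longrightarrow>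
           avg_error a b N (u T) (uC T) \<le> M * mesh_size a b N ^ \<sigma>"
proof -
  define L where "L = b - a"
  have L: "L > 0" using assms(2) by (simp add: L_def)
  have sob: "Sobolev_fun a b (\<sigma> + 1) (u 0)" using assms(5,6) unfolding C1_Sobolev_def by auto
  then obtain g where g: "L2_fun a b g" "weak_deriv a b (Suc \<sigma>) (u 0) g"
    unfolding Sobolev_fun_def by auto
  have per: "u 0 (x + (b - a)) = u 0 x" for x
    using sob unfolding Sobolev_fun_def periodic_fun_simple_def by blast
  have cont: "isCont (u 0) x" for x
    using assms(5,7) unfolding advection_solution_def by (auto intro: differentiable_imp_continuous_within)
  define K where "K = (L2_norm a b g)\<^sup>2"
  obtain D E where D: "D 0 = u 0" "\<And>j x. j < \<sigma> \<Longrightarrow> (D j has_real_derivative D (Suc j) x) (at x)"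
    "\<And>j x. j \<le> \<sigma> \<Longrightarrow> D j (x + L) = D j x" "energy_bound L K E (D \<sigma>)"
    by (rule sobolev_representation[OF assms(2) cont per g, folded L_def K_def]) (rule that)
  have K: "K \<ge> 0" unfolding K_def by simp
  have cD: "isCont (D \<sigma>) x" for x by (rule energy_bound_isCont[OF D(4) K L])
  interpret per: periodic_fun_simple "D \<sigma>" L by unfold_locales (rule D(3)[OF order_refl])
  \<comment> \<open>The sup of the top derivative over one period bounds it everywhere; it enters
    the initial error.\<close>
  have "compact (D \<sigma> ` {0..L})"
    by (intro compact_continuous_image continuous_at_imp_continuous_on ballI cD compact_Icc)
  then obtain S where S: "\<And>x. x \<in> {0..L} \<Longrightarrow> \<bar>D \<sigma> x\<bar> \<le> S"
    unfolding compact_eq_bounded_closed bounded_real by blast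
  have sup: "\<bar>D \<sigma> x\<bar> \<le> S" for x
  proof -
    define n where "n = \<lfloor>x / L\<rfloor>"
    have "of_int n \<le> x / L" "x / L < of_int n + 1" unfolding n_def by linarith+
    then have "x - of_int n * L \<in> {0..L}" using L by (simp add: field_simps)
    moreover have "D \<sigma> (x - of_int n * L) = D \<sigma> x" using per.minus_of_int[of x n] by simp
    ultimately show ?thesis using S by metis
  qed
  obtain Kn where Kn: "Kn > 0" "\<And>p. degree p \<le> k \<Longrightarrow> coeff_norm p \<le> Kn * sqrt (ref_inner (poly p) p)"
    by (rule coeff_norm_le_ref_inner[of k]) (rule that)
  obtain ea eb ed where ep: "error_polys C\<^sub>C\<^sub>F\<^sub>L k ea eb ed"
    using error_polys_exist[OF assms(3,4)] by blast
  have uT: "u T x = D 0 (x - T)" for x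
    unfolding D(1) by (rule advection_translation[OF assms(2,5) _ assms(6,7)]) (use assms(5) in auto)
  let ?B = "(defect_const C\<^sub>C\<^sub>F\<^sub>L k * (21 * ref_const C\<^sub>C\<^sub>F\<^sub>L k + 6 * coeff_norm ea + 6)
      + coeff_norm (taylor_monom (k + 3) - ed)) * (S + taylor_data.om_max L K)"
  let ?R = "residual_const C\<^sub>C\<^sub>F\<^sub>L k (coeff_norm ea + coeff_norm eb + coeff_norm ed)"
  \<comment> \<open>All quantities are fixed before the mesh is chosen; \<open>om_max\<close>
    depends on L and K only.\<close>
  define M where "M = sqrt (2 * L) * (5 * taylor_data.om_max L K)
    + sqrt 2 * (sqrt (2 * L) * ?B + 10 * Kn * ?R * sqrt K * T)"
  have bound: "avg_error a b N (u T) (uC T) \<le> (\<bar>M\<bar> + 1) * mesh_size a b N ^ \<sigma>"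
    if N: "N \<ge> 1" and sol: "cdg_solution a b k C\<^sub>C\<^sub>F\<^sub>L N T uC uD"
      and ini: "corrected_initialization a b k C\<^sub>C\<^sub>F\<^sub>L N (u 0) (uC 0) (uD 0)" for N uC uD
  proof -
    define h where "h = mesh_size a b N"
    have h: "h > 0" "real N * h = L" using primal_dual_meshes(1,2)[OF assms(2) N] by (simp_all add: h_def L_def)
    \<comment> \<open>A cell is not longer than the period, as the energy estimate on windows
      demands.\<close>
    have "1 * h \<le> real N * h" using N h(1) by (intro mult_right_mono) auto
    then interpret taylor_data k \<sigma> L K S h D E
      using assms(4) D(2,4) sup h by unfold_locales (auto simp: \<sigma>_def)
    have "avg_error a b N (u T) (uC T) \<le> M * h ^ \<sigma>"
      unfolding M_def
      by (rule mesh_error[where u = u and uD = uD and eb = eb])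
        (fact assms(2) N assms(3,5) h_def L_def K sol ini D(1)[symmetric] uT D(3) Kn ep)+
    also have "\<dots> \<le> (\<bar>M\<bar> + 1) * h ^ \<sigma>" using h(1) by (intro mult_right_mono) auto
    finally show ?thesis unfolding h_def .
  qed
  \<comment> \<open>The absolute value and the summand 1 ensure positivity of the constant.\<close>
  show ?thesis by (rule exI[of _ "\<bar>M\<bar> + 1"]) (use bound in auto)
qed

end
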